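(* Let $F_1,F_2$ be two Finsler metrics on a closed connected manifold $M$ whose set of free homotopy classes of loops is nontrivial. If $\psi\in\mathrm{Symp}_0(T^*M)$ restricts to a symplectomorphism from $D^{F_1}T^*M$ onto $D^{F_2}T^*M$ such that $\psi(M\times\{0\})$ is the graph of an exact one-form on $M$, then for every nontrivial $\alpha\in[S^1,M]$ we have $l^{F_1}_\alpha=l^{F_2}_\alpha$.
   Context: $S^1=\mathbb{R}/\mathbb{Z}$. A Finsler metric on $M$ is a continuous function $F:TM\to[0,\infty)$ such that: (i) $F$ is $C^\infty$ outside the zero section; (ii) $F(x,\lambda v)=\lambda F(x,v)$ for all $\lambda>0$; (iii) for every $(x,y)\in TM$ with $y\ne0$ the form $g^F(x,y)[u,v]=\frac12\frac{\partial^2}{\partial s\partial t}F^2(x,y+su+tv)|_{s=t=0}$ on $T_xM$ is positive definite. $F^*(x,p)=\max_{F(x,v)\le1}\langle p,v\rangle$ and $D^FT^*M=\{(x,p)\in T^*M:F^*(x,p)<1\}$. $[S^1,M]$ is the set of free homotopy classes of loops in $M$, $\mathrm{len}_F(\gamma)=\int_{S^1}F(\gamma,\dot\gamma)dt$, and $l^F_\alpha=\inf\{\mathrm{len}_F(\gamma):\gamma\in C^\infty(S^1,M),[\gamma]=\alpha\}$. $T^*M$ carries the canonical symplectic form $\omega_0=d\lambda_0$, $\lambda_0(\xi)=\langle p,d\pi(\xi)\rangle$ for $\xi\in T_{(x,p)}T^*M$, $\pi:T^*M\to M$ the projection. $\mathrm{Symp}_0(T^*M)$ is the identity component of the group of symplectomorphisms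 of $(T^*M,\omega_0)$. $M\times\{0\}$ denotes the zero section. *)

theory Defs
  imports "HOL-Analysis.Analysis"
begin

text \<open>
  The distribution has no theory of smooth manifolds, so the differential-geometric notions are
  built here from smooth atlases on a set.
\<close>

section \<open>Smooth maps between Euclidean spaces\<close>

primrec Ck_on :: "nat \<Rightarrow> ('a::real_normed_vector \<Rightarrow> 'b::real_normed_vector) \<Rightarrow> 'a set \<Rightarrow> bool" where
  "Ck_on 0 f S = continuous_on S f"
| "Ck_on (Suc k) f S \<longleftrightarrow>
     (\<forall>x\<in>S. f differentiable (at x)) \<and> (\<forall>v. Ck_on k (\<lambda>x. frechet_derivative f (at x) v) S)"

text \<open>These are used for open \<open>S\<close> only.\<close>

definition smooth_on :: "('a::real_normed_vector \<Rightarrow> 'b::real_normed_vector) \<Rightarrow> 'a set \<Rightarrow> bool" where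
  "smooth_on f S \<longleftrightarrow> (\<forall>k. Ck_on k f S)"

primrec iterated_derivative ::
  "'a list \<Rightarrow> ('a::real_normed_vector \<Rightarrow> 'b::real_normed_vector) \<Rightarrow> 'a \<Rightarrow> 'b" where
  "iterated_derivative [] f = f"
| "iterated_derivative (v # vs) f = (\<lambda>x. frechet_derivative (iterated_derivative vs f) (at x) v)"


section \<open>Smooth manifolds\<close>

text \<open>
  A chart is a pair of its domain and its coordinate map; the values of the coordinate map off the
  domain are irrelevant. A manifold is given by an atlas, not necessarily maximal; its point set is
  the union of the chart domains and its topology is the one induced by the charts.
\<close>

type_synonym ('a, 'e) chart = "'a set \<times> ('a \<Rightarrow> 'e)"

type_synonym ('a, 'e) atlas = "('a, 'e) chart set"

abbreviation chart_dom :: "('a, 'e) chart \<Rightarrow> 'a set" where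
  "chart_dom c \<equiv> fst c"

abbreviation chart_map :: "('a, 'e) chart \<Rightarrow> 'a \<Rightarrow> 'e" where
  "chart_map c \<equiv> snd c"

definition chart_inv :: "('a, 'e) chart \<Rightarrow> 'e \<Rightarrow> 'a" where
  "chart_inv c = inv_into (chart_dom c) (chart_map c)"

definition points :: "('a, 'e) atlas \<Rightarrow> 'a set" where
  "points A = (\<Union>c\<in>A. chart_dom c)"

definition charts_at :: "('a, 'e) atlas \<Rightarrow> 'a \<Rightarrow> ('a, 'e) chart set" where
  "charts_at A x = {c \<in> A. x \<in> chart_dom c}"

definition chart_at :: "('a, 'e) atlas \<Rightarrow> 'a \<Rightarrow> ('a, 'e) chart" where
  "chart_at A x = (SOME c. c \<in> charts_at A x)"

definition manifold_topology :: "('a, 'e::euclidean_space) atlas \<Rightarrow> 'a topology" where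
  "manifold_topology A =
     topology_generated_by {chart_dom c \<inter> chart_map c -` W | c W. c \<in> A \<and> open W}"

definition smooth_atlas :: "('a, 'e::euclidean_space) atlas \<Rightarrow> bool" where
  "smooth_atlas A \<longleftrightarrow>
     (\<forall>c\<in>A. inj_on (chart_map c) (chart_dom c) \<and> open (chart_map c ` chart_dom c)) \<and>
     (\<forall>c\<in>A. \<forall>d\<in>A. open (chart_map c ` (chart_dom c \<inter> chart_dom d)) \<and>
        smooth_on (chart_map d \<circ> chart_inv c) (chart_map c ` (chart_dom c \<inter> chart_dom d)))"

definition smooth_manifold :: "('a, 'e::euclidean_space) atlas \<Rightarrow> bool" where
  "smooth_manifold A \<longleftrightarrow> smooth_atlas A \<and>
     Hausdorff_space (manifold_topology A) \<and> second_countable (manifold_topology A)"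

definition closed_connected_manifold :: "('a, 'e::euclidean_space) atlas \<Rightarrow> bool" where
  "closed_connected_manifold A \<longleftrightarrow> smooth_manifold A \<and> points A \<noteq> {} \<and>
     compact_space (manifold_topology A) \<and> connected_space (manifold_topology A)"

text \<open>The standard smooth structure of a Euclidean space.\<close>

definition euclidean_atlas :: "('e, 'e::euclidean_space) atlas" where
  "euclidean_atlas = {(UNIV, id)}"

text \<open>Smoothness on an open subset \<open>U\<close> of the manifold \<open>A\<close>.\<close>

definition smooth_map_on ::
  "('a, 'e::euclidean_space) atlas \<Rightarrow> ('b, 'f::euclidean_space) atlas \<Rightarrow> 'a set \<Rightarrow> ('a \<Rightarrow> 'b) \<Rightarrow> bool" where
  "smooth_map_on A B U f \<longleftrightarrow>
     continuous_map (subtopology (manifold_topology A) U) (manifold_topology B) f \<and>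
     (\<forall>c\<in>A. \<forall>d\<in>B. smooth_on (chart_map d \<circ> f \<circ> chart_inv c)
        (chart_map c ` (chart_dom c \<inter> U \<inter> f -` chart_dom d)))"


section \<open>Tangent and cotangent vectors\<close>

text \<open>
  A tangent vector at \<open>x\<close> is the family of its coordinate vectors in all charts around \<open>x\<close>, related
  by the derivatives of the chart transitions. At charts not containing \<open>x\<close> the family is set to 0,
  so that the tangent space is closed under pointwise linear combinations.
\<close>

type_synonym ('a, 'e) tangent = "('a, 'e) chart \<Rightarrow> 'e"

definition tangent_space :: "('a, 'e::euclidean_space) atlas \<Rightarrow> 'a \<Rightarrow> ('a, 'e) tangent set" where
  "tangent_space A x = {v.
     (\<forall>c. c \<notin> charts_at A x \<longrightarrow> v c = 0) \<and>
     (\<forall>c \<in> charts_at A x. \<forall>d \<in> charts_at A x.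
        v d = frechet_derivative (chart_map d \<circ> chart_inv c) (at (chart_map c x)) (v c))}"

text \<open>The tangent vector at \<open>x\<close> whose coordinate vector in the chart \<open>c\<close> is \<open>w\<close>.\<close>

definition tangent_of_coords ::
  "('a, 'e::euclidean_space) atlas \<Rightarrow> ('a, 'e) chart \<Rightarrow> 'a \<Rightarrow> 'e \<Rightarrow> ('a, 'e) tangent" where
  "tangent_of_coords A c x w = (\<lambda>d. if d \<in> charts_at A x
     then frechet_derivative (chart_map d \<circ> chart_inv c) (at (chart_map c x)) w else 0)"

definition differential ::
  "('a, 'e::euclidean_space) atlas \<Rightarrow> ('b, 'f::euclidean_space) atlas \<Rightarrow> ('a \<Rightarrow> 'b) \<Rightarrow> 'a \<Rightarrow>
     ('a, 'e) tangent \<Rightarrow> ('b, 'f) tangent" where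
  "differential A B f x v = (let c = chart_at A x in
     (\<lambda>d. if d \<in> charts_at B (f x)
       then frechet_derivative (chart_map d \<circ> f \<circ> chart_inv c) (at (chart_map c x)) (v c) else 0))"

definition velocity :: "('a, 'e::euclidean_space) atlas \<Rightarrow> (real \<Rightarrow> 'a) \<Rightarrow> real \<Rightarrow> ('a, 'e) tangent" where
  "velocity A \<gamma> t = (\<lambda>c. if c \<in> charts_at A (\<gamma> t)
     then vector_derivative (chart_map c \<circ> \<gamma>) (at t) else 0)"

definition tangent_bundle :: "('a, 'e::euclidean_space) atlas \<Rightarrow> ('a \<times> ('a, 'e) tangent) set" where
  "tangent_bundle A = (SIGMA x:points A. tangent_space A x)"

definition tangent_bundle_atlas ::
  "('a, 'e::euclidean_space) atlas \<Rightarrow> ('a \<times> ('a, 'e) tangent, 'e \<times> 'e) atlas" where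
  "tangent_bundle_atlas A =
     (\<lambda>c. (SIGMA x:chart_dom c. tangent_space A x, \<lambda>(x, v). (chart_map c x, v c))) ` A"

type_synonym ('a, 'e) cotangent = "('a, 'e) tangent \<Rightarrow> real"

definition cotangent_space :: "('a, 'e::euclidean_space) atlas \<Rightarrow> 'a \<Rightarrow> ('a, 'e) cotangent set" where
  "cotangent_space A x = {p \<in> extensional (tangent_space A x).
     \<forall>u \<in> tangent_space A x. \<forall>v \<in> tangent_space A x. \<forall>a b.
       p (\<lambda>c. a *\<^sub>R u c + b *\<^sub>R v c) = a * p u + b * p v}"

definition cotangent_bundle :: "('a, 'e::euclidean_space) atlas \<Rightarrow> ('a \<times> ('a, 'e) cotangent) set" where
  "cotangent_bundle A = (SIGMA x:points A. cotangent_space A x)"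

text \<open>The charts \<open>(q, p)\<close> of the cotangent bundle, where \<open>p\<^sub>b = \<langle>p, \<partial>\<^sub>b\<rangle>\<close>.\<close>

definition cotangent_bundle_atlas ::
  "('a, 'e::euclidean_space) atlas \<Rightarrow> ('a \<times> ('a, 'e) cotangent, 'e \<times> 'e) atlas" where
  "cotangent_bundle_atlas A =
     (\<lambda>c. (SIGMA x:chart_dom c. cotangent_space A x,
           \<lambda>(x, p). (chart_map c x, \<Sum>b\<in>Basis. p (tangent_of_coords A c x b) *\<^sub>R b))) ` A"

definition zero_section :: "('a, 'e::euclidean_space) atlas \<Rightarrow> ('a \<times> ('a, 'e) cotangent) set" where
  "zero_section A = {(x, \<lambda>v\<in>tangent_space A x. 0) | x. x \<in> points A}"


section \<open>Differential forms and the canonical symplectic form\<close>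

type_synonym ('a, 'e) one_form = "'a \<Rightarrow> ('a, 'e) tangent \<Rightarrow> real"

type_synonym ('a, 'e) two_form = "'a \<Rightarrow> ('a, 'e) tangent \<Rightarrow> ('a, 'e) tangent \<Rightarrow> real"

definition function_differential ::
  "('a, 'e::euclidean_space) atlas \<Rightarrow> ('a \<Rightarrow> real) \<Rightarrow> ('a, 'e) one_form" where
  "function_differential A f x = (\<lambda>v\<in>tangent_space A x.
     let c = chart_at A x in frechet_derivative (f \<circ> chart_inv c) (at (chart_map c x)) (v c))"

definition exact_one_form :: "('a, 'e::euclidean_space) atlas \<Rightarrow> ('a, 'e) one_form \<Rightarrow> bool" where
  "exact_one_form A \<sigma> \<longleftrightarrow>
     (\<exists>f. smooth_map_on A euclidean_atlas (points A) f \<and> (\<forall>x\<in>points A. \<sigma> x = function_differential A f x))"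

definition one_form_graph ::
  "('a, 'e::euclidean_space) atlas \<Rightarrow> ('a, 'e) one_form \<Rightarrow> ('a \<times> ('a, 'e) cotangent) set" where
  "one_form_graph A \<sigma> = {(x, \<sigma> x) | x. x \<in> points A}"

text \<open>
  \<open>d\<theta>(X, Y) = X(\<theta>(Y)) - Y(\<theta>(X)) - \<theta>([X, Y])\<close>, evaluated on the vector fields with constant
  coefficients in a chart, which commute.
\<close>

definition exterior_derivative ::
  "('a, 'e::euclidean_space) atlas \<Rightarrow> ('a, 'e) one_form \<Rightarrow> ('a, 'e) two_form" where
  "exterior_derivative A \<theta> x \<xi> \<eta> =
     (let c = chart_at A x;
          coeff = (\<lambda>w y. \<theta> (chart_inv c y) (tangent_of_coords A c (chart_inv c y) w))
      in frechet_derivative (coeff (\<eta> c)) (at (chart_map c x)) (\<xi> c)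
       - frechet_derivative (coeff (\<xi> c)) (at (chart_map c x)) (\<eta> c))"

definition liouville_form ::
  "('a, 'e::euclidean_space) atlas \<Rightarrow> ('a \<times> ('a, 'e) cotangent, 'e \<times> 'e) one_form" where
  "liouville_form A = (\<lambda>(x, p) \<xi>. p (differential (cotangent_bundle_atlas A) A fst (x, p) \<xi>))"

definition canonical_symplectic_form ::
  "('a, 'e::euclidean_space) atlas \<Rightarrow> ('a \<times> ('a, 'e) cotangent, 'e \<times> 'e) two_form" where
  "canonical_symplectic_form A = exterior_derivative (cotangent_bundle_atlas A) (liouville_form A)"


section \<open>Symplectomorphisms\<close>

text \<open>\<open>f\<close> is a symplectomorphism from \<open>(U, \<omega>)\<close> onto \<open>(V, \<omega>)\<close>, for open subsets \<open>U\<close> and \<open>V\<close> of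
  the manifold \<open>N\<close> with symplectic form \<open>\<omega>\<close>.\<close>

definition symplectomorphism_between ::
  "('a, 'e::euclidean_space) atlas \<Rightarrow> ('a, 'e) two_form \<Rightarrow> 'a set \<Rightarrow> 'a set \<Rightarrow> ('a \<Rightarrow> 'a) \<Rightarrow> bool" where
  "symplectomorphism_between N \<omega> U V f \<longleftrightarrow>
     bij_betw f U V \<and> smooth_map_on N N U f \<and> smooth_map_on N N V (inv_into U f) \<and>
     (\<forall>z\<in>U. \<forall>\<xi>\<in>tangent_space N z. \<forall>\<eta>\<in>tangent_space N z.
        \<omega> (f z) (differential N N f z \<xi>) (differential N N f z \<eta>) = \<omega> z \<xi> \<eta>)"

text \<open>Maps are normalised to be \<open>undefined\<close> off the manifold.\<close>

definition Symp :: "('a, 'e::euclidean_space) atlas \<Rightarrow> ('a, 'e) two_form \<Rightarrow> ('a \<Rightarrow> 'a) set" where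
  "Symp N \<omega> = {f \<in> extensional (points N). symplectomorphism_between N \<omega> (points N) (points N) f}"

text \<open>
  The compact-open (weak Whitney) \<open>C\<^sup>\<infinity>\<close> topology on smooth maps, with its usual subbasis: a smooth
  map \<open>g\<close> is close to \<open>f\<close> if on a compact set \<open>K\<close> inside a chart \<open>c\<close>, mapped by \<open>f\<close> into a chart \<open>d\<close>,
  all partial derivatives up to order \<open>r\<close> of the local representatives are \<open>\<epsilon>\<close>-close.
\<close>

definition C_infinity_nbhd ::
  "('a, 'e::euclidean_space) atlas \<Rightarrow> ('b, 'f::euclidean_space) atlas \<Rightarrow> ('a \<Rightarrow> 'b) \<Rightarrow>
     ('a, 'e) chart \<Rightarrow> ('b, 'f) chart \<Rightarrow> 'a set \<Rightarrow> nat \<Rightarrow> real \<Rightarrow> ('a \<Rightarrow> 'b) set" where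
  "C_infinity_nbhd A B f c d K r \<epsilon> = {g.
     smooth_map_on A B (points A) g \<and> g ` K \<subseteq> chart_dom d \<and>
     (\<forall>vs. length vs \<le> r \<and> set vs \<subseteq> Basis \<longrightarrow> (\<forall>y \<in> chart_map c ` K.
        norm (iterated_derivative vs (chart_map d \<circ> g \<circ> chart_inv c) y
            - iterated_derivative vs (chart_map d \<circ> f \<circ> chart_inv c) y) < \<epsilon>))}"

definition C_infinity_topology ::
  "('a, 'e::euclidean_space) atlas \<Rightarrow> ('b, 'f::euclidean_space) atlas \<Rightarrow> ('a \<Rightarrow> 'b) topology" where
  "C_infinity_topology A B = topology_generated_by {C_infinity_nbhd A B f c d K r \<epsilon> | f c d K r \<epsilon>.
     smooth_map_on A B (points A) f \<and> c \<in> A \<and> d \<in> B \<and> compactin (manifold_topology A) K \<and>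
     K \<subseteq> chart_dom c \<and> f ` K \<subseteq> chart_dom d \<and> \<epsilon> > 0}"

definition Symp\<^sub>0 :: "('a, 'e::euclidean_space) atlas \<Rightarrow> ('a, 'e) two_form \<Rightarrow> ('a \<Rightarrow> 'a) set" where
  "Symp\<^sub>0 N \<omega> = connected_component_of_set
     (subtopology (C_infinity_topology N N) (Symp N \<omega>)) (\<lambda>z\<in>points N. z)"


section \<open>Finsler metrics\<close>

definition fundamental_tensor ::
  "('a \<times> ('a, 'e::euclidean_space) tangent \<Rightarrow> real) \<Rightarrow> 'a \<Rightarrow> ('a, 'e) tangent \<Rightarrow>
     ('a, 'e) tangent \<Rightarrow> ('a, 'e) tangent \<Rightarrow> real" where
  "fundamental_tensor F x y u v =
     1/2 * deriv (\<lambda>s. deriv (\<lambda>t. (F (x, \<lambda>c. y c + s *\<^sub>R u c + t *\<^sub>R v c))\<^sup>2) 0) 0"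

definition finsler_metric ::
  "('a, 'e::euclidean_space) atlas \<Rightarrow> ('a \<times> ('a, 'e) tangent \<Rightarrow> real) \<Rightarrow> bool" where
  "finsler_metric A F \<longleftrightarrow>
     (\<forall>z \<in> tangent_bundle A. F z \<ge> 0) \<and>
     continuous_map (manifold_topology (tangent_bundle_atlas A)) euclideanreal F \<and>
     smooth_map_on (tangent_bundle_atlas A) euclidean_atlas
       {(x, v) \<in> tangent_bundle A. v \<noteq> (\<lambda>c. 0)} F \<and>
     (\<forall>(x, v) \<in> tangent_bundle A. \<forall>a>0. F (x, \<lambda>c. a *\<^sub>R v c) = a * F (x, v)) \<and>
     (\<forall>(x, y) \<in> tangent_bundle A. y \<noteq> (\<lambda>c. 0) \<longrightarrow>
        (\<forall>u \<in> tangent_space A x. u \<noteq> (\<lambda>c. 0) \<longrightarrow> fundamental_tensor F x y u u > 0))"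

text \<open>The supremum is a maximum, since the unit ball of a Finsler metric in a tangent space is compact.\<close>

definition dual_finsler ::
  "('a, 'e::euclidean_space) atlas \<Rightarrow> ('a \<times> ('a, 'e) tangent \<Rightarrow> real) \<Rightarrow> 'a \<times> ('a, 'e) cotangent \<Rightarrow> real" where
  "dual_finsler A F = (\<lambda>(x, p). SUP v \<in> {v \<in> tangent_space A x. F (x, v) \<le> 1}. p v)"

definition disc_cotangent_bundle ::
  "('a, 'e::euclidean_space) atlas \<Rightarrow> ('a \<times> ('a, 'e) tangent \<Rightarrow> real) \<Rightarrow> ('a \<times> ('a, 'e) cotangent) set" where
  "disc_cotangent_bundle A F = {z \<in> cotangent_bundle A. dual_finsler A F z < 1}"


section \<open>Free homotopy classes of loops and minimal lengths\<close>

text \<open>Maps on \<open>S\<^sup>1 = \<real>/\<int>\<close>, and homotopies of such maps, are given as 1-periodic maps on \<open>\<real>\<close>.\<close>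

definition periodic :: "(real \<Rightarrow> 'a) \<Rightarrow> bool" where
  "periodic \<gamma> \<longleftrightarrow> (\<forall>t. \<gamma> (t + 1) = \<gamma> t)"

definition loops :: "('a, 'e::euclidean_space) atlas \<Rightarrow> (real \<Rightarrow> 'a) set" where
  "loops A = {\<gamma>. continuous_map euclideanreal (manifold_topology A) \<gamma> \<and> periodic \<gamma>}"

definition smooth_loops :: "('a, 'e::euclidean_space) atlas \<Rightarrow> (real \<Rightarrow> 'a) set" where
  "smooth_loops A = {\<gamma>. smooth_map_on euclidean_atlas A UNIV \<gamma> \<and> periodic \<gamma>}"

definition free_homotopy_classes :: "('a, 'e::euclidean_space) atlas \<Rightarrow> (real \<Rightarrow> 'a) set set" where
  "free_homotopy_classes A =
     loops A // {(\<gamma>, \<delta>). homotopic_with periodic euclideanreal (manifold_topology A) \<gamma> \<delta>}"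

text \<open>On a connected manifold all constant loops represent the same class, the trivial one.\<close>

definition nontrivial_class :: "('a, 'e::euclidean_space) atlas \<Rightarrow> (real \<Rightarrow> 'a) set \<Rightarrow> bool" where
  "nontrivial_class A \<alpha> \<longleftrightarrow> (\<forall>x \<in> points A. (\<lambda>t. x) \<notin> \<alpha>)"

definition finsler_length ::
  "('a, 'e::euclidean_space) atlas \<Rightarrow> ('a \<times> ('a, 'e) tangent \<Rightarrow> real) \<Rightarrow> (real \<Rightarrow> 'a) \<Rightarrow> real" where
  "finsler_length A F \<gamma> = integral {0..1} (\<lambda>t. F (\<gamma> t, velocity A \<gamma> t))"

definition min_length ::
  "('a, 'e::euclidean_space) atlas \<Rightarrow> ('a \<times> ('a, 'e) tangent \<Rightarrow> real) \<Rightarrow> (real \<Rightarrow> 'a) set \<Rightarrow> real" where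
  "min_length A F \<alpha> = (INF \<gamma> \<in> smooth_loops A \<inter> \<alpha>. finsler_length A F \<gamma>)"

end

theory Submission
  imports Defs "HOL-Complex_Analysis.Great_Picard" "HOL-Real_Asymp.Real_Asymp"
begin

text \<open>
Why the theorem holds. Let l be the minimal F1-length in a nontrivial class. It is attained by a closed geodesic x of constant speed l (closed_geodesic_exists, by the direct method of the calculus of variations). Its momentum, divided by l, is a loop z of covectors over x of dual norm 1, whose action, the integral of the canonical one-form, is l. Let w be the image of z under the symplectomorphism, and y the projection of w to the manifold. Three facts give l as an upper bound for the minimal F2-length.

Firstly, the F2-speed of y is at most the canonical one-form on the velocity of w (speed_le_density). Indeed the direction of z' is characteristic on the boundary of the F1-disc bundle, the symplectomorphism maps disc bundle to disc bundle, and the discs of F2 are convex.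

Secondly, the action of w is that of z (action_invariant). Shrinking z to the zero section by the factors r in [0, 1] changes the action of the image at the constant rate l, since the symplectic form is preserved, and at r = 0 the image lies on the graph of an exact form, where the action vanishes.

Thirdly, y is in the class of x (Symp0_homotopic), because nearby symplectomorphisms move a loop to homotopic loops, and the symplectomorphism is in the component of the identity.

Hence the F2-length of y is at most l. The first and third facts apply to the inverse as well, and so does the second, being symmetric in z and w; this gives the other inequality. The geometry is done in coordinates: tangent vectors, covectors and velocities are families of coordinate vectors, and bundle charts turn the canonical form into the standard one.
\<close>

text \<open>Short forms of frequent names: mp, dm and iv are the map, the domain and the inverse of a chart.\<close>

abbreviation mp :: "('a, 'e) chart => 'a => 'e" where "mp c \<equiv> snd c"
abbreviation dm :: "('a, 'e) chart => 'a set" where "dm c \<equiv> fst c"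
abbreviation iv :: "('a, 'e) chart => 'e => 'a" where "iv \<equiv> chart_inv"
abbreviation Df :: "('a::real_normed_vector => 'b::real_normed_vector) => 'a => 'a => 'b" where "Df f x \<equiv> frechet_derivative f (at x)"
notation has_vector_derivative (infix "hvd" 50)
notation has_derivative (infix "hder" 50)
abbreviation cont :: "'a::topological_space set => ('a => 'b::topological_space) => bool" where "cont S f \<equiv> continuous_on S f"
notation has_real_derivative (infix "hrd" 50)
abbreviation rcont :: "'a topology => (real => 'a) => bool" where "rcont X g \<equiv> continuous_map euclideanreal X g"
lemmas integrable_cont = integrable_continuous_interval
lemmas cont_subset = continuous_on_subset
lemmas cont_compose = continuous_on_compose2
lemmas hvd_cong_open = has_vector_derivative_transform_within_open
lemmas hder_cong_open = has_derivative_transform_within_open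
lemmas cont_const = continuous_on_const
lemmas cont_Pair = continuous_on_Pair
lemmas cont_fst = continuous_on_fst
lemmas cont_snd = continuous_on_snd
lemmas cont_at = continuous_on_eq_continuous_at
lemmas cont_scaleR = continuous_on_scaleR
lemmas hvd_within = has_vector_derivative_at_within
lemmas cont_at_imp = continuous_at_imp_continuous_on
lemmas blin_hvd = bounded_linear.has_vector_derivative
lemmas hvd_def = has_vector_derivative_def
lemmas hvd_Pair = has_vector_derivative_Pair
lemmas hder_compose = has_derivative_compose
lemmas Df_at = frechet_derivative_at
lemmas fund_thm = fundamental_theorem_of_calculus
lemmas cont_add = continuous_on_add
lemmas cont_diff = continuous_on_diff
lemmas cont_id = continuous_on_id
lemmas hvd_cont = continuous_on_vector_derivative
lemmas hder_linear = has_derivative_linear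

section \<open>Smooth maps between Euclidean spaces\<close>

lemma Ck_on_Suc_imp: "Ck_on (Suc k) f S ==> Ck_on k f S"
proof (induction k arbitrary: f)
 case 0
 then show ?case
  by (auto intro!: cont_at_imp differentiable_imp_continuous_within)
next
 case (Suc k)
 then show ?case by auto
qed

lemma Ck_on_subset: "Ck_on k f S ==> T \<subseteq> S ==> Ck_on k f T"
 by (induction k arbitrary: f) (auto intro: cont_subset)

lemma Ck_on_cong:
 assumes "open S" "\<And>x. x \<in> S ==> f x = g x" "Ck_on k f S"
 shows "Ck_on k g S"
 using assms(2,3)
proof (induction k arbitrary: f g)
 case 0
 then show ?case using continuous_on_cong by fastforce
next
 case (Suc k)
 have tr: "(g hder D) (at x)" if "x \<in> S" "(f hder D) (at x)" for x D
  using hder_cong_open[OF that(2) assms(1) that(1)] Suc.prems(1) by auto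
 have d: "g differentiable (at x)" if "x \<in> S" for x
 proof -
  have "f differentiable (at x)" using Suc.prems(2) that by auto
  then obtain D where "(f hder D) (at x)" unfolding differentiable_def by auto
  then show ?thesis using tr[OF that] unfolding differentiable_def by blast
 qed
 have e: "Df f x = Df g x" if "x \<in> S" for x
 proof -
  have "(f hder Df f x) (at x)"
   using Suc.prems(2) that by (auto simp: frechet_derivative_works)
  then show ?thesis using tr[OF that] Df_at by blast
 qed
 have "Ck_on k (\<lambda>x. Df g x v) S" for v
  by (rule Suc.IH[of "\<lambda>x. Df f x v"]) (use e Suc.prems(2) in auto)
 then show ?case using d by simp
qed

lemma Ck_on_local:
 assumes "\<And>x. x \<in> S ==> \<exists>U. open U \<and> x \<in> U \<and> Ck_on k f U"
 shows "Ck_on k f S"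
 using assms
proof (induction k arbitrary: f)
 case 0
 have "isCont f x" if x: "x \<in> S" for x
 proof -
  obtain U where "open U" "x \<in> U" "cont U f" using 0[OF x] by auto
  then show ?thesis by (simp add: cont_at)
 qed
 then show ?case by (simp add: cont_at_imp)
next
 case (Suc k)
 show ?case
 proof (simp, intro conjI ballI allI)
  show "f differentiable (at x)" if "x \<in> S" for x using Suc.prems[OF that] by auto
  show "Ck_on k (\<lambda>x. Df f x v) S" for v
   by (rule Suc.IH) (use Suc.prems in fastforce)
 qed
qed

lemma Ck_on_const: "Ck_on k (\<lambda>x. c) S"
 by (induction k arbitrary: c) auto

lemma Ck_on_bounded_linear: "bounded_linear f ==> Ck_on k f S"
proof (cases k)
 case 0
 then show "bounded_linear f ==> ?thesis" by (simp add: linear_continuous_on)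
next
 case (Suc m)
 assume f: "bounded_linear f"
 have "Df f x = f" for x
  using bounded_linear_imp_has_derivative[OF f] Df_at by metis
 then show ?thesis using Suc f bounded_linear_imp_differentiable Ck_on_const by auto
qed

lemma Ck_on_add:
 assumes "open S" "Ck_on k f S" "Ck_on k g S"
 shows "Ck_on k (\<lambda>x. f x + g x) S"
 using assms(2,3)
proof (induction k arbitrary: f g)
 case (Suc k)
 have "Ck_on k (\<lambda>x. Df (\<lambda>x. f x + g x) x v) S" for v
 proof (rule Ck_on_cong[OF assms(1)])
  show "Ck_on k (\<lambda>x. Df f x v + Df g x v) S"
   using Suc by auto
  show "Df f x v + Df g x v =
   Df (\<lambda>x. f x + g x) x v" if "x \<in> S" for x
  proof -
   have "((\<lambda>x. f x + g x) hder (\<lambda>v. Df f x v + Df g x v)) (at x)"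
    using Suc.prems that by (auto intro!: derivative_intros simp flip: frechet_derivative_works)
   then show ?thesis by (simp flip: Df_at)
  qed
 qed
 then show ?case using Suc.prems by auto
qed (auto simp: cont_add cont_scaleR continuous_on_inner)

lemma Ck_on_sum:
 assumes "open S" "\<And>i. i \<in> I ==> Ck_on k (f i) S"
 shows "Ck_on k (\<lambda>x. \<Sum>i\<in>I. f i x) S"
 using assms(2) by (induction I rule: infinite_finite_induct) (auto intro: Ck_on_const Ck_on_add assms(1))

lemma Ck_on_scaleR:
 assumes "open S" "Ck_on k f S" "Ck_on k g S"
 shows "Ck_on k (\<lambda>x. f x *\<^sub>R g x) S"
 using assms(2,3)
proof (induction k arbitrary: f g)
 case (Suc k)
 have "Ck_on k (\<lambda>x. Df (\<lambda>x. f x *\<^sub>R g x) x v) S" for v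
 proof (rule Ck_on_cong[OF assms(1)])
  show "Ck_on k (\<lambda>x. f x *\<^sub>R Df g x v + Df f x v *\<^sub>R g x) S"
   using Suc.prems by (intro Ck_on_add assms(1) Suc.IH) (auto intro: Ck_on_Suc_imp)
  show "f x *\<^sub>R Df g x v + Df f x v *\<^sub>R g x =
   Df (\<lambda>x. f x *\<^sub>R g x) x v" if "x \<in> S" for x
  proof -
   have "f differentiable (at x)" "g differentiable (at x)" using Suc.prems that by (simp_all only: Ck_on.simps)
   from has_derivative_scaleR[OF this[unfolded frechet_derivative_works]] have "((\<lambda>x. f x *\<^sub>R g x) hder (\<lambda>v. f x *\<^sub>R Df g x v + Df f x v *\<^sub>R g x)) (at x)" .
   then show ?thesis by (simp flip: Df_at)
  qed
 qed
 then show ?case using Suc.prems by (auto intro!: differentiable_scaleR)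
qed (auto simp: cont_add cont_scaleR continuous_on_inner)

lemma frechet_derivative_basis_expansion:
 fixes g :: "'b::euclidean_space => 'c::real_normed_vector"
 assumes "g differentiable (at y)"
 shows "Df g y w = (\<Sum>b\<in>Basis. (w \<bullet> b) *\<^sub>R Df g y b)"
proof -
 have l: "linear (Df g y)" using assms by (rule linear_frechet_derivative)
 have "Df g y (\<Sum>b\<in>Basis. (w \<bullet> b) *\<^sub>R b) = (\<Sum>b\<in>Basis. (w \<bullet> b) *\<^sub>R Df g y b)"
  by (simp add: linear_sum[OF l] linear_scale[OF l])
 then show ?thesis by (simp add: euclidean_representation)
qed

lemma Ck_on_inner_const:
 assumes "open S" "Ck_on k f S" shows "Ck_on k (\<lambda>x. f x \<bullet> b) S"
 using assms(2)
proof (induction k arbitrary: f)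
 case (Suc k)
 have "Ck_on k (\<lambda>x. Df (\<lambda>x. f x \<bullet> b) x v) S" for v
 proof (rule Ck_on_cong[OF assms(1)])
  show "Ck_on k (\<lambda>x. Df f x v \<bullet> b) S" using Suc by auto
  show "Df f x v \<bullet> b = Df (\<lambda>x. f x \<bullet> b) x v" if "x \<in> S" for x
  proof -
   have "((\<lambda>x. f x \<bullet> b) hder (\<lambda>v. Df f x v \<bullet> b)) (at x)"
    using Suc.prems that by (auto intro!: derivative_eq_intros simp flip: frechet_derivative_works)
   then show ?thesis by (simp flip: Df_at)
  qed
 qed
 then show ?case using Suc.prems by (auto intro!: differentiable_inner)
qed (auto simp: cont_add cont_scaleR continuous_on_inner)

lemma Ck_on_compose:
 fixes f :: "'a::real_normed_vector => 'b::euclidean_space" and g :: "'b => 'c::real_normed_vector"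
 assumes "open S" "f ` S \<subseteq> T" "Ck_on k f S" "Ck_on k g T"
 shows "Ck_on k (\<lambda>x. g (f x)) S"
 using assms(3,4)
proof (induction k arbitrary: g)
 case 0
 then show ?case using cont_compose[of T g S f] assms(2) by simp
next
 case (Suc k)
 have der: "((\<lambda>x. g (f x)) hder (\<lambda>v. Df g (f x) (Df f x v))) (at x)"
  if "x \<in> S" for x
 proof -
  have 1: "(f hder Df f x) (at x)"
   using Suc.prems(1) that by (simp flip: frechet_derivative_works)
  have 2: "(g hder Df g (f x)) (at (f x))"
   using Suc.prems(2) that assms(2) by (auto simp flip: frechet_derivative_works)
  show ?thesis using hder_compose[OF 1 2] .
 qed
 have "Ck_on k (\<lambda>x. Df (\<lambda>x. g (f x)) x v) S" for v
 proof (rule Ck_on_cong[OF assms(1)])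
  show "Ck_on k (\<lambda>x. \<Sum>b\<in>Basis. (Df f x v \<bullet> b) *\<^sub>R Df g (f x) b) S"
   using Suc.prems Ck_on_Suc_imp[OF Suc.prems(1)]
   by (intro Ck_on_sum Ck_on_scaleR Ck_on_inner_const assms(1)) (auto intro!: Suc.IH[of "\<lambda>y. Df g y _"])
  show "(\<Sum>b\<in>Basis. (Df f x v \<bullet> b) *\<^sub>R Df g (f x) b) =
   Df (\<lambda>x. g (f x)) x v" if "x \<in> S" for x
  proof -
   have "g differentiable (at (f x))" using that assms(2) Suc.prems by auto
   then show ?thesis
    using Df_at[OF der[OF that]] frechet_derivative_basis_expansion by metis
  qed
 qed
 then show ?case using der by (auto intro: differentiableI)
qed

lemma smooth_on_imp_differentiable:
 assumes "smooth_on f S" "x \<in> S" shows "f differentiable (at x)"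
proof -
 have "Ck_on (Suc 0) f S" using assms(1) unfolding smooth_on_def by blast
 then show ?thesis using assms(2) by simp
qed

lemma smooth_hder:
 "smooth_on f S ==> x \<in> S ==> (f hder Df f x) (at x)"
 by (simp add: smooth_on_imp_differentiable flip: frechet_derivative_works)

lemma smooth_on_frechet:
 assumes "smooth_on f S" shows "smooth_on (\<lambda>x. Df f x v) S"
 unfolding smooth_on_def
proof
 fix k
 have "Ck_on (Suc k) f S" using assms(1) unfolding smooth_on_def by blast
 then show "Ck_on k (\<lambda>x. Df f x v) S" by simp
qed

lemma smooth_cont: "smooth_on f S ==> cont S f"
 unfolding smooth_on_def by (drule spec[of _ 0]) simp

lemma smooth_on_subset: "smooth_on f S ==> T \<subseteq> S ==> smooth_on f T"
 unfolding smooth_on_def by (blast intro: Ck_on_subset)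

lemma smooth_on_cong:
 "open S ==> (\<And>x. x \<in> S ==> f x = g x) ==> smooth_on f S ==> smooth_on g S"
 unfolding smooth_on_def by (intro allI) (rule Ck_on_cong[where f = f], auto)

lemma smooth_on_local:
 assumes "\<And>x. x \<in> S ==> \<exists>U. open U \<and> x \<in> U \<and> smooth_on f U"
 shows "smooth_on f S"
 unfolding smooth_on_def
proof (intro allI Ck_on_local)
 fix k x assume "x \<in> S"
 then obtain U where "open U" "x \<in> U" "smooth_on f U" using assms by metis
 then show "\<exists>U. open U \<and> x \<in> U \<and> Ck_on k f U" by (intro exI[of _ U]) (simp add: smooth_on_def)
qed

lemma smooth_on_compose:
 fixes f :: "'a::real_normed_vector => 'b::euclidean_space" and g :: "'b => 'c::real_normed_vector"
 shows "open S ==> f ` S \<subseteq> T ==> smooth_on f S ==> smooth_on g T ==> smooth_on (\<lambda>x. g (f x)) S"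
 unfolding smooth_on_def by (rule allI, rule Ck_on_compose[where f = f and g = g and T = T]) auto

lemma smooth_on_add: "open S ==> smooth_on f S ==> smooth_on g S ==> smooth_on (\<lambda>x. f x + g x) S"
 unfolding smooth_on_def by (rule allI, rule Ck_on_add) auto

lemma smooth_on_scaleR: "open S ==> smooth_on f S ==> smooth_on g S ==> smooth_on (\<lambda>x. f x *\<^sub>R g x) S"
 unfolding smooth_on_def by (rule allI, rule Ck_on_scaleR) auto

lemma smooth_on_const: "smooth_on (\<lambda>x. c) S"
 unfolding smooth_on_def by (simp add: Ck_on_const)

lemma smooth_on_bounded_linear: "bounded_linear f ==> smooth_on f S"
 unfolding smooth_on_def by (simp add: Ck_on_bounded_linear)

lemma smooth_Df_joint_cont:
 fixes f :: "'a::euclidean_space => 'b::real_normed_vector"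
 assumes "smooth_on f S"
 shows "cont (S \<times> UNIV) (\<lambda>(x, v). Df f x v)"
proof -
 have c: "cont S (\<lambda>x. Df f x b)" for b
  using assms smooth_on_frechet smooth_cont by blast
 have "cont (S \<times> UNIV) (\<lambda>z. \<Sum>b\<in>Basis. (snd z \<bullet> b) *\<^sub>R Df f (fst z) b)"
  by (intro continuous_intros cont_compose[OF c]) auto
 moreover have "(\<Sum>b\<in>Basis. (snd z \<bullet> b) *\<^sub>R Df f (fst z) b) = (case z of (x, v) => Df f x v)"
  if "z \<in> S \<times> UNIV" for z
  using frechet_derivative_basis_expansion[OF smooth_on_imp_differentiable[OF assms, of "fst z"], of "snd z"] that
  by (auto split: prod.splits)
 ultimately show ?thesis using continuous_on_cong by (smt (verit))
qed

lemma smooth_on_inverse: "smooth_on (inverse :: real => real) (- {0})"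
proof -
 have "Ck_on k (inverse :: real => real) (- {0})" for k
 proof (induction k)
  case 0
  then show ?case by (auto intro: continuous_intros)
 next
  case (Suc k)
  have d: "((inverse :: real => real) hder (\<lambda>v. - (inverse x * v * inverse x))) (at x)" if "x ~= 0" for x :: real
   using has_derivative_inverse'[OF that] by simp
  have "Ck_on k (\<lambda>x. Df (inverse :: real => real) x v) (- {0})" for v
  proof (rule Ck_on_cong)
   show "open (- {0::real})" by auto
   show "Ck_on k (\<lambda>x. (- v) *\<^sub>R (inverse x *\<^sub>R inverse x)) (- {0})"
    by (intro Ck_on_scaleR Suc Ck_on_const) auto
   show "(- v) *\<^sub>R (inverse x *\<^sub>R inverse x) = Df inverse x v" if "x \<in> - {0}" for x
    using Df_at[OF d, of x] that by (simp flip: fun_cong[OF Df_at[OF d, of x], of v])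
  qed
  then show ?case using d by (auto intro: differentiableI)
 qed
 then show ?thesis unfolding smooth_on_def by auto
qed

text \<open>The flat function exp(-1/t) for positive t, multiplied by a power of 1/t. The extra power makes the family closed under differentiation, so that smoothness follows by induction on the order.\<close>

definition flat_exp :: "nat => real => real" where
 "flat_exp m t = (if t > 0 then inverse t ^ m * exp (- inverse t) else 0)"

lemma flat_exp_has_derivative:
 "(flat_exp m hrd flat_exp (m + 2) t - real m * flat_exp (m + 1) t) (at t)"
proof -
 consider "t > 0" | "t < 0" | "t = 0" by linarith
 then show ?thesis
 proof cases
  case 1
  have "((\<lambda>t. inverse t ^ m * exp (- inverse t)) hrd flat_exp (m + 2) t - real m * flat_exp (m + 1) t) (at t)"
  proof (cases m)
   case 0
   then show ?thesis using 1
    by (auto intro!: derivative_eq_intros simp: flat_exp_def field_simps power2_eq_square)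
  next
   case (Suc n)
   have "((\<lambda>t. inverse t ^ Suc n * exp (- inverse t)) has_real_derivative
    inverse t ^ Suc n * (exp (- inverse t) * (inverse t * inverse t)) +
    real (Suc n) * (- (inverse t * inverse t)) * inverse t ^ n * exp (- inverse t)) (at t)"
    using 1 by (auto intro!: derivative_eq_intros simp: algebra_simps simp del: power_Suc)
   moreover have "real (Suc n) * (- (inverse t * inverse t)) * inverse t ^ n * exp (- inverse t) =
    - real m * flat_exp (m + 1) t" "inverse t ^ Suc n * (exp (- inverse t) * (inverse t * inverse t)) = flat_exp (m + 2) t"
    using 1 Suc by (simp_all add: flat_exp_def algebra_simps)
   ultimately have "((\<lambda>t. inverse t ^ Suc n * exp (- inverse t)) has_real_derivative
    flat_exp (m + 2) t + - real m * flat_exp (m + 1) t) (at t)" by (simp only:)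
   then show ?thesis by (simp add: Suc algebra_simps del: power_Suc)
  qed
  then show ?thesis
   by (rule has_field_derivative_transform_within_open[where S = "{0<..}"]) (use 1 in \<open>auto simp: flat_exp_def\<close>)
 next
  case 2
  have "((\<lambda>t. 0) hrd flat_exp (m + 2) t - real m * flat_exp (m + 1) t) (at t)"
   using 2 by (auto simp: flat_exp_def)
  then show ?thesis
   by (rule has_field_derivative_transform_within_open[where S = "{..<0}"]) (use 2 in \<open>auto simp: flat_exp_def\<close>)
 next
  case 3
  have r: "((\<lambda>h. (flat_exp m h - flat_exp m 0) / h) \<longlongrightarrow> 0) (at_right 0)"
  proof (rule Lim_transform_eventually)
   show "((\<lambda>h. inverse h ^ (m + 1) * exp (- inverse h)) \<longlongrightarrow> 0) (at_right (0::real))"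
    by real_asymp
   show "\<forall>\<^sub>F h in at_right 0. inverse h ^ (m + 1) * exp (- inverse h) = (flat_exp m h - flat_exp m 0) / h"
    by (auto simp: eventually_at_right_less flat_exp_def field_simps eventually_at_filter)
  qed
  have l: "((\<lambda>h. (flat_exp m h - flat_exp m 0) / h) \<longlongrightarrow> 0) (at_left 0)"
   by (rule Lim_transform_eventually[OF tendsto_const])
    (auto simp: flat_exp_def eventually_at_filter)
  have "((\<lambda>h. (flat_exp m h - flat_exp m 0) / h) \<longlongrightarrow> 0) (at 0)"
   using l r filterlim_split_at by blast
  then show ?thesis using 3 by (simp add: DERIV_def flat_exp_def)
 qed
qed

lemma smooth_on_flat_exp: "smooth_on (flat_exp m) UNIV"
proof -
 have "Ck_on k (flat_exp m) UNIV" for k m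
 proof (induction k arbitrary: m)
  case 0
  show ?case by (simp add: cont_at_imp DERIV_isCont[OF flat_exp_has_derivative])
 next
  case (Suc k)
  have d: "(flat_exp m hder (\<lambda>v. (flat_exp (m + 2) t - real m * flat_exp (m + 1) t) * v)) (at t)" for t
   using flat_exp_has_derivative[of m t] has_field_derivative_def by blast
  have "Ck_on k (\<lambda>t. Df (flat_exp m) t v) UNIV" for v
  proof (rule Ck_on_cong)
   show "Ck_on k (\<lambda>t. v *\<^sub>R flat_exp (m + 2) t + (- v * real m) *\<^sub>R flat_exp (m + 1) t) UNIV"
    by (intro Ck_on_add Ck_on_scaleR Suc Ck_on_const) auto
   show "v *\<^sub>R flat_exp (m + 2) t + (- v * real m) *\<^sub>R flat_exp (m + 1) t = Df (flat_exp m) t v" for t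
    by (subst Df_at[OF d, symmetric]) (simp add: algebra_simps)
  qed auto
  then show ?case using d by (auto intro: differentiableI)
 qed
 then show ?thesis unfolding smooth_on_def by auto
qed

section \<open>Symmetry of second derivatives\<close>

lemma fundamental_theorem_of_calculus_real:
 fixes f :: "real => real"
 assumes "a \<le> b" "\<And>x. x \<in> {a..b} ==> (f hrd f' x) (at x)"
 shows "(f' has_integral f b - f a) {a..b}"
proof (rule fund_thm[OF assms(1)])
 fix x assume "x \<in> {a..b}"
 then show "(f hvd f' x) (at x within {a..b})"
  using assms(2) by (simp add: has_field_derivative_at_within has_real_derivative_iff_has_vector_derivative[symmetric])
qed

lemma mixed_difference_integral:
 fixes g :: "real => real => real"
 assumes "0 \<le> h"
  and "\<And>s t. s \<in> {0..h} ==> t \<in> {0..h} ==> ((\<lambda>s. g s t) hrd gs s t) (at s)"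
  and "\<And>s t. s \<in> {0..h} ==> t \<in> {0..h} ==> ((\<lambda>t. gs s t) hrd gst s t) (at t)"
 shows "integral {0..h} (\<lambda>s. integral {0..h} (gst s)) = g h h - g h 0 - g 0 h + g 0 0"
proof -
 have 1: "integral {0..h} (gst s) = gs s h - gs s 0" if "s \<in> {0..h}" for s
  by (rule integral_unique, rule fundamental_theorem_of_calculus_real) (use assms(1,3) that in auto)
 have 2: "((\<lambda>s. gs s h - gs s 0) has_integral (g h h - g h 0) - (g 0 h - g 0 0)) {0..h}"
  by (rule fundamental_theorem_of_calculus_real[where f = "\<lambda>s. g s h - g s 0"])
    (use assms(1,2) in \<open>auto intro!: DERIV_diff\<close>)
 have "integral {0..h} (\<lambda>s. integral {0..h} (gst s)) = integral {0..h} (\<lambda>s. gs s h - gs s 0)"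
  by (rule integral_cong) (use 1 in auto)
 then show ?thesis using integral_unique[OF 2] by simp
qed

text \<open>The mixed difference over a small square is the double integral of either mixed derivative. Both are continuous, so if they differed at the centre, they would differ with one sign on a small square, and so would the integrals.\<close>

lemma mixed_partials_commute:
 fixes g :: "real => real => real"
 assumes e: "0 < e"
  and s: "\<And>s t. s \<in> {-e<..<e} ==> t \<in> {-e<..<e} ==> ((\<lambda>s. g s t) hrd gs s t) (at s)"
  and st: "\<And>s t. s \<in> {-e<..<e} ==> t \<in> {-e<..<e} ==> ((\<lambda>t. gs s t) hrd gst s t) (at t)"
  and t: "\<And>s t. s \<in> {-e<..<e} ==> t \<in> {-e<..<e} ==> ((\<lambda>t. g s t) hrd gt s t) (at t)"
  and ts: "\<And>s t. s \<in> {-e<..<e} ==> t \<in> {-e<..<e} ==> ((\<lambda>s. gt s t) hrd gts s t) (at s)"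
  and c1: "cont ({-e<..<e} \<times> {-e<..<e}) (\<lambda>(s, t). gst s t)"
  and c2: "cont ({-e<..<e} \<times> {-e<..<e}) (\<lambda>(s, t). gts s t)"
 shows "gst 0 0 = gts 0 0"
proof (rule ccontr)
 assume ne: "gst 0 0 ~= gts 0 0"
 define D where "D z = (case z of (s, t) => gst s t - gts s t)" for z
 have cD: "cont ({-e<..<e} \<times> {-e<..<e}) D"
  unfolding D_def using cont_diff[OF c1 c2] by (simp add: case_prod_unfold)
 define d where "d = \<bar>gst 0 0 - gts 0 0\<bar> / 2"
 have d: "d > 0" using ne by (simp add: d_def)
 have op: "open ({-e<..<e} \<times> {-e<..<e})" by (intro open_Times open_greaterThanLessThan)
 have "isCont D (0, 0)" using cD e by (simp add: cont_at[OF op])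
 then obtain r where r: "r > 0" "\<And>z. dist z (0, 0) < r ==> dist (D z) (D (0, 0)) < d"
  using d unfolding continuous_at_eps_delta by blast
 define h where "h = min e r / 3"
 have h: "0 < h" "h < e" using e r(1) by (auto simp: h_def)
 have close: "\<bar>gst s t - gts s t - (gst 0 0 - gts 0 0)\<bar> < d" if "s \<in> {0..h}" "t \<in> {0..h}" for s t
 proof -
  have "dist (s, t) (0, 0) \<le> \<bar>s\<bar> + \<bar>t\<bar>"
   by (simp add: dist_Pair_Pair sqrt_sum_squares_le_sum_abs)
  also have "\<dots> < r" using that r(1) h by (auto simp: h_def)
  finally show ?thesis using r(2)[of "(s, t)"] by (simp add: D_def dist_real_def)
 qed
 have box: "{0..h} \<times> {0..h} \<subseteq> {-e<..<e} \<times> {-e<..<e}" using h by auto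
 have i1: "integral {0..h} (\<lambda>s. integral {0..h} (gst s)) = g h h - g h 0 - g 0 h + g 0 0"
  by (rule mixed_difference_integral[where gs = gs]) (use h s st in auto)
 have i2: "integral {0..h} (\<lambda>t. integral {0..h} (\<lambda>s. gts s t)) = g h h - g 0 h - g h 0 + g 0 0"
  by (rule mixed_difference_integral[where gs = "\<lambda>t s. gt s t"]) (use h t ts in auto)
 have cb: "cont (cbox (0, 0) (h, h)) (\<lambda>(s, t). gst s t)" "cont (cbox (0, 0) (h, h)) (\<lambda>(s, t). gts s t)"
  using box c1 c2 by (auto intro: cont_subset simp: cbox_Pair_eq)
 have "integral {0..h} (\<lambda>t. integral {0..h} (\<lambda>s. gts s t)) = integral {0..h} (\<lambda>s. integral {0..h} (\<lambda>t. gts s t))"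
  using integral_swap_continuous[OF cb(2)] by simp
 moreover have *: "integral {0..h} (\<lambda>s. integral {0..h} (f s)) = integral (cbox (0, 0) (h, h)) (\<lambda>(s, t). f s t)"
  if "cont (cbox (0, 0) (h, h)) (\<lambda>(s, t). f s t)" for f :: "real => real => real"
  using integral_prod_continuous[of 0 0 h h "\<lambda>(s, t). f s t"] that by simp
 ultimately have eq: "integral (cbox (0, 0) (h, h)) (\<lambda>(s, t). gst s t) = integral (cbox (0, 0) (h, h)) (\<lambda>(s, t). gts s t)"
  using i1 i2 *[OF cb(1)] *[OF cb(2)] by simp
 have cDb: "cont (cbox (0, 0) (h, h)) D"
  by (rule cont_subset[OF cD]) (use box in \<open>auto simp: cbox_Pair_eq\<close>)
 have "integral (cbox (0, 0) (h, h)) D = integral (cbox (0, 0) (h, h)) (\<lambda>z. (case z of (s, t) => gst s t) - (case z of (s, t) => gts s t))"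
  unfolding D_def by (rule arg_cong[where f = "integral _"]) (auto simp: fun_eq_iff)
 also have "\<dots> = 0"
  using eq by (subst integral_diff[OF integrable_continuous[OF cb(1)] integrable_continuous[OF cb(2)]]) simp
 finally have z: "integral (cbox (0, 0) (h, h)) D = 0" .
 have "norm (integral (cbox (0, 0) (h, h)) (\<lambda>z. D z - D (0, 0))) \<le> d * measure lborel (cbox (0::real, 0::real) (h, h))"
 proof (rule integrable_bound)
  show "0 \<le> d" using d by simp
  show "(\<lambda>z. D z - D (0, 0)) integrable_on cbox (0, 0) (h, h)"
   by (intro integrable_continuous continuous_intros cDb)
  show "norm (D z - D (0, 0)) \<le> d" if "z \<in> cbox (0, 0) (h, h)" for z
   using close[of "fst z" "snd z"] that by (auto simp: D_def cbox_Pair_eq)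
 qed
 moreover have "integral (cbox (0, 0) (h, h)) (\<lambda>z. D z - D (0, 0)) = - (measure lborel (cbox (0::real, 0::real) (h, h)) *\<^sub>R D (0, 0))"
  using z by (simp add: integral_diff[OF integrable_continuous[OF cDb] integrable_const])
 moreover have "measure lborel (cbox (0::real, 0::real) (h, h)) > 0"
  using h by (simp add: content_Pair)
 ultimately have "\<bar>D (0, 0)\<bar> \<le> d" by (simp add: abs_mult field_simps)
 then show False using d by (simp add: D_def d_def)
qed

lemma smooth_on_second_derivative_symmetric:
 fixes f :: "'a::euclidean_space => 'b::euclidean_space"
 assumes S: "open S" "x \<in> S" and f: "smooth_on f S"
 shows "Df (\<lambda>y. frechet_derivative f (at y) u) x v =
     Df (\<lambda>y. frechet_derivative f (at y) v) x u"
proof (rule euclidean_eqI)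
 fix i :: 'b assume "i \<in> Basis"
 define N where "N = norm u + norm v + 1"
 have N: "N > 0" by (simp add: N_def add_nonneg_pos)
 obtain r where r: "r > 0" "ball x r \<subseteq> S" using S open_contains_ball by blast
 define e where "e = r / N"
 have e: "e > 0" using r N by (simp add: e_def)
 have inS: "x + s *\<^sub>R u + t *\<^sub>R v \<in> S" if "s \<in> {-e<..<e}" "t \<in> {-e<..<e}" for s t
 proof -
  have "norm (s *\<^sub>R u + t *\<^sub>R v) \<le> \<bar>s\<bar> * norm u + \<bar>t\<bar> * norm v"
   by (rule order.trans[OF norm_triangle_ineq]) simp
  also have "\<dots> \<le> e * norm u + e * norm v" using that by (intro add_mono mult_right_mono) auto
  also have "\<dots> < e * N" using e by (simp add: N_def algebra_simps)
  also have "\<dots> = r" using N by (simp add: e_def)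
  finally have "x + (s *\<^sub>R u + t *\<^sub>R v) \<in> ball x r"
   using dist_commute[of x "x + (s *\<^sub>R u + t *\<^sub>R v)"] by (simp add: dist_norm[of "x + (s *\<^sub>R u + t *\<^sub>R v)" x])
  then show ?thesis using r by (auto simp: add.assoc)
 qed
 have D: "((\<lambda>y. h y \<bullet> i) hder (\<lambda>w. Df h y w \<bullet> i)) (at y)" if "smooth_on h S" "y \<in> S" for h :: "'a => 'b" and y
  using smooth_hder[OF that] by (auto intro!: derivative_eq_intros)
 have line: "((\<lambda>s. h (p s) \<bullet> i) hrd Df h (p s) w \<bullet> i) (at s)"
  if "smooth_on h S" "p s \<in> S" "(p hvd w) (at s)" for h :: "'a => 'b" and s w and p :: "real => 'a"
 proof -
  have l: "linear (Df h (p s))"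
   by (rule linear_frechet_derivative[OF smooth_on_imp_differentiable[OF that(1,2)]])
  have "((\<lambda>s. h (p s) \<bullet> i) hder (\<lambda>k. Df h (p s) (k *\<^sub>R w) \<bullet> i)) (at s)"
   using hder_compose[OF that(3)[unfolded hvd_def] D[OF that(1,2)]] .
  moreover have "(\<lambda>k. k * (Df h (p s) w \<bullet> i)) = (*) (Df h (p s) w \<bullet> i)"
   by (rule ext) (rule mult.commute)
  ultimately show ?thesis
   by (simp add: has_field_derivative_def linear_scale[OF l])
 qed
 have ps: "((\<lambda>s. x + s *\<^sub>R u + t *\<^sub>R v) hvd u) (at s)" for s t
  by (auto intro!: derivative_eq_intros)
 have pt: "((\<lambda>t. x + s *\<^sub>R u + t *\<^sub>R v) hvd v) (at t)" for s t
  by (auto intro!: derivative_eq_intros)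
 have cont: "cont ({-e<..<e} \<times> {-e<..<e}) (\<lambda>(s, t). Df h (x + s *\<^sub>R u + t *\<^sub>R v) w \<bullet> i)"
  if "smooth_on h S" for h :: "'a => 'b" and w
 proof -
  have c: "cont S (\<lambda>y. Df h y w)"
   using smooth_cont[OF smooth_on_frechet[OF that]] .
  show ?thesis unfolding case_prod_unfold
   by (intro continuous_intros cont_compose[OF c]) (use inS in auto)
 qed
 have sm: "smooth_on (\<lambda>y. Df f y w) S" for w using smooth_on_frechet[OF f] .
 have "Df (\<lambda>y. frechet_derivative f (at y) u) (x + 0 *\<^sub>R u + 0 *\<^sub>R v) v \<bullet> i =
    Df (\<lambda>y. frechet_derivative f (at y) v) (x + 0 *\<^sub>R u + 0 *\<^sub>R v) u \<bullet> i"
 proof (rule mixed_partials_commute[where g = "\<lambda>s t. f (x + s *\<^sub>R u + t *\<^sub>R v) \<bullet> i" and e = e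
    and gs = "\<lambda>s t. Df f (x + s *\<^sub>R u + t *\<^sub>R v) u \<bullet> i"
    and gt = "\<lambda>s t. Df f (x + s *\<^sub>R u + t *\<^sub>R v) v \<bullet> i"
    and gst = "\<lambda>s t. Df (\<lambda>y. frechet_derivative f (at y) u) (x + s *\<^sub>R u + t *\<^sub>R v) v \<bullet> i"
    and gts = "\<lambda>s t. Df (\<lambda>y. frechet_derivative f (at y) v) (x + s *\<^sub>R u + t *\<^sub>R v) u \<bullet> i"])
  show "0 < e" by (rule e)
 next
  fix s t :: real assume st: "s \<in> {-e<..<e}" "t \<in> {-e<..<e}"
  note z = inS[OF st]
  show "((\<lambda>s. f (x + s *\<^sub>R u + t *\<^sub>R v) \<bullet> i) hrd Df f (x + s *\<^sub>R u + t *\<^sub>R v) u \<bullet> i) (at s)"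
   using line[OF f z ps] .
  show "((\<lambda>t. f (x + s *\<^sub>R u + t *\<^sub>R v) \<bullet> i) hrd Df f (x + s *\<^sub>R u + t *\<^sub>R v) v \<bullet> i) (at t)"
   using line[of f "\<lambda>t. x + s *\<^sub>R u + t *\<^sub>R v", OF f z pt] .
  show "((\<lambda>t. Df f (x + s *\<^sub>R u + t *\<^sub>R v) u \<bullet> i) has_real_derivative
    Df (\<lambda>y. frechet_derivative f (at y) u) (x + s *\<^sub>R u + t *\<^sub>R v) v \<bullet> i) (at t)"
   using line[of _ "\<lambda>t. x + s *\<^sub>R u + t *\<^sub>R v", OF sm z pt] .
  show "((\<lambda>s. Df f (x + s *\<^sub>R u + t *\<^sub>R v) v \<bullet> i) has_real_derivative
    Df (\<lambda>y. frechet_derivative f (at y) v) (x + s *\<^sub>R u + t *\<^sub>R v) u \<bullet> i) (at s)"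
   using line[OF sm z ps] .
 qed (intro cont sm)+
 then show "Df (\<lambda>y. frechet_derivative f (at y) u) x v \<bullet> i =
  Df (\<lambda>y. frechet_derivative f (at y) v) x u \<bullet> i" by simp
qed

text \<open>Near points are handled by uniform continuity, and for points at a definite distance a large C absorbs the bounded oscillation. A bound of this shape turns mean square convergence into convergence of integrals.\<close>

lemma compact_continuous_quadratic_modulus:
 fixes g :: "'a::metric_space => 'b::metric_space"
 assumes "compact K" "cont K g" "0 < \<eta>"
 obtains C where "C \<ge> 0" "\<And>a b. a \<in> K ==> b \<in> K ==> dist (g a) (g b) \<le> \<eta> + C * (dist a b)\<^sup>2"
proof -
 have "uniformly_continuous_on K g" using assms compact_uniformly_continuous by blast
 then obtain d where d: "d > 0" "\<And>a b. a \<in> K ==> b \<in> K ==> dist b a < d ==> dist (g b) (g a) < \<eta>"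
  using assms(3) unfolding uniformly_continuous_on_def by metis
 have "bounded (g ` K)" using assms compact_continuous_image compact_imp_bounded by blast
 then obtain M where M: "\<And>a b. a \<in> K ==> b \<in> K ==> dist (g a) (g b) \<le> M"
  unfolding bounded_two_points by auto
 show ?thesis
 proof
  show "0 \<le> max M 0 / d\<^sup>2" by simp
  show "dist (g a) (g b) \<le> \<eta> + max M 0 / d\<^sup>2 * (dist a b)\<^sup>2" if "a \<in> K" "b \<in> K" for a b
  proof (cases "dist a b < d")
   case True
   then show ?thesis using d(2)[of b a] that by (smt (verit) divide_nonneg_nonneg mult_nonneg_nonneg zero_le_power2)
  next
   case False
   have "d\<^sup>2 \<le> (dist a b)\<^sup>2" using False d(1) by (intro power_mono) auto
   then have "max M 0 * d\<^sup>2 \<le> max M 0 * (dist a b)\<^sup>2" by (intro mult_left_mono) auto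
   then have "max M 0 \<le> max M 0 / d\<^sup>2 * (dist a b)\<^sup>2"
    using d(1) by (simp only: times_divide_eq_left pos_le_divide_eq zero_less_power)
   then show ?thesis using M[of a b] that assms(3) by linarith
  qed
 qed
qed

text \<open>The inverse of f is continuous on the compact image of K. Mean square convergence forces y into that image, so w is the preimage of y; the quadratic modulus of g after the inverse of f then bounds the distance of g(u) to g(w) by a small constant plus a multiple of the squared distance of f(u) to y, which is small in the mean.\<close>

lemma integral_limit_injection:
 fixes f :: "'k::euclidean_space => 'y::euclidean_space" and u :: "nat => real => 'k"
 assumes ab: "a < b" and K: "compact K" and f: "cont K f" "inj_on f K"
  and u: "\<And>n. cont {a..b} (u n)" "\<And>n t. t \<in> {a..b} ==> u n t \<in> K"
  and y: "cont {a..b} y"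
  and lim: "(\<lambda>n. integral {a..b} (\<lambda>t. (dist (f (u n t)) (y t))\<^sup>2)) \<longlonglongrightarrow> 0"
 obtains w where "cont {a..b} w" "\<And>t. t \<in> {a..b} ==> w t \<in> K \<and> f (w t) = y t"
  "\<And>(g :: 'k => 'z::euclidean_space) s t. cont K g ==> a \<le> s ==> s \<le> t ==> t \<le> b ==>
    (\<lambda>n. integral {s..t} (\<lambda>r. g (u n r))) \<longlonglongrightarrow> integral {s..t} (\<lambda>r. g (w r))"
proof -
 have fK: "compact (f ` K)" using K f compact_continuous_image by blast
 have cfu: "cont {a..b} (\<lambda>t. f (u n t))" for n
  by (rule cont_compose[OF f(1) u(1)]) (use u(2) in auto)
 have csq: "cont {a..b} (\<lambda>t. (dist (f (u n t)) (y t))\<^sup>2)" for n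
  by (intro continuous_intros cfu y)
 have yK: "y t \<in> f ` K" if t: "t \<in> {a..b}" for t
 proof (rule ccontr)
  assume nt: "y t \<notin> f ` K"
  define W where "W s = infdist (y s) (f ` K)" for s
  have ne: "f ` K ~= {}" using u(2) ab by fastforce
  have pos: "W t > 0" unfolding W_def
   using nt fK ne compact_imp_closed infdist_pos_not_in_closed by blast
  have cW: "cont {a..b} W" unfolding W_def by (intro continuous_intros y)
  then obtain e where e: "e > 0" "\<And>s. s \<in> {a..b} ==> dist s t < e ==> dist (W s) (W t) < W t / 2"
   using pos t unfolding continuous_on_iff by (metis half_gt_zero)
  define s1 s2 where "s1 = max a (t - e/2)" and "s2 = min b (t + e/2)"
  have s: "a \<le> s1" "s1 < s2" "s2 \<le> b" using t e ab by (auto simp: s1_def s2_def)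
  have big: "(W t / 2)\<^sup>2 \<le> (dist (f (u n r)) (y r))\<^sup>2" if "r \<in> {s1..s2}" for r n
  proof -
   have r: "r \<in> {a..b}" "dist r t < e" using that s e by (auto simp: s1_def s2_def dist_real_def)
   have "W t / 2 \<le> W r" using e(2)[OF r] by (auto simp: dist_real_def abs_if split: if_splits)
   also have "\<dots> \<le> dist (y r) (f (u n r))" unfolding W_def using u(2)[OF r(1)] by (intro infdist_le) auto
   finally show ?thesis using pos by (intro power_mono) (auto simp: dist_commute)
  qed
  have "(s2 - s1) * (W t / 2)\<^sup>2 \<le> integral {a..b} (\<lambda>t. (dist (f (u n t)) (y t))\<^sup>2)" for n
  proof -
   have "(s2 - s1) * (W t / 2)\<^sup>2 = integral {s1..s2} (\<lambda>r. (W t / 2)\<^sup>2)" using s by simp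
   also have "\<dots> \<le> integral {s1..s2} (\<lambda>t. (dist (f (u n t)) (y t))\<^sup>2)"
    by (rule integral_le[OF _ integrable_cont[OF cont_subset[OF csq]]]) (use big s in auto)
   also have "\<dots> \<le> integral {a..b} (\<lambda>t. (dist (f (u n t)) (y t))\<^sup>2)"
    by (rule integral_subset_le[OF _ integrable_cont[OF cont_subset[OF csq]] integrable_cont[OF csq]])
     (use s in auto)
   finally show ?thesis .
  qed
  then have "(s2 - s1) * (W t / 2)\<^sup>2 \<le> 0" using lim by (intro LIMSEQ_le_const) auto
  then show False using pos s by (simp add: mult_le_0_iff)
 qed
 define h where "h = inv_into K f"
 have hf: "h (f k) = k" if "k \<in> K" for k using that f by (simp add: h_def)
 have ch: "cont (f ` K) h" by (rule continuous_on_inv[OF f(1) K]) (use hf in auto)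
 define w where "w t = h (y t)" for t
 show ?thesis
 proof (rule that[of w])
  show cw: "cont {a..b} w" unfolding w_def
   by (rule cont_compose[OF ch y]) (use yK in auto)
  show wK: "w t \<in> K \<and> f (w t) = y t" if "t \<in> {a..b}" for t
   using yK[OF that] hf by (auto simp: w_def)
  fix g :: "'k => 'z" and s t :: real
  assume g: "cont K g" and st: "a \<le> s" "s \<le> t" "t \<le> b"
  have sub: "{s..t} \<subseteq> {a..b}" using st by auto
  have cg: "cont (f ` K) (\<lambda>z. g (h z))"
   by (rule cont_compose[OF g ch]) (use hf in auto)
  have cgu: "cont {a..b} (\<lambda>r. g (u n r))" for n
   by (rule cont_compose[OF g u(1)]) (use u(2) in auto)
  have cgw: "cont {a..b} (\<lambda>r. g (w r))"
   by (rule cont_compose[OF g cw]) (use wK in auto)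
  show "(\<lambda>n. integral {s..t} (\<lambda>r. g (u n r))) \<longlonglongrightarrow> integral {s..t} (\<lambda>r. g (w r))"
  proof (rule metric_LIMSEQ_I)
   fix e :: real assume e: "e > 0"
   define \<eta> where "\<eta> = e / (2 * (b - a))"
   have \<eta>: "\<eta> > 0" using e ab by (simp add: \<eta>_def)
   obtain C where C: "C \<ge> 0" "\<And>p q. p \<in> f ` K ==> q \<in> f ` K ==> dist (g (h p)) (g (h q)) \<le> \<eta> + C * (dist p q)\<^sup>2"
    using compact_continuous_quadratic_modulus[OF fK cg \<eta>] by blast
   have "e / (2 * (C + 1)) > 0" using e C by (simp add: divide_pos_pos)
   then obtain n0 where n0: "\<And>n. n \<ge> n0 ==> integral {a..b} (\<lambda>t. (dist (f (u n t)) (y t))\<^sup>2) < e / (2 * (C + 1))"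
    using order_tendstoD(2)[OF lim] unfolding eventually_sequentially by blast
   show "\<exists>n0. \<forall>n\<ge>n0. dist (integral {s..t} (\<lambda>r. g (u n r))) (integral {s..t} (\<lambda>r. g (w r))) < e"
   proof (intro exI allI impI)
    fix n assume n: "n \<ge> n0"
    let ?I = "integral {a..b} (\<lambda>t. (dist (f (u n t)) (y t))\<^sup>2)"
    have I0: "?I \<ge> 0" by (rule integral_nonneg[OF integrable_cont[OF csq]]) simp
    have cb: "cont {a..b} (\<lambda>r. \<eta> + C * (dist (f (u n r)) (y r))\<^sup>2)"
     by (intro cont_add continuous_on_mult cont_const csq)
    have "norm (integral {s..t} (\<lambda>r. g (u n r) - g (w r))) \<le> integral {s..t} (\<lambda>r. \<eta> + C * (dist (f (u n r)) (y r))\<^sup>2)"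
    proof (rule integral_norm_bound_integral)
     show "(\<lambda>r. g (u n r) - g (w r)) integrable_on {s..t}"
      using cont_subset[OF cgu sub] cont_subset[OF cgw sub]
      by (intro integrable_cont continuous_intros)
     show "(\<lambda>r. \<eta> + C * (dist (f (u n r)) (y r))\<^sup>2) integrable_on {s..t}"
      by (rule integrable_cont, rule cont_subset[OF cb sub])
     show "norm (g (u n r) - g (w r)) \<le> \<eta> + C * (dist (f (u n r)) (y r))\<^sup>2" if "r \<in> {s..t}" for r
      using C(2)[of "f (u n r)" "y r"] that sub yK[of r] u(2)[of r n] hf by (auto simp: w_def dist_norm)
    qed
    also have "\<dots> \<le> integral {a..b} (\<lambda>r. \<eta> + C * (dist (f (u n r)) (y r))\<^sup>2)"
    proof (rule integral_subset_le)
     show "(\<lambda>r. \<eta> + C * (dist (f (u n r)) (y r))\<^sup>2) integrable_on {s..t}"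
      by (rule integrable_cont, rule cont_subset[OF cb sub])
     show "(\<lambda>r. \<eta> + C * (dist (f (u n r)) (y r))\<^sup>2) integrable_on {a..b}"
      by (rule integrable_cont, rule cb)
    qed (use sub \<eta> C in auto)
    also have "\<dots> = \<eta> * (b - a) + C * ?I"
    proof -
     have "(\<lambda>t. C * (dist (f (u n t)) (y t))\<^sup>2) integrable_on {a..b}"
      by (rule integrable_cont, intro continuous_on_mult cont_const csq)
     then have "integral {a..b} (\<lambda>r. \<eta> + C * (dist (f (u n r)) (y r))\<^sup>2) =
      integral {a..b} (\<lambda>r. \<eta>) + integral {a..b} (\<lambda>t. C * (dist (f (u n t)) (y t))\<^sup>2)"
      by (intro integral_add) auto
     then show ?thesis using ab by simp
    qed
    also have "\<dots> < e"
    proof -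
     have "C * ?I \<le> (C + 1) * ?I" using I0 by (simp add: algebra_simps)
     also have "\<dots> < (C + 1) * (e / (2 * (C + 1)))" using n0[OF n] C by (intro mult_strict_left_mono) auto
     also have "\<dots> = e / 2" using C by (simp add: field_simps)
     finally have "C * ?I < e / 2" .
     moreover have "\<eta> * (b - a) = e / 2" using ab by (simp add: \<eta>_def field_simps)
     ultimately show ?thesis by linarith
    qed
    finally have "norm (integral {s..t} (\<lambda>r. g (u n r) - g (w r))) < e" .
    moreover have "integral {s..t} (\<lambda>r. g (u n r) - g (w r)) = integral {s..t} (\<lambda>r. g (u n r)) - integral {s..t} (\<lambda>r. g (w r))"
     by (rule integral_diff[OF integrable_cont[OF cont_subset[OF cgu sub]]
       integrable_cont[OF cont_subset[OF cgw sub]]])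
    ultimately show "dist (integral {s..t} (\<lambda>r. g (u n r))) (integral {s..t} (\<lambda>r. g (w r))) < e"
     by (simp add: dist_norm)
   qed
  qed
 qed
qed

section \<open>Limits of minimizing sequences\<close>

lemma nonpos_from_integrals:
 fixes f :: "real => real"
 assumes ab: "a < b" and f: "cont {a..b} f"
  and le: "\<And>s t. a \<le> s ==> s \<le> t ==> t \<le> b ==> integral {s..t} f \<le> 0"
  and t: "t \<in> {a..b}"
 shows "f t \<le> 0"
proof (rule ccontr)
 assume "\<not> f t \<le> 0"
 then have pos: "f t > 0" by simp
 obtain e where e: "e > 0" "\<And>s. s \<in> {a..b} ==> dist s t < e ==> dist (f s) (f t) < f t / 2"
  using f pos t unfolding continuous_on_iff by (metis half_gt_zero)
 define s1 s2 where "s1 = max a (t - e/2)" and "s2 = min b (t + e/2)"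
 have s: "a \<le> s1" "s1 < s2" "s2 \<le> b" using t e ab by (auto simp: s1_def s2_def)
 have sub: "{s1..s2} \<subseteq> {a..b}" using s by auto
 have "(s2 - s1) * (f t / 2) = integral {s1..s2} (\<lambda>_. f t / 2)" using s by simp
 also have "\<dots> \<le> integral {s1..s2} f"
 proof (rule integral_le)
  show "f integrable_on {s1..s2}" by (rule integrable_cont, rule cont_subset[OF f sub])
  fix r assume r: "r \<in> {s1..s2}"
  have "dist r t < e" using r e by (auto simp: s1_def s2_def dist_real_def)
  then show "f t / 2 \<le> f r" using e(2)[of r] r sub pos by (auto simp: dist_real_def abs_if split: if_splits)
 qed auto
 also have "\<dots> \<le> 0" using le s by auto
 finally show False using s pos by (simp add: mult_le_0_iff)
qed

lemma gradient_linearization: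
 fixes L :: "'z::euclidean_space => real"
 assumes D: "open D" and der: "\<And>z. z \<in> D ==> (L hder (\<lambda>h. G z \<bullet> h)) (at z)"
  and G: "cont D G" and Z: "compact Z" "Z \<subseteq> D" and \<eta>: "\<eta> > 0"
 obtains d where "d > 0" "\<And>z h. z \<in> Z ==> norm h \<le> d ==> z + h \<in> D \<and> \<bar>L (z + h) - L z - G z \<bullet> h\<bar> \<le> \<eta> * norm h"
proof -
 obtain r where r: "r > 0" "(\<Union>z\<in>Z. cball z r) \<subseteq> D"
  using compact_subset_open_imp_cball_epsilon_subset[OF Z(1) D Z(2)] by blast
 define Z1 where "Z1 = {z + h | z h. z \<in> Z \<and> h \<in> cball 0 r}"
 have Z1: "compact Z1" unfolding Z1_def by (rule compact_sums[OF Z(1)]) auto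
 have Z1D: "Z1 \<subseteq> D"
 proof
  fix y assume "y \<in> Z1"
  then obtain z h where "y = z + h" "z \<in> Z" "norm h \<le> r" by (auto simp: Z1_def)
  then have "y \<in> cball z r" by (simp add: dist_norm)
  then show "y \<in> D" using r(2) \<open>z \<in> Z\<close> by blast
 qed
 have "uniformly_continuous_on Z1 G"
  by (rule compact_uniformly_continuous[OF cont_subset[OF G Z1D] Z1])
 then obtain d0 where d0: "d0 > 0" "\<And>y z. y \<in> Z1 ==> z \<in> Z1 ==> dist y z < d0 ==> dist (G y) (G z) < \<eta>"
  using \<eta> unfolding uniformly_continuous_on_def by metis
 show ?thesis
 proof (rule that[of "min r (d0 / 2)"])
  show "min r (d0 / 2) > 0" using r d0 by simp
  fix z h :: 'z assume z: "z \<in> Z" and h: "norm h \<le> min r (d0 / 2)"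
  have zt: "z + t *\<^sub>R h \<in> Z1" if "t \<in> {0..1}" for t
  proof -
   have "\<bar>t\<bar> * norm h \<le> 1 * norm h" using that by (intro mult_right_mono) auto
   then show ?thesis using z h unfolding Z1_def by (intro CollectI exI[of _ z] exI[of _ "t *\<^sub>R h"]) auto
  qed
  have z1: "z \<in> Z1" using zt[of 0] by simp
  have dphi: "((\<lambda>t. L (z + t *\<^sub>R h)) hder (\<lambda>s. s * (G (z + t *\<^sub>R h) \<bullet> h))) (at t within {0..1})" if "t \<in> {0..1}" for t
  proof -
   have 1: "((\<lambda>t. z + t *\<^sub>R h) hder (\<lambda>s. s *\<^sub>R h)) (at t within {0..1})"
    by (auto intro!: derivative_eq_intros)
   show ?thesis using hder_compose[OF 1 der[OF subsetD[OF Z1D zt[OF that]]]] by simp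
  qed
  obtain \<theta> where \<theta>: "\<theta> \<in> {0<..<1}" "L (z + 1 *\<^sub>R h) - L (z + 0 *\<^sub>R h) = (1 - 0) * (G (z + \<theta> *\<^sub>R h) \<bullet> h)"
   using mvt_simple[of 0 1 "\<lambda>t. L (z + t *\<^sub>R h)" "\<lambda>t s. s * (G (z + t *\<^sub>R h) \<bullet> h)"] dphi by auto
  have "\<bar>L (z + h) - L z - G z \<bullet> h\<bar> = \<bar>(G (z + \<theta> *\<^sub>R h) - G z) \<bullet> h\<bar>" using \<theta>(2) by (simp add: inner_diff_left)
  also have "\<dots> \<le> norm (G (z + \<theta> *\<^sub>R h) - G z) * norm h" by (rule Cauchy_Schwarz_ineq2)
  also have "\<dots> \<le> \<eta> * norm h"
  proof (rule mult_right_mono)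
   have "\<bar>\<theta>\<bar> * norm h \<le> 1 * norm h" using \<theta>(1) by (intro mult_right_mono) auto
   then have "dist (z + \<theta> *\<^sub>R h) z < d0" using h d0(1) by (simp add: dist_norm)
   then show "norm (G (z + \<theta> *\<^sub>R h) - G z) \<le> \<eta>" using d0(2)[OF zt z1, of \<theta>] \<theta>(1) by (simp add: dist_norm)
  qed simp
  finally show "z + h \<in> D \<and> \<bar>L (z + h) - L z - G z \<bullet> h\<bar> \<le> \<eta> * norm h" using zt[of 1] Z1D by auto
 qed
qed

lemma antiderivative_hvd:
 fixes f :: "real => 'b::euclidean_space"
 assumes "cont {a..b} f" "t \<in> {a..b}"
 shows "((\<lambda>t. integral {a..t} f) hvd f t) (at t within {a..b})"
 using integral_has_vector_derivative[OF assms] .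

lemma derivative_from_integral:
 fixes f :: "real => 'b::euclidean_space"
 assumes f: "cont {a..b} f" and t: "t \<in> {a<..<b}"
  and eq: "\<And>s. s \<in> {a..b} ==> F s - F a = integral {a..s} f"
 shows "(F hvd f t) (at t)"
proof -
 have "((\<lambda>t. F a + integral {a..t} f) hvd f t) (at t within {a..b})"
  using antiderivative_hvd[OF f, of t] t by (auto intro!: derivative_eq_intros)
 then have "((\<lambda>t. F a + integral {a..t} f) hvd f t) (at t)"
  using t by (metis at_within_Icc_at greaterThanLessThan_iff)
 then show ?thesis
  by (rule hvd_cong_open[where S = "{a<..<b}"])
    (use t eq in \<open>auto simp: eq[symmetric]\<close>)
qed

text \<open>The Euler-Lagrange equation for the limit of curves whose action exceeds the minimum by epsilon n, when only the curves and not their derivatives are known to converge. Let p be the fibre part of the gradient along the n-th curve and q an antiderivative of its base part; the equation says that p - q is constant. Testing near-minimality with a variation built from p - q shows that p - q minus its weighted mean m tends to zero in the mean square. By the theorem of Arzela and Ascoli a subsequence of q + m converges uniformly, so p converges in the mean square. As p determines the velocity, integrals of continuous functions of position and velocity converge as well, which yields the equation, and the bound on L, in the limit.\<close>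

lemma minimizing_limit_extremal:
 fixes L :: "'e::euclidean_space \<times> 'e => real" and G :: "'e \<times> 'e => 'e \<times> 'e"
  and x x' :: "nat => real => 'e" and X :: "real => 'e"
 assumes ab: "a < a'" "a' < b'" "b' < b"
  and \<Omega>: "open \<Omega>" and der: "\<And>z. z \<in> \<Omega> \<times> UNIV ==> (L hder (\<lambda>h. G z \<bullet> h)) (at z)"
  and G: "cont (\<Omega> \<times> UNIV) G"
  and inj: "\<And>x v w. x \<in> \<Omega> ==> snd (G (x, v)) = snd (G (x, w)) ==> v = w"
  and K: "compact K" "K \<subseteq> \<Omega>" and \<rho>: "\<rho> > 0"
  and x: "\<And>n t. t \<in> {a..b} ==> (x n hvd x' n t) (at t within {a..b})"
  and x': "\<And>n. cont {a..b} (x' n)"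
  and xK: "\<And>n t. t \<in> {a..b} ==> x n t \<in> K" and xR: "\<And>n t. t \<in> {a..b} ==> norm (x' n t) \<le> R"
  and lim: "\<And>e. e > 0 ==> \<forall>\<^sub>F n in sequentially. \<forall>t\<in>{a..b}. dist (x n t) (X t) < e"
  and \<epsilon>: "\<epsilon> \<longlonglongrightarrow> 0"
  and min: "\<And>n \<xi> \<xi>'. (\<And>t. t \<in> {a..b} ==> (\<xi> hvd \<xi>' t) (at t within {a..b})) ==>
    cont {a..b} \<xi>' ==> \<xi> a = 0 ==> \<xi> b = 0 ==> \<xi>' a = 0 ==> \<xi>' b = 0 ==>
    (\<And>t. t \<in> {a..b} ==> norm (\<xi> t) \<le> \<rho>) ==>
    integral {a..b} (\<lambda>t. L (x n t, x' n t)) - \<epsilon> n \<le> integral {a..b} (\<lambda>t. L (x n t + \<xi> t, x' n t + \<xi>' t))"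
  and c: "\<And>n t. t \<in> {a..b} ==> L (x n t, x' n t) \<le> c n" "c \<longlonglongrightarrow> c0"
 obtains V where "cont {a'..b'} V"
  "\<And>t. t \<in> {a'<..<b'} ==> (X hvd V t) (at t)"
  "\<And>t. t \<in> {a'<..<b'} ==> ((\<lambda>t. snd (G (X t, V t))) hvd fst (G (X t, V t))) (at t)"
  "\<And>t. t \<in> {a'..b'} ==> X t \<in> K \<and> L (X t, V t) \<le> c0"
proof -
 define z where "z n t = (x n t, x' n t)" for n t
 define Z where "Z = K \<times> cball (0::'e) R"
 have Z: "compact Z" "Z \<subseteq> \<Omega> \<times> UNIV" using K by (auto simp: Z_def intro: compact_Times)
 have zZ: "z n t \<in> Z" if "t \<in> {a..b}" for n t using xK[OF that] xR[OF that] by (simp add: z_def Z_def)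
 have cx: "cont {a..b} (x n)" for n
  using x by (rule hvd_cont)
 have cz: "cont {a..b} (z n)" for n
  unfolding z_def by (intro cont_Pair cx x')
 have cGZ: "cont Z G" by (rule cont_subset[OF G Z(2)])
 have cL: "cont (\<Omega> \<times> UNIV) L"
  by (intro cont_at_imp ballI has_derivative_continuous[OF der])
 have cLZ: "cont Z L" by (rule cont_subset[OF cL Z(2)])
 have cGz: "cont {a..b} (\<lambda>t. G (z n t))" for n
  by (rule cont_compose[OF cGZ cz]) (use zZ in auto)
 define g where "g n t = fst (G (z n t))" for n t
 define p where "p n t = snd (G (z n t))" for n t
 have cg: "cont {a..b} (g n)" and cp: "cont {a..b} (p n)" for n
  unfolding g_def p_def by (intro cont_fst cont_snd cGz)+
 have "bounded (G ` Z)" using compact_continuous_image[OF cGZ Z(1)] compact_imp_bounded by blast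
 then obtain M where M: "M > 0" "\<And>y. y \<in> Z ==> norm (G y) \<le> M" unfolding bounded_pos by auto
 have gM: "norm (g n t) \<le> M" and pM: "norm (p n t) \<le> M" if "t \<in> {a..b}" for n t
  using M(2)[OF zZ[OF that, of n]] norm_fst_le[of "fst (G (z n t))" "snd (G (z n t))"]
   norm_snd_le[of "snd (G (z n t))" "fst (G (z n t))"] by (auto simp: g_def p_def intro: order_trans)
 define q where "q n t = integral {a..t} (g n)" for n t
 have dq: "(q n hvd g n t) (at t within {a..b})" if "t \<in> {a..b}" for n t
  unfolding q_def by (rule antiderivative_hvd[OF cg that])
 have cq: "cont {a..b} (q n)" for n
  using dq by (rule hvd_cont)
 have q_diff: "q n t - q n s = integral {s..t} (g n)" if "a \<le> s" "s \<le> t" "t \<le> b" for n s t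
 proof -
  have "integral {a..s} (g n) + integral {s..t} (g n) = integral {a..t} (g n)"
   by (rule Henstock_Kurzweil_Integration.integral_combine[OF that(1,2) integrable_cont[OF cont_subset[OF cg]]]) (use that in auto)
  then show ?thesis by (simp add: q_def algebra_simps)
 qed
 have int_gM: "norm (integral {s..t} (g n)) \<le> M * (t - s)" if "a \<le> s" "s \<le> t" "t \<le> b" for n s t
  using integral_bound[of s t "g n" M] gM that cont_subset[OF cg, of "{s..t}"] by force
 have q_lip: "norm (q n t - q n s) \<le> M * \<bar>t - s\<bar>" if "s \<in> {a..b}" "t \<in> {a..b}" for n s t
 proof (cases "s \<le> t")
  case True
  then show ?thesis using int_gM[of s t n] q_diff[of s t n] that by auto
 next
  case False
  then show ?thesis using int_gM[of t s n] q_diff[of t s n] that by (auto simp: norm_minus_commute)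
 qed
 have qM: "norm (q n t) \<le> M * (b - a)" if "t \<in> {a..b}" for n t
 proof -
  have "norm (q n t) \<le> M * (t - a)" using int_gM[of a t n] that by (simp add: q_def)
  also have "\<dots> \<le> M * (b - a)" using M that by (intro mult_left_mono) auto
  finally show ?thesis .
 qed
 (* The weight vanishes at both ends, which makes the test variation below vanish there to first order. *)
 define \<beta> where "\<beta> t = (t - a) * (b - t)" for t
 have c\<beta>: "cont S \<beta>" for S unfolding \<beta>_def by (intro continuous_intros)
 have \<beta>0: "\<beta> t \<ge> 0" if "t \<in> {a..b}" for t using that by (simp add: \<beta>_def)
 have \<beta>1: "\<beta> t \<le> (b - a)\<^sup>2" if "t \<in> {a..b}" for t
  unfolding \<beta>_def power2_eq_square using that by (intro mult_mono) auto
 define \<beta>m where "\<beta>m = (a' - a) * (b - b')"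
 have \<beta>m: "\<beta>m > 0" "\<And>t. t \<in> {a'..b'} ==> \<beta>m \<le> \<beta> t"
  using ab by (auto simp: \<beta>m_def \<beta>_def intro!: mult_mono)
 define X0 where "X0 = integral {a..b} \<beta>"
 have X0: "X0 > 0"
 proof -
  have "0 < (b' - a') * \<beta>m" using ab \<beta>m by simp
  also have "\<dots> = integral {a'..b'} (\<lambda>_. \<beta>m)" using ab by simp
  also have "\<dots> \<le> integral {a'..b'} \<beta>"
   by (rule integral_le[OF _ integrable_cont[OF c\<beta>]]) (use \<beta>m in auto)
  also have "\<dots> \<le> X0" unfolding X0_def
   by (rule integral_subset_le[OF _ integrable_cont[OF c\<beta>] integrable_cont[OF c\<beta>]])
    (use ab \<beta>0 in auto)
  finally show ?thesis .
 qed
 define r where "r n t = p n t - q n t" for n t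
 have cr: "cont {a..b} (r n)" for n unfolding r_def by (intro cont_diff cp cq)
 have ccr: "cont {a..b} (\<lambda>t. \<beta> t *\<^sub>R r n t)" for n by (intro cont_scaleR c\<beta> cr)
 define Mr where "Mr = M + M * (b - a)"
 have rM: "norm (r n t) \<le> Mr" if "t \<in> {a..b}" for n t
  using norm_triangle_ineq4[of "p n t" "q n t"] pM[OF that, of n] qM[OF that, of n] by (simp add: r_def Mr_def)
 define m where "m n = (1 / X0) *\<^sub>R integral {a..b} (\<lambda>t. \<beta> t *\<^sub>R r n t)" for n
 have X0m: "X0 *\<^sub>R m n = integral {a..b} (\<lambda>t. \<beta> t *\<^sub>R r n t)" for n using X0 by (simp add: m_def)
 have mM: "norm (m n) \<le> Mr" for n
 proof -
  have "norm (integral {a..b} (\<lambda>t. \<beta> t *\<^sub>R r n t)) \<le> integral {a..b} (\<lambda>t. \<beta> t * Mr)"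
  proof (rule integral_norm_bound_integral)
   show "(\<lambda>t. \<beta> t *\<^sub>R r n t) integrable_on {a..b}" by (rule integrable_cont[OF ccr])
   show "(\<lambda>t. \<beta> t * Mr) integrable_on {a..b}" by (intro integrable_cont continuous_on_mult c\<beta> cont_const)
   show "norm (\<beta> t *\<^sub>R r n t) \<le> \<beta> t * Mr" if "t \<in> {a..b}" for t
    using rM[OF that, of n] \<beta>0[OF that] by (simp add: mult_left_mono)
  qed
  also have "\<dots> = X0 * Mr" by (simp add: X0_def)
  finally show ?thesis using X0 unfolding m_def by (simp add: field_simps)
 qed
 (* Since m is the weighted mean of r, the variation with this derivative also ends at zero. *)
 define \<xi>' where "\<xi>' n t = \<beta> t *\<^sub>R (r n t - m n)" for n t
 define \<xi> where "\<xi> n t = integral {a..t} (\<xi>' n)" for n t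
 have c\<xi>': "cont {a..b} (\<xi>' n)" for n
  unfolding \<xi>'_def by (intro cont_scaleR c\<beta> cont_diff cr cont_const)
 have d\<xi>: "(\<xi> n hvd \<xi>' n t) (at t within {a..b})" if "t \<in> {a..b}" for n t
  unfolding \<xi>_def by (rule antiderivative_hvd[OF c\<xi>' that])
 have c\<xi>: "cont {a..b} (\<xi> n)" for n
  using d\<xi> by (rule hvd_cont)
 have \<xi>a: "\<xi> n a = 0" for n by (simp add: \<xi>_def)
 have \<xi>b: "\<xi> n b = 0" for n
 proof -
  have "\<xi> n b = integral {a..b} (\<lambda>t. \<beta> t *\<^sub>R r n t - \<beta> t *\<^sub>R m n)"
   unfolding \<xi>_def \<xi>'_def by (simp add: scaleR_diff_right)
  also have "\<dots> = integral {a..b} (\<lambda>t. \<beta> t *\<^sub>R r n t) - integral {a..b} (\<lambda>t. \<beta> t *\<^sub>R m n)"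
   by (rule integral_diff) (intro integrable_cont ccr cont_scaleR c\<beta> cont_const)+
  also have "integral {a..b} (\<lambda>t. \<beta> t *\<^sub>R m n) = X0 *\<^sub>R m n"
   unfolding X0_def by (rule integral_unique[OF has_integral_scaleR_left[OF integrable_integral[OF integrable_cont[OF c\<beta>]]]])
  finally show ?thesis by (simp add: X0m)
 qed
 define C where "C = (b - a)\<^sup>2 * (Mr + Mr) * (1 + (b - a))"
 have Mr0: "Mr \<ge> 0" using M ab by (simp add: Mr_def)
 have \<xi>'C0: "norm (\<xi>' n t) \<le> (b - a)\<^sup>2 * (Mr + Mr)" if "t \<in> {a..b}" for n t
 proof -
  have "norm (r n t - m n) \<le> Mr + Mr" using norm_triangle_ineq4[of "r n t" "m n"] rM[OF that, of n] mM[of n] by linarith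
  then show ?thesis unfolding \<xi>'_def using \<beta>0[OF that] \<beta>1[OF that] by (simp add: mult_mono)
 qed
 have \<xi>C0: "norm (\<xi> n t) \<le> (b - a)\<^sup>2 * (Mr + Mr) * (b - a)" if "t \<in> {a..b}" for n t
 proof -
  have "norm (\<xi> n t) \<le> (b - a)\<^sup>2 * (Mr + Mr) * (t - a)"
   unfolding \<xi>_def by (rule integral_bound[OF _ cont_subset[OF c\<xi>']]) (use that \<xi>'C0 in auto)
  also have "\<dots> \<le> (b - a)\<^sup>2 * (Mr + Mr) * (b - a)" using that Mr0 by (intro mult_left_mono) auto
  finally show ?thesis .
 qed
 have pairC: "norm (\<xi> n t, \<xi>' n t) \<le> C" if "t \<in> {a..b}" for n t
  using norm_Pair_le[of "\<xi> n t" "\<xi>' n t"] \<xi>C0[OF that, of n] \<xi>'C0[OF that, of n] by (simp add: C_def algebra_simps)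
 have C0: "C \<ge> 0" using Mr0 ab by (simp add: C_def)
 define W where "W n = integral {a..b} (\<lambda>t. \<beta> t * (norm (r n t - m n))\<^sup>2)" for n
 have cW: "cont {a..b} (\<lambda>t. \<beta> t * (norm (r n t - m n))\<^sup>2)" for n
  by (intro continuous_on_mult c\<beta> continuous_on_power continuous_on_norm cont_diff cr cont_const)
 have dE: "integral {a..b} (\<lambda>t. G (z n t) \<bullet> (\<xi> n t, \<xi>' n t)) = W n" for n
 proof -
  have "((\<lambda>t. q n t \<bullet> \<xi>' n t + g n t \<bullet> \<xi> n t) has_integral q n b \<bullet> \<xi> n b - q n a \<bullet> \<xi> n a) {a..b}"
  proof (rule fund_thm)
   show "((\<lambda>t. q n t \<bullet> \<xi> n t) hvd q n t \<bullet> \<xi>' n t + g n t \<bullet> \<xi> n t) (at t within {a..b})"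
    if "t \<in> {a..b}" for t
    using has_derivative_inner[OF dq[OF that, unfolded hvd_def] d\<xi>[OF that, unfolded hvd_def]]
    by (simp add: hvd_def algebra_simps)
  qed (use ab in simp)
  then have 1: "((\<lambda>t. q n t \<bullet> \<xi>' n t + g n t \<bullet> \<xi> n t) has_integral 0) {a..b}" by (simp add: \<xi>a \<xi>b)
  have 2: "((\<lambda>t. m n \<bullet> \<xi>' n t) has_integral m n \<bullet> \<xi> n b) {a..b}"
   unfolding \<xi>_def using has_integral_linear[OF integrable_integral[OF integrable_cont[OF c\<xi>', of n]] bounded_linear_inner_right[of "m n"]]
   by (simp add: o_def)
  have 3: "((\<lambda>t. \<beta> t * (norm (r n t - m n))\<^sup>2) has_integral W n) {a..b}"
   unfolding W_def by (rule integrable_integral[OF integrable_cont[OF cW]])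
  have "((\<lambda>t. (q n t \<bullet> \<xi>' n t + g n t \<bullet> \<xi> n t) + m n \<bullet> \<xi>' n t + \<beta> t * (norm (r n t - m n))\<^sup>2) has_integral 0 + m n \<bullet> \<xi> n b + W n) {a..b}"
   by (intro has_integral_add 1 2 3)
  moreover have "(q n t \<bullet> \<xi>' n t + g n t \<bullet> \<xi> n t) + m n \<bullet> \<xi>' n t + \<beta> t * (norm (r n t - m n))\<^sup>2 = G (z n t) \<bullet> (\<xi> n t, \<xi>' n t)" for t
  proof -
   have "\<beta> t * (norm (r n t - m n))\<^sup>2 = (r n t - m n) \<bullet> \<xi>' n t"
    by (simp add: \<xi>'_def power2_norm_eq_inner)
   moreover have "G (z n t) \<bullet> (\<xi> n t, \<xi>' n t) = g n t \<bullet> \<xi> n t + p n t \<bullet> \<xi>' n t"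
    by (simp add: g_def p_def inner_prod_def)
   ultimately show ?thesis by (simp add: r_def inner_diff_left)
  qed
  ultimately show ?thesis by (simp add: \<xi>b integral_unique)
 qed
 have W0: "W n \<ge> 0" for n
  unfolding W_def by (rule integral_nonneg[OF integrable_cont[OF cW]]) (use \<beta>0 in simp)
 have Wlim: "W \<longlonglongrightarrow> 0"
 proof (rule LIMSEQ_I)
  fix e :: real assume e: "e > 0"
  define \<eta> where "\<eta> = e / (2 * (C + 1) * (b - a))"
  have \<eta>: "\<eta> > 0" using e C0 ab by (simp add: \<eta>_def)
  obtain d where d: "d > 0" "\<And>y h. y \<in> Z ==> norm h \<le> d ==> y + h \<in> \<Omega> \<times> UNIV \<and> \<bar>L (y + h) - L y - G y \<bullet> h\<bar> \<le> \<eta> * norm h"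
   using gradient_linearization[OF open_Times[OF \<Omega> open_UNIV] der G Z \<eta>] by blast
  (* This step is within the range of both the linearization and near-minimality. *)
  define s where "s = min d \<rho> / (C + 1)"
  have s: "s > 0" "s * C \<le> d" "s * C \<le> \<rho>"
  proof -
   have "min d \<rho> * C \<le> min d \<rho> * (C + 1)" using d \<rho> by (intro mult_left_mono) auto
   then have "min d \<rho> * C / (C + 1) \<le> min d \<rho>" using C0 by (subst pos_divide_le_eq) auto
   then have "s * C \<le> min d \<rho>" by (simp add: s_def)
   then show "s * C \<le> d" "s * C \<le> \<rho>" by auto
   show "s > 0" using d \<rho> C0 by (simp add: s_def)
  qed
  have key: "s * W n \<le> \<epsilon> n + s * e / 2" for n
  proof -
   have lin: "z n t + (- s) *\<^sub>R (\<xi> n t, \<xi>' n t) \<in> \<Omega> \<times> UNIV \<and>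
     \<bar>L (z n t + (- s) *\<^sub>R (\<xi> n t, \<xi>' n t)) - L (z n t) - G (z n t) \<bullet> ((- s) *\<^sub>R (\<xi> n t, \<xi>' n t))\<bar> \<le> \<eta> * (s * C)"
    if "t \<in> {a..b}" for t
   proof -
    have nh: "norm ((- s) *\<^sub>R (\<xi> n t, \<xi>' n t)) \<le> s * C" using pairC[OF that, of n] s(1) by (simp del: norm_Pair scaleR_Pair)
    then have "norm ((- s) *\<^sub>R (\<xi> n t, \<xi>' n t)) \<le> d" using s(2) by linarith
    from d(2)[OF zZ[OF that] this] nh show ?thesis
     by (meson \<eta> less_imp_le mult_left_mono order_trans)
   qed
   have cvar: "cont {a..b} (\<lambda>t. L (z n t + (- s) *\<^sub>R (\<xi> n t, \<xi>' n t)))"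
    by (rule cont_compose[OF cL])
     (intro cont_add cz cont_scaleR cont_const cont_Pair c\<xi> c\<xi>',
      use conjunct1[OF lin] in blast)
   have cLz: "cont {a..b} (\<lambda>t. L (z n t))"
    by (rule cont_compose[OF cLZ cz]) (use zZ in auto)
   have cGx: "cont {a..b} (\<lambda>t. G (z n t) \<bullet> (\<xi> n t, \<xi>' n t))"
    by (intro continuous_on_inner cGz cont_Pair c\<xi> c\<xi>')
   have "integral {a..b} (\<lambda>t. L (x n t, x' n t)) - \<epsilon> n \<le> integral {a..b} (\<lambda>t. L (x n t + (- s) *\<^sub>R \<xi> n t, x' n t + (- s) *\<^sub>R \<xi>' n t))"
   proof (rule min)
    show "((\<lambda>t. (- s) *\<^sub>R \<xi> n t) hvd (- s) *\<^sub>R \<xi>' n t) (at t within {a..b})" if "t \<in> {a..b}" for t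
     using blin_hvd[OF bounded_linear_scaleR_right d\<xi>[OF that]] .
    show "cont {a..b} (\<lambda>t. (- s) *\<^sub>R \<xi>' n t)" by (intro cont_scaleR cont_const c\<xi>')
    show "norm ((- s) *\<^sub>R \<xi> n t) \<le> \<rho>" if "t \<in> {a..b}" for t
    proof -
     have "norm (\<xi> n t) \<le> C" using norm_fst_le[of "\<xi> n t" "\<xi>' n t"] pairC[OF that, of n] by linarith
     then have "s * norm (\<xi> n t) \<le> s * C" using s by (intro mult_left_mono) auto
     then have "s * norm (\<xi> n t) \<le> \<rho>" using s(3) by linarith
     then show ?thesis using s(1) by simp
    qed
   qed (simp_all add: \<xi>a \<xi>b \<xi>'_def \<beta>_def)
   then have 1: "integral {a..b} (\<lambda>t. L (z n t)) - \<epsilon> n \<le> integral {a..b} (\<lambda>t. L (z n t + (- s) *\<^sub>R (\<xi> n t, \<xi>' n t)))"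
    by (simp add: z_def)
   have "integral {a..b} (\<lambda>t. L (z n t + (- s) *\<^sub>R (\<xi> n t, \<xi>' n t))) \<le>
    integral {a..b} (\<lambda>t. L (z n t) - s * (G (z n t) \<bullet> (\<xi> n t, \<xi>' n t)) + \<eta> * (s * C))"
   proof (rule integral_le)
    show "(\<lambda>t. L (z n t + (- s) *\<^sub>R (\<xi> n t, \<xi>' n t))) integrable_on {a..b}"
     by (rule integrable_cont[OF cvar])
    show "(\<lambda>t. L (z n t) - s * (G (z n t) \<bullet> (\<xi> n t, \<xi>' n t)) + \<eta> * (s * C)) integrable_on {a..b}"
     by (intro integrable_cont cont_add cont_diff continuous_on_mult cont_const cLz cGx)
    show "L (z n t + (- s) *\<^sub>R (\<xi> n t, \<xi>' n t)) \<le> L (z n t) - s * (G (z n t) \<bullet> (\<xi> n t, \<xi>' n t)) + \<eta> * (s * C)"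
     if "t \<in> {a..b}" for t
     using conjunct2[OF lin[OF that]] unfolding inner_scaleR_right abs_le_iff by linarith
   qed
   also have "\<dots> = integral {a..b} (\<lambda>t. L (z n t)) - s * W n + \<eta> * (s * C) * (b - a)"
   proof (rule integral_unique)
    have i1: "((\<lambda>t. L (z n t)) has_integral integral {a..b} (\<lambda>t. L (z n t))) {a..b}"
     by (rule integrable_integral[OF integrable_cont[OF cLz]])
    have i2: "((\<lambda>t. s * (G (z n t) \<bullet> (\<xi> n t, \<xi>' n t))) has_integral s * W n) {a..b}"
     using has_integral_mult_right[OF integrable_integral[OF integrable_cont[OF cGx]], of s] dE[of n] by simp
    have i3: "((\<lambda>t. \<eta> * (s * C)) has_integral \<eta> * (s * C) * (b - a)) {a..b}"
     using has_integral_const_real[of "\<eta> * (s * C)" a b] ab by (simp add: mult.commute)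
    show "((\<lambda>t. L (z n t) - s * (G (z n t) \<bullet> (\<xi> n t, \<xi>' n t)) + \<eta> * (s * C)) has_integral
     integral {a..b} (\<lambda>t. L (z n t)) - s * W n + \<eta> * (s * C) * (b - a)) {a..b}"
     by (intro has_integral_add has_integral_diff i1 i2 i3)
   qed
   finally have "s * W n \<le> \<epsilon> n + \<eta> * (s * C) * (b - a)" using 1 by linarith
   moreover have "\<eta> * (s * C) * (b - a) \<le> s * e / 2"
   proof -
    have "\<eta> * C * (b - a) \<le> \<eta> * (C + 1) * (b - a)" using \<eta> ab by (intro mult_right_mono mult_left_mono) auto
    also have "\<dots> = e / 2"
    proof -
     have "C + 1 ~= 0" "b - a ~= 0" using ab C0 by auto
     then show ?thesis unfolding \<eta>_def by (simp add: divide_simps)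
    qed
    finally have "s * (\<eta> * C * (b - a)) \<le> s * (e / 2)" using s by (intro mult_left_mono) auto
    then show ?thesis by (simp add: algebra_simps)
   qed
   ultimately show ?thesis by linarith
  qed
  have "s * e / 4 > 0" using s e by simp
  then obtain n0 where n0: "\<And>n. n \<ge> n0 ==> norm (\<epsilon> n - 0) < s * e / 4" using LIMSEQ_D[OF \<epsilon>] by blast
  show "\<exists>n0. \<forall>n\<ge>n0. norm (W n - 0) < e"
  proof (intro exI allI impI)
   fix n assume "n \<ge> n0"
   then have "\<bar>\<epsilon> n\<bar> < s * e / 4" using n0[of n] by simp
   then have "s * W n < s * e" using key[of n] \<open>s * e / 4 > 0\<close> by linarith
   then show "norm (W n - 0) < e" using s W0[of n] by simp
  qed
 qed
 define qh where "qh n t = q n t + m n" for n t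
 have cqh: "cont {a..b} (qh n)" for n unfolding qh_def by (intro cont_add cq cont_const)
 obtain Q k where Q: "cont {a..b} Q" and k: "strict_mono (k :: nat => nat)"
  and Qlim: "\<And>e. 0 < e ==> \<exists>N. \<forall>n x. n \<ge> N \<and> x \<in> {a..b} --> norm (qh (k n) x - Q x) < e"
 proof (rule Arzela_Ascoli[of "{a..b}" qh "M * (b - a) + Mr"])
  show "norm (qh n t) \<le> M * (b - a) + Mr" if "t \<in> {a..b}" for n t
   unfolding qh_def using norm_triangle_ineq[of "q n t" "m n"] qM[OF that, of n] mM[of n] by linarith
  show "\<exists>d. 0 < d \<and> (\<forall>n y. y \<in> {a..b} \<and> norm (t - y) < d --> norm (qh n t - qh n y) < e)" if "t \<in> {a..b}" "0 < e" for t e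
  proof (intro exI[of _ "e / M"] conjI allI impI)
   show "0 < e / M" using M that by simp
   fix n y assume "y \<in> {a..b} \<and> norm (t - y) < e / M"
   then have "norm (qh n t - qh n y) \<le> M * \<bar>t - y\<bar>" "\<bar>t - y\<bar> < e / M" using q_lip[of y t n] that by (auto simp: qh_def)
   then show "norm (qh n t - qh n y) < e" using M by (simp add: field_simps)
  qed
 qed auto
 have sub: "{a'..b'} \<subseteq> {a..b}" using ab by auto
 define f where "f y = (fst y, snd (G y))" for y
 define Y where "Y t = (X t, Q t)" for t
 have cX: "cont {a..b} X"
 proof (rule uniform_limit_theorem)
  show "uniform_limit {a..b} x X sequentially" using lim by (intro uniform_limitI) auto
 qed (use cx in auto)
 have XK: "X t \<in> K" if "t \<in> {a..b}" for t
 proof (rule closed_sequentially[OF compact_imp_closed[OF K(1)]])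
  show "x n t \<in> K" for n using xK[OF that] .
  show "(\<lambda>n. x n t) \<longlonglongrightarrow> X t"
  proof (rule tendstoI)
   fix e :: real assume "e > 0"
   from lim[OF this] show "\<forall>\<^sub>F n in sequentially. dist (x n t) (X t) < e"
    by (rule eventually_mono) (use that in blast)
  qed
 qed
 have limf: "(\<lambda>n. integral {a'..b'} (\<lambda>t. (dist (f (z (k n) t)) (Y t))\<^sup>2)) \<longlonglongrightarrow> 0"
 proof (rule LIMSEQ_I)
  fix e :: real assume e: "e > 0"
  define \<eta> where "\<eta> = sqrt (e / (4 * (b' - a')))"
  have \<eta>: "\<eta> > 0" "\<eta>\<^sup>2 * (b' - a') = e / 4" using e ab by (auto simp: \<eta>_def field_simps)
  have \<eta>2: "\<eta> / 2 > 0" using \<eta> by simp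
  have "(\<lambda>n. W (k n)) \<longlonglongrightarrow> 0" using LIMSEQ_subseq_LIMSEQ[OF Wlim k] by (simp add: o_def)
  then have ev1: "\<forall>\<^sub>F n in sequentially. W (k n) < \<beta>m * e / 8"
   by (rule order_tendstoD) (use \<beta>m e in simp)
  have ev2: "\<forall>\<^sub>F n in sequentially. \<forall>t\<in>{a..b}. dist (x (k n) t) (X t) < \<eta>"
   using lim[OF \<eta>(1)] eventually_subseq[OF k] by blast
  obtain N where N: "\<forall>n x. n \<ge> N \<and> x \<in> {a..b} --> norm (qh (k n) x - Q x) < \<eta> / 2" using Qlim[OF \<eta>2] by blast
  have ev3: "\<forall>\<^sub>F n in sequentially. n \<ge> N" by (rule eventually_ge_at_top)
  have "\<forall>\<^sub>F n in sequentially. norm (integral {a'..b'} (\<lambda>t. (dist (f (z (k n) t)) (Y t))\<^sup>2) - 0) < e"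
   using ev1 ev2 ev3
  proof eventually_elim
   case (elim n)
   let ?h = "\<lambda>t. (dist (f (z (k n) t)) (Y t))\<^sup>2"
   have ptw: "?h t \<le> \<eta>\<^sup>2 + 2 / \<beta>m * (\<beta> t * (norm (r (k n) t - m (k n)))\<^sup>2) + \<eta>\<^sup>2 / 2" if t: "t \<in> {a'..b'}" for t
   proof -
    have tb: "t \<in> {a..b}" using t sub by blast
    let ?u = "r (k n) t - m (k n)" and ?v = "qh (k n) t - Q t"
    have "?h t = (dist (x (k n) t) (X t))\<^sup>2 + (dist (p (k n) t) (Q t))\<^sup>2"
     by (simp add: f_def Y_def z_def p_def dist_Pair_Pair)
    moreover have "(dist (x (k n) t) (X t))\<^sup>2 \<le> \<eta>\<^sup>2" using elim(2) tb by (intro power_mono) (auto simp: less_imp_le)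
    moreover have "(dist (p (k n) t) (Q t))\<^sup>2 \<le> 2 * (norm ?u)\<^sup>2 + 2 * (norm ?v)\<^sup>2"
    proof -
     have pq: "p (k n) t - Q t = ?u + ?v" by (simp add: r_def qh_def)
     have "dist (p (k n) t) (Q t) \<le> norm ?u + norm ?v" unfolding dist_norm pq by (rule norm_triangle_ineq)
     then have "(dist (p (k n) t) (Q t))\<^sup>2 \<le> (norm ?u + norm ?v)\<^sup>2" by (intro power_mono) auto
     also have "\<dots> \<le> 2 * (norm ?u)\<^sup>2 + 2 * (norm ?v)\<^sup>2"
      using sum_squares_bound[of "norm ?u" "norm ?v"] by (simp add: power2_sum)
     finally show ?thesis .
    qed
    moreover have "(norm ?v)\<^sup>2 \<le> (\<eta> / 2)\<^sup>2" using N elim(3) tb by (intro power_mono) (auto simp: less_imp_le)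
    moreover have "2 * (norm ?u)\<^sup>2 \<le> 2 / \<beta>m * (\<beta> t * (norm ?u)\<^sup>2)"
     using \<beta>m(1) mult_right_mono[OF \<beta>m(2)[OF t], of "(norm ?u)\<^sup>2"] by (simp add: field_simps)
    ultimately show ?thesis by (simp add: power_divide)
   qed
   have chh: "cont {a'..b'} ?h"
   proof -
    have "cont {a..b} (\<lambda>t. f (z (k n) t))" unfolding f_def using cz cGz
     by (intro cont_Pair cont_fst cont_snd)
    then show ?thesis using Q cX unfolding Y_def
     by (intro continuous_on_power continuous_on_dist cont_Pair) (auto intro: cont_subset[OF _ sub])
   qed
   have cW': "cont {a'..b'} (\<lambda>t. \<beta> t * (norm (r (k n) t - m (k n)))\<^sup>2)" by (rule cont_subset[OF cW sub])
   have "integral {a'..b'} ?h \<le> integral {a'..b'} (\<lambda>t. \<eta>\<^sup>2 + 2 / \<beta>m * (\<beta> t * (norm (r (k n) t - m (k n)))\<^sup>2) + \<eta>\<^sup>2 / 2)"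
    by (rule integral_le[OF integrable_cont[OF chh] integrable_cont])
     (intro cont_add continuous_on_mult cont_const cW', fact ptw)
   also have "\<dots> = \<eta>\<^sup>2 * (b' - a') + 2 / \<beta>m * integral {a'..b'} (\<lambda>t. \<beta> t * (norm (r (k n) t - m (k n)))\<^sup>2) + \<eta>\<^sup>2 / 2 * (b' - a')"
   proof (rule integral_unique)
    have i: "((\<lambda>t. c) has_integral c * (b' - a')) {a'..b'}" for c :: real
     using has_integral_const_real[of c a' b'] ab by (simp add: mult.commute)
    show "((\<lambda>t. \<eta>\<^sup>2 + 2 / \<beta>m * (\<beta> t * (norm (r (k n) t - m (k n)))\<^sup>2) + \<eta>\<^sup>2 / 2) has_integral
     \<eta>\<^sup>2 * (b' - a') + 2 / \<beta>m * integral {a'..b'} (\<lambda>t. \<beta> t * (norm (r (k n) t - m (k n)))\<^sup>2) + \<eta>\<^sup>2 / 2 * (b' - a')) {a'..b'}"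
     by (intro has_integral_add i has_integral_mult_right integrable_integral integrable_cont cW')
   qed
   also have "\<dots> \<le> e / 4 + 2 / \<beta>m * W (k n) + e / 8"
   proof -
    have "integral {a'..b'} (\<lambda>t. \<beta> t * (norm (r (k n) t - m (k n)))\<^sup>2) \<le> W (k n)" unfolding W_def
     by (rule integral_subset_le[OF sub integrable_cont[OF cW'] integrable_cont[OF cW]]) (use \<beta>0 in simp)
    then have "2 / \<beta>m * integral {a'..b'} (\<lambda>t. \<beta> t * (norm (r (k n) t - m (k n)))\<^sup>2) \<le> 2 / \<beta>m * W (k n)"
     using \<beta>m(1) by (intro mult_left_mono) auto
    moreover have "\<eta>\<^sup>2 / 2 * (b' - a') = (\<eta>\<^sup>2 * (b' - a')) / 2" by simp
    ultimately show ?thesis unfolding \<eta>(2) by linarith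
   qed
   also have "2 / \<beta>m * W (k n) \<le> e / 4"
   proof -
    have "2 / \<beta>m * W (k n) \<le> 2 / \<beta>m * (\<beta>m * e / 8)" using elim(1) \<beta>m(1) by (intro mult_left_mono) auto
    then show ?thesis using \<beta>m(1) by simp
   qed
   finally have "integral {a'..b'} ?h < e" using e by linarith
   moreover have "integral {a'..b'} ?h \<ge> 0" by (rule integral_nonneg[OF integrable_cont[OF chh]]) simp
   ultimately show ?case by simp
  qed
  then show "\<exists>n0. \<forall>n\<ge>n0. norm (integral {a'..b'} (\<lambda>t. (dist (f (z (k n) t)) (Y t))\<^sup>2) - 0) < e"
   unfolding eventually_sequentially .
 qed
 have fcont: "cont Z f" unfolding f_def by (intro cont_Pair cont_fst cont_snd cGZ cont_id)
 have finj: "inj_on f Z"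
 proof (rule inj_onI)
  fix y1 y2 assume y: "y1 \<in> Z" "y2 \<in> Z" "f y1 = f y2"
  obtain x1 v1 x2 v2 where [simp]: "y1 = (x1, v1)" "y2 = (x2, v2)" by (cases y1, cases y2)
  have "x1 \<in> \<Omega>" using y(1) Z(2) by auto
  show "y1 = y2" using inj[OF \<open>x1 \<in> \<Omega>\<close>, of v1 v2] y(3) by (auto simp: f_def)
 qed
 have cY: "cont {a'..b'} Y" unfolding Y_def
  by (intro cont_Pair cont_subset[OF cX sub] cont_subset[OF Q sub])
 note ic = integral_limit_injection[OF ab(2) Z(1) fcont finj cont_subset[OF cz sub] zZ[OF subsetD[OF sub]] cY limf]
 obtain w where cw: "cont {a'..b'} w" and w: "\<And>t. t \<in> {a'..b'} ==> w t \<in> Z \<and> f (w t) = Y t"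
  and wlim: "\<And>(g :: 'e \<times> 'e => 'e) s t. cont Z g ==> a' \<le> s ==> s \<le> t ==> t \<le> b' ==>
    (\<lambda>n. integral {s..t} (\<lambda>r. g (z (k n) r))) \<longlonglongrightarrow> integral {s..t} (\<lambda>r. g (w r))"
 proof (rule ic[where ?'z = 'e])
  fix w assume 1: "cont {a'..b'} w" and 2: "\<And>t. t \<in> {a'..b'} ==> w t \<in> Z \<and> f (w t) = Y t"
   and 3: "\<And>(g :: 'e \<times> 'e => 'e) s t. cont Z g ==> a' \<le> s ==> s \<le> t ==> t \<le> b' ==>
    (\<lambda>n. integral {s..t} (\<lambda>r. g (z (k n) r))) \<longlonglongrightarrow> integral {s..t} (\<lambda>r. g (w r))"
  show thesis by (rule that[OF 1 2 3])
 qed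
 obtain w2 where "cont {a'..b'} w2" and w2: "\<And>t. t \<in> {a'..b'} ==> w2 t \<in> Z \<and> f (w2 t) = Y t"
  and w2lim: "\<And>(g :: 'e \<times> 'e => real) s t. cont Z g ==> a' \<le> s ==> s \<le> t ==> t \<le> b' ==>
    (\<lambda>n. integral {s..t} (\<lambda>r. g (z (k n) r))) \<longlonglongrightarrow> integral {s..t} (\<lambda>r. g (w2 r))"
 proof (rule ic[where ?'z = real])
  fix w assume 1: "cont {a'..b'} w" and 2: "\<And>t. t \<in> {a'..b'} ==> w t \<in> Z \<and> f (w t) = Y t"
   and 3: "\<And>(g :: 'e \<times> 'e => real) s t. cont Z g ==> a' \<le> s ==> s \<le> t ==> t \<le> b' ==>
    (\<lambda>n. integral {s..t} (\<lambda>r. g (z (k n) r))) \<longlonglongrightarrow> integral {s..t} (\<lambda>r. g (w r))"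
  show thesis by (rule that[OF 1 2 3])
 qed
 have w2w: "w2 t = w t" if "t \<in> {a'..b'}" for t
  using inj_onD[OF finj, of "w2 t" "w t"] w[OF that] w2[OF that] by simp
 define V where "V t = snd (w t)" for t
 have wXV: "w t = (X t, V t)" if "t \<in> {a'..b'}" for t
  using w[OF that] by (cases "w t") (auto simp: V_def f_def Y_def)
 have cV: "cont {a'..b'} V" unfolding V_def by (intro cont_snd cw)
 have Xint: "X t - X a' = integral {a'..t} V" if t: "t \<in> {a'..b'}" for t
 proof -
  have ta: "t \<in> {a..b}" "a' \<in> {a..b}" using t sub ab by auto
  have "(\<lambda>n. integral {a'..t} (\<lambda>r. snd (z (k n) r))) \<longlonglongrightarrow> integral {a'..t} (\<lambda>r. snd (w r))"
   by (rule wlim) (use t in \<open>auto intro: cont_snd cont_id\<close>)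
  moreover have "integral {a'..t} (\<lambda>r. snd (z (k n) r)) = x (k n) t - x (k n) a'" for n
  proof (rule integral_unique, rule fund_thm)
   show "(x (k n) hvd snd (z (k n) r)) (at r within {a'..t})" if "r \<in> {a'..t}" for r
    using has_vector_derivative_within_subset[OF x, of r "{a'..t}"] that ta by (auto simp: z_def)
  qed (use t in simp)
  moreover have pl: "(\<lambda>n. x (k n) s) \<longlonglongrightarrow> X s" if "s \<in> {a..b}" for s
  proof -
   have "(\<lambda>n. x n s) \<longlonglongrightarrow> X s"
   proof (rule tendstoI)
    fix e :: real assume "e > 0"
    from lim[OF this] show "\<forall>\<^sub>F n in sequentially. dist (x n s) (X s) < e"
     by (rule eventually_mono) (use that in blast)
   qed
   from LIMSEQ_subseq_LIMSEQ[OF this k] show ?thesis by (simp add: o_def)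
  qed
  ultimately have "(\<lambda>n. x (k n) t - x (k n) a') \<longlonglongrightarrow> integral {a'..t} V" by (simp add: V_def[abs_def])
  then show ?thesis using tendsto_diff[OF pl[OF ta(1)] pl[OF ta(2)]] LIMSEQ_unique by blast
 qed
 have cGw: "cont {a'..b'} (\<lambda>t. G (w t))"
  by (rule cont_compose[OF cGZ cw]) (use w in auto)
 have Qint: "Q t - Q a' = integral {a'..t} (\<lambda>r. fst (G (w r)))" if t: "t \<in> {a'..b'}" for t
 proof -
  have ta: "t \<in> {a..b}" "a' \<in> {a..b}" using t sub ab by auto
  have "(\<lambda>n. integral {a'..t} (\<lambda>r. fst (G (z (k n) r)))) \<longlonglongrightarrow> integral {a'..t} (\<lambda>r. fst (G (w r)))"
   by (rule wlim) (use t in \<open>auto intro: cont_fst cGZ\<close>)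
  moreover have "integral {a'..t} (\<lambda>r. fst (G (z (k n) r))) = qh (k n) t - qh (k n) a'" for n
   using q_diff[of a' t "k n"] ta t by (simp add: qh_def g_def[abs_def])
  moreover have pl: "(\<lambda>n. qh (k n) s) \<longlonglongrightarrow> Q s" if "s \<in> {a..b}" for s
   using Qlim that by (intro LIMSEQ_I) blast
  ultimately have "(\<lambda>n. qh (k n) t - qh (k n) a') \<longlonglongrightarrow> integral {a'..t} (\<lambda>r. fst (G (w r)))" by simp
  then show ?thesis using tendsto_diff[OF pl[OF ta(1)] pl[OF ta(2)]] LIMSEQ_unique by blast
 qed
 show ?thesis
 proof (rule that[OF cV])
  fix t assume t: "t \<in> {a'<..<b'}"
  then have t': "t \<in> {a'..b'}" by auto
  show "(X hvd V t) (at t)" by (rule derivative_from_integral[OF cV t Xint])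
  have "(Q hvd fst (G (w t))) (at t)"
   by (rule derivative_from_integral[OF cont_fst[OF cGw] t Qint])
  then have "((\<lambda>t. snd (G (X t, V t))) hvd fst (G (w t))) (at t)"
  proof (rule hvd_cong_open[where S = "{a'<..<b'}"])
   fix s assume "s \<in> {a'<..<b'}"
   then have s: "s \<in> {a'..b'}" by auto
   show "Q s = snd (G (X s, V s))" using w[OF s] wXV[OF s] by (simp add: f_def Y_def)
  qed (use t in auto)
  then show "((\<lambda>t. snd (G (X t, V t))) hvd fst (G (X t, V t))) (at t)" using wXV[OF t'] by simp
 next
  fix t assume t: "t \<in> {a'..b'}"
  have cLw: "cont {a'..b'} (\<lambda>t. L (w t))"
   by (rule cont_compose[OF cLZ cw]) (use w in auto)
  have "L (w t) - c0 \<le> 0"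
  proof (rule nonpos_from_integrals[OF ab(2) _ _ t])
   show "cont {a'..b'} (\<lambda>t. L (w t) - c0)" by (intro cont_diff cLw cont_const)
   fix s t assume st: "a' \<le> s" "s \<le> t" "t \<le> b'"
   have subst: "{s..t} \<subseteq> {a'..b'}" using st by auto
   have "(\<lambda>n. integral {s..t} (\<lambda>r. L (z (k n) r))) \<longlonglongrightarrow> integral {s..t} (\<lambda>r. L (w2 r))"
    by (rule w2lim[OF cLZ st])
   moreover have "(\<lambda>n. c (k n) * (t - s)) \<longlonglongrightarrow> c0 * (t - s)"
    using LIMSEQ_subseq_LIMSEQ[OF c(2) k] by (intro tendsto_mult tendsto_const) (simp add: o_def)
   moreover have "integral {s..t} (\<lambda>r. L (z (k n) r)) \<le> c (k n) * (t - s)" for n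
   proof -
    have "integral {s..t} (\<lambda>r. L (z (k n) r)) \<le> integral {s..t} (\<lambda>r. c (k n))"
    proof (rule integral_le[OF integrable_cont])
     show "cont {s..t} (\<lambda>r. L (z (k n) r))"
      by (rule cont_compose[OF cLZ cont_subset[OF cz]]) (use zZ subst sub in auto)
     show "L (z (k n) r) \<le> c (k n)" if "r \<in> {s..t}" for r using c(1)[of r "k n"] that subst sub by (auto simp: z_def)
    qed auto
    then show ?thesis using st by (simp add: mult.commute)
   qed
   ultimately have "integral {s..t} (\<lambda>r. L (w2 r)) \<le> c0 * (t - s)" by (intro LIMSEQ_le) auto
   moreover have "integral {s..t} (\<lambda>r. L (w2 r)) = integral {s..t} (\<lambda>r. L (w r))"
    by (rule integral_cong) (use w2w subst in auto)
   moreover have "integral {s..t} (\<lambda>r. L (w r) - c0) = integral {s..t} (\<lambda>r. L (w r)) - integral {s..t} (\<lambda>r. c0)"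
    by (rule integral_diff) (auto intro!: integrable_cont cont_subset[OF cLw subst])
   ultimately show "integral {s..t} (\<lambda>r. L (w r) - c0) \<le> 0" using st by (simp add: mult.commute)
  qed
  then show "X t \<in> K \<and> L (X t, V t) \<le> c0" using wXV[OF t] XK t sub by auto
 qed
qed

section \<open>Charts, tangent vectors and curves\<close>

lemma topspace_manifold_topology [simp]: "topspace (manifold_topology A) = points A"
proof -
 have "dm c \<in> {dm c \<inter> mp c -` W |c W. c \<in> A \<and> open W}" if "c \<in> A" for c
  using that by (intro CollectI exI[of _ c] exI[of _ UNIV]) auto
 then show ?thesis unfolding manifold_topology_def points_def topology_generated_by_topspace by blast
qed

lemma openin_chart_preimage:
 assumes "c \<in> A" "open W" shows "openin (manifold_topology A) (dm c \<inter> mp c -` W)"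
 unfolding manifold_topology_def using assms by (intro topology_generated_by_Basis) blast

lemma openin_chart_dom: "c \<in> A ==> openin (manifold_topology A) (dm c)"
 using openin_chart_preimage[of c A UNIV] by simp

lemma continuous_map_into_manifold:
 "continuous_map X (manifold_topology A) f \<longleftrightarrow>
  f ` topspace X \<subseteq> points A \<and>
  (\<forall>c\<in>A. \<forall>W. open W --> openin X {x \<in> topspace X. f x \<in> dm c \<and> mp c (f x) \<in> W})"
proof -
 have *: "f -` (dm c \<inter> mp c -` W) \<inter> topspace X = {x \<in> topspace X. f x \<in> dm c \<and> mp c (f x) \<in> W}"
  for c W by auto
 have U: "\<Union> {dm c \<inter> mp c -` W |c W. c \<in> A \<and> open W} = points A"
  using topspace_manifold_topology[of A] by (simp add: manifold_topology_def)
 have "(\<forall>U. U \<in> {dm c \<inter> mp c -` W |c W. c \<in> A \<and> open W} --> openin X (f -` U \<inter> topspace X)) \<longleftrightarrow>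
  (\<forall>c\<in>A. \<forall>W. open W --> openin X (f -` (dm c \<inter> mp c -` W) \<inter> topspace X))" by blast
 then show ?thesis unfolding manifold_topology_def continuous_on_generated_topo_iff U *
  by (subst conj_commute) (simp only:)
qed

lemma openin_curve_preimage:
 assumes "rcont (manifold_topology A) q" "c \<in> A" "open W"
 shows "open {t. q t \<in> dm c \<and> mp c (q t) \<in> W}"
 using assms(1)[unfolded continuous_map_into_manifold, THEN conjunct2, rule_format, OF assms(2,3)] by simp

lemma open_curve_dom:
 assumes "rcont (manifold_topology A) q" "c \<in> A"
 shows "open {t. q t \<in> dm c}"
 using openin_curve_preimage[OF assms open_UNIV] by simp

lemma curve_in_points: "rcont (manifold_topology A) q ==> q t \<in> points A"
 unfolding continuous_map_into_manifold by auto

lemma cont_coords: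
 assumes "rcont (manifold_topology A) q" "c \<in> A"
 shows "cont {t. q t \<in> dm c} (\<lambda>t. mp c (q t))"
 unfolding continuous_on_open_vimage[OF open_curve_dom[OF assms]]
proof (intro allI impI)
 fix W :: "'b set" assume "open W"
 have "(\<lambda>t. mp c (q t)) -` W \<inter> {t. q t \<in> dm c} = {t. q t \<in> dm c \<and> mp c (q t) \<in> W}" by auto
 then show "open ((\<lambda>t. mp c (q t)) -` W \<inter> {t. q t \<in> dm c})"
  using openin_curve_preimage[OF assms \<open>open W\<close>] by simp
qed

lemma charts_at_iff: "c \<in> charts_at A x \<longleftrightarrow> c \<in> A \<and> x \<in> dm c"
 by (auto simp: charts_at_def)

lemma chart_at_in: "x \<in> points A ==> chart_at A x \<in> charts_at A x"
 unfolding chart_at_def by (rule someI_ex) (auto simp: points_def charts_at_def)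

lemma manifold_topology_euclidean [simp]: "manifold_topology euclidean_atlas = euclidean"
proof -
 have e: "{dm c \<inter> mp c -` W |c W. c \<in> euclidean_atlas \<and> open W} = {W :: 'a set. open W}"
  by (auto simp: euclidean_atlas_def)
 have "open U" if "generate_topology_on {W. open W} U" for U :: "'a set"
  using that by induction auto
 moreover have "generate_topology_on {W. open W} U" if "open U" for U :: "'a set"
  by (rule generate_topology_on.Basis) (use that in simp)
 ultimately have "openin (topology_generated_by {W :: 'a set. open W}) U \<longleftrightarrow> open U" for U
  unfolding openin_topology_generated_by_iff by blast
 then show ?thesis unfolding manifold_topology_def e topology_eq by simp
qed

lemma chart_inv_id [simp]: "iv (UNIV, id) = id"
 by (rule ext) (simp add: chart_inv_def)

definition C1_curve :: "('a, 'e::euclidean_space) atlas => (real => 'a) => bool" where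
 "C1_curve A q \<longleftrightarrow> rcont (manifold_topology A) q \<and>
   (\<forall>c\<in>A. (\<forall>t. q t \<in> dm c --> (mp c \<circ> q) differentiable (at t)) \<and>
    cont {t. q t \<in> dm c} (\<lambda>t. vector_derivative (mp c \<circ> q) (at t)))"

lemma C1_cont: "C1_curve A q ==> rcont (manifold_topology A) q"
 by (simp add: C1_curve_def)

lemma C1_coords_hvd:
 assumes "C1_curve A q" "c \<in> A" "q t \<in> dm c"
 shows "((\<lambda>t. mp c (q t)) hvd velocity A q t c) (at t)"
proof -
 have "(mp c \<circ> q) differentiable (at t)" using assms by (simp add: C1_curve_def)
 then have "((mp c \<circ> q) hvd vector_derivative (mp c \<circ> q) (at t)) (at t)"
  by (simp add: vector_derivative_works)
 then show ?thesis using assms(2,3) by (simp add: velocity_def charts_at_def o_def)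
qed

lemma C1_cont_velocity:
 assumes "C1_curve A q" "c \<in> A"
 shows "cont {t. q t \<in> dm c} (\<lambda>t. velocity A q t c)"
proof -
 have "cont {t. q t \<in> dm c} (\<lambda>t. vector_derivative (mp c \<circ> q) (at t))"
  using assms by (simp add: C1_curve_def)
 then show ?thesis by (rule continuous_on_eq) (use assms in \<open>auto simp: velocity_def charts_at_def\<close>)
qed

locale atlas_locale =
 fixes A :: "('a, 'e::euclidean_space) atlas"
 assumes atlas: "smooth_atlas A"
begin

abbreviation "MT \<equiv> manifold_topology A"

lemma chart_inj: "c \<in> A ==> inj_on (mp c) (dm c)"
 using atlas by (simp add: smooth_atlas_def)

lemma chart_inv_map [simp]: "c \<in> A ==> x \<in> dm c ==> iv c (mp c x) = x"
 using chart_inj by (simp add: chart_inv_def)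

lemma chart_inv_in: "y \<in> mp c ` dm c ==> iv c y \<in> dm c"
 by (simp add: chart_inv_def inv_into_into)

lemma map_chart_inv: "y \<in> mp c ` dm c ==> mp c (iv c y) = y"
 by (simp add: chart_inv_def f_inv_into_f)

lemma open_chart_image: "c \<in> A ==> open (mp c ` dm c)"
 using atlas by (simp add: smooth_atlas_def)

lemma open_overlap: "c \<in> A ==> d \<in> A ==> open (mp c ` (dm c \<inter> dm d))"
 using atlas by (simp add: smooth_atlas_def)

lemma smooth_transition:
 "c \<in> A ==> d \<in> A ==> smooth_on (mp d \<circ> iv c) (mp c ` (dm c \<inter> dm d))"
 using atlas by (simp add: smooth_atlas_def)

lemma points_chart: "c \<in> A ==> x \<in> dm c ==> x \<in> points A"
 by (auto simp: points_def)

lemma chart_inv_continuous: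
 assumes c: "c \<in> A" shows "continuous_map (top_of_set (mp c ` dm c)) MT (iv c)"
 unfolding continuous_map_into_manifold
proof (intro conjI ballI allI impI)
 show "iv c ` topspace (top_of_set (mp c ` dm c)) \<subseteq> points A"
  using points_chart[OF c] chart_inv_map[OF c] by auto
 fix d W assume d: "d \<in> A" and W: "open (W :: 'e set)"
 let ?O = "mp c ` (dm c \<inter> dm d)"
 have "cont ?O (mp d \<circ> iv c)" using smooth_transition[OF c d] by (rule smooth_cont)
 then have "open ((mp d \<circ> iv c) -` W \<inter> ?O)"
  using W continuous_on_open_vimage[OF open_overlap[OF c d]] by blast
 moreover have "{y \<in> topspace (top_of_set (mp c ` dm c)). iv c y \<in> dm d \<and> mp d (iv c y) \<in> W}
  = (mp d \<circ> iv c) -` W \<inter> ?O"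
  using chart_inv_map[OF c] by auto
 ultimately show "openin (top_of_set (mp c ` dm c))
  {y \<in> topspace (top_of_set (mp c ` dm c)). iv c y \<in> dm d \<and> mp d (iv c y) \<in> W}"
  using open_chart_image[OF c] by (auto simp: openin_open_eq)
qed

lemma continuous_into_chartsI:
 fixes q :: "'m::metric_space => 'a"
 assumes "\<And>t0. t0 \<in> S ==> \<exists>c\<in>A. \<exists>e>0. (\<forall>t\<in>S \<inter> ball t0 e. q t \<in> dm c) \<and> cont (S \<inter> ball t0 e) (\<lambda>t. mp c (q t))"
 shows "continuous_map (top_of_set S) MT q"
 unfolding continuous_map_into_manifold
proof (intro conjI ballI allI impI)
 show "q ` topspace (top_of_set S) \<subseteq> points A"
 proof clarify
  fix t0 assume "t0 \<in> topspace (top_of_set S)"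
  then have "t0 \<in> S" by simp
  then obtain c e where "c \<in> A" "e > 0" "\<forall>t\<in>S \<inter> ball t0 e. q t \<in> dm c" using assms[of t0] by blast
  then show "q t0 \<in> points A" using points_chart[of c "q t0"] \<open>t0 \<in> S\<close> by simp
 qed
 fix d W assume d: "d \<in> A" and W: "open (W :: 'e set)"
 have "openin (top_of_set S) {t\<in>S. q t \<in> dm d \<and> mp d (q t) \<in> W}"
  unfolding openin_subopen[of _ "{t\<in>S. q t \<in> dm d \<and> mp d (q t) \<in> W}"]
 proof clarify
  fix t0 assume t0: "t0 \<in> S" "q t0 \<in> dm d" "mp d (q t0) \<in> W"
  obtain c e where c: "c \<in> A" and e: "e > 0" and dom: "\<forall>t\<in>S \<inter> ball t0 e. q t \<in> dm c"
   and cont: "cont (S \<inter> ball t0 e) (\<lambda>t. mp c (q t))" using assms[OF t0(1)] by blast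
  let ?O = "mp c ` (dm c \<inter> dm d)"
  let ?P = "(mp d \<circ> iv c) -` W \<inter> ?O"
  have "cont ?O (mp d \<circ> iv c)" using smooth_transition[OF c d] by (rule smooth_cont)
  then have "open ?P" using W continuous_on_open_vimage[OF open_overlap[OF c d]] by blast
  then have "openin (top_of_set (S \<inter> ball t0 e)) ((S \<inter> ball t0 e) \<inter> (\<lambda>t. mp c (q t)) -` ?P)"
   using cont continuous_openin_preimage_gen by blast
  then have op: "openin (top_of_set S) ((S \<inter> ball t0 e) \<inter> (\<lambda>t. mp c (q t)) -` ?P)"
   by (rule openin_trans) (simp add: openin_open_Int)
  have 1: "t0 \<in> (S \<inter> ball t0 e) \<inter> (\<lambda>t. mp c (q t)) -` ?P"
   using t0 e dom c by auto
  have 2: "(S \<inter> ball t0 e) \<inter> (\<lambda>t. mp c (q t)) -` ?P \<subseteq> {t\<in>S. q t \<in> dm d \<and> mp d (q t) \<in> W}"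
  proof
   fix t assume t: "t \<in> (S \<inter> ball t0 e) \<inter> (\<lambda>t. mp c (q t)) -` ?P"
   then have "q t \<in> dm c" using dom by blast
   moreover obtain y where "y \<in> dm c \<inter> dm d" "mp c (q t) = mp c y" using t by auto
   ultimately have "q t \<in> dm d" using inj_onD[OF chart_inj[OF c]] by (metis IntD1 IntD2)
   then show "t \<in> {t\<in>S. q t \<in> dm d \<and> mp d (q t) \<in> W}"
    using t \<open>q t \<in> dm c\<close> c by auto
  qed
  show "\<exists>T. openin (top_of_set S) T \<and> t0 \<in> T \<and> T \<subseteq> {t\<in>S. q t \<in> dm d \<and> mp d (q t) \<in> W}"
   using op 1 2 by blast
 qed
 then show "openin (top_of_set S) {t \<in> topspace (top_of_set S). q t \<in> dm d \<and> mp d (q t) \<in> W}"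
  by simp
qed

lemma continuous_curveI:
 assumes "\<And>t0. \<exists>c\<in>A. \<exists>e>0. (\<forall>t\<in>ball t0 e. q t \<in> dm c) \<and> cont (ball t0 e) (\<lambda>t. mp c (q t))"
 shows "rcont MT q"
 using continuous_into_chartsI[of UNIV q] assms by simp

lemma curve_chart_ball:
 assumes "rcont MT q" "c \<in> A" "q t0 \<in> dm c"
 obtains e where "e > 0" "\<And>t. t \<in> ball t0 e ==> q t \<in> dm c"
proof -
 have "t0 \<in> {t. q t \<in> dm c}" using assms(3) by simp
 then obtain e where "e > 0" "ball t0 e \<subseteq> {t. q t \<in> dm c}"
  using open_curve_dom[OF assms(1,2)] open_contains_ball by blast
 then show ?thesis using that by blast
qed

subsection \<open>Tangent vectors\<close>

lemma transition_derivative: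
 assumes "c \<in> charts_at A x" "d \<in> charts_at A x"
 shows "((mp d \<circ> iv c) has_derivative
  Df (mp d \<circ> iv c) (mp c x)) (at (mp c x))"
 by (rule smooth_hder[OF smooth_transition]) (use assms in \<open>auto simp: charts_at_iff\<close>)

lemma transition_cocycle:
 assumes c: "c \<in> charts_at A x" and d: "d \<in> charts_at A x" and e: "e \<in> charts_at A x"
 shows "Df (mp e \<circ> iv d) (mp d x)
   (Df (mp d \<circ> iv c) (mp c x) w)
  = Df (mp e \<circ> iv c) (mp c x) w"
proof -
 have cA: "c \<in> A" "x \<in> dm c" and dA: "d \<in> A" "x \<in> dm d" and eA: "e \<in> A" "x \<in> dm e"
  using assms by (auto simp: charts_at_iff)
 have x: "(mp d \<circ> iv c) (mp c x) = mp d x" using cA by simp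
 have comp: "(((mp e \<circ> iv d) \<circ> (mp d \<circ> iv c)) has_derivative
   (Df (mp e \<circ> iv d) (mp d x) \<circ>
   Df (mp d \<circ> iv c) (mp c x))) (at (mp c x))"
  using diff_chain_at[OF transition_derivative[OF c d], of "mp e \<circ> iv d"]
   transition_derivative[OF d e] unfolding x by blast
 have "((mp e \<circ> iv c) has_derivative
   (Df (mp e \<circ> iv d) (mp d x) \<circ>
   Df (mp d \<circ> iv c) (mp c x))) (at (mp c x))"
  by (rule hder_cong_open[OF comp open_overlap[OF cA(1) dA(1)]])
    (use cA dA in auto)
 from Df_at[OF this] show ?thesis by (metis comp_apply)
qed

lemma transition_self:
 assumes c: "c \<in> charts_at A x"
 shows "Df (mp c \<circ> iv c) (mp c x) w = w"
proof -
 have cA: "c \<in> A" "x \<in> dm c" using assms by (auto simp: charts_at_iff)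
 have "((mp c \<circ> iv c) hder (\<lambda>w. w)) (at (mp c x))"
  by (rule hder_cong_open[OF has_derivative_ident open_chart_image[OF cA(1)]])
    (use cA in auto)
 from Df_at[OF this] show ?thesis by metis
qed

lemma transition_linear:
 "c \<in> charts_at A x ==> d \<in> charts_at A x ==>
  linear (Df (mp d \<circ> iv c) (mp c x))"
 using transition_derivative hder_linear by blast

lemma tangent_transition:
 assumes "v \<in> tangent_space A x" "c \<in> charts_at A x" "d \<in> charts_at A x"
 shows "v d = Df (mp d \<circ> iv c) (mp c x) (v c)"
 using assms unfolding tangent_space_def by blast

lemma tangent_off: "v \<in> tangent_space A x ==> c \<notin> charts_at A x ==> v c = 0"
 unfolding tangent_space_def by blast

lemma tangent_of_coords_in:
 assumes "c \<in> charts_at A x" shows "tangent_of_coords A c x w \<in> tangent_space A x"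
 unfolding tangent_space_def
proof (intro CollectI conjI allI impI ballI)
 show "tangent_of_coords A c x w d = 0" if "d \<notin> charts_at A x" for d
  using that by (simp add: tangent_of_coords_def)
 fix d e assume d: "d \<in> charts_at A x" and e: "e \<in> charts_at A x"
 show "tangent_of_coords A c x w e = Df (mp e \<circ> iv d) (mp d x) (tangent_of_coords A c x w d)"
  using d e transition_cocycle[OF assms d e] by (simp add: tangent_of_coords_def)
qed

lemma tangent_of_coords_self: "c \<in> charts_at A x ==> tangent_of_coords A c x w c = w"
 by (simp add: tangent_of_coords_def transition_self)

lemma tangent_of_coords_coords:
 "v \<in> tangent_space A x ==> c \<in> charts_at A x ==> tangent_of_coords A c x (v c) = v"
proof (rule ext)
 fix d assume *: "v \<in> tangent_space A x" "c \<in> charts_at A x"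
 show "tangent_of_coords A c x (v c) d = v d"
  using tangent_transition[OF *, of d] tangent_off[OF *(1), of d] by (simp add: tangent_of_coords_def)
qed

lemma tangent_of_coords_linear:
 assumes "c \<in> charts_at A x"
 shows "tangent_of_coords A c x (a *\<^sub>R u + b *\<^sub>R v) =
  (\<lambda>d. a *\<^sub>R tangent_of_coords A c x u d + b *\<^sub>R tangent_of_coords A c x v d)"
proof (rule ext)
 fix d
 show "tangent_of_coords A c x (a *\<^sub>R u + b *\<^sub>R v) d = a *\<^sub>R tangent_of_coords A c x u d + b *\<^sub>R tangent_of_coords A c x v d"
  by (cases "d \<in> charts_at A x")
   (simp_all add: tangent_of_coords_def linear_add[OF transition_linear[OF assms]] linear_scale[OF transition_linear[OF assms]])
qed

lemma tangent_of_coords_zero: "c \<in> charts_at A x ==> tangent_of_coords A c x 0 = (\<lambda>d. 0)"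
 using tangent_of_coords_linear[of c x 0 0 0 0] unfolding scaleR_zero_left add_0 .

lemma tangent_eqI:
 assumes "u \<in> tangent_space A x" "v \<in> tangent_space A x" "c \<in> charts_at A x" "u c = v c" shows "u = v"
 using tangent_of_coords_coords[OF assms(1,3)] tangent_of_coords_coords[OF assms(2,3)] unfolding assms(4) by (rule trans[OF sym])

lemma tangent_space_combination:
 assumes "u \<in> tangent_space A x" "v \<in> tangent_space A x"
 shows "(\<lambda>c. a *\<^sub>R u c + b *\<^sub>R v c) \<in> tangent_space A x"
 unfolding tangent_space_def
proof (intro CollectI conjI allI impI ballI)
 show "a *\<^sub>R u c + b *\<^sub>R v c = 0" if "c \<notin> charts_at A x" for c
  using tangent_off[OF assms(1) that] tangent_off[OF assms(2) that] by simp
 fix c d assume cd: "c \<in> charts_at A x" "d \<in> charts_at A x"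
 have "u d = Df (mp d \<circ> iv c) (mp c x) (u c)"
  "v d = Df (mp d \<circ> iv c) (mp c x) (v c)"
  using tangent_transition[OF assms(1) cd] tangent_transition[OF assms(2) cd] .
 then show "a *\<^sub>R u d + b *\<^sub>R v d = Df (mp d \<circ> iv c) (mp c x) (a *\<^sub>R u c + b *\<^sub>R v c)"
  by (simp only: linear_add[OF transition_linear[OF cd]] linear_scale[OF transition_linear[OF cd]])
qed

lemma zero_tangent: "(\<lambda>c. 0) \<in> tangent_space A x"
 unfolding tangent_space_def
proof (intro CollectI conjI allI impI ballI)
 fix c d assume cd: "c \<in> charts_at A x" "d \<in> charts_at A x"
 show "0 = Df (mp d \<circ> iv c) (mp c x) 0"
  using linear_0[OF transition_linear[OF cd]] by simp
qed simp

lemma curve_transition_derivative: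
 assumes q: "q t \<in> dm c" "q t \<in> dm d" and cd: "c \<in> A" "d \<in> A"
  and e: "e > 0" "\<And>s. s \<in> ball t e ==> q s \<in> dm c"
  and der: "((\<lambda>t. mp c (q t)) hvd g) (at t)"
 shows "((\<lambda>t. mp d (q t)) has_vector_derivative
  Df (mp d \<circ> iv c) (mp c (q t)) g) (at t)"
proof -
 have cA: "c \<in> charts_at A (q t)" and dA: "d \<in> charts_at A (q t)" using q cd by (auto simp: charts_at_iff)
 have "(((mp d \<circ> iv c) \<circ> (\<lambda>t. mp c (q t))) has_vector_derivative
   Df (mp d \<circ> iv c) (mp c (q t)) g) (at t)"
  by (rule vector_derivative_diff_chain_within[OF der has_derivative_at_withinI[OF transition_derivative[OF cA dA]]])
 then show ?thesis
  by (rule hvd_cong_open[where S = "ball t e"]) (use e cd in auto)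
qed

text \<open>The derivative in one chart around each time determines the derivatives in all the others by the chain rule.\<close>

lemma C1_curveI:
 assumes loc: "\<And>t0. \<exists>c\<in>A. \<exists>e>0. \<exists>g. (\<forall>t\<in>ball t0 e. q t \<in> dm c \<and>
   ((\<lambda>t. mp c (q t)) hvd g t) (at t)) \<and> cont (ball t0 e) g"
 shows "C1_curve A q"
proof -
 have cont: "rcont MT q"
 proof (rule continuous_curveI)
  fix t0
  obtain c e g where *: "c \<in> A" "e > 0" "\<And>t. t\<in>ball t0 e ==> q t \<in> dm c \<and>
   ((\<lambda>t. mp c (q t)) hvd g t) (at t)" using loc[of t0] by metis
  have "cont (ball t0 e) (\<lambda>t. mp c (q t))"
   by (rule hvd_cont[where f' = g]) (use * hvd_within in blast)
  then show "\<exists>c\<in>A. \<exists>e>0. (\<forall>t\<in>ball t0 e. q t \<in> dm c) \<and> cont (ball t0 e) (\<lambda>t. mp c (q t))"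
   using * by blast
 qed
 have key: "\<exists>h r. r > 0 \<and> (\<forall>t\<in>ball t0 r. q t \<in> dm d \<and> ((\<lambda>t. mp d (q t)) hvd h t) (at t))
   \<and> cont (ball t0 r) h" if d: "d \<in> A" "q t0 \<in> dm d" for d t0
 proof -
  obtain c e g where c: "c \<in> A" and e: "e > 0" and ct: "\<And>t. t\<in>ball t0 e ==> q t \<in> dm c"
   and der: "\<And>t. t\<in>ball t0 e ==> ((\<lambda>t. mp c (q t)) hvd g t) (at t)"
   and g: "cont (ball t0 e) g" using loc[of t0] by metis
  obtain e' where e': "e' > 0" "\<And>t. t \<in> ball t0 e' ==> q t \<in> dm d"
   using curve_chart_ball[OF cont d] by blast
  define r where "r = min e e'"
  define h where "h t = Df (mp d \<circ> iv c) (mp c (q t)) (g t)" for t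
  have r: "r > 0" "ball t0 r \<subseteq> ball t0 e" "ball t0 r \<subseteq> ball t0 e'" using e e' by (auto simp: r_def)
  have "((\<lambda>t. mp d (q t)) hvd h t) (at t)" if t: "t \<in> ball t0 r" for t
  proof -
   have te: "t \<in> ball t0 e" "t \<in> ball t0 e'" using t r by auto
   obtain W where W: "W > 0" "ball t W \<subseteq> ball t0 e" using te(1) open_ball open_contains_ball by blast
   show ?thesis unfolding h_def
    by (rule curve_transition_derivative[OF ct[OF te(1)] e'(2)[OF te(2)] c d(1) W(1) ct der[OF te(1)]])
     (use W(2) in blast)
  qed
  moreover have "cont (ball t0 r) h"
  proof -
   have "cont (ball t0 r) (\<lambda>t. (case (mp c (q t), g t) of (x, v) => Df (mp d \<circ> iv c) x v))"
   proof (rule cont_compose[OF smooth_Df_joint_cont[OF smooth_transition[OF c d(1)]]])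
    have "cont (ball t0 e) (\<lambda>t. mp c (q t))"
     by (rule hvd_cont[where f' = g]) (use der hvd_within in blast)
    then show "cont (ball t0 r) (\<lambda>t. (mp c (q t), g t))"
     using g r by (intro cont_Pair) (auto intro: cont_subset)
    show "(\<lambda>t. (mp c (q t), g t)) ` ball t0 r \<subseteq> mp c ` (dm c \<inter> dm d) \<times> UNIV"
     using ct[OF subsetD[OF r(2)]] e'(2)[OF subsetD[OF r(3)]] by blast
   qed
   then show ?thesis by (simp add: h_def)
  qed
  ultimately show ?thesis using r e' by blast
 qed
 show ?thesis unfolding C1_curve_def
 proof (intro conjI ballI allI impI cont)
  fix d t assume d: "d \<in> A" "q t \<in> dm d"
  obtain h r where "r > 0" "\<forall>t\<in>ball t r. ((\<lambda>t. mp d (q t)) hvd h t) (at t)"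
   using key[OF d] by blast
  then have "((\<lambda>t. mp d (q t)) hvd h t) (at t)" by simp
  then show "(mp d \<circ> q) differentiable (at t)" using differentiableI_vector unfolding o_def by blast
 next
  fix d assume d: "d \<in> A"
  show "cont {t. q t \<in> dm d} (\<lambda>t. vector_derivative (mp d \<circ> q) (at t))"
  proof (intro cont_at_imp ballI)
   fix t0 assume t0: "t0 \<in> {t. q t \<in> dm d}"
   then obtain h r where r: "r > 0" "\<And>t. t\<in>ball t0 r ==> ((\<lambda>t. mp d (q t)) hvd h t) (at t)"
    and h: "cont (ball t0 r) h" using key[OF d, of t0] by blast
   have "cont (ball t0 r) (\<lambda>t. vector_derivative (mp d \<circ> q) (at t))"
    by (rule continuous_on_eq[OF h]) (simp add: vector_derivative_at[OF r(2)] o_def)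
   then show "isCont (\<lambda>t. vector_derivative (mp d \<circ> q) (at t)) t0"
    using r(1) by (simp add: cont_at)
  qed
 qed
qed

lemma velocity_tangent:
 assumes "C1_curve A q" shows "velocity A q t \<in> tangent_space A (q t)"
 unfolding tangent_space_def
proof (intro CollectI conjI allI impI ballI)
 show "velocity A q t c = 0" if "c \<notin> charts_at A (q t)" for c using that by (simp add: velocity_def)
 fix c d assume c: "c \<in> charts_at A (q t)" and d: "d \<in> charts_at A (q t)"
 have cA: "c \<in> A" "q t \<in> dm c" and dA: "d \<in> A" "q t \<in> dm d" using c d by (auto simp: charts_at_iff)
 obtain e where e: "e > 0" "\<And>s. s \<in> ball t e ==> q s \<in> dm c"
  using curve_chart_ball[OF C1_cont[OF assms] cA] by blast
 have "((\<lambda>t. mp d (q t)) has_vector_derivative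
  Df (mp d \<circ> iv c) (mp c (q t)) (velocity A q t c)) (at t)"
  by (rule curve_transition_derivative[OF cA(2) dA(2) cA(1) dA(1) e C1_coords_hvd[OF assms cA]])
 with C1_coords_hvd[OF assms dA]
 show "velocity A q t d = Df (mp d \<circ> iv c) (mp c (q t)) (velocity A q t c)"
  by (rule vector_derivative_unique_at)
qed

lemma velocity_eqI:
 assumes "c \<in> A" "q t \<in> dm c" "((\<lambda>t. mp c (q t)) hvd w) (at t)"
 shows "velocity A q t c = w"
 using assms vector_derivative_at by (auto simp: velocity_def charts_at_iff o_def)

subsection \<open>Smooth curves\<close>

definition smooth_curve_at :: "(real => 'a) => real => bool" where
 "smooth_curve_at q t0 \<longleftrightarrow> (\<exists>c\<in>A. \<exists>e>0. (\<forall>t\<in>ball t0 e. q t \<in> dm c) \<and> smooth_on (\<lambda>t. mp c (q t)) (ball t0 e))"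

lemma smooth_map_real_iff:
 "smooth_map_on euclidean_atlas A UNIV q \<longleftrightarrow>
  rcont MT q \<and> (\<forall>c\<in>A. smooth_on (\<lambda>t. mp c (q t)) {t. q t \<in> dm c})"
proof -
 have "(mp d \<circ> q \<circ> id) = (\<lambda>t. mp d (q t))" for d :: "('a, 'e) chart" by auto
 moreover have "id ` (UNIV \<inter> UNIV \<inter> q -` dm d) = {t. q t \<in> dm d}" for d :: "('a, 'e) chart" by auto
 ultimately show ?thesis unfolding smooth_map_on_def
  by (simp add: subtopology_UNIV) (simp add: euclidean_atlas_def o_def)
qed

lemma smooth_curveI:
 assumes loc: "\<And>t0. smooth_curve_at q t0"
 shows "smooth_map_on euclidean_atlas A UNIV q"
proof -
 have cont: "rcont MT q"
 proof (rule continuous_curveI)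
  fix t0
  from loc[of t0] obtain c e where "c \<in> A" "e > 0" "\<forall>t\<in>ball t0 e. q t \<in> dm c" "smooth_on (\<lambda>t. mp c (q t)) (ball t0 e)"
   unfolding smooth_curve_at_def by blast
  then show "\<exists>c\<in>A. \<exists>e>0. (\<forall>t\<in>ball t0 e. q t \<in> dm c) \<and> cont (ball t0 e) (\<lambda>t. mp c (q t))"
   using smooth_cont by (intro bexI[of _ c] exI[of _ e]) auto
 qed
 have "smooth_on (\<lambda>t. mp d (q t)) {t. q t \<in> dm d}" if d: "d \<in> A" for d
 proof (rule smooth_on_local)
  fix t0 assume t0: "t0 \<in> {t. q t \<in> dm d}"
  obtain c e where c: "c \<in> A" and e: "e > 0" and ct: "\<And>t. t\<in>ball t0 e ==> q t \<in> dm c"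
   and sm: "smooth_on (\<lambda>t. mp c (q t)) (ball t0 e)" using loc[of t0] unfolding smooth_curve_at_def by metis
  obtain e' where e': "e' > 0" "\<And>t. t \<in> ball t0 e' ==> q t \<in> dm d"
   using curve_chart_ball[OF cont d] t0 by blast
  define r where "r = min e e'"
  have r: "r > 0" "ball t0 r \<subseteq> ball t0 e" "ball t0 r \<subseteq> ball t0 e'" using e e' by (auto simp: r_def)
  have "smooth_on (\<lambda>t. (mp d \<circ> iv c) (mp c (q t))) (ball t0 r)"
   by (rule smooth_on_compose[OF open_ball _ smooth_on_subset[OF sm r(2)] smooth_transition[OF c d]])
     (use ct[OF subsetD[OF r(2)]] e'(2)[OF subsetD[OF r(3)]] in blast)
  then have "smooth_on (\<lambda>t. mp d (q t)) (ball t0 r)"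
   by (rule smooth_on_cong[OF open_ball, rotated]) (use ct r c in auto)
  then show "\<exists>U. open U \<and> t0 \<in> U \<and> smooth_on (\<lambda>t. mp d (q t)) U"
   using r by (intro exI[of _ "ball t0 r"]) auto
 qed
 then show ?thesis using cont by (simp add: smooth_map_real_iff)
qed

lemma smooth_curve_imp_C1:
 assumes "smooth_map_on euclidean_atlas A UNIV q" shows "C1_curve A q"
proof -
 have cont: "rcont MT q"
  and sm: "\<And>c. c \<in> A ==> smooth_on (\<lambda>t. mp c (q t)) {t. q t \<in> dm c}"
  using assms smooth_map_real_iff by auto
 show ?thesis
 proof (rule C1_curveI)
  fix t0
  obtain c where c: "c \<in> A" "q t0 \<in> dm c" using curve_in_points[OF cont, of t0] by (auto simp: points_def)
  obtain e where e: "e > 0" "\<And>t. t \<in> ball t0 e ==> q t \<in> dm c" using curve_chart_ball[OF cont c] by blast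
  let ?g = "\<lambda>t. Df (\<lambda>t. mp c (q t)) t 1"
  have "((\<lambda>t. mp c (q t)) hvd ?g t) (at t)" if "t \<in> ball t0 e" for t
  proof -
   have d: "((\<lambda>t. mp c (q t)) hder Df (\<lambda>t. mp c (q t)) t) (at t)"
    by (rule smooth_hder[OF sm[OF c(1)]]) (use e that in auto)
   have "Df (\<lambda>t. mp c (q t)) t s = s *\<^sub>R ?g t" for s
    using linear_scale[OF hder_linear[OF d], of s 1] by simp
   then have "Df (\<lambda>t. mp c (q t)) t = (\<lambda>s. s *\<^sub>R ?g t)" by (rule ext)
   with d show ?thesis unfolding hvd_def by (simp only:)
  qed
  moreover have "cont (ball t0 e) ?g"
   by (rule cont_subset[OF smooth_cont[OF smooth_on_frechet[OF sm[OF c(1)]]]]) (use e in auto)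
  ultimately show "\<exists>c\<in>A. \<exists>e>0. \<exists>g. (\<forall>t\<in>ball t0 e. q t \<in> dm c \<and>
   ((\<lambda>t. mp c (q t)) hvd g t) (at t)) \<and> cont (ball t0 e) g"
   using c(1) e by (intro bexI[of _ c] exI[of _ e] conjI exI[of _ ?g] ballI) auto
 qed
qed

end

section \<open>Loops and homotopies\<close>

text \<open>The 1-periodic function that agrees with f on [u, u + 1).\<close>

definition wrap :: "real => (real => 'b) => real => 'b" where
 "wrap u f t = f (t - of_int \<lfloor>t - u\<rfloor>)"

lemma wrap_periodic: "periodic (wrap u f)"
proof -
 have "\<lfloor>t + 1 - u\<rfloor> = \<lfloor>t - u\<rfloor> + 1" for t :: real
  using floor_add_int[of "t - u" 1] by (simp add: algebra_simps)
 then show ?thesis by (simp add: periodic_def wrap_def)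
qed

lemma periodic_shift:
 assumes "periodic f" shows "f (t - of_int n) = f t"
proof -
 have "f (t + real k) = f t" for t k
 proof (induction k)
  case (Suc k)
  have "f (t + real (Suc k)) = f ((t + real k) + 1)" by (simp add: algebra_simps)
  then show ?case using assms Suc unfolding periodic_def by metis
 qed simp
 from this[of "t - of_int n" "nat n"] this[of t "nat (- n)"] show ?thesis
  by (cases "n \<ge> 0") (auto simp: algebra_simps)
qed

lemma periodic_eqI:
 assumes "periodic f" "periodic g" "\<And>t. t \<in> {0..<1} ==> f t = g t" shows "f = g"
proof (rule ext)
 fix t :: real
 have "t - of_int \<lfloor>t\<rfloor> \<in> {0..<1}" by simp linarith
 then show "f t = g t" using assms(3) periodic_shift[OF assms(1)] periodic_shift[OF assms(2)] by metis
qed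

lemma wrap_eq: "t \<in> {u..<u+1} ==> wrap u f t = f t"
proof -
 assume "t \<in> {u..<u+1}"
 then have "\<lfloor>t - u\<rfloor> = 0" by (intro floor_unique) auto
 then show ?thesis by (simp add: wrap_def)
qed

text \<open>No seam appears at u if f is equal to a periodic function away from [a, b]: near each time, wrap u f is a translate of f.\<close>

lemma wrap_local:
 assumes "u < a" "b < u + 1"
 shows "\<exists>(n :: int) e. e > 0 \<and>
  (\<forall>(f :: real => 'b) q t. periodic q --> (\<forall>t. t \<notin> {a..b} --> f t = q t) --> t \<in> ball t0 e --> wrap u f t = f (t - of_int n))"
proof -
 define n where "n = \<lfloor>t0 - u\<rfloor>"
 have n: "of_int n \<le> t0 - u" "t0 - u < of_int n + 1" unfolding n_def by linarith+
 show ?thesis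
 proof (cases "t0 - u = of_int n")
  case False
  define e where "e = min (t0 - u - of_int n) (of_int n + 1 - (t0 - u))"
  have "e > 0" using n False by (auto simp: e_def)
  moreover have "wrap u f t = f (t - of_int n)" if "t \<in> ball t0 e" for f :: "real => 'b" and t
  proof -
   have "of_int n \<le> t - u" "t - u < of_int n + 1" using that by (auto simp: e_def dist_real_def)
   then have "\<lfloor>t - u\<rfloor> = n" by (intro floor_unique) auto
   then show ?thesis by (simp add: wrap_def)
  qed
  ultimately show ?thesis by (intro exI[of _ n] exI[of _ e]) blast
 next
  case True
  define e where "e = min (a - u) (u + 1 - b)"
  have e: "e > 0" using assms by (auto simp: e_def)
  define e' where "e' = min e 1"
  have "wrap u f t = f (t - of_int n)"
   if f: "periodic q" "\<forall>t. t \<notin> {a..b} --> f t = q t" and t: "t \<in> ball t0 e'" for f q :: "real => 'b" and t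
  proof (cases "t \<ge> t0")
   case t': True
   then have "\<lfloor>t - u\<rfloor> = n" using t True by (intro floor_unique) (auto simp: e'_def dist_real_def)
   then show ?thesis by (simp add: wrap_def)
  next
   case t': False
   then have "\<lfloor>t - u\<rfloor> = n - 1" using t True by (intro floor_unique) (auto simp: e'_def dist_real_def)
   then have "wrap u f t = f (t - of_int (n - 1))" by (simp add: wrap_def)
   moreover have "t - of_int (n - 1) \<notin> {a..b}" using t True by (auto simp: e'_def e_def dist_real_def)
   moreover have "t - of_int n \<notin> {a..b}" using t t' True by (auto simp: e'_def e_def dist_real_def)
   ultimately show ?thesis using f(2) periodic_shift[OF f(1)] by metis
  qed
  moreover have "e' > 0" using e by (simp add: e'_def)
  ultimately show ?thesis by (intro exI[of _ n] exI[of _ e']) blast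
 qed
qed

lemma has_vector_derivative_shift:
 "((f hvd D) (at (t - n))) ==> ((\<lambda>t. f (t - n)) hvd D) (at (t :: real))"
proof -
 assume f: "(f hvd D) (at (t - n))"
 have "((\<lambda>t. t - n) hvd 1) (at t)" by (auto intro!: derivative_eq_intros)
 from vector_diff_chain_at[OF this f] show ?thesis by (simp add: o_def)
qed

lemma continuous_on_shift_ball:
 "cont (ball (t0 - n) e) f ==> cont (ball t0 e) (\<lambda>t :: real. f (t - n))"
 by (rule cont_compose[of "ball (t0 - n) e" f]) (auto intro!: continuous_intros simp: dist_real_def)

lemma smooth_on_shift_ball:
 "smooth_on f (ball (t0 - n) e) ==> smooth_on (\<lambda>t :: real. f (t - n)) (ball t0 e)"
proof -
 assume f: "smooth_on f (ball (t0 - n) e)"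
 have "smooth_on (\<lambda>t. t + (- n)) (ball t0 e)"
  by (intro smooth_on_add smooth_on_const smooth_on_bounded_linear bounded_linear_ident open_ball)
 then have "smooth_on (\<lambda>t. f (t + (- n))) (ball t0 e)"
  by (rule smooth_on_compose[OF open_ball _ _ f, rotated]) (auto simp: dist_real_def)
 then show ?thesis by simp
qed

context atlas_locale
begin

definition C1_at :: "(real => 'a) => real => bool" where
 "C1_at q t0 \<longleftrightarrow> (\<exists>c\<in>A. \<exists>e>0. \<exists>g. (\<forall>t\<in>ball t0 e. q t \<in> dm c \<and>
   ((\<lambda>t. mp c (q t)) hvd g t) (at t)) \<and> cont (ball t0 e) g)"

lemma C1_curve_iff: "C1_curve A q \<longleftrightarrow> (\<forall>t. C1_at q t)"
proof
 assume "\<forall>t. C1_at q t" then show "C1_curve A q" by (intro C1_curveI) (simp add: C1_at_def)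
next
 assume q: "C1_curve A q"
 show "\<forall>t. C1_at q t"
 proof
  fix t0
  note cont = C1_cont[OF q]
  obtain c where c: "c \<in> A" "q t0 \<in> dm c" using curve_in_points[OF cont, of t0] by (auto simp: points_def)
  obtain e where e: "e > 0" "\<And>t. t \<in> ball t0 e ==> q t \<in> dm c" using curve_chart_ball[OF cont c] by blast
  show "C1_at q t0" unfolding C1_at_def
   by (intro bexI[of _ c] exI[of _ e] conjI exI[of _ "\<lambda>t. velocity A q t c"] ballI e c(1)
     C1_coords_hvd[OF q c(1)] cont_subset[OF C1_cont_velocity[OF q c(1)]])
    (use e in auto)
 qed
qed

lemma C1_at_cong:
 assumes "C1_at q (t0 - n)" "r > 0" "\<And>t. t \<in> ball t0 r ==> W t = q (t - n)"
 shows "C1_at W t0"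
proof -
 obtain c e g where c: "c \<in> A" and e: "e > 0" and g: "cont (ball (t0 - n) e) g"
  and d: "\<And>t. t\<in>ball (t0 - n) e ==> q t \<in> dm c \<and> ((\<lambda>t. mp c (q t)) hvd g t) (at t)"
  using assms(1) unfolding C1_at_def by blast
 define e' where "e' = min e r"
 have e': "e' > 0" "ball t0 e' \<subseteq> ball t0 r" using e assms(2) by (auto simp: e'_def)
 have sh: "t - n \<in> ball (t0 - n) e" if "t \<in> ball t0 e'" for t using that by (auto simp: e'_def dist_real_def)
 show ?thesis unfolding C1_at_def
 proof (intro bexI[of _ c] exI[of _ e'] exI[of _ "\<lambda>t. g (t - n)"] conjI ballI)
  show "cont (ball t0 e') (\<lambda>t. g (t - n))"
   by (rule cont_subset[OF continuous_on_shift_ball[OF g]]) (auto simp: e'_def)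
  fix t assume t: "t \<in> ball t0 e'"
  show "W t \<in> dm c" using d[OF sh[OF t]] assms(3)[OF subsetD[OF e'(2) t]] by simp
  have "((\<lambda>t. mp c (q (t - n))) hvd g (t - n)) (at t)"
   using has_vector_derivative_shift[OF conjunct2[OF d[OF sh[OF t]]]] .
  then show "((\<lambda>t. mp c (W t)) hvd g (t - n)) (at t)"
   by (rule hvd_cong_open[where S = "ball t0 e'"]) (use t e' assms(3) in auto)
 qed (use c e' in auto)
qed

lemma smooth_curve_at_cong:
 assumes "smooth_curve_at q (t0 - n)" "r > 0" "\<And>t. t \<in> ball t0 r ==> W t = q (t - n)"
 shows "smooth_curve_at W t0"
proof -
 obtain c e where c: "c \<in> A" and e: "e > 0" and g: "smooth_on (\<lambda>t. mp c (q t)) (ball (t0 - n) e)"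
  and d: "\<And>t. t\<in>ball (t0 - n) e ==> q t \<in> dm c"
  using assms(1) unfolding smooth_curve_at_def by blast
 define e' where "e' = min e r"
 have e': "e' > 0" "ball t0 e' \<subseteq> ball t0 r" "ball t0 e' \<subseteq> ball t0 e" using e assms(2) by (auto simp: e'_def)
 have sh: "t - n \<in> ball (t0 - n) e" if "t \<in> ball t0 e'" for t using that by (auto simp: e'_def dist_real_def)
 have "smooth_on (\<lambda>t. mp c (W t)) (ball t0 e')"
  by (rule smooth_on_cong[OF open_ball _ smooth_on_subset[OF smooth_on_shift_ball[OF g] e'(3)]])
    (simp add: assms(3)[OF subsetD[OF e'(2)]])
 moreover have "W t \<in> dm c" if "t \<in> ball t0 e'" for t
  using d[OF sh[OF that]] assms(3)[OF subsetD[OF e'(2) that]] by simp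
 ultimately show ?thesis unfolding smooth_curve_at_def using c e'(1) by blast
qed

lemma velocity_cong:
 assumes "r > 0" "\<And>t. t \<in> ball t0 r ==> W t = q (t - n)"
 shows "velocity A W t0 = velocity A q (t0 - n)"
proof (rule ext)
 fix c :: "('a, 'e) chart"
 have "((mp c \<circ> W) hvd D) (at t0) \<longleftrightarrow> ((mp c \<circ> q) hvd D) (at (t0 - n))" for D
 proof
  assume *: "((mp c \<circ> W) hvd D) (at t0)"
  have "((\<lambda>t. (mp c \<circ> W) (t - (- n))) hvd D) (at (t0 - n))"
   by (rule has_vector_derivative_shift) (use * in \<open>simp add: o_def\<close>)
  then show "((mp c \<circ> q) hvd D) (at (t0 - n))"
   by (rule hvd_cong_open[where S = "ball (t0 - n) r"])
    (use assms in \<open>auto simp: dist_real_def\<close>)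
 next
  assume *: "((mp c \<circ> q) hvd D) (at (t0 - n))"
  show "((mp c \<circ> W) hvd D) (at t0)"
   by (rule hvd_cong_open[OF has_vector_derivative_shift[OF *], where S = "ball t0 r"])
    (use assms in auto)
 qed
 then have "vector_derivative (mp c \<circ> W) (at t0) = vector_derivative (mp c \<circ> q) (at (t0 - n))"
  by (simp add: vector_derivative_def)
 moreover have "W t0 = q (t0 - n)" using assms by simp
 ultimately show "velocity A W t0 c = velocity A q (t0 - n) c" by (simp add: velocity_def)
qed

text \<open>The loop obtained from a given one by replacing its part over the window J with the curve Y in the coordinates of the chart c. All surgery on loops below has this form.\<close>

definition modified :: "real => ('a, 'e) chart => real set => (real => 'e) => (real => 'a) => real => 'a" where
 "modified u c J Y q = wrap u (\<lambda>t. if t \<in> J then iv c (Y t) else q t)"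

definition homotopic_loops :: "(real => 'a) => (real => 'a) => bool" where
 "homotopic_loops q W \<longleftrightarrow> homotopic_with periodic euclideanreal MT q W"

lemma homotopic_loops_trans: "homotopic_loops q W ==> homotopic_loops W \<eta> ==> homotopic_loops q \<eta>"
 unfolding homotopic_loops_def by (rule homotopic_with_trans)

lemma homotopic_loops_sym: "homotopic_loops q W ==> homotopic_loops W q"
 unfolding homotopic_loops_def by (simp add: homotopic_with_sym)

lemma homotopic_loops_refl: "q \<in> loops A ==> homotopic_loops q q"
 unfolding homotopic_loops_def loops_def by simp

lemma homotopic_loops_imp_loops: "homotopic_loops q W ==> q \<in> loops A \<and> W \<in> loops A"
 unfolding homotopic_loops_def loops_def
 using homotopic_with_imp_continuous_maps homotopic_with_imp_property by blast

lemma free_homotopy_class_iff: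
 assumes "\<alpha> \<in> free_homotopy_classes A" "q \<in> \<alpha>"
 shows "W \<in> \<alpha> \<longleftrightarrow> homotopic_loops q W"
proof -
 obtain \<beta> where \<beta>: "\<beta> \<in> loops A" "\<alpha> = {W. homotopic_loops \<beta> W}"
  using assms(1) unfolding free_homotopy_classes_def quotient_def homotopic_loops_def by auto
 then show ?thesis using assms(2) homotopic_loops_trans homotopic_loops_sym by blast
qed

lemma free_homotopy_class_loops: "\<alpha> \<in> free_homotopy_classes A ==> q \<in> \<alpha> ==> q \<in> loops A"
 using free_homotopy_class_iff homotopic_loops_imp_loops by blast

lemma modified_local:
 assumes "u < a" "b < u + 1" "periodic q"
  and "\<And>t. t \<in> J - {a..b} ==> q t \<in> dm c \<and> Y t = mp c (q t)" and "c \<in> A"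
 obtains n e where "e > 0"
  "\<And>t. t \<in> ball t0 e ==> modified u c J Y q t = (if t - n \<in> J then iv c (Y (t - n)) else q (t - n))"
proof -
 obtain n :: int and e where "e > 0" and *: "\<forall>(f :: real => 'a) q t. periodic q --> (\<forall>t. t \<notin> {a..b} --> f t = q t) --> t \<in> ball t0 e --> wrap u f t = f (t - of_int n)"
  using wrap_local[OF assms(1,2), of t0] by (elim exE conjE)
 have off: "\<forall>t. t \<notin> {a..b} --> (if t \<in> J then iv c (Y t) else q t) = q t"
  using assms(4,5) by auto
 have "modified u c J Y q t = (if t - of_int n \<in> J then iv c (Y (t - of_int n)) else q (t - of_int n))" if "t \<in> ball t0 e" for t
  unfolding modified_def using *[rule_format, OF assms(3) off[rule_format] that] .
 with \<open>e > 0\<close> show ?thesis by (rule that)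
qed

text \<open>The straight line between the two coordinate curves is a homotopy, constant away from [a, b].\<close>

lemma modified_homotopic:
 assumes u: "u < a" "b < u + 1" and q: "q \<in> loops A" and c: "c \<in> A"
  and J: "open J" "\<And>t. t \<in> J ==> q t \<in> dm c" "{a..b} \<subseteq> J"
  and Y: "cont J Y" "\<And>t. t \<in> J - {a..b} ==> Y t = mp c (q t)"
  and seg: "\<And>t s. t \<in> J ==> s \<in> {0..1} ==> (1 - s) *\<^sub>R mp c (q t) + s *\<^sub>R Y t \<in> mp c ` dm c"
 shows "homotopic_loops q (modified u c J Y q)"
proof -
 have qc: "rcont MT q" and qp: "periodic q" using q by (auto simp: loops_def)
 define f where "f s t = (if t \<in> J then iv c ((1 - s) *\<^sub>R mp c (q t) + s *\<^sub>R Y t) else q t)" for s t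
 have f_off: "f s t = q t" if "t \<notin> {a..b}" for s t
  using that Y(2)[of t] J(2)[of t] c by (auto simp: f_def simp flip: scaleR_left.add)
 define h where "h p = wrap u (f (fst p)) (snd p)" for p
 have hc: "continuous_map (top_of_set ({0..1} \<times> UNIV)) MT h"
 proof (rule continuous_into_chartsI)
  fix p0 :: "real \<times> real" assume "p0 \<in> {0..1} \<times> UNIV"
  then obtain s0 t0 where p0: "p0 = (s0, t0)" "s0 \<in> {0..1}" by auto
  obtain n :: int and e where e: "e > 0" and loc: "\<forall>(f :: real => 'a) q t. periodic q --> (\<forall>t. t \<notin> {a..b} --> f t = q t) --> t \<in> ball t0 e --> wrap u f t = f (t - of_int n)"
   using wrap_local[OF u, of t0] by (elim exE conjE)
  have hloc: "h (s, t) = f s (t - of_int n)" if "t \<in> ball t0 e" for s t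
   using loc[rule_format, of q "f s" t] qp f_off[of _ s] that by (simp add: h_def)
  let ?n = "of_int n :: real"
  have sndball: "snd p \<in> ball t0 r" if "p \<in> ball p0 r" for p r
   using that dist_snd_le[of p0 p] by (auto simp: p0)
  show "\<exists>c\<in>A. \<exists>e>0. (\<forall>p\<in>({0..1} \<times> UNIV) \<inter> ball p0 e. h p \<in> dm c) \<and> cont (({0..1} \<times> UNIV) \<inter> ball p0 e) (\<lambda>p. mp c (h p))"
  proof (cases "t0 - ?n \<in> {a..b}")
   case True
   then obtain r where r: "r > 0" "ball (t0 - ?n) r \<subseteq> J" using J(1,3) open_contains_ball by blast
   define e' where "e' = min e r"
   let ?B = "({0..1} \<times> UNIV) \<inter> ball p0 e'"
   have inJ: "snd p - ?n \<in> J" and sB: "snd p \<in> ball t0 e" and f01: "fst p \<in> {0..1}" if "p \<in> ?B" for p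
    using sndball[of p e'] that r by (auto simp: e'_def dist_real_def subset_iff)
   let ?y = "\<lambda>p. (1 - fst p) *\<^sub>R mp c (q (snd p - ?n)) + fst p *\<^sub>R Y (snd p - ?n)"
   have hy: "h p = iv c (?y p)" "?y p \<in> mp c ` dm c" if "p \<in> ?B" for p
    using hloc[OF sB[OF that], of "fst p"] inJ[OF that] seg[OF inJ[OF that] f01[OF that]] by (auto simp: f_def)
   have cy: "cont ?B ?y"
   proof -
    have 1: "cont J (\<lambda>t. mp c (q t))"
     by (rule cont_subset[OF cont_coords[OF qc c]]) (use J in auto)
    have i: "cont ?B (\<lambda>p. snd p - ?n)" by (intro continuous_intros)
    show ?thesis
     by (intro cont_add cont_scaleR cont_diff cont_const cont_fst cont_id
       cont_compose[OF 1 i] cont_compose[OF Y(1) i]) (use inJ in blast)+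
   qed
   have "h p \<in> dm c" if "p \<in> ?B" for p using hy[OF that] chart_inv_in by simp
   moreover have "cont ?B (\<lambda>p. mp c (h p))"
    by (rule continuous_on_eq[OF cy]) (simp add: hy map_chart_inv)
   moreover have "e' > 0" using e r by (simp add: e'_def)
   ultimately show ?thesis using c by blast
  next
   case False
   then obtain r where r: "r > 0" "ball (t0 - ?n) r \<subseteq> - {a..b}"
    using open_contains_ball_eq[of "- {a..b}" "t0 - ?n"] by auto
   obtain d where d: "d \<in> A" "q (t0 - ?n) \<in> dm d"
    using curve_in_points[OF qc, of "t0 - ?n"] unfolding points_def by blast
   obtain r' where r': "r' > 0" "\<And>t. t \<in> ball (t0 - ?n) r' ==> q t \<in> dm d" using curve_chart_ball[OF qc d] by blast
   define e' where "e' = min e (min r r')"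
   let ?B = "({0..1} \<times> UNIV) \<inter> ball p0 e'"
   have hy: "h p = q (snd p - ?n)" "q (snd p - ?n) \<in> dm d" if "p \<in> ?B" for p
   proof -
    have s: "snd p \<in> ball t0 e'" using sndball that by blast
    then have "snd p \<in> ball t0 e" and s2: "snd p - ?n \<in> ball (t0 - ?n) r" "snd p - ?n \<in> ball (t0 - ?n) r'"
     by (auto simp: e'_def dist_real_def)
    then show "h p = q (snd p - ?n)" using hloc[of "snd p" "fst p"] f_off[of "snd p - ?n" "fst p"] r(2) by auto
    show "q (snd p - ?n) \<in> dm d" using r'(2) s2 by blast
   qed
   have "cont ?B (\<lambda>p. mp d (q (snd p - ?n)))"
    by (rule cont_compose[OF cont_coords[OF qc d(1)], of _ "\<lambda>p. snd p - ?n"])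
      (use hy in \<open>auto intro!: continuous_intros\<close>)
   then have "cont ?B (\<lambda>p. mp d (h p))" by (rule continuous_on_eq) (use hy in simp)
   moreover have "h p \<in> dm d" if "p \<in> ?B" for p using hy[OF that] by simp
   moreover have "e' > 0" using e r r' by (simp add: e'_def)
   ultimately show ?thesis using d by blast
  qed
 qed
 have h0: "h (0, t) = q t" for t
 proof -
  have "f 0 s = q s" for s using J(2) c by (simp add: f_def)
  then have "h (0, t) = q (t - of_int \<lfloor>t - u\<rfloor>)" by (simp add: h_def wrap_def)
  then show ?thesis using periodic_shift[OF qp] by simp
 qed
 have "f 1 = (\<lambda>t. if t \<in> J then iv c (Y t) else q t)" by (rule ext) (simp add: f_def)
 then have h1: "h (1, t) = modified u c J Y q t" for t by (simp add: h_def modified_def)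
 have top: "prod_topology (top_of_set {0..1 :: real}) euclideanreal = top_of_set ({0..1} \<times> (UNIV :: real set))"
  using prod_topology_subtopology_eu[of "{0..1 :: real}" "UNIV :: real set"] by simp
 show ?thesis unfolding homotopic_loops_def homotopic_with_def top
  by (rule exI[of _ h]) (use hc h0 h1 wrap_periodic in \<open>auto simp: h_def\<close>)
qed

lemma modified_C1:
 assumes u: "u < a" "b < u + 1" and q: "C1_curve A q" "periodic q" and c: "c \<in> A"
  and J: "open J" "\<And>t. t \<in> J ==> q t \<in> dm c" "{a..b} \<subseteq> J"
  and Y: "\<And>t. t \<in> J ==> (Y hvd Y' t) (at t)" "cont J Y'"
   "\<And>t. t \<in> J - {a..b} ==> Y t = mp c (q t)"
   "\<And>t. t \<in> J ==> Y t \<in> mp c ` dm c"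
 shows "C1_curve A (modified u c J Y q)"
  and "\<And>t. t \<in> J \<inter> {u<..<u+1} ==> modified u c J Y q t = iv c (Y t) \<and> velocity A (modified u c J Y q) t c = Y' t"
  and "\<And>t. t \<in> {u<..<u+1} - {a..b} ==> modified u c J Y q t = q t \<and> velocity A (modified u c J Y q) t = velocity A q t"
proof -
 let ?f = "\<lambda>t. if t \<in> J then iv c (Y t) else q t"
 have off: "?f t = q t" if "t \<notin> {a..b}" for t using that Y(3)[of t] J(2)[of t] c by auto
 have onJ: "?f t = iv c (Y t) \<and> iv c (Y t) \<in> dm c \<and> mp c (?f t) = Y t" if "t \<in> J" for t
  using chart_inv_in[OF Y(4)[OF that]] map_chart_inv[OF Y(4)[OF that]] that by simp
 have C1f: "C1_at ?f t0" for t0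
 proof (cases "t0 \<in> {a..b}")
  case True
  then obtain e where e: "e > 0" "ball t0 e \<subseteq> J" using J(1,3) open_contains_ball by blast
  show ?thesis unfolding C1_at_def
  proof (intro bexI[OF _ c] exI[of _ e] conjI exI[of _ Y'] ballI)
   show "cont (ball t0 e) Y'" using Y(2) e cont_subset by blast
   fix t assume t: "t \<in> ball t0 e"
   show "?f t \<in> dm c" using onJ[of t] t e by auto
   show "((\<lambda>t. mp c (?f t)) hvd Y' t) (at t)"
    by (rule hvd_cong_open[OF Y(1), where S = "ball t0 e"]) (use t e onJ in auto)
  qed (use e in auto)
 next
  case False
  then obtain e where e: "e > 0" "ball t0 e \<subseteq> - {a..b}" using open_contains_ball_eq[of "- {a..b}" t0] by auto
  show ?thesis
  proof (rule C1_at_cong[of q t0 0 e])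
   show "?f t = q (t - 0)" if "t \<in> ball t0 e" for t using off[of t] subsetD[OF e(2) that] by simp
  qed (use q(1) C1_curve_iff e in auto)
 qed
 show "C1_curve A (modified u c J Y q)" unfolding C1_curve_iff
 proof
  fix t0
  obtain n e where "e > 0" "\<And>t. t \<in> ball t0 e ==> modified u c J Y q t = ?f (t - n)"
   by (rule modified_local[OF u q(2) _ c, of J Y t0]) (use J(2) Y(3) in auto)
  then show "C1_at (modified u c J Y q) t0" using C1_at_cong[OF C1f] by blast
 qed
 have eq: "modified u c J Y q t = ?f t" if "t \<in> {u<..<u+1}" for t
  unfolding modified_def by (rule wrap_eq) (use that in auto)
 show "modified u c J Y q t = iv c (Y t) \<and> velocity A (modified u c J Y q) t c = Y' t" if t: "t \<in> J \<inter> {u<..<u+1}" for t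
 proof
  show 1: "modified u c J Y q t = iv c (Y t)" using eq t by simp
  show "velocity A (modified u c J Y q) t c = Y' t"
  proof (rule velocity_eqI[OF c])
   show "modified u c J Y q t \<in> dm c" using 1 onJ t by auto
   show "((\<lambda>t. mp c (modified u c J Y q t)) hvd Y' t) (at t)"
    by (rule hvd_cong_open[OF Y(1), where S = "J \<inter> {u<..<u+1}"])
     (use t J(1) onJ eq in auto)
  qed
 qed
 show "modified u c J Y q t = q t \<and> velocity A (modified u c J Y q) t = velocity A q t" if t: "t \<in> {u<..<u+1} - {a..b}" for t
 proof
  show "modified u c J Y q t = q t" using eq[of t] off[of t] t by simp
  have "open ({u<..<u+1} - {a..b})" by auto
  then obtain r where r: "r > 0" "ball t r \<subseteq> {u<..<u+1} - {a..b}" using t open_contains_ball by blast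
  have "velocity A (modified u c J Y q) t = velocity A q (t - 0)"
   by (rule velocity_cong[OF r(1)]) (use r eq off in auto)
  then show "velocity A (modified u c J Y q) t = velocity A q t" by simp
 qed
qed

end

section \<open>Continuous convergence of curves\<close>

text \<open>Quotients of flat exponentials give the cutoff.\<close>

lemma smooth_bump:
 assumes e: "e > 0"
 shows "\<exists>\<rho> :: real => real. smooth_on \<rho> UNIV \<and> (\<forall>t\<in>cball t0 e. \<rho> t = 1) \<and>
  (\<forall>t. t \<notin> {t0 - 2 * e..t0 + 2 * e} --> \<rho> t = 0) \<and> (\<forall>t. 0 \<le> \<rho> t \<and> \<rho> t \<le> 1)"
proof -
 define f where "f = flat_exp 0"
 have pos: "f t > 0" if "t > 0" for t using that by (simp add: f_def flat_exp_def)
 have nn: "f t \<ge> 0" for t by (simp add: f_def flat_exp_def)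
 have z: "f t = 0" if "t \<le> 0" for t using that by (simp add: f_def flat_exp_def)
 define g h where "g t = f ((2 * e)\<^sup>2 - (t - t0)\<^sup>2)" and "h t = f ((t - t0)\<^sup>2 - e\<^sup>2)" for t
 have e4: "e\<^sup>2 < (2 * e)\<^sup>2" using e by (simp add: power2_eq_square)
 have D: "g t + h t > 0" for t
 proof (cases "(t - t0)\<^sup>2 < (2 * e)\<^sup>2")
  case True
  then show ?thesis unfolding g_def h_def by (intro add_pos_nonneg pos nn) linarith
 next
  case False
  then have "e\<^sup>2 < (t - t0)\<^sup>2" using e4 by linarith
  then show ?thesis unfolding g_def h_def by (intro add_nonneg_pos pos nn) linarith
 qed
 have "smooth_on (\<lambda>t. k + c *\<^sub>R ((t + (- t0)) *\<^sub>R (t + (- t0)))) UNIV" for k c :: real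
  by (intro smooth_on_add smooth_on_scaleR smooth_on_const smooth_on_bounded_linear[OF bounded_linear_ident] open_UNIV)
 from smooth_on_compose[OF open_UNIV subset_UNIV this smooth_on_flat_exp]
 have sm: "smooth_on (\<lambda>t. f (k + c *\<^sub>R ((t + (- t0)) *\<^sub>R (t + (- t0))))) UNIV" for k c :: real unfolding f_def .
 have gh: "smooth_on g UNIV" "smooth_on h UNIV" using sm[of "(2 * e)\<^sup>2" "- 1"] sm[of "- e\<^sup>2" 1]
  by (simp_all add: g_def[abs_def] h_def[abs_def] power2_eq_square)
 have "smooth_on (\<lambda>t. inverse (g t + h t)) UNIV"
  by (rule smooth_on_compose[OF _ _ smooth_on_add smooth_on_inverse]) (use D gh in \<open>auto simp: less_le\<close>)
 then have s: "smooth_on (\<lambda>t. inverse (g t + h t) *\<^sub>R g t) UNIV" by (intro smooth_on_scaleR gh) auto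
 show ?thesis
 proof (intro exI[of _ "\<lambda>t. inverse (g t + h t) *\<^sub>R g t"] conjI ballI allI impI s)
  fix t
  show "inverse (g t + h t) *\<^sub>R g t = 1" if "t \<in> cball t0 e"
  proof -
   have "(t - t0)\<^sup>2 \<le> e\<^sup>2" using that e by (intro power2_le_iff_abs_le[THEN iffD2]) (auto simp: dist_real_def)
   then show ?thesis using z[of "(t - t0)\<^sup>2 - e\<^sup>2"] D[of t] by (simp add: h_def)
  qed
  show "inverse (g t + h t) *\<^sub>R g t = 0" if "t \<notin> {t0 - 2 * e..t0 + 2 * e}"
  proof -
   have "\<bar>2 * e\<bar> \<le> \<bar>t - t0\<bar>" using that e by auto
   then have "(2 * e)\<^sup>2 \<le> (t - t0)\<^sup>2" by (simp only: abs_le_square_iff)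
   then show ?thesis using z[of "(2 * e)\<^sup>2 - (t - t0)\<^sup>2"] by (simp add: g_def)
  qed
  show "0 \<le> inverse (g t + h t) *\<^sub>R g t" "inverse (g t + h t) *\<^sub>R g t \<le> 1"
   using D[of t] nn by (simp_all add: g_def h_def field_simps)
 qed
qed

lemma continuous_near_compact:
 fixes f :: "'m::euclidean_space => 'n::metric_space"
 assumes K: "compact K" "K \<subseteq> D" and D: "open D" and f: "cont D f" and \<epsilon>: "\<epsilon> > 0"
 shows "\<exists>r>0. \<forall>x\<in>K. \<forall>y. dist y x < r --> y \<in> D \<and> dist (f y) (f x) < \<epsilon>"
proof -
 obtain r where r: "r > 0" "(\<Union>x\<in>K. cball x r) \<subseteq> D"
  using compact_subset_open_imp_cball_epsilon_subset[OF K(1) D K(2)] by blast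
 define K1 where "K1 = {x + h | x h. x \<in> K \<and> h \<in> cball 0 r}"
 have K1: "x \<in> K ==> dist y x \<le> r ==> y \<in> K1" for x y
  unfolding K1_def by (rule CollectI, rule exI[of _ x], rule exI[of _ "y - x"]) (simp add: dist_norm norm_minus_commute)
 have "K1 \<subseteq> D" using r(2) by (force simp: K1_def subset_iff dist_norm)
 moreover have "compact K1" unfolding K1_def by (rule compact_sums[OF K(1)]) auto
 ultimately have "uniformly_continuous_on K1 f" using f cont_subset compact_uniformly_continuous by blast
 then obtain d where d: "d > 0" "\<And>x y. x \<in> K1 ==> y \<in> K1 ==> dist y x < d ==> dist (f y) (f x) < \<epsilon>"
  using \<epsilon> unfolding uniformly_continuous_on_def by metis
 show ?thesis
 proof (intro exI[of _ "min r d"] conjI ballI allI impI)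
  fix x y assume x: "x \<in> K" and y: "dist y x < min r d"
  have "y \<in> cball x r" using y by (simp add: dist_commute)
  then show "y \<in> D" using r(2) x by blast
  show "dist (f y) (f x) < \<epsilon>" using d(2)[of x y] K1[OF x, of x] K1[OF x, of y] y r(1) by simp
 qed (use r d in simp)
qed

text \<open>Finite covers in the form of an induction: what holds for the empty set and can be extended over a neighbourhood of each point holds on a set containing the compact one.\<close>

lemma compact_open_induct:
 assumes S: "compact S" and 0: "P {}"
  and step: "\<And>t. t \<in> S ==> \<exists>U. open U \<and> t \<in> U \<and> (\<forall>T. P T --> P (U \<union> T))"
 shows "\<exists>T. S \<subseteq> T \<and> P T"
proof -
 define D where "D = {U. open U \<and> (\<forall>T. P T --> P (U \<union> T))}"
 have "S \<subseteq> \<Union>D" using step by (fastforce simp: D_def)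
 moreover have "\<forall>B\<in>D. open B" by (simp add: D_def)
 ultimately obtain E where E: "E \<subseteq> D" "finite E" "S \<subseteq> \<Union>E" using compactE[OF S] by metis
 have "P (\<Union>E)" using E(2,1) by (induction E) (auto simp: 0 D_def)
 then show ?thesis using E(3) by blast
qed

context atlas_locale
begin

text \<open>Continuous convergence of curves, which amounts to locally uniform convergence. It is phrased with open sets, so that no metric on the manifold is chosen, and for filters, so that it covers sequences and neighbourhoods in the smooth topology alike.\<close>

definition conv :: "'i filter => ('i => real => 'a) => (real => 'a) => bool" where
 "conv \<F> W q \<longleftrightarrow> (\<forall>t0 U. openin MT U --> q t0 \<in> U -->
   (\<exists>e>0. \<forall>\<^sub>F i in \<F>. \<forall>t\<in>ball t0 e. W i t \<in> U))"

lemma open_chart_image_openin: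
 assumes c: "c \<in> A" and U: "openin MT U"
 shows "open (mp c ` (dm c \<inter> U))"
proof -
 have "openin (top_of_set (mp c ` dm c)) {y \<in> mp c ` dm c. iv c y \<in> U}"
  using openin_continuous_map_preimage[OF chart_inv_continuous[OF c] U] by simp
 moreover have "{y \<in> mp c ` dm c. iv c y \<in> U} = mp c ` (dm c \<inter> U)"
  using chart_inv_map[OF c] by auto
 ultimately show ?thesis using open_chart_image[OF c] by (simp add: openin_open_eq)
qed

lemma convI:
 assumes "\<And>t0. \<exists>c\<in>A. q t0 \<in> dm c \<and> (\<forall>\<eta>>0. \<exists>e>0. \<forall>\<^sub>F i in \<F>. \<forall>t\<in>ball t0 e.
   W i t \<in> dm c \<and> dist (mp c (W i t)) (mp c (q t0)) < \<eta>)"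
 shows "conv \<F> W q"
 unfolding conv_def
proof (intro allI impI)
 fix t0 U assume U: "openin MT U" "q t0 \<in> U"
 obtain c where c: "c \<in> A" "q t0 \<in> dm c" and
  cc: "\<And>\<eta>. \<eta> > 0 ==> \<exists>e>0. \<forall>\<^sub>F i in \<F>. \<forall>t\<in>ball t0 e. W i t \<in> dm c \<and> dist (mp c (W i t)) (mp c (q t0)) < \<eta>"
  using assms[of t0] by blast
 have "mp c (q t0) \<in> mp c ` (dm c \<inter> U)" using c U by blast
 then obtain \<eta> where \<eta>: "\<eta> > 0" "ball (mp c (q t0)) \<eta> \<subseteq> mp c ` (dm c \<inter> U)"
  using open_chart_image_openin[OF c(1) U(1)] open_contains_ball by blast
 obtain e where e: "e > 0" "\<forall>\<^sub>F i in \<F>. \<forall>t\<in>ball t0 e. W i t \<in> dm c \<and> dist (mp c (W i t)) (mp c (q t0)) < \<eta>"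
  using cc[OF \<eta>(1)] by blast
 have "\<forall>\<^sub>F i in \<F>. \<forall>t\<in>ball t0 e. W i t \<in> U"
 proof (rule eventually_mono[OF e(2)], rule ballI)
  fix i t assume *: "\<forall>t\<in>ball t0 e. W i t \<in> dm c \<and> dist (mp c (W i t)) (mp c (q t0)) < \<eta>" and t: "t \<in> ball t0 e"
  then have "mp c (W i t) \<in> mp c ` (dm c \<inter> U)" using \<eta>(2) by (auto simp: dist_commute subset_iff)
  then obtain y where "y \<in> dm c" "y \<in> U" "mp c (W i t) = mp c y" by auto
  then show "W i t \<in> U" using inj_onD[OF chart_inj[OF c(1)]] * t by blast
 qed
 then show "\<exists>e>0. \<forall>\<^sub>F i in \<F>. \<forall>t\<in>ball t0 e. W i t \<in> U" using e(1) by blast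
qed

lemma convD:
 assumes "conv \<F> W q" "c \<in> A" "q t0 \<in> dm c" "\<eta> > 0"
 obtains e where "e > 0" "\<forall>\<^sub>F i in \<F>. \<forall>t\<in>ball t0 e. W i t \<in> dm c \<and> dist (mp c (W i t)) (mp c (q t0)) < \<eta>"
proof -
 have "openin MT (dm c \<inter> mp c -` ball (mp c (q t0)) \<eta>)"
  by (rule openin_chart_preimage[OF assms(2)]) simp
 moreover have "q t0 \<in> dm c \<inter> mp c -` ball (mp c (q t0)) \<eta>" using assms by simp
 ultimately obtain e where e: "e > 0" "\<forall>\<^sub>F i in \<F>. \<forall>t\<in>ball t0 e. W i t \<in> dm c \<inter> mp c -` ball (mp c (q t0)) \<eta>"
  using assms(1) unfolding conv_def by blast
 have "\<forall>\<^sub>F i in \<F>. \<forall>t\<in>ball t0 e. W i t \<in> dm c \<and> dist (mp c (W i t)) (mp c (q t0)) < \<eta>"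
  by (rule eventually_mono[OF e(2)]) (auto simp: dist_commute)
 with e(1) show ?thesis by (rule that)
qed

lemma eventually_ball_compact:
 fixes S :: "'m::metric_space set"
 assumes "compact S" "\<And>t0. t0 \<in> S ==> \<exists>e>0. \<forall>\<^sub>F i in \<F>. \<forall>t\<in>ball t0 e. P i t"
 shows "\<forall>\<^sub>F i in \<F>. \<forall>t\<in>S. P i t"
proof -
 obtain r where r: "\<And>t0. t0 \<in> S ==> r t0 > 0" "\<And>t0. t0 \<in> S ==> \<forall>\<^sub>F i in \<F>. \<forall>t\<in>ball t0 (r t0). P i t"
  using assms(2) by metis
 have "S \<subseteq> (\<Union>t0\<in>S. ball t0 (r t0))" using r(1) by auto
 then obtain D where D: "D \<subseteq> S" "finite D" "S \<subseteq> (\<Union>t0\<in>D. ball t0 (r t0))"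
  using compactE_image[OF assms(1), of S "\<lambda>t0. ball t0 (r t0)"] by auto
 have "\<forall>\<^sub>F i in \<F>. \<forall>t0\<in>D. \<forall>t\<in>ball t0 (r t0). P i t"
  using D r(2) by (intro eventually_ball_finite) auto
 then show ?thesis by (rule eventually_mono) (use D(3) in blast)
qed

lemma conv_compact:
 assumes conv: "conv \<F> W q" and q: "rcont MT q" and c: "c \<in> A"
  and S: "compact S" "\<And>t. t \<in> S ==> q t \<in> dm c" and \<eta>: "\<eta> > 0"
 shows "\<forall>\<^sub>F i in \<F>. \<forall>t\<in>S. W i t \<in> dm c \<and> dist (mp c (W i t)) (mp c (q t)) < \<eta>"
proof (rule eventually_ball_compact[OF S(1)])
 fix t0 assume t0: "t0 \<in> S"
 have \<eta>2: "\<eta> / 2 > 0" using \<eta> by simp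
 obtain e where e: "e > 0" "\<forall>\<^sub>F i in \<F>. \<forall>t\<in>ball t0 e. W i t \<in> dm c \<and> dist (mp c (W i t)) (mp c (q t0)) < \<eta> / 2"
  using convD[OF conv c S(2)[OF t0] \<eta>2] by blast
 have "open {t. q t \<in> dm c \<and> mp c (q t) \<in> ball (mp c (q t0)) (\<eta> / 2)}"
  by (rule openin_curve_preimage[OF q c]) simp
 moreover have "t0 \<in> {t. q t \<in> dm c \<and> mp c (q t) \<in> ball (mp c (q t0)) (\<eta> / 2)}"
  using S(2)[OF t0] \<eta> by simp
 ultimately obtain e' where e': "e' > 0" "ball t0 e' \<subseteq> {t. q t \<in> dm c \<and> mp c (q t) \<in> ball (mp c (q t0)) (\<eta> / 2)}"
  using open_contains_ball by blast
 show "\<exists>e>0. \<forall>\<^sub>F i in \<F>. \<forall>t\<in>ball t0 e. W i t \<in> dm c \<and> dist (mp c (W i t)) (mp c (q t)) < \<eta>"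
 proof (intro exI[of _ "min e e'"] conjI)
  show "\<forall>\<^sub>F i in \<F>. \<forall>t\<in>ball t0 (min e e'). W i t \<in> dm c \<and> dist (mp c (W i t)) (mp c (q t)) < \<eta>"
  proof (rule eventually_mono[OF e(2)], intro ballI conjI)
   fix i t assume *: "\<forall>t\<in>ball t0 e. W i t \<in> dm c \<and> dist (mp c (W i t)) (mp c (q t0)) < \<eta> / 2"
    and t: "t \<in> ball t0 (min e e')"
   then show "W i t \<in> dm c" by simp
   have "dist (mp c (W i t)) (mp c (q t0)) < \<eta> / 2" using * t by simp
   moreover have "t \<in> ball t0 e'" using t by simp
   then have "dist (mp c (q t0)) (mp c (q t)) < \<eta> / 2" using e'(2) by (auto simp: subset_iff)
   ultimately show "dist (mp c (W i t)) (mp c (q t)) < \<eta>"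
    using dist_triangle[of "mp c (W i t)" "mp c (q t)" "mp c (q t0)"] by linarith
  qed
 qed (use e e' in auto)
qed

lemma chart_window:
 assumes q: "rcont MT q"
 shows "\<exists>c\<in>A. \<exists>e>0. e < 1/8 \<and> (\<forall>t\<in>cball t0 (3 * e). q t \<in> dm c)"
proof -
 obtain c where c: "c \<in> A" "q t0 \<in> dm c" using curve_in_points[OF q, of t0] unfolding points_def by blast
 obtain e where e: "e > 0" "\<And>t. t \<in> ball t0 e ==> q t \<in> dm c" using curve_chart_ball[OF q c] by blast
 show ?thesis by (intro bexI[OF _ c(1)] exI[of _ "min (e / 4) (1 / 16)"]) (use e in auto)
qed

lemma conv_const: assumes "rcont MT q" shows "conv \<F> (\<lambda>i. q) q"
 unfolding conv_def
proof (intro allI impI)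
 fix t0 U assume "openin MT U" "q t0 \<in> U"
 then obtain e where "e > 0" "ball t0 e \<subseteq> {t. q t \<in> U}"
  using openin_continuous_map_preimage[OF assms] open_contains_ball[of "{t. q t \<in> U}"] by auto
 then have "e > 0" "\<forall>t\<in>ball t0 e. q t \<in> U" by blast+
 then show "\<exists>e>0. \<forall>\<^sub>F i in \<F>. \<forall>t\<in>ball t0 e. q t \<in> U" by (intro exI[of _ e] conjI always_eventually allI)
qed

lemma modified_conv:
 assumes u: "u < a" "b < u + 1" and conv: "conv \<F> W q" and q: "q \<in> loops A" and c: "c \<in> A"
  and J: "open J" "\<And>t. t \<in> J ==> q t \<in> dm c" "{a..b} \<subseteq> J"
  and W: "\<forall>\<^sub>F i in \<F>. periodic (W i) \<and> (\<forall>t\<in>J. W i t \<in> dm c) \<and> (\<forall>t. t \<notin> {a..b} --> Y i t = mp c (W i t))"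
  and Y: "\<And>\<eta>. \<eta> > 0 ==> \<forall>\<^sub>F i in \<F>. \<forall>t\<in>J. dist (Y i t) (mp c (q t)) < \<eta>"
 shows "conv \<F> (\<lambda>i. modified u c J (Y i) (W i)) q"
 unfolding conv_def
proof (intro allI impI)
 fix t0 U assume U: "openin MT U" "q t0 \<in> U"
 have qc: "rcont MT q" and qp: "periodic q" using q by (auto simp: loops_def)
 obtain n :: int and e where e: "e > 0" and *: "\<forall>(f :: real => 'a) q t. periodic q --> (\<forall>t. t \<notin> {a..b} --> f t = q t) --> t \<in> ball t0 e --> wrap u f t = f (t - of_int n)"
  using wrap_local[OF u, of t0] by (elim exE conjE)
 let ?s = "t0 - of_int n"
 have qn: "q ?s \<in> U" using U(2) periodic_shift[OF qp] by simp
 have val: "modified u c J (Y i) (W i) t = (if t - of_int n \<in> J then iv c (Y i (t - of_int n)) else W i (t - of_int n))"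
  if i: "periodic (W i) \<and> (\<forall>t\<in>J. W i t \<in> dm c) \<and> (\<forall>t. t \<notin> {a..b} --> Y i t = mp c (W i t))" and t: "t \<in> ball t0 e" for i t
 proof -
  have "(if t \<in> J then iv c (Y i t) else W i t) = W i t" if "t \<notin> {a..b}" for t
   using i that c by simp
  from *[rule_format, OF conjunct1[OF i] this t] show ?thesis by (simp add: modified_def)
 qed
 have sh: "t - of_int n \<in> ball ?s r" if "t \<in> ball t0 r" for t r using that by (simp add: dist_real_def)
 show "\<exists>e>0. \<forall>\<^sub>F i in \<F>. \<forall>t\<in>ball t0 e. modified u c J (Y i) (W i) t \<in> U"
 proof (cases "?s \<in> J")
  case True
  let ?x = "mp c (q ?s)"
  have "?x \<in> mp c ` (dm c \<inter> U)" using qn J(2)[OF True] by blast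
  then obtain r where r: "r > 0" "ball ?x r \<subseteq> mp c ` (dm c \<inter> U)"
   using open_chart_image_openin[OF c U(1)] open_contains_ball by blast
  let ?O = "J \<inter> {t. q t \<in> dm c \<and> mp c (q t) \<in> ball ?x (r / 2)}"
  have "open ?O" by (intro open_Int J(1) openin_curve_preimage[OF qc c] open_ball)
  moreover have "?s \<in> ?O" using True J(2)[OF True] r(1) by simp
  ultimately obtain e2 where e2: "e2 > 0" "ball ?s e2 \<subseteq> ?O" using open_contains_ball by blast
  have r2: "r / 2 > 0" using r(1) by simp
  show ?thesis
  proof (intro exI[of _ "min e e2"] conjI)
   show "\<forall>\<^sub>F i in \<F>. \<forall>t\<in>ball t0 (min e e2). modified u c J (Y i) (W i) t \<in> U" using W Y[OF r2]
   proof eventually_elim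
    case (elim i)
    show ?case
    proof
     fix t assume t: "t \<in> ball t0 (min e e2)"
     let ?t = "t - of_int n"
     have tO: "?t \<in> ?O" using sh[of t e2] t e2(2) by auto
     then have "dist (Y i ?t) (mp c (q ?t)) < r / 2" "dist ?x (mp c (q ?t)) < r / 2" using elim(2) by auto
     then have "Y i ?t \<in> ball ?x r" using dist_triangle_half_l by (metis dist_commute mem_ball)
     then obtain y where "y \<in> dm c" "y \<in> U" "Y i ?t = mp c y" using r(2) by auto
     then show "modified u c J (Y i) (W i) t \<in> U" using val[of i t] elim(1) t tO c by simp
    qed
   qed
  qed (use e e2 in simp)
 next
  case False
  then have "?s \<notin> {a..b}" using J(3) by blast
  then obtain e2 where e2: "e2 > 0" "ball ?s e2 \<subseteq> - {a..b}" using open_contains_ball_eq[of "- {a..b}" ?s] by auto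
  obtain e1 where e1: "e1 > 0" "\<forall>\<^sub>F i in \<F>. \<forall>t\<in>ball ?s e1. W i t \<in> U" using conv U(1) qn unfolding conv_def by blast
  show ?thesis
  proof (intro exI[of _ "Min {e, e1, e2}"] conjI)
   show "\<forall>\<^sub>F i in \<F>. \<forall>t\<in>ball t0 (Min {e, e1, e2}). modified u c J (Y i) (W i) t \<in> U" using W e1(2)
   proof eventually_elim
    case (elim i)
    show ?case
    proof
     fix t assume t: "t \<in> ball t0 (Min {e, e1, e2})"
     then have "t - of_int n \<notin> {a..b}" "W i (t - of_int n) \<in> U" "t \<in> ball t0 e"
      using sh[of t e2] e2(2) sh[of t e1] elim(2) by auto
     then show "modified u c J (Y i) (W i) t \<in> U" using val[of i t] elim(1) c by simp
    qed
   qed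
  qed (use e e1 e2 in simp)
 qed
qed

text \<open>Window by window, the nearby loop is replaced by the limit loop itself, interpolating in a chart with a cutoff. Each replacement is a homotopy through straight lines in the chart and does not spoil the convergence, and finitely many windows cover a period.\<close>

theorem conv_eventually_homotopic:
 assumes conv: "conv \<F> W q" and q: "q \<in> loops A" and W: "\<forall>\<^sub>F i in \<F>. W i \<in> loops A"
 shows "\<forall>\<^sub>F i in \<F>. homotopic_loops (W i) q"
proof -
 have qc: "rcont MT q" and qp: "periodic q" using q by (auto simp: loops_def)
 let ?P = "\<lambda>T. \<exists>W'. conv \<F> W' q \<and> (\<forall>\<^sub>F i in \<F>. homotopic_loops (W i) (W' i) \<and> (\<forall>t\<in>T. W' i t = q t))"
 have "\<exists>T. {0..1} \<subseteq> T \<and> ?P T"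
 proof (rule compact_open_induct[OF compact_Icc])
  have "\<forall>\<^sub>F i in \<F>. homotopic_loops (W i) (W i)" by (rule eventually_mono[OF W]) (rule homotopic_loops_refl)
  then show "?P {}" using conv by auto
 next
  fix t0 :: real
  obtain c e where c: "c \<in> A" and e: "e > 0" "e < 1/8" and dom: "\<And>t. t \<in> cball t0 (3 * e) ==> q t \<in> dm c"
   using chart_window[OF qc, of t0] by blast
  define u a b J where "u = t0 - 1/2" and "a = t0 - 2 * e" and "b = t0 + 2 * e" and "J = ball t0 (3 * e)"
  have ab: "u < a" "b < u + 1" "{a..b} \<subseteq> J" "J \<subseteq> cball t0 (3 * e)" using e by (auto simp: u_def a_def b_def J_def dist_real_def)
  have core: "t \<in> J \<and> t \<in> {u..<u+1}" if "t \<in> ball t0 e" for t using that e by (auto simp: u_def J_def dist_real_def)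
  obtain \<rho> :: "real => real" where \<rho>: "smooth_on \<rho> UNIV" "\<forall>t\<in>cball t0 e. \<rho> t = 1" "\<forall>t. t \<notin> {a..b} --> \<rho> t = 0" "\<forall>t. 0 \<le> \<rho> t \<and> \<rho> t \<le> 1"
   using smooth_bump[OF e(1), of t0] unfolding a_def b_def by (elim exE conjE)
  have "?P (ball t0 e \<union> T)" if PT: "?P T" for T
  proof -
   obtain W1 where d1: "conv \<F> W1 q" "\<forall>\<^sub>F i in \<F>. homotopic_loops (W i) (W1 i) \<and> (\<forall>t\<in>T. W1 i t = q t)" using PT by (elim exE conjE)
   define Y where "Y i t = (1 - \<rho> t) *\<^sub>R mp c (W1 i t) + \<rho> t *\<^sub>R mp c (q t)" for i t
   have Y1: "Y i t = mp c (W1 i t)" if "t \<notin> {a..b}" for i t using \<rho>(3) that by (simp add: Y_def)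
   have Y2: "dist (Y i t) (mp c (q t)) \<le> dist (mp c (W1 i t)) (mp c (q t))" for i t
   proof -
    have "Y i t - mp c (q t) = (1 - \<rho> t) *\<^sub>R (mp c (W1 i t) - mp c (q t))" by (simp add: Y_def algebra_simps)
    then show ?thesis using \<rho>(4)[rule_format, of t] by (simp add: dist_norm mult_left_le_one_le)
   qed
   have ev: "\<forall>\<^sub>F i in \<F>. \<forall>t\<in>cball t0 (3 * e). W1 i t \<in> dm c \<and> dist (mp c (W1 i t)) (mp c (q t)) < \<eta>" if "\<eta> > 0" for \<eta>
    by (rule conv_compact[OF d1(1) qc c compact_cball dom that])
   have cc: "cont (cball t0 (3 * e)) (\<lambda>t. mp c (q t))"
    by (rule cont_subset[OF cont_coords[OF qc c]]) (use dom in auto)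
   obtain r where r: "r > 0" "\<forall>x\<in>(\<lambda>t. mp c (q t)) ` cball t0 (3 * e). \<forall>y. dist y x < r --> y \<in> mp c ` dm c \<and> dist y x < 1"
    using continuous_near_compact[OF compact_continuous_image[OF cc compact_cball] _ open_chart_image[OF c] cont_id zero_less_one] dom by blast
   let ?W' = "\<lambda>i. modified u c J (Y i) (W1 i)"
   have "conv \<F> ?W' q"
   proof (rule modified_conv[OF ab(1,2) d1(1) q c])
    show "open J" "{a..b} \<subseteq> J" "\<And>t. t \<in> J ==> q t \<in> dm c" using ab dom by (auto simp: J_def)
    show "\<forall>\<^sub>F i in \<F>. periodic (W1 i) \<and> (\<forall>t\<in>J. W1 i t \<in> dm c) \<and> (\<forall>t. t \<notin> {a..b} --> Y i t = mp c (W1 i t))"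
     using d1(2) ev[OF zero_less_one] by eventually_elim (use homotopic_loops_imp_loops ab(4) Y1 in \<open>fastforce simp: loops_def\<close>)
    show "\<forall>\<^sub>F i in \<F>. \<forall>t\<in>J. dist (Y i t) (mp c (q t)) < \<eta>" if "\<eta> > 0" for \<eta>
     by (rule eventually_mono[OF ev[OF that]]) (use ab(4) Y2 in \<open>meson le_less_trans subsetD\<close>)
   qed
   moreover have "\<forall>\<^sub>F i in \<F>. homotopic_loops (W i) (?W' i) \<and> (\<forall>t\<in>ball t0 e \<union> T. ?W' i t = q t)" using d1(2) ev[OF r(1)]
   proof eventually_elim
    case (elim i)
    have l: "W1 i \<in> loops A" using elim(1) homotopic_loops_imp_loops by blast
    then have Wc: "rcont MT (W1 i)" and Wp: "periodic (W1 i)" by (auto simp: loops_def)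
    have dJ: "W1 i t \<in> dm c" if "t \<in> J" for t using elim(2) that ab(4) by blast
    have "homotopic_loops (W1 i) (?W' i)"
    proof (rule modified_homotopic[OF ab(1,2) l c _ dJ ab(3)])
     show "open J" by (simp add: J_def)
     show "cont J (Y i)" unfolding Y_def
      by (intro cont_add cont_scaleR cont_diff cont_const cont_subset[OF cc ab(4)]
        cont_subset[OF smooth_cont[OF \<rho>(1)]] cont_subset[OF cont_coords[OF Wc c]]) (use dJ in auto)
     show "Y i t = mp c (W1 i t)" if "t \<in> J - {a..b}" for t using Y1 that by blast
     show "(1 - s) *\<^sub>R mp c (W1 i t) + s *\<^sub>R Y i t \<in> mp c ` dm c" if t: "t \<in> J" and s: "s \<in> {0..1}" for t s
     proof -
      have tI: "t \<in> cball t0 (3 * e)" using t ab(4) by blast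
      have "mp c (W1 i t) \<in> ball (mp c (q t)) r" using elim(2) tI by (simp add: dist_commute)
      moreover from this have "Y i t \<in> ball (mp c (q t)) r" using Y2[of i t] by (simp add: dist_commute)
      ultimately have "(1 - s) *\<^sub>R mp c (W1 i t) + s *\<^sub>R Y i t \<in> ball (mp c (q t)) r"
       using s by (intro convexD_alt[OF convex_ball]) auto
      then show ?thesis using r(2) tI by (simp add: dist_commute)
     qed
    qed
    then have "homotopic_loops (W i) (?W' i)" using elim(1) homotopic_loops_trans by blast
    moreover have "?W' i t = q t" if t: "t \<in> ball t0 e" for t
    proof -
     have "q t \<in> dm c" using core[OF t] dom ab(4) by blast
     then show ?thesis using core[OF t] t \<rho>(2) c by (simp add: modified_def wrap_eq Y_def)
    qed
    moreover have "?W' i t = q t" if t: "t \<in> T" for t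
    proof -
     define s where "s = t - of_int \<lfloor>t - u\<rfloor>"
     have s: "W1 i s = q s" "q s = q t" using elim(1) t periodic_shift[OF Wp] periodic_shift[OF qp] by (simp_all add: s_def)
     have "?W' i t = (if s \<in> J then iv c (Y i s) else W1 i s)" by (simp add: modified_def wrap_def s_def)
     moreover have "Y i s = mp c (q s)" using s by (simp add: Y_def flip: scaleR_left.add)
     moreover have "q s \<in> dm c" if "s \<in> J" using dom ab(4) that by blast
     ultimately show ?thesis using s c by simp
    qed
    ultimately show ?case by blast
   qed
   ultimately show ?thesis by blast
  qed
  then show "\<exists>U. open U \<and> t0 \<in> U \<and> (\<forall>T. ?P T --> ?P (U \<union> T))" using e(1) by (intro exI[of _ "ball t0 e"]) auto
 qed
 then obtain T W' where T: "{0..1} \<subseteq> T" and W': "\<forall>\<^sub>F i in \<F>. homotopic_loops (W i) (W' i) \<and> (\<forall>t\<in>T. W' i t = q t)" by (elim exE conjE)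
 show ?thesis
 proof (rule eventually_mono[OF W'])
  fix i assume *: "homotopic_loops (W i) (W' i) \<and> (\<forall>t\<in>T. W' i t = q t)"
  then have "periodic (W' i)" using homotopic_loops_imp_loops by (auto simp: loops_def)
  then have "W' i = q" by (rule periodic_eqI[OF _ qp]) (use * T in \<open>simp add: subset_iff\<close>)
  with * show "homotopic_loops (W i) q" by simp
 qed
qed

end

section \<open>Finsler metrics in charts\<close>

lemma has_derivative_inner_gradient:
 fixes f :: "'z::euclidean_space => real"
 assumes "(f hder D) (at z)"
 shows "D h = (\<Sum>b\<in>Basis. D b *\<^sub>R b) \<bullet> h"
proof -
 have l: "linear D" using assms hder_linear by blast
 have "D h = D (\<Sum>b\<in>Basis. (h \<bullet> b) *\<^sub>R b)" by (simp add: euclidean_representation)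
 also have "\<dots> = (\<Sum>b\<in>Basis. (h \<bullet> b) * D b)" by (simp add: linear_sum[OF l] linear_scale[OF l])
 also have "\<dots> = (\<Sum>b\<in>Basis. D b *\<^sub>R b) \<bullet> h"
  by (simp add: inner_sum_left inner_commute[of h] mult.commute)
 finally show ?thesis .
qed

locale finsler = atlas_locale A for A :: "('a, 'e::euclidean_space) atlas" +
 fixes F :: "'a \<times> ('a, 'e) tangent => real"
 assumes F: "finsler_metric A F"
begin

text \<open>The metric in the coordinates of a chart.\<close>

definition Fc :: "('a, 'e) chart => 'e \<times> 'e => real" where
 "Fc c z = F (iv c (fst z), tangent_of_coords A c (iv c (fst z)) (snd z))"

abbreviation rng :: "('a, 'e) chart => 'e set" where "rng c \<equiv> mp c ` dm c"

abbreviation len :: "(real => 'a) => real" where "len q \<equiv> finsler_length A F q"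

lemma chart_inv_charts_at: "c \<in> A ==> x \<in> rng c ==> c \<in> charts_at A (iv c x)"
 using chart_inv_in by (simp add: charts_at_iff)

lemma F_eq_Fc:
 assumes "c \<in> charts_at A x" "v \<in> tangent_space A x"
 shows "F (x, v) = Fc c (mp c x, v c)"
 using assms tangent_of_coords_coords[OF assms(2,1)] by (simp add: Fc_def charts_at_iff)

lemma tangent_bundle_coords: "c \<in> A ==> x \<in> rng c ==>
  (iv c x, tangent_of_coords A c (iv c x) v) \<in> tangent_bundle A"
 unfolding tangent_bundle_def
 using points_chart[OF _ chart_inv_in] tangent_of_coords_in[OF chart_inv_charts_at] by auto

lemma tangent_of_coords_eq_zero_iff:
 assumes "c \<in> charts_at A x" shows "tangent_of_coords A c x v = (\<lambda>c. 0) \<longleftrightarrow> v = 0"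
proof
 assume "tangent_of_coords A c x v = (\<lambda>c. 0)"
 then show "v = 0" using tangent_of_coords_self[OF assms, of v] by metis
next
 assume "v = 0" then show "tangent_of_coords A c x v = (\<lambda>c. 0)" using tangent_of_coords_zero[OF assms] by metis
qed

lemma Fc_nonneg: "c \<in> A ==> x \<in> rng c ==> Fc c (x, v) \<ge> 0"
 using F tangent_bundle_coords[of c x v] unfolding finsler_metric_def Fc_def by (simp del: split_paired_All)

lemma Fc_scale:
 assumes "c \<in> A" "x \<in> rng c" "a > 0" shows "Fc c (x, a *\<^sub>R v) = a * Fc c (x, v)"
proof -
 have h: "\<forall>(x, v) \<in> tangent_bundle A. \<forall>a>0. F (x, \<lambda>c. a *\<^sub>R v c) = a * F (x, v)"
  using F unfolding finsler_metric_def by blast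
 have "tangent_of_coords A c (iv c x) (a *\<^sub>R v) = (\<lambda>d. a *\<^sub>R tangent_of_coords A c (iv c x) v d)"
  using tangent_of_coords_linear[OF chart_inv_charts_at[OF assms(1,2)], of a v 0 0] by simp
 then show ?thesis using h tangent_bundle_coords[OF assms(1,2), of v] assms(3) by (auto simp: Fc_def)
qed

lemma Fc_zero: "c \<in> A ==> x \<in> rng c ==> Fc c (x, 0) = 0"
 using Fc_scale[of c x 2 0] by simp

lemma Fc_smooth:
 assumes c: "c \<in> A" shows "smooth_on (Fc c) (rng c \<times> (- {0}))"
proof -
 define TC :: "('a \<times> ('a, 'e) tangent, 'e \<times> 'e) chart" where
  "TC = (SIGMA x:dm c. tangent_space A x, \<lambda>(x, v). (mp c x, v c))"
 define U where "U = {(x, v) \<in> tangent_bundle A. v ~= (\<lambda>c. 0)}"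
 have TCA: "TC \<in> tangent_bundle_atlas A" unfolding TC_def tangent_bundle_atlas_def using c by blast
 have "smooth_map_on (tangent_bundle_atlas A) euclidean_atlas U F"
  using F unfolding finsler_metric_def U_def by blast
 then have "\<forall>c\<in>tangent_bundle_atlas A. \<forall>d\<in>euclidean_atlas. smooth_on (mp d \<circ> F \<circ> iv c)
    (mp c ` (dm c \<inter> U \<inter> F -` dm d))" unfolding smooth_map_on_def by blast
 from this[rule_format, OF TCA, of "(UNIV, id)"]
 have sm: "smooth_on (F \<circ> iv TC) (mp TC ` (dm TC \<inter> U))"
  by (simp add: euclidean_atlas_def)
 have dom: "mp TC ` (dm TC \<inter> U) = rng c \<times> (- {0})"
 proof (intro equalityI subsetI)
  fix z assume "z \<in> mp TC ` (dm TC \<inter> U)"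
  then obtain x v where xv: "x \<in> dm c" "v \<in> tangent_space A x" "v ~= (\<lambda>c. 0)" "z = (mp c x, v c)"
   by (auto simp: TC_def U_def)
  have cx: "c \<in> charts_at A x" using xv c by (simp add: charts_at_iff)
  have "v c ~= 0" using xv(3) tangent_of_coords_coords[OF xv(2) cx] tangent_of_coords_zero[OF cx] by metis
  then show "z \<in> rng c \<times> (- {0})" using xv by simp
 next
  fix z :: "'e \<times> 'e" assume "z \<in> rng c \<times> (- {0})"
  then obtain x v where z: "z = (x, v)" "x \<in> rng c" "v ~= 0" by (cases z) blast
  have cx: "c \<in> charts_at A (iv c x)" using chart_inv_charts_at[OF c z(2)] .
  have "(iv c x, tangent_of_coords A c (iv c x) v) \<in> dm TC \<inter> U"
   using tangent_bundle_coords[OF c z(2), of v] tangent_of_coords_eq_zero_iff[OF cx, of v] z chart_inv_in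
    tangent_of_coords_in[OF cx] by (simp add: TC_def U_def)
  moreover have "mp TC (iv c x, tangent_of_coords A c (iv c x) v) = z"
   using z map_chart_inv tangent_of_coords_self[OF cx] by (simp add: TC_def)
  ultimately show "z \<in> mp TC ` (dm TC \<inter> U)" by (metis image_eqI)
 qed
 have inj: "inj_on (mp TC) (dm TC)"
 proof (rule inj_onI)
  fix z1 z2 assume "z1 \<in> dm TC" "z2 \<in> dm TC" "mp TC z1 = mp TC z2"
  then obtain x1 v1 x2 v2 where z: "z1 = (x1, v1)" "z2 = (x2, v2)" "x1 \<in> dm c" "x2 \<in> dm c"
   "v1 \<in> tangent_space A x1" "v2 \<in> tangent_space A x2" "mp c x1 = mp c x2" "v1 c = v2 c"
   by (auto simp: TC_def)
  have x: "x1 = x2" using inj_onD[OF chart_inj[OF c] z(7)] z by blast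
  have "c \<in> charts_at A x1" using z c by (simp add: charts_at_iff)
  then have "v1 = v2" using z x by (intro tangent_eqI[of v1 x1 v2 c]) auto
  with x z show "z1 = z2" by simp
 qed
 have eq: "(F \<circ> iv TC) z = Fc c z" if "z \<in> rng c \<times> (- {0})" for z :: "'e \<times> 'e"
 proof -
  obtain x v where z0: "z = (x, v)" by (cases z)
  with that have z: "z = (x, v)" "x \<in> rng c" by simp_all
  have cx: "c \<in> charts_at A (iv c x)" using chart_inv_charts_at[OF c z(2)] .
  have "iv TC z = (iv c x, tangent_of_coords A c (iv c x) v)"
   unfolding chart_inv_def[of TC]
  proof (rule inv_into_f_eq[OF inj])
   show "(iv c x, tangent_of_coords A c (iv c x) v) \<in> dm TC"
    using z chart_inv_in tangent_of_coords_in[OF cx] by (simp add: TC_def)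
   show "mp TC (iv c x, tangent_of_coords A c (iv c x) v) = z"
    using z map_chart_inv tangent_of_coords_self[OF cx] by (simp add: TC_def)
  qed
  then show ?thesis using z by (simp add: Fc_def)
 qed
 have "open (rng c \<times> (- {0::'e}))" using open_chart_image[OF c] by (intro open_Times) auto
 then show ?thesis using smooth_on_cong[OF _ _ sm[unfolded dom]] eq by blast
qed

lemma deriv_shift: "deriv (\<lambda>t. f (s + t)) (0::real) = deriv f s" for f :: "real => real"
proof -
 have "(f has_field_derivative D) (at s) \<longleftrightarrow> ((\<lambda>t. f (s + t)) has_field_derivative D) (at 0)" for D
  using DERIV_shift[of f D 0 s] by (simp add: add.commute)
 then show ?thesis by (simp add: deriv_def)
qed

lemma fundamental_tensor_coords:
 assumes c: "c \<in> A" and x: "x \<in> rng c"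
 shows "fundamental_tensor F (iv c x) (tangent_of_coords A c (iv c x) y)
   (tangent_of_coords A c (iv c x) u) (tangent_of_coords A c (iv c x) u)
  = 1/2 * deriv (deriv (\<lambda>s. (Fc c (x, y + s *\<^sub>R u))\<^sup>2)) 0"
proof -
 have cx: "c \<in> charts_at A (iv c x)" using chart_inv_charts_at[OF c x] .
 let ?T = "tangent_of_coords A c (iv c x)"
 have lin: "(\<lambda>d. ?T y d + s *\<^sub>R ?T u d + t *\<^sub>R ?T u d) = ?T (y + (s + t) *\<^sub>R u)" for s t
  using tangent_of_coords_linear[OF cx, of 1 y "s + t" u] by (simp add: scaleR_add_left add.assoc)
 have "deriv (\<lambda>t. (F (iv c x, \<lambda>d. ?T y d + s *\<^sub>R ?T u d + t *\<^sub>R ?T u d))\<^sup>2) 0 = deriv (\<lambda>s. (Fc c (x, y + s *\<^sub>R u))\<^sup>2) s" for s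
  using deriv_shift[of "\<lambda>s. (Fc c (x, y + s *\<^sub>R u))\<^sup>2" s] unfolding lin by (simp add: Fc_def)
 then show ?thesis unfolding fundamental_tensor_def by simp
qed

lemma second_derivative_pos:
 assumes c: "c \<in> A" and x: "x \<in> rng c" and "y ~= 0" "u ~= 0"
 shows "deriv (deriv (\<lambda>s. (Fc c (x, y + s *\<^sub>R u))\<^sup>2)) 0 > 0"
proof -
 have cx: "c \<in> charts_at A (iv c x)" using chart_inv_charts_at[OF c x] .
 let ?T = "tangent_of_coords A c (iv c x)"
 have pd: "\<forall>(x, y) \<in> tangent_bundle A. y ~= (\<lambda>c. 0) -->
    (\<forall>u \<in> tangent_space A x. u ~= (\<lambda>c. 0) --> fundamental_tensor F x y u u > 0)"
  using F unfolding finsler_metric_def by (elim conjE)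
 from bspec[OF pd tangent_bundle_coords[OF c x, of y]]
 have "?T y ~= (\<lambda>c. 0) --> (\<forall>u \<in> tangent_space A (iv c x). u ~= (\<lambda>c. 0) --> fundamental_tensor F (iv c x) (?T y) u u > 0)"
  by simp
 moreover have "?T y ~= (\<lambda>c. 0)" using tangent_of_coords_eq_zero_iff[OF cx] assms(3) by blast
 ultimately have "?T u ~= (\<lambda>c. 0) --> fundamental_tensor F (iv c x) (?T y) (?T u) (?T u) > 0"
  using tangent_of_coords_in[OF cx] by blast
 moreover have "?T u ~= (\<lambda>c. 0)" using tangent_of_coords_eq_zero_iff[OF cx] assms(4) by blast
 ultimately show ?thesis using fundamental_tensor_coords[OF c x, of y u] by simp
qed

lemma Fc_pos:
 assumes c: "c \<in> A" and x: "x \<in> rng c" and v: "v ~= 0" shows "Fc c (x, v) > 0"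
proof (rule ccontr)
 assume "\<not> Fc c (x, v) > 0"
 then have 0: "Fc c (x, v) = 0" using Fc_nonneg[OF c x, of v] by simp
 have z: "(Fc c (x, v + s *\<^sub>R v))\<^sup>2 = 0" if "s \<in> {-1<..}" for s
 proof -
  have "v + s *\<^sub>R v = (1 + s) *\<^sub>R v" by (simp add: scaleR_add_left)
  then show ?thesis using Fc_scale[OF c x, of "1 + s" v] that 0 by simp
 qed
 have d1: "deriv (\<lambda>s. (Fc c (x, v + s *\<^sub>R v))\<^sup>2) s = 0" if "s \<in> {-1<..}" for s
  by (rule DERIV_imp_deriv, rule has_field_derivative_transform_within_open[OF DERIV_const[of 0], where S = "{-1<..}"])
   (use z that in auto)
 have "deriv (deriv (\<lambda>s. (Fc c (x, v + s *\<^sub>R v))\<^sup>2)) 0 = 0"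
  by (rule DERIV_imp_deriv, rule has_field_derivative_transform_within_open[OF DERIV_const[of 0], where S = "{-1<..}"])
   (use d1 in auto)
 then show False using second_derivative_pos[OF c x v v] by simp
qed

definition Lc :: "('a, 'e) chart => 'e \<times> 'e => real" where
 "Lc c z = (Fc c z)\<^sup>2 / 2"

text \<open>The gradient of the Lagrangian Lc. Its value 0 on zero vectors is the derivative there as well, since Lc is quadratically homogeneous; Lc is in general not twice differentiable at such points.\<close>

definition Gc :: "('a, 'e) chart => 'e \<times> 'e => 'e \<times> 'e" where
 "Gc c z = (if snd z = 0 then 0 else (\<Sum>b\<in>Basis. Df (Lc c) z b *\<^sub>R b))"

lemma Lc_smooth:
 assumes c: "c \<in> A" shows "smooth_on (Lc c) (rng c \<times> (- {0}))"
proof -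
 have o: "open (rng c \<times> (- {0::'e}))" using open_chart_image[OF c] by (intro open_Times) auto
 have "smooth_on (\<lambda>z. (1/2) *\<^sub>R (Fc c z *\<^sub>R Fc c z)) (rng c \<times> (- {0}))"
  by (intro smooth_on_scaleR smooth_on_const Fc_smooth[OF c] o)
 then show ?thesis by (rule smooth_on_cong[OF o, rotated]) (simp add: Lc_def power2_eq_square)
qed

lemma Lc_nonneg: "Lc c z \<ge> 0" by (simp add: Lc_def)

lemma Lc_scale: "c \<in> A ==> x \<in> rng c ==> a > 0 ==> Lc c (x, a *\<^sub>R v) = a\<^sup>2 * Lc c (x, v)"
 by (simp add: Lc_def Fc_scale power_mult_distrib)

lemma Lc_derivative_nz:
 assumes c: "c \<in> A" and x: "x \<in> rng c" and v: "v ~= 0"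
 shows "(Lc c hder (\<lambda>h. Gc c (x, v) \<bullet> h)) (at (x, v))"
proof -
 have d: "(Lc c hder Df (Lc c) (x, v)) (at (x, v))"
  by (rule smooth_hder[OF Lc_smooth[OF c]]) (use x v in auto)
 have "Df (Lc c) (x, v) = (\<lambda>h. Gc c (x, v) \<bullet> h)"
  by (rule ext, subst has_derivative_inner_gradient[OF d]) (simp add: Gc_def v)
 with d show ?thesis by (simp only:)
qed

lemma Gc_continuous_nz: "c \<in> A ==> cont (rng c \<times> (- {0})) (Gc c)"
proof -
 assume c: "c \<in> A"
 have "cont (rng c \<times> (- {0})) (\<lambda>z. \<Sum>b\<in>Basis. Df (Lc c) z b *\<^sub>R b)"
  by (intro continuous_on_sum cont_scaleR cont_const smooth_cont smooth_on_frechet Lc_smooth c)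
 then show ?thesis by (rule continuous_on_eq) (auto simp: Gc_def)
qed

lemma Gc_scale:
 assumes c: "c \<in> A" and x: "x \<in> rng c" and a: "a > 0"
 shows "fst (Gc c (x, a *\<^sub>R v)) = a\<^sup>2 *\<^sub>R fst (Gc c (x, v))" "snd (Gc c (x, a *\<^sub>R v)) = a *\<^sub>R snd (Gc c (x, v))"
proof -
 have key: "Gc c (x, a *\<^sub>R v) \<bullet> (h, a *\<^sub>R k) = a\<^sup>2 * (Gc c (x, v) \<bullet> (h, k))" for h k
 proof (cases "v = 0")
  case True then show ?thesis by (simp add: Gc_def)
 next
  case False
  have S: "((\<lambda>z. (fst z, a *\<^sub>R snd z)) hder (\<lambda>z. (fst z, a *\<^sub>R snd z))) (at (x, v))"
   by (auto intro!: derivative_eq_intros)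
  have "(Lc c hder (\<lambda>h. Gc c (x, a *\<^sub>R v) \<bullet> h)) (at (fst (x, v), a *\<^sub>R snd (x, v)))"
   using Lc_derivative_nz[OF c x, of "a *\<^sub>R v"] False a by simp
  from hder_compose[OF S this]
  have 1: "((\<lambda>z. Lc c (fst z, a *\<^sub>R snd z)) hder (\<lambda>z. Gc c (x, a *\<^sub>R v) \<bullet> (fst z, a *\<^sub>R snd z))) (at (x, v))" .
  have "((\<lambda>z. a\<^sup>2 * Lc c z) hder (\<lambda>h. a\<^sup>2 * (Gc c (x, v) \<bullet> h))) (at (x, v))"
   using Lc_derivative_nz[OF c x False] by (rule has_derivative_mult_right)
  then have 2: "((\<lambda>z. Lc c (fst z, a *\<^sub>R snd z)) hder (\<lambda>h. a\<^sup>2 * (Gc c (x, v) \<bullet> h))) (at (x, v))"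
  proof (rule hder_cong_open)
   show "open (rng c \<times> (UNIV :: 'e set))" using open_chart_image[OF c] by (intro open_Times) auto
   show "(x, v) \<in> rng c \<times> UNIV" using x by simp
   show "a\<^sup>2 * Lc c z = Lc c (fst z, a *\<^sub>R snd z)" if "z \<in> rng c \<times> UNIV" for z
    using Lc_scale[OF c _ a, of "fst z" "snd z"] that by (simp add: mem_Times_iff)
  qed
  from has_derivative_unique[OF 1 2] show ?thesis by (metis fst_conv snd_conv)
 qed
 show "fst (Gc c (x, a *\<^sub>R v)) = a\<^sup>2 *\<^sub>R fst (Gc c (x, v))"
  by (rule euclidean_eqI) (use key[of _ 0] in \<open>simp add: inner_prod_def\<close>)
 show "snd (Gc c (x, a *\<^sub>R v)) = a *\<^sub>R snd (Gc c (x, v))"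
 proof (rule euclidean_eqI)
  fix i :: 'e
  have "a * (snd (Gc c (x, a *\<^sub>R v)) \<bullet> i) = a * (a * (snd (Gc c (x, v)) \<bullet> i))"
   using key[of 0 i] by (simp add: inner_prod_def power2_eq_square algebra_simps)
  then show "snd (Gc c (x, a *\<^sub>R v)) \<bullet> i = (a *\<^sub>R snd (Gc c (x, v))) \<bullet> i" using a by simp
 qed
qed

lemma homogeneous_bounds:
 assumes c: "c \<in> A" and K: "compact K" "K \<subseteq> rng c"
 obtains M where "M > 0" "\<And>x v. x \<in> K ==> Fc c (x, v) \<le> M * norm v"
  "\<And>x v. x \<in> K ==> norm v \<le> 1 ==> norm (Gc c (x, v)) \<le> M * norm v"
proof -
 define S where "S = K \<times> sphere (0::'e) 1"
 have S: "compact S" "S \<subseteq> rng c \<times> (- {0})" using K by (auto simp: S_def intro: compact_Times)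
 have "bounded (Fc c ` S)" "bounded (Gc c ` S)"
  using compact_continuous_image[OF cont_subset[OF smooth_cont[OF Fc_smooth[OF c]] S(2)] S(1)]
   compact_continuous_image[OF cont_subset[OF Gc_continuous_nz[OF c] S(2)] S(1)] compact_imp_bounded by blast+
 then obtain M1 M2 where M1: "M1 > 0" "\<And>z. z \<in> S ==> norm (Fc c z) \<le> M1" and M2: "M2 > 0" "\<And>z. z \<in> S ==> norm (Gc c z) \<le> M2"
  unfolding bounded_pos by blast
 define M where "M = M1 + 2 * M2"
 show ?thesis
 proof (rule that[of M])
  show "M > 0" using M1 M2 by (simp add: M_def)
  fix x and v :: 'e assume x: "x \<in> K"
  have xr: "x \<in> rng c" using x K by blast
  show "Fc c (x, v) \<le> M * norm v"
  proof (cases "v = 0")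
   case True then show ?thesis using Fc_zero[OF c xr] by simp
  next
   case False
   define w where "w = v /\<^sub>R norm v"
   have w: "(x, w) \<in> S" "v = norm v *\<^sub>R w" using x False by (auto simp: S_def w_def)
   have "Fc c (x, v) = norm v * Fc c (x, w)" using Fc_scale[OF c xr, of "norm v" w] w(2) False by simp
   also have "\<dots> \<le> norm v * M1" using M1(2)[OF w(1)] by (intro mult_left_mono) auto
   also have "\<dots> = M1 * norm v" by (rule mult.commute)
   also have "\<dots> \<le> M * norm v" using M2(1) by (intro mult_right_mono) (auto simp: M_def)
   finally show ?thesis .
  qed
  assume v1: "norm v \<le> 1"
  show "norm (Gc c (x, v)) \<le> M * norm v"
  proof (cases "v = 0")
   case True then show ?thesis by (simp add: Gc_def)
  next
   case False
   define w where "w = v /\<^sub>R norm v"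
   have w: "(x, w) \<in> S" "v = norm v *\<^sub>R w" using x False by (auto simp: S_def w_def)
   have pos: "norm v > 0" using False by simp
   have f: "norm (fst (Gc c (x, w))) \<le> M2" "norm (snd (Gc c (x, w))) \<le> M2"
    using M2(2)[OF w(1)] norm_fst_le[of "fst (Gc c (x, w))" "snd (Gc c (x, w))"]
     norm_snd_le[of "snd (Gc c (x, w))" "fst (Gc c (x, w))"] by auto
   have "norm (Gc c (x, v)) \<le> norm (fst (Gc c (x, v))) + norm (snd (Gc c (x, v)))"
    using norm_Pair_le[of "fst (Gc c (x, v))" "snd (Gc c (x, v))"] by simp
   also have "\<dots> = (norm v)\<^sup>2 * norm (fst (Gc c (x, w))) + norm v * norm (snd (Gc c (x, w)))"
    using Gc_scale[OF c xr pos, of w] w(2) by simp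
   also have "\<dots> \<le> norm v * M2 + norm v * M2"
   proof (rule add_mono)
    have "(norm v)\<^sup>2 \<le> norm v" using v1 by (simp add: power2_eq_square mult_left_le)
    then show "(norm v)\<^sup>2 * norm (fst (Gc c (x, w))) \<le> norm v * M2" using f by (intro mult_mono) auto
    show "norm v * norm (snd (Gc c (x, w))) \<le> norm v * M2" using f by (intro mult_left_mono) auto
   qed
   also have "\<dots> \<le> M * norm v" using M1(1) by (simp add: M_def algebra_simps)
   finally show ?thesis .
  qed
 qed
qed

lemma chart_image_cball:
 assumes "c \<in> A" "x \<in> rng c"
 obtains r where "r > 0" "cball x r \<subseteq> rng c"
 using open_contains_cball open_chart_image[OF assms(1)] assms(2) by blast

lemma Lc_has_derivative:
 assumes c: "c \<in> A" and z: "z \<in> rng c \<times> UNIV"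
 shows "(Lc c hder (\<lambda>h. Gc c z \<bullet> h)) (at z)"
proof (cases "snd z = 0")
 case False
 then show ?thesis using Lc_derivative_nz[OF c, of "fst z" "snd z"] z by (cases z) auto
next
 case True
 obtain x where z0: "z = (x, 0)" "x \<in> rng c" using True z by (cases z) auto
 obtain r where r: "r > 0" "cball x r \<subseteq> rng c" using chart_image_cball[OF c z0(2)] .
 obtain M where M: "M > 0" "\<And>y v. y \<in> cball x r ==> Fc c (y, v) \<le> M * norm v"
  using homogeneous_bounds[OF c _ r(2)] by (metis compact_cball)
 have L0: "Lc c z = 0" using Fc_zero[OF c z0(2)] z0 by (simp add: Lc_def)
 show ?thesis unfolding has_derivative_at_alt
 proof (intro conjI allI impI)
  show "bounded_linear (\<lambda>h. Gc c z \<bullet> h)" by (rule bounded_linear_inner_right)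
  fix e :: real assume e: "e > 0"
  define d where "d = min r (2 * e / M\<^sup>2)"
  have "d > 0" using r e M by (simp add: d_def)
  moreover have "norm (Lc c y - Lc c z - Gc c z \<bullet> (y - z)) \<le> e * norm (y - z)" if y: "norm (y - z) < d" for y
  proof -
   have n: "norm (fst y - x) \<le> norm (y - z)" "norm (snd y) \<le> norm (y - z)"
    using norm_fst_le[of "fst y - x" "snd y"] norm_snd_le[of "snd y" "fst y - x"] z0 by (cases y; simp)+
   have "fst y \<in> cball x r" using n(1) y by (simp add: d_def dist_norm norm_minus_commute)
   then have F1: "0 \<le> Fc c y" "Fc c y \<le> M * norm (snd y)" using M(2)[of "fst y" "snd y"] Fc_nonneg[OF c, of "fst y" "snd y"] r(2) by auto
   have "Lc c y \<le> (M * norm (snd y))\<^sup>2 / 2" unfolding Lc_def using F1 by (intro divide_right_mono power_mono) auto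
   also have "\<dots> \<le> (M * norm (y - z))\<^sup>2 / 2" using n M by (intro divide_right_mono power_mono mult_left_mono) auto
   also have "\<dots> = (M\<^sup>2 / 2 * norm (y - z)) * norm (y - z)" by (simp add: power2_eq_square)
   also have "\<dots> \<le> e * norm (y - z)"
   proof (rule mult_right_mono)
    have "norm (y - z) \<le> 2 * e / M\<^sup>2" using y by (simp add: d_def)
    then show "M\<^sup>2 / 2 * norm (y - z) \<le> e" using M(1) by (simp add: field_simps)
   qed simp
   finally show ?thesis using L0 Lc_nonneg[of c y] z0 by (simp add: Gc_def)
  qed
  ultimately show "\<exists>d>0. \<forall>y. norm (y - z) < d --> norm (Lc c y - Lc c z - Gc c z \<bullet> (y - z)) \<le> e * norm (y - z)" by blast
 qed
qed

lemma Gc_continuous: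
 assumes c: "c \<in> A" shows "cont (rng c \<times> UNIV) (Gc c)"
proof (intro cont_at_imp ballI)
 fix z assume z: "z \<in> rng c \<times> (UNIV :: 'e set)"
 show "isCont (Gc c) z"
 proof (cases "snd z = 0")
  case False
  have "open (rng c \<times> (- {0::'e}))" using open_chart_image[OF c] by (intro open_Times) auto
  then show ?thesis using Gc_continuous_nz[OF c] z False cont_at[of "rng c \<times> (- {0::'e})" "Gc c"]
   by (cases z) auto
 next
  case True
  obtain x where z0: "z = (x, 0)" "x \<in> rng c" using True z by (cases z) auto
  obtain r where r: "r > 0" "cball x r \<subseteq> rng c" using chart_image_cball[OF c z0(2)] .
  obtain M where M: "M > 0" "\<And>y v. y \<in> cball x r ==> norm v \<le> 1 ==> norm (Gc c (y, v)) \<le> M * norm v"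
   using homogeneous_bounds[OF c _ r(2)] by (metis compact_cball)
  show ?thesis unfolding continuous_at_eps_delta
  proof (intro allI impI)
   fix e :: real assume e: "e > 0"
   define d where "d = Min {r, 1, e / (M + 1)}"
   have d: "d > 0" "d \<le> r" "d \<le> 1" "d \<le> e / (M + 1)" using r e M by (auto simp: d_def)
   have "dist (Gc c y) (Gc c z) < e" if y: "dist y z < d" for y
   proof -
    have n: "dist (fst y) x \<le> dist y z" "dist (snd y) 0 \<le> dist y z"
     using dist_fst_le[of y z] dist_snd_le[of y z] z0 by simp_all
    have "norm (Gc c (fst y, snd y)) \<le> M * norm (snd y)"
     by (rule M(2)) (use n y d in \<open>auto simp: dist_commute\<close>)
    also have "\<dots> \<le> M * d" using n y M by (intro mult_left_mono) auto
    also have "\<dots> \<le> M * (e / (M + 1))" using d M by (intro mult_left_mono) auto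
    also have "\<dots> < e" using M e by (simp add: field_simps)
    finally show ?thesis using z0 by (simp add: Gc_def)
   qed
   with d(1) show "\<exists>d>0. \<forall>x'. dist x' z < d --> dist (Gc c x') (Gc c z) < e" by blast
  qed
 qed
qed

lemma Lc_continuous: "c \<in> A ==> cont (rng c \<times> UNIV) (Lc c)"
 by (intro cont_at_imp ballI has_derivative_continuous[OF Lc_has_derivative])

lemma Fc_eq_sqrt: "c \<in> A ==> z \<in> rng c \<times> UNIV ==> Fc c z = sqrt (2 * Lc c z)"
 using Fc_nonneg[of c "fst z" "snd z"] by (cases z) (simp add: Lc_def)

lemma Fc_continuous: "c \<in> A ==> cont (rng c \<times> UNIV) (Fc c)"
 by (rule continuous_on_eq[of _ "\<lambda>z. sqrt (2 * Lc c z)"])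
  (auto simp: Fc_eq_sqrt intro!: continuous_on_real_sqrt continuous_on_mult cont_const Lc_continuous)

lemma Fc_lower_bound:
 assumes c: "c \<in> A" and K: "compact K" "K \<subseteq> rng c"
 obtains m where "m > 0" "\<And>x v. x \<in> K ==> m * norm v \<le> Fc c (x, v)"
proof (cases "K = {}")
 case True then show ?thesis using that[of 1] by simp
next
 case False
 define S where "S = K \<times> sphere (0::'e) 1"
 obtain b :: 'e where "norm b = 1" using vector_choose_size[of 1] by auto
 then have S: "compact S" "S \<subseteq> rng c \<times> (- {0})" "S ~= {}" using K False by (auto simp: S_def intro: compact_Times)
 obtain z where z: "z \<in> S" "\<And>y. y \<in> S ==> Fc c z \<le> Fc c y"
  using continuous_attains_inf[OF S(1,3) cont_subset[OF smooth_cont[OF Fc_smooth[OF c]] S(2)]] by blast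
 have pos: "Fc c z > 0" using Fc_pos[OF c, of "fst z" "snd z"] z(1) S(2) by (cases z) auto
 show ?thesis
 proof (rule that[OF pos])
  fix x v assume x: "x \<in> K"
  have xr: "x \<in> rng c" using x K by blast
  show "Fc c z * norm v \<le> Fc c (x, v)"
  proof (cases "v = 0")
   case True then show ?thesis using Fc_zero[OF c xr] by simp
  next
   case False
   define w where "w = v /\<^sub>R norm v"
   have w: "(x, w) \<in> S" "v = norm v *\<^sub>R w" using x False by (auto simp: S_def w_def)
   have "Fc c (x, v) = norm v * Fc c (x, w)" using Fc_scale[OF c xr, of "norm v" w] w(2) False by simp
   moreover have "norm v * Fc c z \<le> norm v * Fc c (x, w)" using z(2)[OF w(1)] by (intro mult_left_mono) auto
   ultimately show ?thesis by (simp add: mult.commute)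
  qed
 qed
qed

lemma Gc_euler:
 assumes c: "c \<in> A" and x: "x \<in> rng c" shows "snd (Gc c (x, v)) \<bullet> v = (Fc c (x, v))\<^sup>2"
proof -
 have 1: "((\<lambda>s. Lc c (x, (1 + s) *\<^sub>R v)) hder (\<lambda>s. Gc c (x, v) \<bullet> (0, s *\<^sub>R v))) (at 0)"
 proof -
  have "((\<lambda>s. (x, (1 + s) *\<^sub>R v)) hder (\<lambda>s. (0, s *\<^sub>R v))) (at 0)" by (auto intro!: derivative_eq_intros)
  from hder_compose[OF this, of "Lc c" "\<lambda>h. Gc c (x, v) \<bullet> h"] show ?thesis
   using Lc_has_derivative[OF c, of "(x, v)"] x by simp
 qed
 have "((\<lambda>s. (1 + s)\<^sup>2 * Lc c (x, v)) hder (\<lambda>s. s * (2 * Lc c (x, v)))) (at (0::real))"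
  by (auto intro!: derivative_eq_intros)
 then have 2: "((\<lambda>s. Lc c (x, (1 + s) *\<^sub>R v)) hder (\<lambda>s. s * (2 * Lc c (x, v)))) (at 0)"
  by (rule hder_cong_open[OF _ open_greaterThan[of "-1"]]) (use Lc_scale[OF c x] in auto)
 from has_derivative_unique[OF 1 2] have "Gc c (x, v) \<bullet> (0, 1 *\<^sub>R v) = 1 * (2 * Lc c (x, v))" by metis
 then show ?thesis by (simp add: inner_prod_def Lc_def)
qed

lemma Lc_line_derivative:
 assumes c: "c \<in> A" and x: "x \<in> rng c"
 shows "((\<lambda>s. Lc c (x, y + s *\<^sub>R u)) hrd snd (Gc c (x, y + s *\<^sub>R u)) \<bullet> u) (at s)"
proof -
 have "((\<lambda>s. (x, y + s *\<^sub>R u)) hder (\<lambda>k. (0, k *\<^sub>R u))) (at s)" by (auto intro!: derivative_eq_intros)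
 from hder_compose[OF this, of "Lc c" "\<lambda>h. Gc c (x, y + s *\<^sub>R u) \<bullet> h"]
 have "((\<lambda>s. Lc c (x, y + s *\<^sub>R u)) hder (\<lambda>k. Gc c (x, y + s *\<^sub>R u) \<bullet> (0, k *\<^sub>R u))) (at s)"
  using Lc_has_derivative[OF c, of "(x, y + s *\<^sub>R u)"] x by simp
 then show ?thesis unfolding has_field_derivative_def
  by (rule has_derivative_eq_rhs) (simp add: inner_prod_def fun_eq_iff)
qed

text \<open>On a segment that avoids the zero vector the fundamental tensor is positive, so the fibre derivative increases strictly along it.\<close>

lemma Gc_strictly_monotone:
 assumes c: "c \<in> A" and x: "x \<in> rng c" and u: "u ~= 0"
  and nz: "\<And>s. s \<in> {0..1} ==> y + s *\<^sub>R u ~= 0" and s: "0 \<le> s" "s < t" "t \<le> 1"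
 shows "snd (Gc c (x, y + s *\<^sub>R u)) \<bullet> u < snd (Gc c (x, y + t *\<^sub>R u)) \<bullet> u"
proof (rule DERIV_pos_imp_increasing[OF s(2)])
 define g where "g s = snd (Gc c (x, y + s *\<^sub>R u)) \<bullet> u" for s
 have d1: "deriv (\<lambda>s. (Fc c (x, y + s *\<^sub>R u))\<^sup>2) = (\<lambda>s. 2 * g s)"
 proof
  fix s
  have "((\<lambda>s. 2 * Lc c (x, y + s *\<^sub>R u)) hrd 2 * g s) (at s)"
   unfolding g_def by (rule DERIV_cmult[OF Lc_line_derivative[OF c x]])
  then show "deriv (\<lambda>s. (Fc c (x, y + s *\<^sub>R u))\<^sup>2) s = 2 * g s"
   by (intro DERIV_imp_deriv) (simp add: Lc_def)
 qed
 fix r assume r: "s \<le> r" "r \<le> t"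
 then have yr: "y + r *\<^sub>R u ~= 0" using nz s by simp
 have "deriv (deriv (\<lambda>k. (Fc c (x, (y + r *\<^sub>R u) + k *\<^sub>R u))\<^sup>2)) 0 > 0"
  by (rule second_derivative_pos[OF c x yr u])
 moreover have "deriv (\<lambda>k. (Fc c (x, (y + r *\<^sub>R u) + k *\<^sub>R u))\<^sup>2) k = 2 * g (r + k)" for k
  using deriv_shift[of "\<lambda>s. (Fc c (x, y + s *\<^sub>R u))\<^sup>2" "r + k"]
   deriv_shift[of "\<lambda>k. (Fc c (x, (y + r *\<^sub>R u) + k *\<^sub>R u))\<^sup>2" k] d1 by (simp add: scaleR_add_left algebra_simps)
 then have "deriv (\<lambda>k. (Fc c (x, (y + r *\<^sub>R u) + k *\<^sub>R u))\<^sup>2) = (\<lambda>k. 2 * g (r + k))" by (rule ext)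
 ultimately have "deriv (\<lambda>k. 2 * g (r + k)) 0 > 0" by simp
 then have pos: "deriv (\<lambda>s. 2 * g s) r > 0" using deriv_shift[of "\<lambda>s. 2 * g s" r] by simp
 have diff: "\<exists>D. (g hrd D) (at r)"
 proof -
  have smG: "smooth_on (\<lambda>z. Df (Lc c) z (0, u)) (rng c \<times> (- {0}))"
   by (rule smooth_on_frechet[OF Lc_smooth[OF c]])
  have "((\<lambda>s. (x, y + s *\<^sub>R u)) hder (\<lambda>k. (0, k *\<^sub>R u))) (at r)" by (auto intro!: derivative_eq_intros)
  from hder_compose[OF this smooth_hder[OF smG]]
  have dd: "((\<lambda>s. Df (Lc c) (x, y + s *\<^sub>R u) (0, u)) has_derivative
   (\<lambda>k. Df (\<lambda>z. Df (Lc c) z (0, u)) (x, y + r *\<^sub>R u) (0, k *\<^sub>R u))) (at r)"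
   using x yr by simp
  have op: "open {s. y + s *\<^sub>R u ~= 0}" by (intro open_Collect_neq continuous_intros)
  have "(g has_derivative
   (\<lambda>k. Df (\<lambda>z. Df (Lc c) z (0, u)) (x, y + r *\<^sub>R u) (0, k *\<^sub>R u))) (at r)"
  proof (rule hder_cong_open[OF dd op])
   show "r \<in> {s. y + s *\<^sub>R u ~= 0}" using yr by simp
   fix s assume "s \<in> {s. y + s *\<^sub>R u ~= 0}"
   then have "Df (Lc c) (x, y + s *\<^sub>R u) (0, u) = Gc c (x, y + s *\<^sub>R u) \<bullet> (0, u)"
    using Df_at[OF Lc_derivative_nz[OF c x]] by (metis mem_Collect_eq)
   then show "Df (Lc c) (x, y + s *\<^sub>R u) (0, u) = g s" by (simp add: g_def inner_prod_def)
  qed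
  then have "g differentiable (at r)" by (rule differentiableI)
  then show ?thesis using real_differentiable_def by blast
 qed
 then obtain D where D: "(g hrd D) (at r)" by blast
 have "deriv (\<lambda>s. 2 * g s) r = 2 * D" by (rule DERIV_imp_deriv[OF DERIV_cmult[OF D]])
 then show "\<exists>D. ((\<lambda>s. snd (Gc c (x, y + s *\<^sub>R u)) \<bullet> u) hrd D) (at r) \<and> 0 < D"
  using D pos unfolding g_def[symmetric] by (intro exI[of _ D]) simp
qed

text \<open>The Legendre transform is injective in a fibre: monotonicity separates the end points of a segment, and if the segment passes through zero, its end points are multiples of each other and Euler's identity separates them.\<close>

lemma Gc_inj:
 assumes c: "c \<in> A" and x: "x \<in> rng c" and eq: "snd (Gc c (x, v)) = snd (Gc c (x, w))"
 shows "v = w"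
proof (rule ccontr)
 assume ne: "v ~= w"
 define u where "u = w - v"
 have u: "u ~= 0" using ne by (simp add: u_def)
 show False
 proof (cases "\<exists>s\<in>{0..1}. v + s *\<^sub>R u = 0")
  case False
  then have "snd (Gc c (x, v + 0 *\<^sub>R u)) \<bullet> u < snd (Gc c (x, v + 1 *\<^sub>R u)) \<bullet> u"
   by (intro Gc_strictly_monotone[OF c x u]) auto
  then show False using eq by (simp add: u_def)
 next
  case True
  then obtain s where s: "s \<in> {0..1}" "v + s *\<^sub>R u = 0" by blast
  have v: "v = (- s) *\<^sub>R u" using s(2) by (simp add: eq_neg_iff_add_eq_0)
  have w: "w = (1 - s) *\<^sub>R u" using v by (simp add: u_def algebra_simps)
  have "(1 - s) * (snd (Gc c (x, w)) \<bullet> u) = (Fc c (x, w))\<^sup>2" using Gc_euler[OF c x, of w] w by simp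
  moreover have "(- s) * (snd (Gc c (x, v)) \<bullet> u) = (Fc c (x, v))\<^sup>2" using Gc_euler[OF c x, of v] v by simp
  moreover have "(Fc c (x, v))\<^sup>2 > 0 \<or> (Fc c (x, w))\<^sup>2 > 0"
   using Fc_pos[OF c x, of v] Fc_pos[OF c x, of w] ne by (cases "v = 0") auto
  moreover have "(Fc c (x, v))\<^sup>2 \<ge> 0" "(Fc c (x, w))\<^sup>2 \<ge> 0" by auto
  moreover have "0 \<le> s" "0 \<le> 1 - s" using s(1) by auto
  moreover define q where "q = snd (Gc c (x, v)) \<bullet> u"
  ultimately have *: "(1 - s) * q = (Fc c (x, w))\<^sup>2" "(- s) * q = (Fc c (x, v))\<^sup>2" "0 \<le> s" "0 \<le> 1 - s"
   "(Fc c (x, v))\<^sup>2 > 0 \<or> (Fc c (x, w))\<^sup>2 > 0" "(Fc c (x, v))\<^sup>2 \<ge> 0" "(Fc c (x, w))\<^sup>2 \<ge> 0"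
   using eq by simp_all
  show False
  proof (cases "q \<ge> 0")
   case True
   have "- (s * q) \<ge> 0" using *(6) unfolding *(2)[symmetric] by simp
   moreover have "s * q \<ge> 0" using *(3) True by simp
   ultimately have 0: "s * q = 0" by linarith
   have "(Fc c (x, v))\<^sup>2 = - (s * q)" using *(2) by simp
   then have "(Fc c (x, v))\<^sup>2 = 0" unfolding 0 by simp
   then have "(Fc c (x, w))\<^sup>2 > 0" using *(5) by simp
   then have "(1 - s) * q ~= 0" using *(1) by simp
   then have "s = 0" using 0 by auto
   then have "v = 0" using v by simp
   with eq have "snd (Gc c (x, w)) = 0" by (simp add: Gc_def)
   then show False using \<open>(Fc c (x, w))\<^sup>2 > 0\<close> Gc_euler[OF c x, of w] by simp
  next
   case False
   then have 0: "(1 - s) * q = 0" using *(1,4,7) mult_nonneg_nonpos[of "1 - s" q] by simp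
   then have "(Fc c (x, v))\<^sup>2 > 0" using *(1,5) by simp
   moreover have "s = 1" using 0 False by simp
   then have "w = 0" using w by simp
   with eq have "snd (Gc c (x, v)) = 0" by (simp add: Gc_def)
   ultimately show False using Gc_euler[OF c x, of v] by simp
  qed
 qed
qed

text \<open>The hyperplane dual to v supports the unit ball of F: this is the convexity of the metric in the form in which it enters all comparisons below.\<close>

lemma Gc_fundamental_inequality:
 assumes c: "c \<in> A" and x: "x \<in> rng c"
 shows "snd (Gc c (x, y)) \<bullet> w \<le> Fc c (x, y) * Fc c (x, w)"
proof -
 consider "y = 0" | "w = 0" | "y ~= 0" "w ~= 0" by blast
 then show ?thesis
 proof cases
  case 1 then show ?thesis using Fc_zero[OF c x] by (simp add: Gc_def)
 next
  case 2 then show ?thesis using Fc_zero[OF c x] by simp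
 next
  case 3
  have Fy: "Fc c (x, y) > 0" and Fw: "Fc c (x, w) > 0" using Fc_pos[OF c x] 3 by auto
  define a where "a = Fc c (x, y) / Fc c (x, w)"
  have a: "a > 0" using Fy Fw by (simp add: a_def)
  define w' where "w' = a *\<^sub>R w"
  have Fw': "Fc c (x, w') = Fc c (x, y)" using Fc_scale[OF c x a, of w] Fw by (simp add: w'_def a_def)
  define u where "u = w' - y"
  have key: "snd (Gc c (x, y)) \<bullet> w' \<le> Fc c (x, y) * Fc c (x, y)"
  proof (cases "u = 0")
   case True
   then show ?thesis using Gc_euler[OF c x, of y] by (simp add: u_def power2_eq_square)
  next
   case u: False
   show ?thesis
   proof (cases "\<exists>s\<in>{0..1}. y + s *\<^sub>R u = 0")
    case False
    obtain r where r: "0 < r" "r < 1" "Lc c (x, y + 1 *\<^sub>R u) - Lc c (x, y + 0 *\<^sub>R u) = (1 - 0) * (snd (Gc c (x, y + r *\<^sub>R u)) \<bullet> u)"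
     using MVT2[of 0 1 "\<lambda>s. Lc c (x, y + s *\<^sub>R u)" "\<lambda>s. snd (Gc c (x, y + s *\<^sub>R u)) \<bullet> u"] Lc_line_derivative[OF c x] by auto
    have "Lc c (x, y + 1 *\<^sub>R u) = Lc c (x, y + 0 *\<^sub>R u)" using Fw' by (simp add: u_def Lc_def)
    moreover have "snd (Gc c (x, y + 0 *\<^sub>R u)) \<bullet> u < snd (Gc c (x, y + r *\<^sub>R u)) \<bullet> u"
     by (rule Gc_strictly_monotone[OF c x u]) (use False r in auto)
    ultimately have "snd (Gc c (x, y)) \<bullet> u < 0" using r by simp
    then show ?thesis using Gc_euler[OF c x, of y] by (simp add: u_def inner_diff_right power2_eq_square)
   next
    case True
    then obtain s where s: "s \<in> {0..1}" "y + s *\<^sub>R u = 0" by blast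
    have "s ~= 0" using s 3 by auto
    have "s *\<^sub>R w' = (- (1 - s)) *\<^sub>R y" using s(2) by (simp add: u_def algebra_simps eq_neg_iff_add_eq_0)
    then have "s * (snd (Gc c (x, y)) \<bullet> w') = - (1 - s) * (snd (Gc c (x, y)) \<bullet> y)"
     by (metis inner_scaleR_right)
    also have "\<dots> \<le> 0" unfolding Gc_euler[OF c x, of y] using s(1) by (intro mult_nonpos_nonneg) auto
    finally have "snd (Gc c (x, y)) \<bullet> w' \<le> 0" using s(1) \<open>s ~= 0\<close> by (auto simp: mult_le_0_iff)
    also have "0 \<le> Fc c (x, y) * Fc c (x, y)" by simp
    finally show ?thesis .
   qed
  qed
  have "a * (snd (Gc c (x, y)) \<bullet> w) \<le> a * (Fc c (x, y) * Fc c (x, w))"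
   using key Fw by (simp add: w'_def a_def)
  then show ?thesis using a by simp
 qed
qed

end

section \<open>Smoothing of loops\<close>

lemma antiderivative_on_reals:
 fixes f :: "real => 'b::euclidean_space"
 assumes "cont UNIV f"
 obtains G where "\<And>t. (G hvd f t) (at t)"
proof -
 have "\<exists>Q. \<forall>x::real. (-\<infinity> :: ereal) < ereal x --> ereal x < \<infinity> --> (Q hvd f x) (at x)"
  by (rule einterval_antiderivative) (use assms in \<open>auto simp: cont_at\<close>)
 then show ?thesis using that by auto
qed

lemma integral_antiderivative:
 fixes f :: "real => 'b::euclidean_space"
 assumes "\<And>t. (G hvd f t) (at t)" "a \<le> b"
 shows "(f has_integral G b - G a) {a..b}"
 by (rule fund_thm[OF assms(2) hvd_within[OF assms(1)]])

lemma periodic_antiderivative: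
 fixes f :: "real => 'b::euclidean_space"
 assumes G: "\<And>t. (G hvd f t) (at t)" and p: "periodic f"
 shows "G (t + 1) - G t = integral {0..1} f"
proof -
 have "((\<lambda>t. G (t - (- 1)) - G t) hvd 0) (at t)" for t
  using has_vector_derivative_diff[OF has_vector_derivative_shift[of G "f (t + 1)" t "- 1"] G[of t]] G[of "t + 1"] p
  by (simp add: periodic_def)
 then have "((\<lambda>t. G (t - (- 1)) - G t) hder (\<lambda>h. 0)) (at t within UNIV)" for t
  by (simp add: hvd_def)
 then obtain k where "\<And>t. G (t - (- 1)) - G t = k"
  using has_derivative_zero_constant[of UNIV "\<lambda>t. G (t - (- 1)) - G t"] by auto
 then have "G (t + 1) - G t = G 1 - G 0" by (metis add_0 diff_minus_eq_add)
 then show ?thesis using integral_unique[OF integral_antiderivative[OF G, of 0 1]] by simp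
qed

lemma integral_period:
 fixes f :: "real => 'b::euclidean_space"
 assumes "cont UNIV f" "periodic f"
 shows "integral {u..u+1} f = integral {0..1} f"
proof -
 obtain G where G: "\<And>t. (G hvd f t) (at t)" using antiderivative_on_reals[OF assms(1)] by blast
 show ?thesis using integral_unique[OF integral_antiderivative[OF G, of u "u + 1"]] periodic_antiderivative[OF G assms(2), of u] by simp
qed

lemma smooth_on_polynomial_function:
 fixes p :: "real => 'b::euclidean_space"
 assumes "polynomial_function p" shows "smooth_on p UNIV"
proof -
 have "Ck_on k p UNIV" if "polynomial_function p" for k and p :: "real => 'b"
  using that
 proof (induction k arbitrary: p)
  case 0
  then show ?case by (simp add: continuous_on_polymonial_function)
 next
  case (Suc k)
  obtain p' where p': "polynomial_function p'" "\<And>x. (p hvd p' x) (at x)"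
   by (rule has_vector_derivative_polynomial_function[OF Suc.prems]) blast
  have fd: "Df p x v = v *\<^sub>R p' x" for x v
   using fun_cong[OF Df_at[OF p'(2)[unfolded hvd_def]], of v x] by simp
  have "Ck_on k (\<lambda>x. v *\<^sub>R p' x) UNIV" for v by (intro Ck_on_scaleR Ck_on_const Suc.IH p') auto
  moreover have "p differentiable (at x)" for x using p'(2) differentiableI_vector by blast
  ultimately show ?case by (simp add: fd)
 qed
 then show ?thesis using assms unfolding smooth_on_def by blast
qed

lemma smooth_on_antiderivative:
 fixes p :: "real => 'b::euclidean_space"
 assumes "\<And>t. (P hvd p t) (at t)" "smooth_on p UNIV"
 shows "smooth_on P UNIV"
 unfolding smooth_on_def
proof
 fix k
 show "Ck_on k P UNIV"
 proof (cases k)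
  case 0
  have "cont UNIV P" by (rule hvd_cont[OF hvd_within[OF assms(1)]])
  then show ?thesis using 0 by simp
 next
  case (Suc m)
  have fd: "Df P x v = v *\<^sub>R p x" for x v
   using fun_cong[OF Df_at[OF assms(1)[unfolded hvd_def]], of v x] by simp
  have "Ck_on m (\<lambda>x. v *\<^sub>R p x) UNIV" for v
   using assms(2) unfolding smooth_on_def by (intro Ck_on_scaleR Ck_on_const) auto
  moreover have "P differentiable (at x)" for x using assms(1) differentiableI_vector by blast
  ultimately show ?thesis using Suc by (simp add: fd)
 qed
qed

text \<open>The theorem of Weierstrass applied to the derivative; the antiderivative of the polynomial approximates the curve.\<close>

lemma smooth_C1_approximation:
 fixes X :: "real => 'b::euclidean_space"
 assumes lr: "l \<le> r" "r \<le> l + 1" and X: "\<And>t. t \<in> {l..r} ==> (X hvd V t) (at t within {l..r})"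
  and V: "cont {l..r} V" and \<eta>: "\<eta> > 0"
 shows "\<exists>P p. smooth_on P UNIV \<and> (\<forall>t. (P hvd p t) (at t)) \<and> smooth_on p UNIV \<and>
  (\<forall>t\<in>{l..r}. dist (P t) (X t) \<le> \<eta> \<and> dist (p t) (V t) \<le> \<eta>)"
proof -
 obtain p where p: "polynomial_function p" "\<forall>t\<in>{l..r}. norm (V t - p t) < \<eta>"
  using Stone_Weierstrass_polynomial_function[OF compact_Icc V \<eta>] by blast
 have sp: "smooth_on p UNIV" by (rule smooth_on_polynomial_function[OF p(1)])
 have cp: "cont UNIV p" by (rule smooth_cont[OF sp])
 obtain Q where Q: "\<And>t. (Q hvd p t) (at t)" using antiderivative_on_reals[OF cp] by blast
 define P where "P t = Q t + (X l - Q l)" for t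
 have P: "(P hvd p t) (at t)" for t
  unfolding P_def using Q[of t] by (auto intro!: derivative_eq_intros)
 have "dist (P t) (X t) \<le> \<eta>" if t: "t \<in> {l..r}" for t
 proof -
  have "((\<lambda>s. p s - V s) has_integral (P t - X t) - (P l - X l)) {l..t}"
  proof (rule fund_thm)
   show "((\<lambda>s. P s - X s) hvd p s - V s) (at s within {l..t})" if "s \<in> {l..t}" for s
    using that t by (intro has_vector_derivative_diff hvd_within[OF P] has_vector_derivative_within_subset[OF X]) auto
  qed (use t in simp)
  then have e: "P t - X t = integral {l..t} (\<lambda>s. p s - V s)" by (simp add: P_def integral_unique)
  have "norm (integral {l..t} (\<lambda>s. p s - V s)) \<le> \<eta> * (t - l)"
  proof (rule integral_bound)
   show "cont {l..t} (\<lambda>s. p s - V s)"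
    by (intro cont_diff cont_subset[OF cp] cont_subset[OF V]) (use t in auto)
   show "norm (p s - V s) \<le> \<eta>" if "s \<in> {l..t}" for s using p(2) that t by (auto simp: norm_minus_commute less_imp_le)
  qed (use t in simp)
  also have "\<dots> \<le> \<eta> * 1" using t lr \<eta> by (intro mult_left_mono) auto
  finally show ?thesis by (simp add: dist_norm e)
 qed
 then show ?thesis using P sp p(2) smooth_on_antiderivative[OF P sp]
  by (intro exI[of _ P] exI[of _ p]) (auto simp: dist_norm norm_minus_commute less_imp_le)
qed

context atlas_locale
begin

lemma smooth_curve_at_chart:
 assumes sm: "smooth_curve_at q t0" and q: "rcont MT q" and d: "d \<in> A" "q t0 \<in> dm d"
 shows "\<exists>e>0. (\<forall>t\<in>ball t0 e. q t \<in> dm d) \<and> smooth_on (\<lambda>t. mp d (q t)) (ball t0 e)"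
proof -
 obtain c e where c: "c \<in> A" and e: "e > 0" and ct: "\<And>t. t\<in>ball t0 e ==> q t \<in> dm c"
  and sm: "smooth_on (\<lambda>t. mp c (q t)) (ball t0 e)" using sm unfolding smooth_curve_at_def by metis
 obtain e' where e': "e' > 0" "\<And>t. t \<in> ball t0 e' ==> q t \<in> dm d"
  using curve_chart_ball[OF q d] by blast
 define r where "r = min e e'"
 have r: "r > 0" "ball t0 r \<subseteq> ball t0 e" "ball t0 r \<subseteq> ball t0 e'" using e e' by (auto simp: r_def)
 have "smooth_on (\<lambda>t. (mp d \<circ> iv c) (mp c (q t))) (ball t0 r)"
  by (rule smooth_on_compose[OF open_ball _ smooth_on_subset[OF sm r(2)] smooth_transition[OF c d(1)]])
    (use ct[OF subsetD[OF r(2)]] e'(2)[OF subsetD[OF r(3)]] in blast)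
 then have "smooth_on (\<lambda>t. mp d (q t)) (ball t0 r)"
  by (rule smooth_on_cong[OF open_ball, rotated]) (use ct r c in auto)
 then show ?thesis using r e'(2) by blast
qed

lemma smooth_curve_at_shift:
 assumes "periodic q" "smooth_curve_at q t" shows "smooth_curve_at q (t - of_int n)"
 using smooth_curve_at_cong[of q "t - of_int n" "- of_int n" 1 q] assms(2) periodic_shift[OF assms(1), of _ "- n"] by simp

lemma modified_smooth:
 assumes u: "u < a" "b < u + 1" and q: "rcont MT q" "periodic q" and c: "c \<in> A"
  and J: "open J" "\<And>t. t \<in> J ==> q t \<in> dm c" "{a..b} \<subseteq> J"
  and \<rho>: "smooth_on \<rho> UNIV" "\<And>t. t \<notin> {a..b} ==> \<rho> t = 0" and P: "smooth_on P UNIV"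
 defines "Y \<equiv> \<lambda>t. (1 - \<rho> t) *\<^sub>R mp c (q t) + \<rho> t *\<^sub>R P t"
 assumes Y: "\<And>t. t \<in> J ==> Y t \<in> mp c ` dm c"
 shows "smooth_curve_at q t ==> smooth_curve_at (modified u c J Y q) t"
  and "open U ==> U \<subseteq> J \<inter> {u..<u+1} ==> (\<And>t. t \<in> U ==> \<rho> t = 1) ==> t \<in> U ==> smooth_curve_at (modified u c J Y q) t"
proof -
 define f where "f t = (if t \<in> J then iv c (Y t) else q t)" for t
 have off: "f t = q t" if "t \<notin> {a..b}" for t using \<rho>(2)[OF that] J(2)[of t] c by (simp add: f_def Y_def)
 have toJ: "smooth_curve_at f s" if s: "s \<in> J" and sm: "open V" "s \<in> V" "smooth_on Y V" for s V
 proof -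
  obtain e where e: "e > 0" "ball s e \<subseteq> J \<inter> V" using s sm J(1) open_contains_ball open_Int by (metis IntI)
  have fJ: "f t \<in> dm c \<and> mp c (f t) = Y t" if "t \<in> ball s e" for t
  proof -
   have t: "t \<in> J" using e(2) that by blast
   show ?thesis using chart_inv_in[OF Y[OF t]] map_chart_inv[OF Y[OF t]] t by (simp add: f_def)
  qed
  have "smooth_on (\<lambda>t. mp c (f t)) (ball s e)"
   by (rule smooth_on_cong[OF open_ball _ smooth_on_subset[OF sm(3)]]) (use fJ e(2) in auto)
  then show ?thesis unfolding smooth_curve_at_def using c e(1) fJ by blast
 qed
 have old: "smooth_curve_at f s" if s: "smooth_curve_at q s" for s
 proof (cases "s \<in> J")
  case True
  obtain e where e: "e > 0" "\<forall>t\<in>ball s e. q t \<in> dm c" "smooth_on (\<lambda>t. mp c (q t)) (ball s e)"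
   using smooth_curve_at_chart[OF s q(1) c J(2)[OF True]] by blast
  have "smooth_on (\<lambda>t. (1 + (-1) *\<^sub>R \<rho> t) *\<^sub>R mp c (q t) + \<rho> t *\<^sub>R P t) (ball s e)"
   by (intro smooth_on_add smooth_on_scaleR smooth_on_const e(3) open_ball smooth_on_subset[OF \<rho>(1)] smooth_on_subset[OF P]) auto
  then have "smooth_on Y (ball s e)" by (simp add: Y_def)
  then show ?thesis using toJ[OF True open_ball[of s e]] e(1) by simp
 next
  case False
  then have "s \<notin> {a..b}" using J(3) by blast
  then obtain e where "e > 0" "ball s e \<subseteq> - {a..b}" using open_contains_ball_eq[of "- {a..b}" s] by auto
  then show ?thesis using smooth_curve_at_cong[of q s 0 e f] s off by (simp add: subset_iff)
 qed
 show "smooth_curve_at (modified u c J Y q) t" if "smooth_curve_at q t"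
 proof -
  obtain n :: int and e where e: "e > 0" "\<And>s. s \<in> ball t e ==> modified u c J Y q s = f (s - of_int n)"
   using wrap_local[OF u, of t] q(2) off unfolding modified_def f_def[abs_def, symmetric] by metis
  show ?thesis by (rule smooth_curve_at_cong[OF old[OF smooth_curve_at_shift[OF q(2) that]] e])
 qed
 show "smooth_curve_at (modified u c J Y q) t"
  if U: "open U" "U \<subseteq> J \<inter> {u..<u+1}" "\<And>t. t \<in> U ==> \<rho> t = 1" "t \<in> U"
 proof -
  have "smooth_on Y U" by (rule smooth_on_cong[OF U(1) _ smooth_on_subset[OF P subset_UNIV]]) (simp add: Y_def U(3))
  then have sf: "smooth_curve_at f t" using toJ[OF _ U(1,4)] U(2,4) by blast
  obtain e where e: "e > 0" "ball t e \<subseteq> U" using U(1,4) open_contains_ball by blast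
  have "modified u c J Y q s = f (s - 0)" if "s \<in> ball t e" for s
  proof -
   have "s \<in> {u..<u+1}" using that e(2) U(2) by blast
   then show ?thesis using wrap_eq[of s u f] by (simp add: modified_def f_def[abs_def])
  qed
  then show ?thesis using smooth_curve_at_cong[of f t 0 e] sf e(1) by simp
 qed
qed

end

context finsler
begin

definition speed :: "(real => 'a) => real => real" where "speed q t = F (q t, velocity A q t)"

lemma finsler_length_speed: "len q = integral {0..1} (speed q)"
 by (simp add: finsler_length_def speed_def[abs_def])

lemma speed_chart:
 assumes "C1_curve A q" "c \<in> A" "q t \<in> dm c"
 shows "speed q t = Fc c (mp c (q t), velocity A q t c)"
 unfolding speed_def using assms by (intro F_eq_Fc velocity_tangent) (auto simp: charts_at_iff)

lemma chart_at_curve: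
 assumes "rcont MT q"
 obtains c where "c \<in> A" "q t \<in> dm c"
 using curve_in_points[OF assms, of t] unfolding points_def by blast

lemma speed_nonneg: assumes "C1_curve A q" shows "speed q t \<ge> 0"
proof -
 obtain c where c: "c \<in> A" "q t \<in> dm c" using chart_at_curve[OF C1_cont[OF assms]] .
 show ?thesis using speed_chart[OF assms c] Fc_nonneg[OF c(1)] c(2) by simp
qed

lemma speed_continuous: assumes q: "C1_curve A q" shows "cont UNIV (speed q)"
proof (intro cont_at_imp ballI)
 fix t0
 obtain c where c: "c \<in> A" "q t0 \<in> dm c" using chart_at_curve[OF C1_cont[OF q]] .
 let ?O = "{t. q t \<in> dm c}"
 have "cont ?O (\<lambda>t. Fc c (mp c (q t), velocity A q t c))"
  by (rule cont_compose[OF Fc_continuous[OF c(1)] cont_Pair[OF cont_coords[OF C1_cont[OF q] c(1)] C1_cont_velocity[OF q c(1)]]])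
   auto
 then have "cont ?O (speed q)" by (rule continuous_on_eq) (use speed_chart[OF q c(1)] in simp)
 then show "isCont (speed q) t0"
  using cont_at[OF open_curve_dom[OF C1_cont[OF q] c(1)]] c(2) by blast
qed

lemma velocity_periodic: "periodic q ==> velocity A q (t + 1) = velocity A q t"
 using velocity_cong[of 1 "t + 1" q q 1] periodic_shift[of q _ 1] by simp

lemma speed_periodic: "periodic q ==> periodic (speed q)"
 using velocity_periodic by (simp add: periodic_def speed_def)

lemma finsler_length_nonneg: "C1_curve A q ==> len q \<ge> 0"
 unfolding finsler_length_speed
 by (rule integral_nonneg[OF integrable_cont[OF cont_subset[OF speed_continuous]]]) (auto intro: speed_nonneg)

lemma speed_near_window:
 assumes q: "C1_curve A q" and c: "c \<in> A" and dom: "\<And>t. t \<in> {a..b} ==> q t \<in> dm c" and \<epsilon>: "\<epsilon> > 0"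
 shows "\<exists>r>0. \<forall>t\<in>{a..b}. \<forall>y w. dist y (mp c (q t)) + dist w (velocity A q t c) < r --> y \<in> rng c \<and> Fc c (y, w) \<le> speed q t + \<epsilon>"
proof -
 let ?z = "\<lambda>t. (mp c (q t), velocity A q t c)"
 have "cont {a..b} ?z"
  by (intro cont_Pair cont_subset[OF cont_coords[OF C1_cont[OF q] c]]
    cont_subset[OF C1_cont_velocity[OF q c]]) (use dom in auto)
 from continuous_near_compact[OF compact_continuous_image[OF this compact_Icc] _ open_Times[OF open_chart_image[OF c] open_UNIV] Fc_continuous[OF c] \<epsilon>]
 obtain r where r: "r > 0" "\<forall>x\<in>?z ` {a..b}. \<forall>y. dist y x < r --> y \<in> rng c \<times> UNIV \<and> dist (Fc c y) (Fc c x) < \<epsilon>" using dom by blast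
 show ?thesis
 proof (intro exI[of _ r] conjI r(1) ballI allI impI)
  fix t y w assume t: "t \<in> {a..b}" and d: "dist y (mp c (q t)) + dist w (velocity A q t c) < r"
  have "dist (y, w) (?z t) \<le> dist y (mp c (q t)) + dist w (velocity A q t c)"
   unfolding dist_Pair_Pair by (rule sqrt_sum_squares_le_sum) auto
  then have "(y, w) \<in> rng c \<times> UNIV \<and> dist (Fc c (y, w)) (Fc c (?z t)) < \<epsilon>" using r(2) t d by (meson imageI le_less_trans)
  then show "y \<in> rng c" "Fc c (y, w) \<le> speed q t + \<epsilon>" using speed_chart[OF q c dom[OF t]] by (auto simp: dist_real_def)
 qed
qed

text \<open>A polynomial curve close to the given one in the C1 sense is blended in by a cutoff. The curve and its velocity change little, and so does the speed.\<close>

lemma smoothing_window: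
 assumes q: "C1_curve A q" "periodic q" and c: "c \<in> A" and e: "0 < e" "e < 1/8"
  and dom: "\<And>t. t \<in> ball t0 (3 * e) ==> q t \<in> dm c" and \<epsilon>: "\<epsilon> > 0"
 shows "\<exists>Y. (\<forall>t. t \<notin> {t0 - 2 * e..t0 + 2 * e} --> Y t = mp c (q t)) \<and>
  (\<forall>t\<in>ball t0 (3 * e). dist (Y t) (mp c (q t)) < \<epsilon>) \<and>
  (\<exists>W. W = modified (t0 - 1/2) c (ball t0 (3 * e)) Y q \<and> C1_curve A W \<and> len W \<le> len q + \<epsilon> \<and>
   (\<forall>t. smooth_curve_at q t \<or> t \<in> ball t0 e --> smooth_curve_at W t))"
proof -
 obtain \<rho> :: "real => real" where \<rho>: "smooth_on \<rho> UNIV" "\<forall>t. t \<notin> {t0 - 2 * e..t0 + 2 * e} --> \<rho> t = 0" "\<forall>t. 0 \<le> \<rho> t \<and> \<rho> t \<le> 1"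
  and \<rho>1: "\<forall>t\<in>cball t0 e. \<rho> t = 1" using smooth_bump[OF e(1), of t0] by (elim exE conjE)
 define u a b J where "u = t0 - 1/2" and "a = t0 - 2 * e" and "b = t0 + 2 * e" and "J = ball t0 (3 * e)"
 have ab: "u < a" "b < u + 1" "{a..b} \<subseteq> J" "a \<le> b" "b \<le> a + 1" using e by (auto simp: u_def a_def b_def J_def dist_real_def)
 have dJ: "q t \<in> dm c" if "t \<in> J" for t using dom that by (simp add: J_def)
 have dab: "q t \<in> dm c" if "t \<in> {a..b}" for t using dJ ab(3) that by blast
 have \<rho>0: "\<rho> t = 0" if "t \<notin> {a..b}" for t using \<rho>(2) that by (simp add: a_def b_def)
 define \<rho>' where "\<rho>' t = Df \<rho> t 1" for t
 have c\<rho>': "cont UNIV \<rho>'" unfolding \<rho>'_def by (rule smooth_cont[OF smooth_on_frechet[OF \<rho>(1)]])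
 have d\<rho>: "(\<rho> hrd \<rho>' t) (at t)" for t
 proof -
  have d: "(\<rho> hder Df \<rho> t) (at t)" by (rule smooth_hder[OF \<rho>(1)]) simp
  have "Df \<rho> t = (*) (\<rho>' t)"
  proof
   fix h show "Df \<rho> t h = \<rho>' t * h"
    using linear_scale[OF hder_linear[OF d], of h 1] by (simp add: \<rho>'_def mult.commute)
  qed
  with d show ?thesis unfolding has_field_derivative_def by (simp only:)
 qed
 have "bounded (\<rho>' ` {a..b})" by (rule compact_imp_bounded[OF compact_continuous_image[OF cont_subset[OF c\<rho>' subset_UNIV] compact_Icc]])
 then obtain M where "M > 0 \<and> (\<forall>y\<in>\<rho>' ` {a..b}. norm y \<le> M)" unfolding bounded_pos by (elim exE)
 then have M: "M > 0" "\<And>t. t \<in> {a..b} ==> \<bar>\<rho>' t\<bar> \<le> M" by simp_all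
 obtain r where r: "r > 0" "\<And>t y w. t \<in> {a..b} ==> dist y (mp c (q t)) + dist w (velocity A q t c) < r ==> y \<in> rng c \<and> Fc c (y, w) \<le> speed q t + \<epsilon>"
  using speed_near_window[of q c a b \<epsilon>] q(1) c dab \<epsilon> by (metis (lifting))
 define \<eta> where "\<eta> = min r \<epsilon> / (3 + M)"
 have \<eta>0: "\<eta> > 0" "\<eta> * (3 + M) = min r \<epsilon>" using r(1) \<epsilon> M(1) by (simp_all add: \<eta>_def)
 have \<eta>: "\<eta> > 0" "\<eta> * (2 + M) < r" "\<eta> < \<epsilon>" using \<eta>0 mult_pos_pos[OF \<eta>0(1) M(1)] by (simp_all add: distrib_left)
 have cv: "cont {a..b} (\<lambda>t. velocity A q t c)"
  by (rule cont_subset[OF C1_cont_velocity[OF q(1) c]]) (use dab in auto)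
 obtain P p where P: "smooth_on P UNIV" "\<And>t. (P hvd p t) (at t)" "smooth_on p UNIV"
  "\<And>t. t \<in> {a..b} ==> dist (P t) (mp c (q t)) \<le> \<eta> \<and> dist (p t) (velocity A q t c) \<le> \<eta>"
  using smooth_C1_approximation[OF ab(4,5) hvd_within[OF C1_coords_hvd[OF q(1) c dab]] cv \<eta>(1)] by blast
 define Y where "Y = (\<lambda>t. (1 - \<rho> t) *\<^sub>R mp c (q t) + \<rho> t *\<^sub>R P t)"
 define Y' where "Y' t = ((1 - \<rho> t) *\<^sub>R velocity A q t c + \<rho> t *\<^sub>R p t) + \<rho>' t *\<^sub>R (P t - mp c (q t))" for t
 have off: "Y t = mp c (q t)" if "t \<notin> {a..b}" for t using \<rho>0[OF that] by (simp add: Y_def)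
 have near: "dist (Y t) (mp c (q t)) \<le> \<eta> \<and> dist (Y' t) (velocity A q t c) \<le> \<eta> + M * \<eta>" if t: "t \<in> {a..b}" for t
 proof -
  have "Y t - mp c (q t) = \<rho> t *\<^sub>R (P t - mp c (q t))" by (simp add: Y_def algebra_simps)
  moreover have "Y' t - velocity A q t c = \<rho> t *\<^sub>R (p t - velocity A q t c) + \<rho>' t *\<^sub>R (P t - mp c (q t))" by (simp add: Y'_def algebra_simps)
  moreover have "norm (\<rho> t *\<^sub>R v) \<le> \<eta>" if "norm v \<le> \<eta>" for v :: 'e
   using mult_left_le_one_le[of "norm v" "\<rho> t"] \<rho>(3) that by (simp add: order_trans)
  moreover have "norm (\<rho>' t *\<^sub>R (P t - mp c (q t))) \<le> M * \<eta>"
   using P(4)[OF t] M(2)[OF t] by (auto simp: dist_norm intro!: mult_mono)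
  ultimately show ?thesis using P(4)[OF t] unfolding dist_norm by (auto intro!: order_trans[OF norm_triangle_ineq] add_mono)
 qed
 have good: "Y t \<in> rng c \<and> Fc c (Y t, Y' t) \<le> speed q t + \<epsilon>" if t: "t \<in> {a..b}" for t
  using r(2)[OF t, of "Y t" "Y' t"] near[OF t] \<eta>(2) by (simp add: algebra_simps)
 have Yr: "Y t \<in> rng c" if "t \<in> J" for t using good[of t] off[of t] dJ[OF that] by (cases "t \<in> {a..b}") auto
 have Yd: "(Y hvd Y' t) (at t)" if "t \<in> J" for t
  unfolding Y_def Y'_def using C1_coords_hvd[OF q(1) c dJ[OF that]] P(2)[of t] d\<rho>[of t]
  by (auto intro!: derivative_eq_intros simp: has_real_derivative_iff_has_vector_derivative algebra_simps)
 have Yc: "cont J Y'" unfolding Y'_def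
  by (intro cont_add cont_scaleR cont_diff cont_const
    cont_subset[OF cont_coords[OF C1_cont[OF q(1)] c]] cont_subset[OF C1_cont_velocity[OF q(1) c]]
    cont_subset[OF smooth_cont[OF \<rho>(1)]] cont_subset[OF c\<rho>']
    cont_subset[OF smooth_cont[OF P(1)]] cont_subset[OF smooth_cont[OF P(3)]]) (use dJ in auto)
 let ?W = "modified u c J Y q"
 have oJ: "open J" by (simp add: J_def)
 have Yo: "Y t = mp c (q t)" if "t \<in> J - {a..b}" for t using off that by blast
 have W: "C1_curve A ?W" by (rule modified_C1(1)[OF ab(1,2) q c oJ dJ ab(3) Yd Yc Yo Yr])
 have le: "speed ?W t \<le> speed q t + \<epsilon>" if t: "t \<in> {u<..<u+1}" for t
 proof (cases "t \<in> {a..b}")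
  case True
  then have tJ: "t \<in> J \<inter> {u<..<u+1}" using t ab(3) by blast
  have "?W t = iv c (Y t) \<and> velocity A ?W t c = Y' t"
   by (rule modified_C1(2)[OF ab(1,2) q c oJ dJ ab(3) Yd Yc Yo Yr tJ])
  then have "speed ?W t = Fc c (Y t, Y' t)" using speed_chart[OF W c, of t] chart_inv_in[OF Yr] map_chart_inv[OF Yr] tJ by simp
  then show ?thesis using good[OF True] by simp
 next
  case False
  then have "?W t = q t \<and> velocity A ?W t = velocity A q t"
   using modified_C1(3)[OF ab(1,2) q c oJ dJ ab(3) Yd Yc Yo Yr, of t] t by blast
  then show ?thesis using \<epsilon> by (simp add: speed_def)
 qed
 have per: "len \<sigma> = integral {u<..<u+1} (speed \<sigma>)" if "C1_curve A \<sigma>" "periodic \<sigma>" for \<sigma>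
  unfolding finsler_length_speed integral_open_interval_real[of u "u + 1", symmetric] by (rule integral_period[OF speed_continuous speed_periodic, symmetric]) fact+
 have int: "speed \<sigma> integrable_on {u<..<u+1}" if "C1_curve A \<sigma>" for \<sigma> unfolding integrable_on_open_interval_real
  by (rule integrable_cont[OF cont_subset[OF speed_continuous[OF that] subset_UNIV]])
 have k\<epsilon>: "(\<lambda>t. \<epsilon>) integrable_on {u<..<u+1}" "integral {u<..<u+1} (\<lambda>t. \<epsilon>) = \<epsilon>"
  unfolding integrable_on_open_interval_real integral_open_interval_real[symmetric] using integrable_const_ivl[of \<epsilon> u "u + 1"] by auto
 have "len ?W = integral {u<..<u+1} (speed ?W)" by (rule per[OF W]) (simp add: modified_def wrap_periodic)
 also have "\<dots> \<le> integral {u<..<u+1} (\<lambda>t. speed q t + \<epsilon>)"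
  by (intro integral_le int W integrable_add q le k\<epsilon>(1))
 also have "\<dots> = len q + \<epsilon>" unfolding per[OF q] integral_add[OF int[OF q(1)] k\<epsilon>(1)] k\<epsilon>(2) ..
 finally have "len ?W \<le> len q + \<epsilon>" .
 moreover have "dist (Y t) (mp c (q t)) < \<epsilon>" for t
  using near[of t] off[of t] \<eta>(3) \<epsilon> by (cases "t \<in> {a..b}") auto
 moreover have "smooth_curve_at ?W t" if "smooth_curve_at q t" for t unfolding Y_def
  by (rule modified_smooth(1)[OF ab(1,2) C1_cont[OF q(1)] q(2) c oJ dJ ab(3) \<rho>(1) \<rho>0 P(1) Yr[unfolded Y_def] that])
 moreover have "ball t0 e \<subseteq> J \<inter> {u..<u+1}" using e by (auto simp: u_def J_def dist_real_def)
 then have "smooth_curve_at ?W t" if "t \<in> ball t0 e" for t unfolding Y_def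
  by (intro modified_smooth(2)[OF ab(1,2) C1_cont[OF q(1)] q(2) c oJ dJ ab(3) \<rho>(1) \<rho>0 P(1) Yr[unfolded Y_def] open_ball _ _ that]) (use \<rho>1 in auto)
 ultimately show ?thesis using W off unfolding u_def J_def a_def b_def by (intro exI[of _ Y] conjI exI refl) auto
qed

text \<open>The infimum over smooth loops bounds the length of every C1 loop of the class from below, since smoothing in finitely many windows preserves the class and lengthens the loop arbitrarily little.\<close>

theorem min_length_le:
 assumes \<alpha>: "\<alpha> \<in> free_homotopy_classes A" and q: "C1_curve A q" "q \<in> \<alpha>"
 shows "min_length A F \<alpha> \<le> len q"
proof (rule field_le_epsilon)
 fix \<eta> :: real assume \<eta>: "\<eta> > 0"
 have ql: "q \<in> loops A" and qp: "periodic q" using free_homotopy_class_loops[OF \<alpha> q(2)] by (auto simp: loops_def)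
 have qc: "rcont MT q" by (rule C1_cont[OF q(1)])
 let ?P = "\<lambda>T. \<exists>W. conv sequentially W q \<and> (\<forall>\<epsilon>>0. \<forall>\<^sub>F n in sequentially. len (W n) \<le> len q + \<epsilon>) \<and>
  (\<forall>\<^sub>F n in sequentially. C1_curve A (W n) \<and> periodic (W n) \<and> (\<forall>t\<in>T. smooth_curve_at (W n) t))"
 have "\<exists>T. {0..1} \<subseteq> T \<and> ?P T"
 proof (rule compact_open_induct[OF compact_Icc])
  have "conv sequentially (\<lambda>n. q) q" by (rule conv_const[OF qc])
  then show "?P {}" using q(1) qp by (intro exI[of _ "\<lambda>n. q"]) auto
 next
  fix t0 :: real
  obtain c e where c: "c \<in> A" and e: "e > 0" "e < 1/8" and dom: "\<And>t. t \<in> cball t0 (3 * e) ==> q t \<in> dm c"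
   using chart_window[OF qc, of t0] by blast
  let ?J = "ball t0 (3 * e)" and ?u = "t0 - 1/2"
  have ab: "?u < t0 - 2 * e" "t0 + 2 * e < ?u + 1" "{t0 - 2 * e..t0 + 2 * e} \<subseteq> ?J" using e by (auto simp: dist_real_def)
  have "?P (ball t0 e \<union> T)" if PT: "?P T" for T
  proof -
   obtain W where W: "conv sequentially W q" "\<forall>\<epsilon>>0. \<forall>\<^sub>F n in sequentially. len (W n) \<le> len q + \<epsilon>"
    "\<forall>\<^sub>F n in sequentially. C1_curve A (W n) \<and> periodic (W n) \<and> (\<forall>t\<in>T. smooth_curve_at (W n) t)" using PT by (elim exE conjE)
   have near: "\<forall>\<^sub>F n in sequentially. \<forall>t\<in>cball t0 (3 * e). W n t \<in> dm c \<and> dist (mp c (W n t)) (mp c (q t)) < \<epsilon>" if "\<epsilon> > 0" for \<epsilon>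
    by (rule conv_compact[OF W(1) qc c compact_cball dom that])
   define good where "good n \<longleftrightarrow> C1_curve A (W n) \<and> periodic (W n) \<and> (\<forall>t\<in>?J. W n t \<in> dm c)" for n
   have good: "\<forall>\<^sub>F n in sequentially. good n" using W(3) near[OF zero_less_one] by eventually_elim (auto simp: good_def)
   have ex: "\<exists>Y. good n --> (\<forall>t. t \<notin> {t0 - 2 * e..t0 + 2 * e} --> Y t = mp c (W n t)) \<and>
    (\<forall>t\<in>?J. dist (Y t) (mp c (W n t)) < 1 / real (Suc n)) \<and>
    (\<exists>W'. W' = modified ?u c ?J Y (W n) \<and> C1_curve A W' \<and> len W' \<le> len (W n) + 1 / real (Suc n) \<and>
     (\<forall>t. smooth_curve_at (W n) t \<or> t \<in> ball t0 e --> smooth_curve_at W' t))" for n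
   proof (cases "good n")
    case True
    then have g: "C1_curve A (W n)" "periodic (W n)" "\<And>t. t \<in> ?J ==> W n t \<in> dm c" by (auto simp: good_def)
    show ?thesis using smoothing_window[where ?t0.0 = t0 and \<epsilon> = "1 / real (Suc n)", OF g(1,2) c e g(3)] by simp
   qed simp
   from choice[OF allI[OF ex]] obtain Y where Y: "\<forall>n. good n --> (\<forall>t. t \<notin> {t0 - 2 * e..t0 + 2 * e} --> Y n t = mp c (W n t)) \<and>
    (\<forall>t\<in>?J. dist (Y n t) (mp c (W n t)) < 1 / real (Suc n)) \<and>
    (\<exists>W'. W' = modified ?u c ?J (Y n) (W n) \<and> C1_curve A W' \<and> len W' \<le> len (W n) + 1 / real (Suc n) \<and>
     (\<forall>t. smooth_curve_at (W n) t \<or> t \<in> ball t0 e --> smooth_curve_at W' t))" ..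
   let ?W' = "\<lambda>n. modified ?u c ?J (Y n) (W n)"
   have Y1: "\<And>t. t \<notin> {t0 - 2 * e..t0 + 2 * e} ==> Y n t = mp c (W n t)" and Y2: "\<And>t. t \<in> ?J ==> dist (Y n t) (mp c (W n t)) < 1 / real (Suc n)"
    and Y3: "C1_curve A (?W' n)" "len (?W' n) \<le> len (W n) + 1 / real (Suc n)"
     "\<And>t. smooth_curve_at (W n) t \<or> t \<in> ball t0 e ==> smooth_curve_at (?W' n) t" if "good n" for n
    using Y that by blast+
   have small: "\<forall>\<^sub>F n in sequentially. 1 / real (Suc n) < \<epsilon>" if "\<epsilon> > 0" for \<epsilon>
    using order_tendstoD(2)[OF LIMSEQ_inverse_real_of_nat that] by (simp add: inverse_eq_divide)
   have "conv sequentially ?W' q"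
   proof (rule modified_conv[OF ab(1,2) W(1) ql c open_ball _ ab(3)])
    show "q t \<in> dm c" if "t \<in> ?J" for t using dom that by simp
    show "\<forall>\<^sub>F n in sequentially. periodic (W n) \<and> (\<forall>t\<in>?J. W n t \<in> dm c) \<and> (\<forall>t. t \<notin> {t0 - 2 * e..t0 + 2 * e} --> Y n t = mp c (W n t))"
     by (rule eventually_mono[OF good]) (use Y1 in \<open>auto simp: good_def\<close>)
    fix \<epsilon> :: real assume "\<epsilon> > 0"
    then have "\<epsilon> / 2 > 0" by simp
    show "\<forall>\<^sub>F n in sequentially. \<forall>t\<in>?J. dist (Y n t) (mp c (q t)) < \<epsilon>" using good near[OF \<open>\<epsilon> / 2 > 0\<close>] small[OF \<open>\<epsilon> / 2 > 0\<close>]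
    proof eventually_elim
     case (elim n)
     show ?case
     proof
      fix t assume t: "t \<in> ?J"
      have "dist (Y n t) (mp c (W n t)) < \<epsilon> / 2" "dist (mp c (W n t)) (mp c (q t)) < \<epsilon> / 2"
       using Y2[OF elim(1) t] elim(2,3) t by auto
      then show "dist (Y n t) (mp c (q t)) < \<epsilon>"
       using dist_triangle[of "Y n t" "mp c (q t)" "mp c (W n t)"] by linarith
     qed
    qed
   qed
   moreover have "\<forall>\<^sub>F n in sequentially. len (?W' n) \<le> len q + \<epsilon>" if "\<epsilon> > 0" for \<epsilon>
   proof -
    have "\<epsilon> / 2 > 0" using that by simp
    show ?thesis using good small[OF \<open>\<epsilon> / 2 > 0\<close>] W(2)[rule_format, OF \<open>\<epsilon> / 2 > 0\<close>]
    proof eventually_elim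
     case (elim n)
     then show ?case using Y3(2)[of n] by linarith
    qed
   qed
   moreover have "\<forall>\<^sub>F n in sequentially. C1_curve A (?W' n) \<and> periodic (?W' n) \<and> (\<forall>t\<in>ball t0 e \<union> T. smooth_curve_at (?W' n) t)"
    using good W(3)
   proof eventually_elim
    case (elim n)
    have "periodic (?W' n)" by (simp only: modified_def wrap_periodic)
    then show ?case using Y3(1,3)[OF elim(1)] elim(2) by blast
   qed
   ultimately show ?thesis by (intro exI[of _ ?W']) blast
  qed
  then show "\<exists>U. open U \<and> t0 \<in> U \<and> (\<forall>T. ?P T --> ?P (U \<union> T))" using e(1) by (intro exI[of _ "ball t0 e"]) auto
 qed
 then obtain T W where T: "{0..1} \<subseteq> T" and W: "conv sequentially W q" "\<forall>\<epsilon>>0. \<forall>\<^sub>F n in sequentially. len (W n) \<le> len q + \<epsilon>"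
  "\<forall>\<^sub>F n in sequentially. C1_curve A (W n) \<and> periodic (W n) \<and> (\<forall>t\<in>T. smooth_curve_at (W n) t)" by (elim exE conjE)
 have "\<forall>\<^sub>F n in sequentially. W n \<in> loops A" by (rule eventually_mono[OF W(3)]) (simp add: loops_def C1_cont)
 from conv_eventually_homotopic[OF W(1) ql this] W(3) W(2)[rule_format, OF \<eta>]
 have "\<forall>\<^sub>F n in sequentially. homotopic_loops (W n) q \<and> periodic (W n) \<and> (\<forall>t\<in>T. smooth_curve_at (W n) t) \<and> len (W n) \<le> len q + \<eta>"
  by eventually_elim blast
 then obtain n where n: "homotopic_loops (W n) q" "periodic (W n)" "\<And>t. t \<in> T ==> smooth_curve_at (W n) t" "len (W n) \<le> len q + \<eta>"
  using eventually_happens'[OF sequentially_bot] by blast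
 have "smooth_curve_at (W n) t" for t
 proof -
  have "t - of_int \<lfloor>t\<rfloor> \<in> {0..1}" by simp linarith
  then have "smooth_curve_at (W n) (t - of_int \<lfloor>t\<rfloor> - of_int (- \<lfloor>t\<rfloor>))" by (intro smooth_curve_at_shift n(2,3) subsetD[OF T]) simp_all
  then show ?thesis by simp
 qed
 then have "W n \<in> smooth_loops A" using smooth_curveI n(2) by (simp add: smooth_loops_def)
 moreover have "W n \<in> \<alpha>" using free_homotopy_class_iff[OF \<alpha> q(2)] homotopic_loops_sym[OF n(1)] by blast
 moreover have "bdd_below (len ` (smooth_loops A \<inter> \<alpha>))"
  using finsler_length_nonneg smooth_curve_imp_C1 by (intro bdd_belowI2[of _ 0]) (auto simp: smooth_loops_def)
 ultimately have "min_length A F \<alpha> \<le> len (W n)" unfolding min_length_def by (simp only: cINF_lower Int_iff)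
 then show "min_length A F \<alpha> \<le> len q + \<eta>" using n(4) by linarith
qed

end

section \<open>Near-minimizers\<close>

lemma square_integral_le:
 fixes f :: "real => real"
 assumes "cont {u..u+1} f"
 shows "(integral {u..u+1} f)\<^sup>2 \<le> integral {u..u+1} (\<lambda>t. (f t)\<^sup>2)"
proof -
 let ?m = "integral {u..u+1} f"
 have i: "(f has_integral ?m) {u..u+1}" by (rule integrable_integral[OF integrable_cont[OF assms]])
 have i2: "((\<lambda>t. (f t)\<^sup>2) has_integral integral {u..u+1} (\<lambda>t. (f t)\<^sup>2)) {u..u+1}"
  by (rule integrable_integral[OF integrable_cont[OF continuous_on_power[OF assms]]])
 have i3: "((\<lambda>t. ?m\<^sup>2) has_integral ?m\<^sup>2) {u..u+1}" using has_integral_const_real[of "?m\<^sup>2" u "u + 1"] by simp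
 have "((\<lambda>t. (f t)\<^sup>2 - 2 * ?m * f t + ?m\<^sup>2) has_integral integral {u..u+1} (\<lambda>t. (f t)\<^sup>2) - 2 * ?m * ?m + ?m\<^sup>2) {u..u+1}"
  by (intro has_integral_add has_integral_diff i2 i3 has_integral_mult_right[OF i])
 moreover have "(f t)\<^sup>2 - 2 * ?m * f t + ?m\<^sup>2 = (f t - ?m)\<^sup>2" for t by (simp add: power2_diff)
 ultimately have "((\<lambda>t. (f t - ?m)\<^sup>2) has_integral integral {u..u+1} (\<lambda>t. (f t)\<^sup>2) - 2 * ?m * ?m + ?m\<^sup>2) {u..u+1}" by simp
 then have "0 \<le> integral {u..u+1} (\<lambda>t. (f t)\<^sup>2) - 2 * ?m * ?m + ?m\<^sup>2" by (rule has_integral_nonneg) simp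
 then show ?thesis by (simp add: power2_eq_square)
qed

text \<open>A variation that vanishes to first order at both ends of an interval is continuously differentiable after extension by zero.\<close>

lemma extension_by_zero:
 fixes \<xi> :: "real => 'b::euclidean_space"
 assumes ab: "a \<le> b" and d: "\<And>t. t \<in> {a..b} ==> (\<xi> hvd \<xi>' t) (at t within {a..b})"
  and c: "cont {a..b} \<xi>'" and 0: "\<xi> a = 0" "\<xi> b = 0" "\<xi>' a = 0" "\<xi>' b = 0"
 obtains Z Z' where "\<And>t. (Z hvd Z' t) (at t)" "cont UNIV Z'"
  "\<And>t. t \<in> {a..b} ==> Z t = \<xi> t \<and> Z' t = \<xi>' t" "\<And>t. t \<notin> {a..b} ==> Z t = 0"
proof -
 define Z' where "Z' t = \<xi>' (max a (min b t))" for t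
 have cZ': "cont UNIV Z'" unfolding Z'_def
  by (rule cont_compose[OF c]) (use ab in \<open>auto intro!: continuous_intros\<close>)
 obtain Z0 where Z0: "\<And>t. (Z0 hvd Z' t) (at t)" using antiderivative_on_reals[OF cZ'] by blast
 define Z where "Z t = Z0 t - Z0 a" for t
 have Z: "(Z hvd Z' t) (at t)" for t unfolding Z_def using Z0[of t] by (auto intro!: derivative_eq_intros)
 have in1: "Z' t = \<xi>' t" if "t \<in> {a..b}" for t
 proof -
  have "max a (min b t) = t" using that by auto
  then show ?thesis by (simp add: Z'_def)
 qed
 have in2: "Z t = \<xi> t" if t: "t \<in> {a..b}" for t
 proof -
  have "(Z' has_integral Z t - Z a) {a..t}" by (rule integral_antiderivative[OF Z]) (use t in auto)
  moreover have "(\<xi>' has_integral \<xi> t - \<xi> a) {a..t}"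
  proof (rule fund_thm)
   show "(\<xi> hvd \<xi>' s) (at s within {a..t})" if "s \<in> {a..t}" for s
    by (rule has_vector_derivative_within_subset[OF d]) (use t that in auto)
  qed (use t in auto)
  then have "(Z' has_integral \<xi> t - \<xi> a) {a..t}" by (rule has_integral_eq[rotated]) (use in1 t in auto)
  ultimately have "Z t - Z a = \<xi> t - \<xi> a" by (rule has_integral_unique)
  then show ?thesis using 0 by (simp add: Z_def)
 qed
 have out: "Z t = 0" if "t \<notin> {a..b}" for t
 proof (cases "t < a")
  case True
  have "(Z' has_integral Z a - Z t) {t..a}" by (rule integral_antiderivative[OF Z]) (use True in auto)
  moreover have "(Z' has_integral 0) {t..a}"
   by (rule has_integral_is_0) (use ab 0 in \<open>auto simp: Z'_def max_def min_def\<close>)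
  ultimately have "Z a - Z t = 0" by (rule has_integral_unique)
  then show ?thesis by (simp add: Z_def)
 next
  case False
  then have t: "b < t" using that by auto
  have "(Z' has_integral Z t - Z b) {b..t}" by (rule integral_antiderivative[OF Z]) (use t in auto)
  moreover have "(Z' has_integral 0) {b..t}"
   by (rule has_integral_is_0) (use ab 0 in \<open>auto simp: Z'_def max_def min_def\<close>)
  ultimately have "Z t - Z b = 0" by (rule has_integral_unique)
  then show ?thesis using in2[of b] ab 0 by simp
 qed
 show ?thesis by (rule that[OF Z cZ']) (use in1 in2 out in auto)
qed

lemma (in atlas_locale) C1_reparametrization:
 assumes q: "C1_curve A q" and T: "\<And>t. (T hrd T' t) (at t)" "cont UNIV T'"
 shows "C1_curve A (\<lambda>t. q (T t))" "velocity A (\<lambda>t. q (T t)) t = (\<lambda>c. T' t *\<^sub>R velocity A q (T t) c)"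
proof -
 have cT: "cont UNIV T" using T(1) DERIV_isCont cont_at_imp by blast
 have der: "((\<lambda>t. mp c (q (T t))) hvd T' t *\<^sub>R velocity A q (T t) c) (at t)"
  if "c \<in> A" "q (T t) \<in> dm c" for c t
  using vector_diff_chain_at[OF T(1)[unfolded has_real_derivative_iff_has_vector_derivative] C1_coords_hvd[OF q that]]
  by (simp add: o_def)
 show C: "C1_curve A (\<lambda>t. q (T t))"
 proof (rule C1_curveI)
  fix t0
  obtain c where c: "c \<in> A" "q (T t0) \<in> dm c"
   using curve_in_points[OF C1_cont[OF q], of "T t0"] unfolding points_def by blast
  let ?O = "{t. q t \<in> dm c}"
  have "open (T -` ?O)" using open_vimage[OF open_curve_dom[OF C1_cont[OF q] c(1)] cT] .
  then obtain e where e: "e > 0" "ball t0 e \<subseteq> T -` ?O" using c(2) open_contains_ball by blast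
  have "cont (ball t0 e) (\<lambda>t. T' t *\<^sub>R velocity A q (T t) c)"
   by (intro cont_scaleR cont_subset[OF T(2)] cont_compose[OF C1_cont_velocity[OF q c(1)] cont_subset[OF cT]])
    (use e in auto)
  then show "\<exists>c\<in>A. \<exists>e>0. \<exists>g. (\<forall>t\<in>ball t0 e. q (T t) \<in> dm c \<and>
   ((\<lambda>t. mp c (q (T t))) hvd g t) (at t)) \<and> cont (ball t0 e) g"
   by (intro bexI[OF _ c(1)] exI[of _ e] exI[of _ "\<lambda>t. T' t *\<^sub>R velocity A q (T t) c"] conjI e(1) ballI der[OF c(1)])
    (use e in auto)
 qed
 show "velocity A (\<lambda>t. q (T t)) t = (\<lambda>c. T' t *\<^sub>R velocity A q (T t) c)"
 proof (rule ext)
  fix c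
  show "velocity A (\<lambda>t. q (T t)) t c = T' t *\<^sub>R velocity A q (T t) c"
  proof (cases "c \<in> charts_at A (q (T t))")
   case True
   show ?thesis by (rule velocity_eqI) (use True der in \<open>auto simp: charts_at_iff\<close>)
  next
   case False
   then show ?thesis by (simp add: velocity_def)
  qed
 qed
qed

lemma (in atlas_locale) reparametrization_homotopic:
 assumes q: "q \<in> loops A" and T: "cont UNIV T" "\<And>t. T (t + 1) = T t + 1"
 shows "homotopic_loops q (\<lambda>t. q (T t))"
proof -
 have qc: "rcont MT q" and qp: "\<And>t. q (t + 1) = q t" using q by (auto simp: loops_def periodic_def)
 let ?k = "\<lambda>p. (1 - fst p) * snd p + fst p * T (snd p)"
 have "cont ({0..1} \<times> UNIV) ?k"
  by (intro continuous_intros cont_compose[OF T(1)]) auto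
 then have "continuous_map (top_of_set ({0..1} \<times> UNIV)) euclideanreal ?k" by simp
 then have "continuous_map (top_of_set ({0..1} \<times> UNIV)) MT (q \<circ> ?k)"
  by (rule continuous_map_compose[OF _ qc])
 moreover have top: "prod_topology (top_of_set {0..1 :: real}) euclideanreal = top_of_set ({0..1} \<times> (UNIV :: real set))"
  using prod_topology_subtopology_eu[of "{0..1 :: real}" "UNIV :: real set"] by simp
 moreover have "periodic (\<lambda>t. (q \<circ> ?k) (s, t))" for s
 proof -
  have "(1 - s) * (t + 1) + s * T (t + 1) = ((1 - s) * t + s * T t) + 1" for t unfolding T(2) by (simp add: algebra_simps)
  then show ?thesis using qp by (simp add: periodic_def)
 qed
 ultimately show ?thesis unfolding homotopic_loops_def homotopic_with_def top
  by (intro exI[of _ "q \<circ> ?k"]) auto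
qed

context finsler
begin

text \<open>The speed plus a small constant is positive, so its normalized integral is a C1 diffeomorphism of the circle; its inverse reparametrizes the loop so that its speed is bounded by that integral. The constant makes this work where the curve stands still.\<close>

lemma reparametrize:
 assumes q: "C1_curve A q" "q \<in> loops A" and \<epsilon>: "\<epsilon> > 0"
 shows "\<exists>W. C1_curve A W \<and> homotopic_loops q W \<and> (\<forall>t. speed W t \<le> len q + \<epsilon>)"
proof -
 have qp: "periodic q" using q(2) by (simp add: loops_def)
 define g where "g t = speed q t + \<epsilon>" for t
 have g: "g t > 0" for t using speed_nonneg[OF q(1), of t] \<epsilon> by (simp add: g_def)
 have cg: "cont UNIV g" unfolding g_def by (intro cont_add cont_const speed_continuous q(1))
 have pg: "periodic g" using speed_periodic[OF qp] by (simp add: periodic_def g_def)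
 define \<Lambda> where "\<Lambda> = integral {0..1} g"
 have \<Lambda>: "\<Lambda> = len q + \<epsilon>"
  unfolding finsler_length_speed \<Lambda>_def g_def
  by (subst integral_add) (auto intro!: integrable_cont cont_subset[OF speed_continuous[OF q(1)]])
 have \<Lambda>0: "\<Lambda> > 0" using finsler_length_nonneg[OF q(1)] \<epsilon> by (simp add: \<Lambda>)
 obtain G where G: "\<And>t. (G hvd g t) (at t)" using antiderivative_on_reals[OF cg] by blast
 define S where "S t = G t / \<Lambda>" for t
 have S': "(S hrd g t / \<Lambda>) (at t)" for t
  unfolding S_def using G[of t] by (intro DERIV_cdivide) (simp add: has_real_derivative_iff_has_vector_derivative)
 have S1: "S (t + 1) = S t + 1" for t
  using periodic_antiderivative[OF G pg, of t] \<Lambda>0 by (simp add: S_def \<Lambda>_def[symmetric] field_simps)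
 have Smono: "S s < S t" if "s < t" for s t
  by (rule DERIV_pos_imp_increasing[OF that]) (use S' g \<Lambda>0 in \<open>auto intro!: exI[of _ "g _ / \<Lambda>"]\<close>)
 have Sinj: "S s = S t \<longleftrightarrow> s = t" for s t using Smono by (metis less_irrefl linorder_neqE_linordered_idom)
 have Sc: "isCont S t" for t using S' DERIV_isCont by blast
 have Sn: "S (t + real k) = S t + real k" for t k
 proof (induction k)
  case (Suc k)
  have "t + real (Suc k) = (t + real k) + 1" by simp
  then have "S (t + real (Suc k)) = S (t + real k) + 1" by (simp only: S1)
  then show ?case using Suc by simp
 qed simp
 have Ssurj: "\<exists>t. S t = y" for y
 proof -
  obtain k :: nat where k: "real k > \<bar>y - S 0\<bar>" using reals_Archimedean2 by blast
  have "S (- real k) \<le> y" "y \<le> S (real k)" using Sn[of "- real k" k] Sn[of 0 k] k by auto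
  then show ?thesis using IVT[of S "- real k" y "real k"] Sc by auto
 qed
 define T where "T y = (SOME t. S t = y)" for y
 have ST: "S (T y) = y" for y unfolding T_def by (rule someI_ex[OF Ssurj])
 have TS: "T (S t) = t" for t using ST[of "S t"] Sinj by blast
 have T1: "T (y + 1) = T y + 1" for y using TS[of "T y + 1"] by (simp add: S1 ST)
 have Tc: "isCont T y" for y
 proof -
  have "isCont T (S (T y))"
   by (rule isCont_inverse_function2[of "T y - 1" "T y" "T y + 1"]) (use TS Sc in auto)
  then show ?thesis by (simp add: ST)
 qed
 define T' where "T' y = inverse (g (T y) / \<Lambda>)" for y
 have T': "(T hrd T' y) (at y)" for y
  unfolding T'_def
  by (rule DERIV_inverse_function[where f = S and a = "y - 1" and b = "y + 1", OF S']) (use g[of "T y"] \<Lambda>0 ST Tc in auto)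
 have cT: "cont UNIV T" using Tc by (simp add: cont_at_imp)
 have cT': "cont UNIV T'" unfolding T'_def
  by (intro continuous_on_inverse continuous_on_divide cont_const cont_compose[OF cg cT])
   (use g \<Lambda>0 in \<open>auto simp: less_le\<close>)
 show ?thesis
 proof (intro exI[of _ "\<lambda>t. q (T t)"] conjI allI)
  show C: "C1_curve A (\<lambda>t. q (T t))" by (rule C1_reparametrization(1)[OF q(1) T' cT'])
  show "homotopic_loops q (\<lambda>t. q (T t))" by (rule reparametrization_homotopic[OF q(2) cT T1])
  fix t
  obtain c where c: "c \<in> A" "q (T t) \<in> dm c" using chart_at_curve[OF C1_cont[OF q(1)]] .
  have T'0: "T' t > 0" using g \<Lambda>0 by (simp add: T'_def)
  have "speed (\<lambda>t. q (T t)) t = T' t * speed q (T t)"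
   using speed_chart[OF C c(1), of t] speed_chart[OF q(1) c] c Fc_scale[OF c(1) _ T'0]
    C1_reparametrization(2)[OF q(1) T' cT', of t] by simp
  also have "\<dots> \<le> T' t * g (T t)" using T'0 \<epsilon> by (intro mult_left_mono) (auto simp: g_def)
  also have "\<dots> = \<Lambda>" using g[of "T t"] \<Lambda>0 by (simp add: T'_def field_simps)
  finally show "speed (\<lambda>t. q (T t)) t \<le> len q + \<epsilon>" using \<Lambda> by simp
 qed
qed

text \<open>By the inequality of Cauchy and Schwarz the energy of the varied loop is at least half its squared length, hence at least half the squared minimal length. The loop itself almost attains this bound because its speed is bounded by almost the minimal length, and the variation changes the energy only over [a, b].\<close>

lemma energy_near_minimality:
 assumes \<alpha>: "\<alpha> \<in> free_homotopy_classes A" and q: "C1_curve A q" "q \<in> \<alpha>"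
  and bd: "\<And>t. speed q t \<le> min_length A F \<alpha> + \<epsilon>" and l0: "min_length A F \<alpha> \<ge> 0" and \<epsilon>: "\<epsilon> \<ge> 0"
  and c: "c \<in> A" and ab: "a < b" "b < a + 1" and dom: "\<And>t. t \<in> {a..b} ==> q t \<in> dm c"
  and K: "\<And>t. t \<in> {a..b} ==> cball (mp c (q t)) \<rho> \<subseteq> rng c"
  and \<xi>: "\<And>t. t \<in> {a..b} ==> (\<xi> hvd \<xi>' t) (at t within {a..b})" "cont {a..b} \<xi>'"
   "\<xi> a = 0" "\<xi> b = 0" "\<xi>' a = 0" "\<xi>' b = 0" "\<And>t. t \<in> {a..b} ==> norm (\<xi> t) \<le> \<rho>"
 shows "integral {a..b} (\<lambda>t. Lc c (mp c (q t), velocity A q t c)) - ((min_length A F \<alpha> + \<epsilon>)\<^sup>2 - (min_length A F \<alpha>)\<^sup>2) / 2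
  \<le> integral {a..b} (\<lambda>t. Lc c (mp c (q t) + \<xi> t, velocity A q t c + \<xi>' t))"
proof -
 let ?l = "min_length A F \<alpha>"
 have ql: "q \<in> loops A" and qc: "rcont MT q" and qp: "periodic q"
  using free_homotopy_class_loops[OF \<alpha> q(2)] by (auto simp: loops_def)
 obtain Z Z' where Z: "\<And>t. (Z hvd Z' t) (at t)" "cont UNIV Z'"
  "\<And>t. t \<in> {a..b} ==> Z t = \<xi> t \<and> Z' t = \<xi>' t" "\<And>t. t \<notin> {a..b} ==> Z t = 0"
  by (rule extension_by_zero[OF less_imp_le[OF ab(1)] \<xi>(1-6)]) (assumption, blast)
 have cZ: "cont UNIV Z" by (rule hvd_cont[OF hvd_within[OF Z(1)]])
 define u where "u = (a + b - 1) / 2"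
 have u: "u < a" "b < u + 1" using ab unfolding u_def by (simp_all add: field_simps)
 define J where "J = {t. q t \<in> dm c}"
 have J: "open J" "\<And>t. t \<in> J ==> q t \<in> dm c" "{a..b} \<subseteq> J"
  unfolding J_def using open_curve_dom[OF qc c] dom by auto
 define Y where "Y t = mp c (q t) + Z t" for t
 define Y' where "Y' t = velocity A q t c + Z' t" for t
 have Yd: "(Y hvd Y' t) (at t)" if "t \<in> J" for t
  unfolding Y_def Y'_def by (intro has_vector_derivative_add C1_coords_hvd[OF q(1) c] Z(1) J(2) that)
 have Yc: "cont J Y'" unfolding Y'_def J_def
  by (intro cont_add C1_cont_velocity[OF q(1) c] cont_subset[OF Z(2)]) auto
 have Yc0: "cont J Y" by (rule hvd_cont[OF hvd_within[OF Yd]])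
 have Yo: "Y t = mp c (q t)" if "t \<in> J - {a..b}" for t using Z(4) that by (simp add: Y_def)
 have Yseg: "(1 - s) *\<^sub>R mp c (q t) + s *\<^sub>R Y t \<in> rng c" if t: "t \<in> J" and s: "s \<in> {0..1}" for t s
 proof (cases "t \<in> {a..b}")
  case True
  have "s * norm (Z t) \<le> 1 * norm (Z t)" by (rule mult_right_mono) (use s in auto)
  then have "norm (s *\<^sub>R Z t) \<le> \<rho>" using s \<xi>(7)[OF True] Z(3)[OF True] by simp
  moreover have "(1 - s) *\<^sub>R mp c (q t) + s *\<^sub>R Y t = mp c (q t) + s *\<^sub>R Z t"
   by (simp add: Y_def algebra_simps)
  ultimately have "(1 - s) *\<^sub>R mp c (q t) + s *\<^sub>R Y t \<in> cball (mp c (q t)) \<rho>" by (simp add: dist_norm)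
  then show ?thesis using K[OF True] by blast
 next
  case False
  then have "Y t = mp c (q t)" using Yo t by blast
  then show ?thesis using J(2)[OF t] by (simp flip: scaleR_left.add)
 qed
 have Yr: "Y t \<in> rng c" if "t \<in> J" for t using Yseg[OF that, of 1] by simp
 define W where "W = modified u c J Y q"
 have hom: "homotopic_loops q W" unfolding W_def
  by (rule modified_homotopic[OF u ql c J Yc0 Yo Yseg])
 have WC: "C1_curve A W" unfolding W_def by (rule modified_C1(1)[OF u q(1) qp c J Yd Yc Yo Yr])
 have mC2: "W t = iv c (Y t) \<and> velocity A W t c = Y' t" if "t \<in> J \<inter> {u<..<u+1}" for t
  unfolding W_def by (rule modified_C1(2)[OF u q(1) qp c J Yd Yc Yo Yr that])
 have mC3: "W t = q t \<and> velocity A W t = velocity A q t" if "t \<in> {u<..<u+1} - {a..b}" for t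
  unfolding W_def by (rule modified_C1(3)[OF u q(1) qp c J Yd Yc Yo Yr that])
 have W\<alpha>: "W \<in> \<alpha>" using free_homotopy_class_iff[OF \<alpha> q(2)] hom by blast
 have Wp: "periodic W" using free_homotopy_class_loops[OF \<alpha> W\<alpha>] by (simp add: loops_def)
 have csp: "cont S (\<lambda>t. (speed \<eta> t)\<^sup>2)" if "C1_curve A \<eta>" for \<eta> S
  by (intro continuous_on_power cont_subset[OF speed_continuous[OF that]]) auto
 have per: "integral {u..u+1} (speed W) = len W"
  unfolding finsler_length_speed by (rule integral_period[OF speed_continuous[OF WC] speed_periodic[OF Wp]])
 have "?l \<le> integral {u..u+1} (speed W)" unfolding per by (rule min_length_le[OF \<alpha> WC W\<alpha>])
 then have "?l\<^sup>2 \<le> (integral {u..u+1} (speed W))\<^sup>2" using l0 by (intro power_mono) auto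
 also have "\<dots> \<le> integral {u..u+1} (\<lambda>t. (speed W t)\<^sup>2)"
  by (rule square_integral_le[OF cont_subset[OF speed_continuous[OF WC]]]) simp
 finally have low: "?l\<^sup>2 \<le> integral {u..u+1} (\<lambda>t. (speed W t)\<^sup>2)" .
 have "integral {u..u+1} (\<lambda>t. (speed q t)\<^sup>2) \<le> integral {u..u+1} (\<lambda>t. (?l + \<epsilon>)\<^sup>2)"
  by (rule integral_le[OF integrable_cont[OF csp[OF q(1)]]])
   (use bd speed_nonneg[OF q(1)] in \<open>auto intro!: power_mono\<close>)
 then have up: "integral {u..u+1} (\<lambda>t. (speed q t)\<^sup>2) \<le> (?l + \<epsilon>)\<^sup>2" by simp
 have split: "integral {u..u+1} (\<lambda>t. (speed \<eta> t)\<^sup>2) = integral {u..a} (\<lambda>t. (speed \<eta> t)\<^sup>2) + integral {a..b} (\<lambda>t. (speed \<eta> t)\<^sup>2) + integral {b..u+1} (\<lambda>t. (speed \<eta> t)\<^sup>2)"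
  if \<eta>: "C1_curve A \<eta>" for \<eta>
 proof -
  have "integral {u..a} (\<lambda>t. (speed \<eta> t)\<^sup>2) + integral {a..u+1} (\<lambda>t. (speed \<eta> t)\<^sup>2) = integral {u..u+1} (\<lambda>t. (speed \<eta> t)\<^sup>2)"
   by (rule Henstock_Kurzweil_Integration.integral_combine[OF _ _ integrable_cont[OF csp[OF \<eta>]]]) (use u ab in auto)
  moreover have "integral {a..b} (\<lambda>t. (speed \<eta> t)\<^sup>2) + integral {b..u+1} (\<lambda>t. (speed \<eta> t)\<^sup>2) = integral {a..u+1} (\<lambda>t. (speed \<eta> t)\<^sup>2)"
   by (rule Henstock_Kurzweil_Integration.integral_combine[OF _ _ integrable_cont[OF csp[OF \<eta>]]]) (use u ab in auto)
  ultimately show ?thesis by linarith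
 qed
 have same: "speed W t = speed q t" if "t \<in> {u<..<u+1} - {a..b}" for t using mC3[OF that] by (simp add: speed_def)
 have s1: "integral {u..a} (\<lambda>t. (speed W t)\<^sup>2) = integral {u..a} (\<lambda>t. (speed q t)\<^sup>2)"
  by (rule integral_spike[of "{u, a}"]) (use same u ab in auto)
 have s2: "integral {b..u+1} (\<lambda>t. (speed W t)\<^sup>2) = integral {b..u+1} (\<lambda>t. (speed q t)\<^sup>2)"
  by (rule integral_spike[of "{b, u+1}"]) (use same u ab in auto)
 have i1: "integral {a..b} (\<lambda>t. (speed q t)\<^sup>2) = 2 * integral {a..b} (\<lambda>t. Lc c (mp c (q t), velocity A q t c))"
 proof -
  have "integral {a..b} (\<lambda>t. (speed q t)\<^sup>2) = integral {a..b} (\<lambda>t. 2 * Lc c (mp c (q t), velocity A q t c))"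
   by (rule integral_cong) (use speed_chart[OF q(1) c dom] in \<open>simp add: Lc_def\<close>)
  then show ?thesis by simp
 qed
 have i2: "integral {a..b} (\<lambda>t. (speed W t)\<^sup>2) = 2 * integral {a..b} (\<lambda>t. Lc c (mp c (q t) + \<xi> t, velocity A q t c + \<xi>' t))"
 proof -
  have "integral {a..b} (\<lambda>t. (speed W t)\<^sup>2) = integral {a..b} (\<lambda>t. 2 * Lc c (mp c (q t) + \<xi> t, velocity A q t c + \<xi>' t))"
  proof (rule integral_cong)
   fix t assume t: "t \<in> {a..b}"
   then have tJ: "t \<in> J" "t \<in> J \<inter> {u<..<u+1}" using J(3) u by auto
   have "W t = iv c (Y t)" "velocity A W t c = Y' t" using mC2[OF tJ(2)] by auto
   moreover have "W t \<in> dm c" "mp c (W t) = Y t"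
    using mC2[OF tJ(2)] chart_inv_in[OF Yr[OF tJ(1)]] map_chart_inv[OF Yr[OF tJ(1)]] by auto
   ultimately show "(speed W t)\<^sup>2 = 2 * Lc c (mp c (q t) + \<xi> t, velocity A q t c + \<xi>' t)"
    using speed_chart[OF WC c, of t] Z(3)[OF t] by (simp add: Lc_def Y_def Y'_def)
  qed
  then show ?thesis by simp
 qed
 have arith: "i - (P - Q) / 2 \<le> i'" if "Q \<le> D" "G \<le> P" "G = g1 + 2 * i + g2" "D = g1 + 2 * i' + g2" for i i' P Q D G g1 g2 :: real
  using that by argo
 show ?thesis by (rule arith[OF low up]) (use split[OF q(1)] split[OF WC] in \<open>simp_all only: s1 s2 i1 i2\<close>)
qed

text \<open>Near t0 the curves lie in one chart, where they satisfy the hypotheses of the variational limit theorem with the Lagrangian Lc.\<close>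

theorem limit_of_minimizers_is_extremal:
 assumes \<alpha>: "\<alpha> \<in> free_homotopy_classes A" and qn: "\<And>n. C1_curve A (qn n)" "\<And>n. qn n \<in> \<alpha>"
  and bd: "\<And>n t. speed (qn n) t \<le> min_length A F \<alpha> + \<epsilon> n" and l0: "min_length A F \<alpha> \<ge> 0"
  and \<epsilon>: "\<And>n. \<epsilon> n \<ge> 0" "\<epsilon> \<longlonglongrightarrow> 0"
  and conv: "conv sequentially qn q" and q: "rcont MT q"
  and c: "c \<in> A" "q t0 \<in> dm c"
 shows "\<exists>e>0. \<exists>V. cont (ball t0 e) V \<and> (\<forall>t\<in>ball t0 e. q t \<in> dm c \<and>
  ((\<lambda>t. mp c (q t)) hvd V t) (at t) \<and>
  ((\<lambda>t. snd (Gc c (mp c (q t), V t))) hvd fst (Gc c (mp c (q t), V t))) (at t) \<and>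
  Lc c (mp c (q t), V t) \<le> (min_length A F \<alpha>)\<^sup>2 / 2)"
proof -
 let ?l = "min_length A F \<alpha>"
 define x0 where "x0 = mp c (q t0)"
 obtain r3 where r3: "r3 > 0" "cball x0 r3 \<subseteq> rng c" using chart_image_cball[OF c(1), of x0] c(2) unfolding x0_def by blast
 define r where "r = r3 / 2"
 have r: "r > 0" using r3 by (simp add: r_def)
 define K where "K = cball x0 r"
 have K: "compact K" "K \<subseteq> rng c" using r3 by (auto simp: K_def r_def)
 have K2: "cball x r \<subseteq> rng c" if "x \<in> K" for x
 proof
  fix y assume "y \<in> cball x r"
  then have "dist x0 y \<le> r3" using that dist_triangle[of x0 y x] by (auto simp: K_def r_def)
  then show "y \<in> rng c" using r3 by auto
 qed
 obtain e where e: "e > 0" "\<forall>\<^sub>F n in sequentially. \<forall>t\<in>ball t0 e. qn n t \<in> dm c \<and> dist (mp c (qn n t)) (mp c (q t0)) < r"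
  using convD[OF conv c r] by blast
 obtain e1 where e1: "e1 > 0" "\<And>t. t \<in> ball t0 e1 ==> q t \<in> dm c" using curve_chart_ball[OF q c] by blast
 define e2 where "e2 = Min {e, e1, 1/2} / 2"
 have e2: "e2 > 0" "e2 < e" "e2 < e1" "e2 < 1/2" using e(1) e1(1) by (auto simp: e2_def min_def)
 define a b where "a = t0 - e2" and "b = t0 + e2"
 have abI: "t \<in> ball t0 e" "t \<in> ball t0 e1" if "t \<in> {a..b}" for t using that e2 by (auto simp: a_def b_def dist_real_def)
 have "\<forall>\<^sub>F n in sequentially. \<epsilon> n < 1" using order_tendstoD(2)[OF \<epsilon>(2)] by simp
 with e(2) have "\<forall>\<^sub>F n in sequentially. \<epsilon> n < 1 \<and> (\<forall>t\<in>ball t0 e. qn n t \<in> dm c \<and> dist (mp c (qn n t)) (mp c (q t0)) < r)"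
  by eventually_elim blast
 then obtain n0 where n0: "\<And>n. n \<ge> n0 ==> \<epsilon> n < 1 \<and> (\<forall>t\<in>ball t0 e. qn n t \<in> dm c \<and> dist (mp c (qn n t)) (mp c (q t0)) < r)"
  unfolding eventually_sequentially by blast
 define W where "W n = qn (n + n0)" for n
 have WC: "C1_curve A (W n)" for n by (simp add: W_def qn)
 have Wdom: "W n t \<in> dm c" and WK: "mp c (W n t) \<in> K" if "t \<in> {a..b}" for n t
  using n0[of "n + n0"] abI(1)[OF that] by (auto simp: W_def K_def x0_def dist_commute less_imp_le)
 obtain m where m: "m > 0" "\<And>x v. x \<in> K ==> m * norm v \<le> Fc c (x, v)" using Fc_lower_bound[OF c(1) K] by blast
 have WR: "norm (velocity A (W n) t c) \<le> (?l + 1) / m" if t: "t \<in> {a..b}" for n t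
 proof -
  have "m * norm (velocity A (W n) t c) \<le> Fc c (mp c (W n t), velocity A (W n) t c)" by (rule m(2)[OF WK[OF t]])
  also have "\<dots> = speed (W n) t" using speed_chart[OF WC c(1) Wdom[OF t]] by simp
  also have "\<dots> \<le> ?l + 1" using bd[of "n + n0" t] n0[of "n + n0"] by (simp add: W_def)
  finally show ?thesis using m(1) by (simp add: field_simps)
 qed
 define a' b' where "a' = t0 - e2 / 2" and "b' = t0 + e2 / 2"
 have ab': "a < a'" "a' < b'" "b' < b" using e2 by (auto simp: a_def b_def a'_def b'_def)
 have lims: "(\<lambda>n. \<epsilon> (n + n0)) \<longlonglongrightarrow> 0" using \<epsilon>(2) LIMSEQ_ignore_initial_segment by blast
 have lim1: "(\<lambda>n. ((?l + \<epsilon> (n + n0))\<^sup>2 - ?l\<^sup>2) / 2) \<longlonglongrightarrow> ((?l + 0)\<^sup>2 - ?l\<^sup>2) / 2"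
  by (intro tendsto_divide tendsto_diff tendsto_power tendsto_add tendsto_const lims) auto
 have lim2: "(\<lambda>n. (?l + \<epsilon> (n + n0))\<^sup>2 / 2) \<longlonglongrightarrow> (?l + 0)\<^sup>2 / 2"
  by (intro tendsto_divide tendsto_power tendsto_add tendsto_const lims) auto
 obtain V where V: "cont {a'..b'} V"
  "\<And>t. t \<in> {a'<..<b'} ==> ((\<lambda>t. mp c (q t)) hvd V t) (at t)"
  "\<And>t. t \<in> {a'<..<b'} ==> ((\<lambda>t. snd (Gc c (mp c (q t), V t))) hvd fst (Gc c (mp c (q t), V t))) (at t)"
  "\<And>t. t \<in> {a'..b'} ==> mp c (q t) \<in> K \<and> Lc c (mp c (q t), V t) \<le> ?l\<^sup>2 / 2"
 proof (rule minimizing_limit_extremal[where L = "Lc c" and G = "Gc c" and \<Omega> = "rng c" and K = K and \<rho> = r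
   and x = "\<lambda>n t. mp c (W n t)" and x' = "\<lambda>n t. velocity A (W n) t c" and X = "\<lambda>t. mp c (q t)"
   and \<epsilon> = "\<lambda>n. ((?l + \<epsilon> (n + n0))\<^sup>2 - ?l\<^sup>2) / 2" and c = "\<lambda>n. (?l + \<epsilon> (n + n0))\<^sup>2 / 2" and ?c0.0 = "?l\<^sup>2 / 2"
   and a = a and a' = a' and b' = b' and b = b and R = "(?l + 1) / m"])
  show "a < a'" "a' < b'" "b' < b" by (fact ab')+
  show "open (rng c)" by (rule open_chart_image[OF c(1)])
  show "(Lc c hder (\<lambda>h. Gc c z \<bullet> h)) (at z)" if "z \<in> rng c \<times> UNIV" for z by (rule Lc_has_derivative[OF c(1) that])
  show "cont (rng c \<times> UNIV) (Gc c)" by (rule Gc_continuous[OF c(1)])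
  show "v = w" if "x \<in> rng c" "snd (Gc c (x, v)) = snd (Gc c (x, w))" for x v w by (rule Gc_inj[OF c(1) that])
  show "compact K" "K \<subseteq> rng c" "r > 0" by (fact K r)+
  show "((\<lambda>t. mp c (W n t)) hvd velocity A (W n) t c) (at t within {a..b})" if "t \<in> {a..b}" for n t
   by (rule hvd_within[OF C1_coords_hvd[OF WC c(1) Wdom[OF that]]])
  show "cont {a..b} (\<lambda>t. velocity A (W n) t c)" for n
   by (rule cont_subset[OF C1_cont_velocity[OF WC c(1)]]) (use Wdom in auto)
  show "mp c (W n t) \<in> K" if "t \<in> {a..b}" for n t by (rule WK[OF that])
  show "norm (velocity A (W n) t c) \<le> (?l + 1) / m" if "t \<in> {a..b}" for n t by (rule WR[OF that])
  show "\<forall>\<^sub>F n in sequentially. \<forall>t\<in>{a..b}. dist (mp c (W n t)) (mp c (q t)) < \<eta>" if "\<eta> > 0" for \<eta>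
  proof -
   have "\<forall>\<^sub>F n in sequentially. \<forall>t\<in>{a..b}. qn n t \<in> dm c \<and> dist (mp c (qn n t)) (mp c (q t)) < \<eta>"
    by (rule conv_compact[OF conv q c(1) compact_Icc e1(2)[OF abI(2)] that])
   then have "\<forall>\<^sub>F n in sequentially. \<forall>t\<in>{a..b}. dist (mp c (qn n t)) (mp c (q t)) < \<eta>"
    by (rule eventually_mono) blast
   then show ?thesis unfolding W_def
    by (subst eventually_sequentially_seg[of "\<lambda>n. \<forall>t\<in>{a..b}. dist (mp c (qn n t)) (mp c (q t)) < \<eta>"])
  qed
  show "(\<lambda>n. ((?l + \<epsilon> (n + n0))\<^sup>2 - ?l\<^sup>2) / 2) \<longlonglongrightarrow> 0" using lim1 by simp
  show "(\<lambda>n. (?l + \<epsilon> (n + n0))\<^sup>2 / 2) \<longlonglongrightarrow> ?l\<^sup>2 / 2" using lim2 by simp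
  show "Lc c (mp c (W n t), velocity A (W n) t c) \<le> (?l + \<epsilon> (n + n0))\<^sup>2 / 2" if "t \<in> {a..b}" for n t
  proof -
   have "Fc c (mp c (W n t), velocity A (W n) t c) \<le> ?l + \<epsilon> (n + n0)"
    using speed_chart[OF WC c(1) Wdom[OF that], of n] bd[of "n + n0" t] by (simp add: W_def)
   moreover have "0 \<le> Fc c (mp c (W n t), velocity A (W n) t c)"
    using Fc_nonneg[OF c(1)] WK[OF that] K(2) by blast
   ultimately show ?thesis unfolding Lc_def by (intro divide_right_mono power_mono) auto
  qed
  show "integral {a..b} (\<lambda>t. Lc c (mp c (W n t), velocity A (W n) t c)) - ((?l + \<epsilon> (n + n0))\<^sup>2 - ?l\<^sup>2) / 2
   \<le> integral {a..b} (\<lambda>t. Lc c (mp c (W n t) + \<xi> t, velocity A (W n) t c + \<xi>' t))"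
   if \<xi>: "\<And>t. t \<in> {a..b} ==> (\<xi> hvd \<xi>' t) (at t within {a..b})" "cont {a..b} \<xi>'"
    "\<xi> a = 0" "\<xi> b = 0" "\<xi>' a = 0" "\<xi>' b = 0" "\<And>t. t \<in> {a..b} ==> norm (\<xi> t) \<le> r" for n \<xi> \<xi>'
  proof (rule energy_near_minimality[OF \<alpha> WC _ _ l0 \<epsilon>(1) c(1) _ _ Wdom K2[OF WK] \<xi>])
   show "W n \<in> \<alpha>" by (simp add: W_def qn)
   show "speed (W n) t \<le> ?l + \<epsilon> (n + n0)" for t using bd by (simp add: W_def)
   show "a < b" "b < a + 1" using e2 by (auto simp: a_def b_def)
  qed
 qed (assumption | blast)+
 have bb: "ball t0 (e2 / 2) = {a'<..<b'}" unfolding a'_def b'_def ball_eq_greaterThanLessThan ..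
 have "cont (ball t0 (e2 / 2)) V" by (rule cont_subset[OF V(1)]) (auto simp: bb)
 moreover have "q t \<in> dm c" if "t \<in> ball t0 (e2 / 2)" for t using e1(2) that e2 by (auto simp: dist_real_def)
 ultimately show ?thesis using V(2-4) e2(1)
  by (intro exI[of _ "e2 / 2"] conjI exI[of _ V] ballI) (auto simp: bb)
qed

end

section \<open>Closed geodesics by compactness\<close>

context finsler
begin

text \<open>In a compact coordinate ball the metric bounds the coordinate norm of velocities, so a curve of bounded speed needs a definite time to leave the ball and is Lipschitz until then.\<close>

lemma bounded_speed_stays_in_chart:
 assumes H: "Hausdorff_space MT" and x: "x \<in> points A" and L: "L > 0"
 shows "\<exists>U \<tau> c K R. openin MT U \<and> x \<in> U \<and> \<tau> > 0 \<and> c \<in> A \<and> compact K \<and> K \<subseteq> rng c \<and>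
  (\<forall>q s. C1_curve A q --> (\<forall>t. speed q t \<le> L) --> q s \<in> U -->
   (\<forall>t\<in>{s..s+\<tau>}. q t \<in> dm c \<and> mp c (q t) \<in> K \<and>
    (\<forall>t'\<in>{s..s+\<tau>}. norm (mp c (q t) - mp c (q t')) \<le> R * norm (t - t'))))"
proof -
 obtain c where c: "c \<in> A" "x \<in> dm c" using x unfolding points_def by blast
 define y where "y = mp c x"
 obtain r where r: "r > 0" "cball y r \<subseteq> rng c" using chart_image_cball[OF c(1), of y] c(2) unfolding y_def by blast
 define \<rho> where "\<rho> = r / 2"
 define K where "K = cball y r"
 have K: "compact K" "K \<subseteq> rng c" using r by (auto simp: K_def)
 obtain m where m: "m > 0" "\<And>x v. x \<in> K ==> m * norm v \<le> Fc c (x, v)" using Fc_lower_bound[OF c(1) K] by blast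
 define R where "R = L / m"
 have R: "R > 0" using L m by (simp add: R_def)
 define U where "U = dm c \<inter> mp c -` ball y \<rho>"
 define \<tau> where "\<tau> = \<rho> / (2 * R)"
 have \<tau>: "\<tau> > 0" "R * \<tau> = \<rho> / 2" using R r by (simp_all add: \<tau>_def \<rho>_def)
 have main: "\<forall>t\<in>{s..s+\<tau>}. q t \<in> dm c \<and> mp c (q t) \<in> K \<and>
    (\<forall>t'\<in>{s..s+\<tau>}. norm (mp c (q t) - mp c (q t')) \<le> R * norm (t - t'))"
  if q: "C1_curve A q" and sp: "\<And>t. speed q t \<le> L" and s: "q s \<in> U" for q s
 proof -
  have qc: "rcont MT q" by (rule C1_cont[OF q])
  define W where "W = dm c \<inter> mp c -` ball y r"
  have WK: "mp c z \<in> K" if "z \<in> W" for z using that by (simp add: W_def K_def)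
  have lip: "norm (mp c (q t) - mp c (q t')) \<le> R * norm (t - t')"
   if "\<And>t. t \<in> {a..b} ==> q t \<in> W" "t \<in> {a..b}" "t' \<in> {a..b}" for a b t t'
  proof (rule differentiable_bound[of "{a..b}" _ "\<lambda>t h. h *\<^sub>R velocity A q t c"])
   fix t assume t: "t \<in> {a..b}"
   then have tW: "q t \<in> dm c" "mp c (q t) \<in> K" using that(1) WK by (auto simp: W_def)
   show "((\<lambda>t. mp c (q t)) hder (\<lambda>h. h *\<^sub>R velocity A q t c)) (at t within {a..b})"
    using hvd_within[OF C1_coords_hvd[OF q c(1) tW(1)]] by (simp add: hvd_def)
   have "m * norm (velocity A q t c) \<le> L"
    using m(2)[OF tW(2), of "velocity A q t c"] speed_chart[OF q c(1) tW(1)] sp[of t] by linarith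
   then have "norm (velocity A q t c) \<le> R" using m(1) by (simp add: R_def field_simps)
   then show "onorm (\<lambda>h. h *\<^sub>R velocity A q t c) \<le> R"
    by (intro onorm_le) (simp add: mult.commute[of R] mult_left_mono)
  qed (use that in auto)
  have inW: "q t \<in> W" if t: "t \<in> {s..s+\<tau>}" for t
  proof (rule ccontr)
   assume bad: "q t \<notin> W"
   define B where "B = {s..s+\<tau>} \<inter> - {t. q t \<in> dm c \<and> mp c (q t) \<in> ball y r}"
   have B: "closed B" unfolding B_def by (intro closed_Int closed_atLeastAtMost closed_Compl openin_curve_preimage[OF qc c(1)] open_ball)
   have tB: "t \<in> B" and Bs: "bdd_below B" using bad t by (auto simp: B_def W_def)
   define b where "b = Inf B"
   have bB: "b \<in> B" unfolding b_def using closed_contains_Inf[OF _ Bs B] tB by blast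
   have "q s \<in> W" using s r(1) by (auto simp: U_def W_def \<rho>_def)
   then have "b ~= s" using bB by (auto simp: B_def W_def)
   then have sb: "s < b" "b \<le> s + \<tau>" using bB by (auto simp: B_def)
   have before: "q u \<in> W" if "u \<in> {s..<b}" for u
    using cInf_lower[OF _ Bs, of u] that sb unfolding b_def[symmetric] by (auto simp: B_def W_def)
   define C where "C = iv c ` cball y (\<rho> + \<rho> / 2)"
   have Ksub: "cball y (\<rho> + \<rho> / 2) \<subseteq> rng c" using r by (auto simp: \<rho>_def)
   have "compactin (top_of_set (rng c)) (cball y (\<rho> + \<rho> / 2))" using Ksub by (simp add: compactin_subtopology)
   then have "closedin MT C" unfolding C_def
    by (intro compactin_imp_closedin[OF H] image_compactin[OF _ chart_inv_continuous[OF c(1)]])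
   then have cl: "closed {u. q u \<in> C}" using closedin_continuous_map_preimage[OF qc] by simp
   have "{s..<b} \<subseteq> {u. q u \<in> C}"
   proof
    fix u assume u: "u \<in> {s..<b}"
    have "norm (mp c (q u) - mp c (q s)) \<le> R * norm (u - s)"
     by (rule lip[of s u]) (use before u in auto)
    also have "\<dots> \<le> R * \<tau>" using u sb R by (intro mult_left_mono) auto
    finally have "norm (mp c (q u) - mp c (q s)) \<le> \<rho> / 2" by (simp only: \<tau>(2))
    moreover have "dist y (mp c (q s)) < \<rho>" using s by (simp add: U_def)
    ultimately have "dist y (mp c (q u)) \<le> \<rho> + \<rho> / 2"
     using dist_triangle[of y "mp c (q u)" "mp c (q s)"]
     by (simp add: dist_norm norm_minus_commute)
    moreover have "iv c (mp c (q u)) = q u" using before[OF u] c(1) by (simp add: W_def)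
    ultimately show "u \<in> {u. q u \<in> C}" unfolding C_def mem_Collect_eq mem_cball[symmetric] by (metis imageI)
   qed
   then have "closure {s..<b} \<subseteq> {u. q u \<in> C}" by (rule closure_minimal[OF _ cl])
   then have "{s..b} \<subseteq> {u. q u \<in> C}" using sb(1) by simp
   from subsetD[OF this, of b] have "q b \<in> C" using sb(1) by simp
   then obtain z where z: "dist y z \<le> \<rho> + \<rho> / 2" "q b = iv c z" unfolding C_def by auto
   have zr: "z \<in> rng c" using Ksub z(1) by auto
   have "q b \<in> dm c \<and> mp c (q b) \<in> ball y r"
    using chart_inv_in[OF zr] map_chart_inv[OF zr] z r(1) by (simp add: \<rho>_def)
   then show False using bB by (auto simp: B_def)
  qed
  show ?thesis
  proof (intro ballI conjI)
   fix t assume t: "t \<in> {s..s+\<tau>}"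
   show "q t \<in> dm c" "mp c (q t) \<in> K" using inW[OF t] WK by (auto simp: W_def)
   show "norm (mp c (q t) - mp c (q t')) \<le> R * norm (t - t')" if "t' \<in> {s..s+\<tau>}" for t'
    by (rule lip[OF inW t that])
  qed
 qed
 have "openin MT U" unfolding U_def by (rule openin_chart_preimage[OF c(1) open_ball])
 moreover have "x \<in> U" using c r(1) by (simp add: U_def y_def \<rho>_def)
 ultimately show ?thesis
  by (intro exI[of _ U] exI[of _ \<tau>] exI[of _ c] exI[of _ K] exI[of _ R] conjI \<tau>(1) c(1) K allI impI main) blast+
qed

text \<open>The limit is a curve in coordinates; whether limits over different windows fit together is settled later, by the Hausdorff property.\<close>

definition converges_in_chart :: "(nat => real => 'a) => real set => bool" where
 "converges_in_chart W I \<longleftrightarrow> (\<exists>c\<in>A. \<exists>g. cont I g \<and> g ` I \<subseteq> rng c \<and> (\<forall>n. \<forall>t\<in>I. W n t \<in> dm c) \<and>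
   (\<forall>\<eta>>0. \<forall>\<^sub>F n in sequentially. \<forall>t\<in>I. dist (mp c (W n t)) (g t) < \<eta>))"

lemma converges_in_chart_subsequence:
 assumes "converges_in_chart W I" "strict_mono r" shows "converges_in_chart (\<lambda>n. W (r n)) I"
proof -
 obtain c g where *: "c \<in> A" "cont I g" "g ` I \<subseteq> rng c" "\<And>n t. t \<in> I ==> W n t \<in> dm c"
   "\<And>\<eta>. \<eta> > 0 ==> \<forall>\<^sub>F n in sequentially. \<forall>t\<in>I. dist (mp c (W n t)) (g t) < \<eta>"
  using assms(1) unfolding converges_in_chart_def by blast
 show ?thesis unfolding converges_in_chart_def
  by (intro bexI[OF _ *(1)] exI[of _ g] conjI *(2,3) allI ballI impI *(4) eventually_subseq[OF assms(2) *(5)])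
qed

text \<open>The windows around single points have a common length by compactness of the manifold. Infinitely many members of the sequence start in one of finitely many of these neighbourhoods, and the theorem of Arzela and Ascoli applies to them.\<close>

lemma uniform_chart_windows:
 assumes H: "Hausdorff_space MT" "compact_space MT" and L: "L > 0"
 shows "\<exists>\<tau>>0. \<forall>W s. (\<forall>n. C1_curve A (W n) \<and> (\<forall>t. speed (W n) t \<le> L)) -->
  (\<exists>r :: nat => nat. strict_mono r \<and> converges_in_chart (\<lambda>n. W (r n :: nat)) {s..s+\<tau>})"
proof -
 define P where "P U \<tau> \<longleftrightarrow> (\<exists>c K R. c \<in> A \<and> compact K \<and> K \<subseteq> rng c \<and>
  (\<forall>q s. C1_curve A q --> (\<forall>t. speed q t \<le> L) --> q s \<in> U -->
   (\<forall>t\<in>{s..s+\<tau>}. q t \<in> dm c \<and> mp c (q t) \<in> K \<and>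
    (\<forall>t'\<in>{s..s+\<tau>}. norm (mp c (q t) - mp c (q t')) \<le> R * norm (t - t')))))" for U and \<tau> :: real
 define \<U> where "\<U> = {U. openin MT U \<and> (\<exists>\<tau>>0. P U \<tau>)}"
 have "topspace MT \<subseteq> \<Union>\<U>"
 proof
  fix x assume "x \<in> topspace MT"
  then have "x \<in> points A" by simp
  from bounded_speed_stays_in_chart[OF H(1) this L] have "\<exists>U \<tau>. openin MT U \<and> x \<in> U \<and> \<tau> > 0 \<and> P U \<tau>"
   unfolding P_def by (elim exE conjE) (intro exI conjI, assumption+)
  then show "x \<in> \<Union>\<U>" unfolding \<U>_def by blast
 qed
 moreover have "\<forall>U\<in>\<U>. openin MT U" by (simp add: \<U>_def)
 ultimately have "\<exists>\<F>. finite \<F> \<and> \<F> \<subseteq> \<U> \<and> topspace MT \<subseteq> \<Union>\<F>"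
  using H(2) unfolding compact_space_alt by blast
 then obtain \<F> where \<F>: "finite \<F>" "\<F> \<subseteq> \<U>" "points A \<subseteq> \<Union>\<F>" by auto
 have "\<forall>U\<in>\<F>. \<exists>\<tau>>0. P U \<tau>" using \<F>(2) by (auto simp: \<U>_def)
 then obtain T where T: "\<And>U. U \<in> \<F> ==> T U > 0 \<and> P U (T U)" by metis
 define \<tau> where "\<tau> = Min (insert 1 (T ` \<F>))"
 have \<tau>: "\<tau> > 0" using \<F>(1) T by (simp add: \<tau>_def)
 have \<tau>T: "\<tau> \<le> T U" if "U \<in> \<F>" for U unfolding \<tau>_def using \<F>(1) that by (intro Min_le) auto
 show ?thesis
 proof (intro exI[of _ \<tau>] conjI \<tau> allI impI)
  fix W :: "nat => real => 'a" and s :: real assume W: "\<forall>n. C1_curve A (W n) \<and> (\<forall>t. speed (W n) t \<le> L)"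
  have "\<exists>U\<in>\<F>. infinite {n \<in> UNIV :: nat set. W n s \<in> U}"
  proof (rule pigeonhole_infinite_rel[OF _ \<F>(1)])
   show "\<forall>n\<in>UNIV. \<exists>U\<in>\<F>. W n s \<in> U"
    using \<F>(3) curve_in_points[OF C1_cont[of A "W _"]] W by blast
  qed simp
  then obtain U where U: "U \<in> \<F>" "infinite {n. W n s \<in> U}" by auto
  define r0 where "r0 = enumerate {n. W n s \<in> U}"
  have r0: "strict_mono r0" "\<And>n. W (r0 n) s \<in> U"
   using strict_mono_enumerate[OF U(2)] enumerate_in_set[OF U(2)] by (auto simp: r0_def)
  obtain c K R where c: "c \<in> A" "compact K" "K \<subseteq> rng c" and *: "\<And>q s. C1_curve A q ==> (\<forall>t. speed q t \<le> L) ==> q s \<in> U ==>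
   (\<forall>t\<in>{s..s+T U}. q t \<in> dm c \<and> mp c (q t) \<in> K \<and>
    (\<forall>t'\<in>{s..s+T U}. norm (mp c (q t) - mp c (q t')) \<le> R * norm (t - t')))"
   using T[OF U(1)] unfolding P_def by blast
  let ?I = "{s..s+\<tau>}"
  define f where "f n t = mp c (W (r0 n) t)" for n t
  have f: "W (r0 n) t \<in> dm c" "f n t \<in> K" "t' \<in> ?I ==> norm (f n t - f n t') \<le> R * norm (t - t')"
   if "t \<in> ?I" for n t t'
   using *[of "W (r0 n)" s] W r0(2)[of n] that \<tau>T[OF U(1)] by (auto simp: f_def)
  obtain M where M: "\<And>y. y \<in> K ==> norm y \<le> M" using compact_imp_bounded[OF c(2)] unfolding bounded_iff by blast
  obtain g and k :: "nat => nat" where g: "cont ?I g" and k: "strict_mono k"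
   and lim: "\<And>e. 0 < e ==> \<exists>N. \<forall>n t. n \<ge> N \<and> t \<in> ?I --> norm (f (k n) t - g t) < e"
  proof (rule Arzela_Ascoli[of ?I f M])
   show "norm (f n t) \<le> M" if "t \<in> ?I" for n t using M f(2)[OF that] by blast
   show "\<exists>d>0. \<forall>n t'. t' \<in> ?I \<and> norm (t - t') < d --> norm (f n t - f n t') < e" if t: "t \<in> ?I" and e: "0 < e" for t e
   proof (intro exI[of _ "e / (\<bar>R\<bar> + 1)"] conjI allI impI)
    fix n t' assume t': "t' \<in> ?I \<and> norm (t - t') < e / (\<bar>R\<bar> + 1)"
    have "norm (f n t - f n t') \<le> R * norm (t - t')" using f(3)[OF t] t' by blast
    also have "\<dots> \<le> (\<bar>R\<bar> + 1) * norm (t - t')" by (intro mult_right_mono) auto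
    also have "\<dots> < e" using t' by (simp add: pos_less_divide_eq[of "\<bar>R\<bar> + 1"] mult.commute)
    finally show "norm (f n t - f n t') < e" .
   qed (use e in simp)
  qed (use that in auto)
  have "g t \<in> K" if t: "t \<in> ?I" for t
  proof (rule closed_sequentially[OF compact_imp_closed[OF c(2)], where f = "\<lambda>n. f (k n) t"])
   show "(\<lambda>n. f (k n) t) \<longlonglongrightarrow> g t" unfolding LIMSEQ_iff using lim t by blast
  qed (rule f(2)[OF t])
  then have "converges_in_chart (\<lambda>n. W (r0 (k n))) ?I" unfolding converges_in_chart_def
  proof (intro bexI[OF _ c(1)] exI[of _ g] conjI g allI ballI impI)
   show "\<forall>\<^sub>F n in sequentially. \<forall>t\<in>?I. dist (mp c (W (r0 (k n)) t)) (g t) < \<eta>" if "\<eta> > 0" for \<eta>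
    using lim[OF that] unfolding eventually_sequentially f_def dist_norm by blast
  qed (use c f(1) in auto)
  then show "\<exists>r :: nat => nat. strict_mono r \<and> converges_in_chart (\<lambda>n. W (r n)) ?I"
   using strict_mono_o[OF r0(1) k] by (intro exI[of _ "r0 \<circ> k"]) (simp add: o_def)
 qed
qed

text \<open>Finitely many windows of the uniform length cover a period; passing to subsequences one window at a time gives convergence on all of them. Limits are unique in a Hausdorff space, so the pieces form a loop.\<close>

lemma bounded_speed_loops_subsequence:
 assumes H: "Hausdorff_space MT" "compact_space MT"
  and W: "\<And>n. C1_curve A (W n)" "\<And>n. periodic (W n)" "\<And>n t. speed (W n) t \<le> L"
 shows "\<exists>r q. strict_mono (r :: nat => nat) \<and> q \<in> loops A \<and> conv sequentially (\<lambda>n. W (r n)) q"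
proof -
 have bd: "speed (W n) t \<le> \<bar>L\<bar> + 1" for n t using W(3)[of n t] by linarith
 have "\<bar>L\<bar> + 1 > 0" by simp
 then obtain \<tau> where \<tau>: "\<tau> > 0" "\<And>W s. (\<forall>n. C1_curve A (W n) \<and> (\<forall>t. speed (W n) t \<le> \<bar>L\<bar> + 1)) ==>
  (\<exists>r :: nat => nat. strict_mono r \<and> converges_in_chart (\<lambda>n. W (r n)) {s..s+\<tau>})"
  using uniform_chart_windows[OF H] by meson
 obtain N :: nat where N: "2 / \<tau> < real N" using reals_Archimedean2 by blast
 have N0: "real N > 0" using N \<tau>(1) by (meson divide_pos_pos less_trans zero_less_numeral)
 have N\<tau>: "2 / real N < \<tau>" using N N0 \<tau>(1) by (simp add: field_simps)
 have "\<exists>r :: nat => nat. strict_mono r \<and> (\<forall>k<j. converges_in_chart (\<lambda>n. W (r n)) {real k / N..real k / N + \<tau>})" for j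
 proof (induction j)
  case 0
  show ?case using strict_mono_id by auto
 next
  case (Suc j)
  then obtain r :: "nat => nat" where r: "strict_mono r" "\<And>k. k < j ==> converges_in_chart (\<lambda>n. W (r n)) {real k / N..real k / N + \<tau>}" by blast
  obtain r' :: "nat => nat" where r': "strict_mono r'" "converges_in_chart (\<lambda>n. W (r (r' n))) {real j / N..real j / N + \<tau>}"
   using \<tau>(2)[of "\<lambda>n. W (r n)"] W(1) bd by blast
  have "converges_in_chart (\<lambda>n. W (r (r' n))) {real k / N..real k / N + \<tau>}" if "k < Suc j" for k
  proof (cases "k = j")
   case False
   then show ?thesis using converges_in_chart_subsequence[OF r(2) r'(1)] that by simp
  qed (use r' in simp)
  then show ?case using strict_mono_o[OF r(1) r'(1)] by (intro exI[of _ "r \<circ> r'"]) (simp add: o_def)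
 qed
 then obtain r :: "nat => nat" where r: "strict_mono r" "\<And>k. k < 2 * N ==> converges_in_chart (\<lambda>n. W (r n)) {real k / N..real k / N + \<tau>}" by blast
 define q where "q t = (SOME x. limitin MT (\<lambda>n. W (r n) t) x sequentially)" for t
 have qp: "periodic q" using W(2) by (simp add: periodic_def q_def)
 have loc: "\<exists>c\<in>A. \<exists>e>0. \<exists>g. cont (ball t0 e) g \<and> (\<forall>t\<in>ball t0 e. q t \<in> dm c \<and> mp c (q t) = g t \<and> (\<forall>n. W (r n) t \<in> dm c)) \<and>
  (\<forall>\<eta>>0. \<forall>\<^sub>F n in sequentially. \<forall>t\<in>ball t0 e. dist (mp c (W (r n) t)) (g t) < \<eta>)"
  if t0: "t0 \<in> {1..<2}" for t0
 proof -
  define k where "k = nat (\<lfloor>t0 * N\<rfloor> - 1)"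
  have N1: "real N \<ge> 1" using N0 by simp
  have "1 * real N \<le> t0 * N" using t0 by (intro mult_right_mono) auto
  moreover have "t0 * real N < 2 * real N" using t0 N0 by (intro mult_strict_right_mono) auto
  ultimately have b: "1 \<le> t0 * N" "t0 * N < 2 * N" using N1 by linarith+
  then have "1 \<le> \<lfloor>t0 * N\<rfloor>" "\<lfloor>t0 * N\<rfloor> < 2 * int N" using N1 by (auto simp: le_floor_iff floor_less_iff)
  then have k: "real k = real_of_int \<lfloor>t0 * N\<rfloor> - 1" "k < 2 * N" by (auto simp: k_def nat_less_iff)
  have k1: "real k + 1 \<le> t0 * N" "t0 * N < real k + 2" unfolding k(1) by linarith+
  then have k2: "real k / N + 1 / N \<le> t0" "t0 < real k / N + 2 / N" using N0 by (simp_all add: field_simps)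
  define e where "e = min (1 / N) (\<tau> - 2 / N)"
  have e: "e > 0" using N0 N\<tau> by (simp add: e_def)
  have sub: "ball t0 e \<subseteq> {real k / N..real k / N + \<tau>}" using k2 by (auto simp: e_def dist_real_def)
  obtain c g where c: "c \<in> A" and g1: "cont {real k / N..real k / N + \<tau>} g" "g ` {real k / N..real k / N + \<tau>} \<subseteq> rng c"
   and d1: "\<forall>n. \<forall>t\<in>{real k / N..real k / N + \<tau>}. W (r n) t \<in> dm c"
   and lim1: "\<forall>\<eta>>0. \<forall>\<^sub>F n in sequentially. \<forall>t\<in>{real k / N..real k / N + \<tau>}. dist (mp c (W (r n) t)) (g t) < \<eta>"
   using r(2)[OF k(2)] unfolding converges_in_chart_def by (elim bexE exE conjE) (rule that)
  have g: "cont {real k / N..real k / N + \<tau>} g" "\<And>t. t \<in> {real k / N..real k / N + \<tau>} ==> g t \<in> rng c"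
   and d: "\<And>n t. t \<in> {real k / N..real k / N + \<tau>} ==> W (r n) t \<in> dm c"
   and lim: "\<And>\<eta>. \<eta>>0 ==> \<forall>\<^sub>F n in sequentially. \<forall>t\<in>{real k / N..real k / N + \<tau>}. dist (mp c (W (r n) t)) (g t) < \<eta>"
   using g1 d1 lim1 by blast+
  have q: "q t = iv c (g t)" if t: "t \<in> {real k / N..real k / N + \<tau>}" for t
  proof -
   have "(\<lambda>n. mp c (W (r n) t)) \<longlonglongrightarrow> g t"
   proof (rule tendstoI)
    show "\<forall>\<^sub>F n in sequentially. dist (mp c (W (r n) t)) (g t) < \<eta>" if "\<eta> > 0" for \<eta>
     by (rule eventually_mono[OF lim[OF that]]) (use t in blast)
   qed
   then have "limitin (top_of_set (rng c)) (\<lambda>n. mp c (W (r n) t)) (g t) sequentially"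
    using g(2)[OF t] d[OF t] by (auto simp: limitin_subtopology)
   then have "limitin MT (iv c \<circ> (\<lambda>n. mp c (W (r n) t))) (iv c (g t)) sequentially"
    by (rule continuous_map_limit[OF chart_inv_continuous[OF c]])
   then have l: "limitin MT (\<lambda>n. W (r n) t) (iv c (g t)) sequentially" using c d[OF t] by (simp add: o_def)
   have "x = iv c (g t)" if "limitin MT (\<lambda>n. W (r n) t) x sequentially" for x
    by (rule limitin_Hausdorff_unique[OF that l _ H(1)]) simp
   then show ?thesis unfolding q_def by (intro some_equality l)
  qed
  show ?thesis
  proof (intro bexI[OF _ c] exI[of _ e] exI[of _ g] conjI e ballI allI impI)
   show "cont (ball t0 e) g" by (rule cont_subset[OF g(1) sub])
   show "q t \<in> dm c" "mp c (q t) = g t" if "t \<in> ball t0 e" for t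
    using that sub q[of t] chart_inv_in[OF g(2), of t] map_chart_inv[OF g(2), of t] by auto
   show "W (r n) t \<in> dm c" if "t \<in> ball t0 e" for n t using d sub that by blast
   show "\<forall>\<^sub>F n in sequentially. \<forall>t\<in>ball t0 e. dist (mp c (W (r n) t)) (g t) < \<eta>" if "\<eta> > 0" for \<eta>
    by (rule eventually_mono[OF lim[OF that]]) (use sub in blast)
  qed
 qed
 have loc': "\<exists>c\<in>A. \<exists>e>0. cont (ball t0 e) (\<lambda>t. mp c (q t)) \<and> (\<forall>t\<in>ball t0 e. q t \<in> dm c) \<and>
  (\<forall>\<eta>>0. \<forall>\<^sub>F n in sequentially. \<forall>t\<in>ball t0 e. W (r n) t \<in> dm c \<and> dist (mp c (W (r n) t)) (mp c (q t)) < \<eta>)" for t0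
 proof -
  define m where "m = \<lfloor>t0\<rfloor> - 1"
  have m: "t0 - of_int m \<in> {1..<2}" unfolding m_def by simp linarith
  have per: "q (t - of_int m) = q t" "W (r n) (t - of_int m) = W (r n) t" for n t
   using periodic_shift qp W(2) by blast+
  have sh: "t - of_int m \<in> ball (t0 - of_int m) e" if "t \<in> ball t0 e" for t e using that by (simp add: dist_real_def)
  obtain c e g where c: "c \<in> A" "e > 0" "cont (ball (t0 - of_int m) e) g"
   "\<And>t. t \<in> ball (t0 - of_int m) e ==> q t \<in> dm c \<and> mp c (q t) = g t \<and> (\<forall>n. W (r n) t \<in> dm c)"
   "\<And>\<eta>. \<eta> > 0 ==> \<forall>\<^sub>F n in sequentially. \<forall>t\<in>ball (t0 - of_int m) e. dist (mp c (W (r n) t)) (g t) < \<eta>"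
   using loc[OF m] by meson
  have *: "q t \<in> dm c \<and> mp c (q t) = g (t - of_int m) \<and> (\<forall>n. W (r n) t \<in> dm c)" if "t \<in> ball t0 e" for t
   using c(4)[OF sh[OF that]] unfolding per .
  show ?thesis
  proof (intro bexI[OF _ c(1)] exI[of _ e] conjI c(2) ballI allI impI)
   show "cont (ball t0 e) (\<lambda>t. mp c (q t))"
    by (rule continuous_on_eq[OF continuous_on_shift_ball[OF c(3)]]) (use * in simp)
   show "q t \<in> dm c" if "t \<in> ball t0 e" for t using *[OF that] by blast
   show "\<forall>\<^sub>F n in sequentially. \<forall>t\<in>ball t0 e. W (r n) t \<in> dm c \<and> dist (mp c (W (r n) t)) (mp c (q t)) < \<eta>"
    if "\<eta> > 0" for \<eta>
   proof (rule eventually_mono[OF c(5)[OF that]], rule ballI)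
    fix n t assume 1: "\<forall>t\<in>ball (t0 - of_int m) e. dist (mp c (W (r n) t)) (g t) < \<eta>" and t: "t \<in> ball t0 e"
    show "W (r n) t \<in> dm c \<and> dist (mp c (W (r n) t)) (mp c (q t)) < \<eta>"
     using bspec[OF 1 sh[OF t]] *[OF t] unfolding per by simp
   qed
  qed
 qed
 have qc: "rcont MT q" by (rule continuous_curveI) (use loc' in meson)
 have "conv sequentially (\<lambda>n. W (r n)) q"
 proof (rule convI)
  fix t0
  obtain c e where c: "c \<in> A" "e > 0" "cont (ball t0 e) (\<lambda>t. mp c (q t))" "\<And>t. t\<in>ball t0 e ==> q t \<in> dm c"
   "\<And>\<eta>. \<eta> > 0 ==> \<forall>\<^sub>F n in sequentially. \<forall>t\<in>ball t0 e. W (r n) t \<in> dm c \<and> dist (mp c (W (r n) t)) (mp c (q t)) < \<eta>"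
   using loc'[of t0] by meson
  have "\<exists>e>0. \<forall>\<^sub>F n in sequentially. \<forall>t\<in>ball t0 e. W (r n) t \<in> dm c \<and> dist (mp c (W (r n) t)) (mp c (q t0)) < \<eta>"
   if \<eta>: "\<eta> > 0" for \<eta>
  proof -
   obtain e' where e': "e' > 0" "\<And>t. t \<in> ball t0 e ==> dist t t0 < e' ==> dist (mp c (q t)) (mp c (q t0)) < \<eta> / 2"
    using c(2,3) \<eta> unfolding continuous_on_iff by (metis centre_in_ball half_gt_zero)
   have "\<eta> / 2 > 0" using \<eta> by simp
   show ?thesis
   proof (intro exI[of _ "min e e'"] conjI eventually_mono[OF c(5)[OF \<open>\<eta> / 2 > 0\<close>]] ballI)
    fix n t assume 1: "\<forall>t\<in>ball t0 e. W (r n) t \<in> dm c \<and> dist (mp c (W (r n) t)) (mp c (q t)) < \<eta> / 2"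
     and t: "t \<in> ball t0 (min e e')"
    then have t1: "t \<in> ball t0 e" "dist t t0 < e'" by (auto simp: dist_commute)
    show "W (r n) t \<in> dm c" using 1 t1 by blast
    show "dist (mp c (W (r n) t)) (mp c (q t0)) < \<eta>"
     using 1 t1(1) e'(2)[OF t1] dist_triangle_half_l by (metis dist_commute)
   qed (use c(2) e'(1) in simp)
  qed
  then show "\<exists>c\<in>A. q t0 \<in> dm c \<and> (\<forall>\<eta>>0. \<exists>e>0. \<forall>\<^sub>F i in sequentially. \<forall>t\<in>ball t0 e.
   W (r i) t \<in> dm c \<and> dist (mp c (W (r i) t)) (mp c (q t0)) < \<eta>)"
   using c(1) c(4)[of t0] c(2) by auto
 qed
 then show ?thesis using r(1) qc qp by (auto simp: loops_def)
qed

text \<open>A closed geodesic: the Euler-Lagrange equation of the energy, together with constant speed.\<close>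

definition extremal :: "(real => 'a) => real => bool" where
 "extremal q l \<longleftrightarrow> C1_curve A q \<and> l > 0 \<and> (\<forall>t. speed q t = l) \<and>
  (\<forall>c\<in>A. \<forall>t. q t \<in> dm c --> ((\<lambda>t. snd (Gc c (mp c (q t), velocity A q t c)))
    hvd fst (Gc c (mp c (q t), velocity A q t c))) (at t))"

text \<open>Loops of almost minimal length, reparametrized to bounded speed, have a subsequence that converges to a loop. It lies in the same class because close loops are homotopic, and it solves the Euler-Lagrange equation. Its speed is at most the minimal length, which its length cannot fall below; so the speed is constant. It is positive as the class contains no constant loop.\<close>

theorem closed_geodesic_exists:
 assumes H: "Hausdorff_space MT" "compact_space MT" and \<alpha>: "\<alpha> \<in> free_homotopy_classes A" "nontrivial_class A \<alpha>"
  and ne: "smooth_loops A \<inter> \<alpha> ~= {}"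
 shows "\<exists>q\<in>\<alpha>. extremal q (min_length A F \<alpha>)"
proof -
 let ?l = "min_length A F \<alpha>"
 define \<epsilon> where "\<epsilon> n = 1 / real (Suc n)" for n
 have \<epsilon>0: "\<epsilon> n > 0" for n by (simp add: \<epsilon>_def)
 have \<epsilon>lim: "\<epsilon> \<longlonglongrightarrow> 0" unfolding \<epsilon>_def[abs_def] by (rule LIMSEQ_Suc[OF lim_1_over_n])
 have C1: "C1_curve A \<sigma>" if "\<sigma> \<in> smooth_loops A" for \<sigma> using that smooth_curve_imp_C1 by (simp add: smooth_loops_def)
 have l0: "?l \<ge> 0" unfolding min_length_def by (rule cINF_greatest[OF ne]) (use C1 finsler_length_nonneg in blast)
 have ex: "\<exists>W. C1_curve A W \<and> W \<in> \<alpha> \<and> (\<forall>t. speed W t \<le> ?l + \<epsilon> n)" for n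
 proof -
  have "?l < ?l + \<epsilon> n / 2" using \<epsilon>0[of n] by simp
  then obtain \<sigma> where \<sigma>: "\<sigma> \<in> smooth_loops A \<inter> \<alpha>" "len \<sigma> < ?l + \<epsilon> n / 2"
   unfolding min_length_def using cINF_less_iff[OF ne] C1 finsler_length_nonneg
   by (metis (no_types, lifting) IntD1 bdd_belowI2)
  obtain W where W: "C1_curve A W" "homotopic_loops \<sigma> W" "\<And>t. speed W t \<le> len \<sigma> + \<epsilon> n / 2"
   using reparametrize[of \<sigma> "\<epsilon> n / 2"] C1 \<sigma>(1) free_homotopy_class_loops[OF \<alpha>(1)] \<epsilon>0[of n] by auto
  have "speed W t \<le> ?l + \<epsilon> n" for t using W(3)[of t] \<sigma>(2) by linarith
  then show ?thesis using W(1,2) free_homotopy_class_iff[OF \<alpha>(1), of \<sigma>] \<sigma>(1) by blast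
 qed
 then obtain W where W: "\<And>n. C1_curve A (W n)" "\<And>n. W n \<in> \<alpha>" "\<And>n t. speed (W n) t \<le> ?l + \<epsilon> n" by metis
 have Wl: "W n \<in> loops A" for n by (rule free_homotopy_class_loops[OF \<alpha>(1) W(2)])
 have "speed (W n) t \<le> ?l + 1" for n t using W(3)[of n t] by (simp add: \<epsilon>_def) (smt (verit) divide_le_eq_1 of_nat_0_le_iff)
 moreover have "periodic (W n)" for n using Wl[of n] by (simp add: loops_def)
 ultimately have "\<exists>r q. strict_mono (r :: nat => nat) \<and> q \<in> loops A \<and> conv sequentially (\<lambda>n. W (r n)) q"
  by (intro bounded_speed_loops_subsequence[OF H W(1)])
 then obtain r :: "nat => nat" and q where r: "strict_mono r" and q: "q \<in> loops A" and conv: "conv sequentially (\<lambda>n. W (r n)) q"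
  by blast
 have qc: "rcont MT q" and qp: "periodic q" using q by (auto simp: loops_def)
 obtain n where "homotopic_loops (W (r n)) q"
  using conv_eventually_homotopic[OF conv q] Wl eventually_happens'[OF sequentially_bot] by (metis (mono_tags, lifting) always_eventually)
 then have q\<alpha>: "q \<in> \<alpha>" using free_homotopy_class_iff[OF \<alpha>(1) W(2)] by blast
 have limr: "(\<lambda>n. \<epsilon> (r n)) \<longlonglongrightarrow> 0" using LIMSEQ_subseq_LIMSEQ[OF \<epsilon>lim r] by (simp add: o_def)
 have loc: "\<exists>e>0. \<exists>V. cont (ball t0 e) V \<and> (\<forall>t\<in>ball t0 e. q t \<in> dm c \<and>
  ((\<lambda>t. mp c (q t)) hvd V t) (at t) \<and>
  ((\<lambda>t. snd (Gc c (mp c (q t), V t))) hvd fst (Gc c (mp c (q t), V t))) (at t) \<and>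
  Lc c (mp c (q t), V t) \<le> ?l\<^sup>2 / 2)" if "c \<in> A" "q t0 \<in> dm c" for c t0
  by (rule limit_of_minimizers_is_extremal[OF \<alpha>(1) W(1) W(2) W(3) l0 less_imp_le[OF \<epsilon>0] limr conv qc that])
 have qC: "C1_curve A q"
 proof (rule C1_curveI)
  fix t0
  obtain c where c: "c \<in> A" "q t0 \<in> dm c" using chart_at_curve[OF qc] .
  show "\<exists>c\<in>A. \<exists>e>0. \<exists>g. (\<forall>t\<in>ball t0 e. q t \<in> dm c \<and>
   ((\<lambda>t. mp c (q t)) hvd g t) (at t)) \<and> cont (ball t0 e) g"
   using loc[OF c] c(1) by blast
 qed
 have pt: "((\<lambda>t. snd (Gc c (mp c (q t), velocity A q t c))) hvd fst (Gc c (mp c (q t0), velocity A q t0 c))) (at t0)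
  \<and> speed q t0 \<le> ?l" if c: "c \<in> A" "q t0 \<in> dm c" for c t0
 proof -
  obtain e V where e: "e > 0" and V: "\<And>t. t \<in> ball t0 e ==> q t \<in> dm c \<and>
   ((\<lambda>t. mp c (q t)) hvd V t) (at t) \<and>
   ((\<lambda>t. snd (Gc c (mp c (q t), V t))) hvd fst (Gc c (mp c (q t), V t))) (at t) \<and>
   Lc c (mp c (q t), V t) \<le> ?l\<^sup>2 / 2" using loc[OF c] by blast
  have vel: "V t = velocity A q t c" if "t \<in> ball t0 e" for t using velocity_eqI[OF c(1)] V[OF that] by metis
  have in0: "t0 \<in> ball t0 e" using e by simp
  have d: "((\<lambda>t. snd (Gc c (mp c (q t), V t))) hvd fst (Gc c (mp c (q t0), V t0))) (at t0)"
   using V[OF in0] by blast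
  have "((\<lambda>t. snd (Gc c (mp c (q t), velocity A q t c))) hvd fst (Gc c (mp c (q t0), V t0))) (at t0)"
   by (rule hvd_cong_open[OF d open_ball in0]) (simp add: vel)
  moreover have "(speed q t0)\<^sup>2 \<le> ?l\<^sup>2" using V[OF in0] vel[OF in0] speed_chart[OF qC c] by (simp add: Lc_def)
  then have "speed q t0 \<le> ?l" using l0 by (rule power2_le_imp_le)
  ultimately show ?thesis using vel[OF in0] by simp
 qed
 have sp: "speed q t \<le> ?l" for t using pt chart_at_curve[OF qc, of t] by metis
 have i: "integral {0..1} (speed q) \<ge> ?l" using min_length_le[OF \<alpha>(1) qC q\<alpha>] by (simp add: finsler_length_speed)
 have cs: "cont {0..1} (speed q)" by (rule cont_subset[OF speed_continuous[OF qC]]) simp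
 have const: "speed q t = ?l" for t
 proof -
  have "((\<lambda>t. ?l - speed q t) has_integral ?l - integral {0..1} (speed q)) {0..1}"
   using has_integral_diff[OF has_integral_const_real[of ?l 0 1] integrable_integral[OF integrable_cont[OF cs]]] by simp
  moreover have "?l - integral {0..1} (speed q) \<ge> 0" using has_integral_nonneg[OF calculation] sp by simp
  ultimately have z: "((\<lambda>t. ?l - speed q t) has_integral 0) (cbox 0 1)" using i by simp
  have eq: "speed q t = ?l" if "t \<in> {0..1}" for t
  proof -
   have "cont (cbox 0 1) (\<lambda>t. ?l - speed q t)" using cs by (intro cont_diff cont_const) simp
   from has_integral_0_cbox_imp_0[OF this _ z] have "?l - speed q t = 0" using that sp by simp
   then show ?thesis by simp
  qed
  have "t - of_int \<lfloor>t\<rfloor> \<in> {0..1}" by simp linarith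
  then show ?thesis using eq periodic_shift[OF speed_periodic[OF qp], of t "\<lfloor>t\<rfloor>"] by simp
 qed
 have "?l ~= 0"
 proof
  assume l: "?l = 0"
  have "\<exists>e>0. \<forall>t\<in>ball t0 e. q t = q t0" for t0
  proof -
   obtain c where c: "c \<in> A" "q t0 \<in> dm c" using chart_at_curve[OF qc] .
   obtain e where e: "e > 0" "\<And>t. t \<in> ball t0 e ==> q t \<in> dm c" using curve_chart_ball[OF qc c] by blast
   have v: "velocity A q t c = 0" if "t \<in> ball t0 e" for t
    using const[of t] l speed_chart[OF qC c(1) e(2)[OF that]] Fc_pos[OF c(1), of "mp c (q t)" "velocity A q t c"] e(2)[OF that] by force
   have d0: "((\<lambda>t. mp c (q t)) hder (\<lambda>h. 0)) (at t within ball t0 e)" if "t \<in> ball t0 e" for t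
    using hvd_within[OF C1_coords_hvd[OF qC c(1) e(2)[OF that]], of "ball t0 e"] v[OF that]
    by (simp add: hvd_def)
   obtain k where "\<And>t. t \<in> ball t0 e ==> mp c (q t) = k"
    using has_derivative_zero_constant[OF convex_ball d0] by blast
   then have "q t = q t0" if "t \<in> ball t0 e" for t
    using that e chart_inv_map[OF c(1) e(2)[OF that]] chart_inv_map[OF c] by (metis centre_in_ball)
   then show ?thesis using e(1) by blast
  qed
  then have "open {t. q t \<in> Q}" for Q unfolding open_contains_ball by (metis mem_Collect_eq subsetI)
  from this[of "{q 0}"] this[of "- {q 0}"] have "{t. q t = q 0} = UNIV"
   using clopen[of "{t. q t = q 0}"] by (auto simp: closed_def Collect_neg_eq[symmetric])
  then have "q = (\<lambda>t. q 0)" by auto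
  then have "(\<lambda>t. q 0) \<in> \<alpha>" using q\<alpha> by simp
  then show False using \<alpha>(2) curve_in_points[OF qc] unfolding nontrivial_class_def by blast
 qed
 then show ?thesis unfolding extremal_def using qC l0 const pt by (intro bexI[OF _ q\<alpha>]) auto
qed

end

section \<open>The cotangent bundle\<close>

lemma smooth_on_Pair:
 fixes f :: "'a::real_normed_vector => 'b::euclidean_space" and g :: "'a => 'c::euclidean_space"
 assumes "open S" "smooth_on f S" "smooth_on g S" shows "smooth_on (\<lambda>x. (f x, g x)) S"
proof -
 have "bounded_linear (\<lambda>x :: 'b. (x, 0 :: 'c))" "bounded_linear (\<lambda>x :: 'c. (0 :: 'b, x))"
  by (intro bounded_linear_Pair bounded_linear_ident bounded_linear_zero)+
 note l = this[THEN smooth_on_bounded_linear]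
 have "smooth_on (\<lambda>x. (f x, 0) + (0, g x)) S"
  by (intro smooth_on_add assms(1) smooth_on_compose[OF assms(1) subset_UNIV assms(2) l(1)] smooth_on_compose[OF assms(1) subset_UNIV assms(3) l(2)])
 then show ?thesis by simp
qed

lemma smooth_on_sum:
 "open S ==> (\<And>i. i \<in> I ==> smooth_on (f i) S) ==> smooth_on (\<lambda>x. \<Sum>i\<in>I. f i x) S"
 unfolding smooth_on_def by (rule allI, rule Ck_on_sum) auto

lemma smooth_on_inner_const: "open S ==> smooth_on f S ==> smooth_on (\<lambda>x. f x \<bullet> b) S"
 unfolding smooth_on_def by (rule allI, rule Ck_on_inner_const) auto

lemma smooth_on_inner:
 fixes f :: "'a::real_normed_vector => 'b::euclidean_space"
 assumes "open S" "smooth_on f S" "smooth_on g S" shows "smooth_on (\<lambda>x. f x \<bullet> g x) S"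
proof -
 have "smooth_on (\<lambda>x. \<Sum>b\<in>Basis. (f x \<bullet> b) *\<^sub>R (g x \<bullet> b)) S"
  by (rule smooth_on_sum[OF assms(1)], rule smooth_on_scaleR[OF assms(1)])
   (rule smooth_on_inner_const[OF assms(1)], rule assms)+
 moreover have "(\<Sum>b\<in>Basis. (f x \<bullet> b) *\<^sub>R (g x \<bullet> b)) = f x \<bullet> g x" for x by (simp add: euclidean_inner[of "f x" "g x"])
 ultimately show ?thesis by simp
qed

text \<open>The derivative of a smooth map as a function of point and vector jointly: the tangent map.\<close>

lemma smooth_Df_joint:
 fixes f :: "'a::euclidean_space => 'b::euclidean_space"
 assumes S: "open S" and f: "smooth_on f S"
 defines "G \<equiv> \<lambda>z. Df f (fst z) (snd z)"
 shows "smooth_on G (S \<times> UNIV)"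
  and "x \<in> S ==> Df G (x, b) (h, k) =
   Df (\<lambda>y. frechet_derivative f (at y) b) x h + Df f x k"
proof -
 have SU: "open (S \<times> (UNIV :: 'a set))" using S by (intro open_Times) auto
 show G: "smooth_on G (S \<times> UNIV)"
 proof (rule smooth_on_cong[OF SU])
  show "smooth_on (\<lambda>z. \<Sum>b\<in>Basis. (snd z \<bullet> b) *\<^sub>R Df f (fst z) b) (S \<times> UNIV)"
  proof -
   have "smooth_on (\<lambda>z :: 'a \<times> 'a. Df f (fst z) b) (S \<times> UNIV)" for b
    by (rule smooth_on_compose[OF SU _ smooth_on_bounded_linear[OF bounded_linear_fst] smooth_on_frechet[OF f]]) auto
   moreover have "smooth_on (\<lambda>z :: 'a \<times> 'a. snd z \<bullet> b) (S \<times> UNIV)" for b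
    by (rule smooth_on_inner[OF SU smooth_on_bounded_linear[OF bounded_linear_snd] smooth_on_const])
   ultimately show ?thesis by (intro smooth_on_sum[OF SU] smooth_on_scaleR[OF SU])
  qed
  show "(\<Sum>b\<in>Basis. (snd z \<bullet> b) *\<^sub>R Df f (fst z) b) = G z" if "z \<in> S \<times> UNIV" for z
   unfolding G_def using that
   by (intro frechet_derivative_basis_expansion[symmetric] smooth_on_imp_differentiable[OF f]) auto
 qed
 assume x: "x \<in> S"
 let ?D = "Df G (x, b)"
 have D: "(G hder ?D) (at (x, b))" by (rule smooth_hder[OF G]) (use x in auto)
 have "((\<lambda>y. (y, b)) hder (\<lambda>h. (h, 0))) (at x)" by (auto intro!: derivative_eq_intros)
 from hder_compose[OF this D]
 have "((\<lambda>y. Df f y b) hder (\<lambda>h. ?D (h, 0))) (at x)" by (simp add: G_def)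
 then have 1: "?D (h, 0) = Df (\<lambda>y. frechet_derivative f (at y) b) x h"
  by (rule fun_cong[OF Df_at])
 have bl: "bounded_linear (Df f x)"
  by (rule has_derivative_bounded_linear[OF smooth_hder[OF f x]])
 have "((\<lambda>c. (x, c)) hder (\<lambda>h. (0, h))) (at b)" by (auto intro!: derivative_eq_intros)
 from hder_compose[OF this D]
 have "(Df f x hder (\<lambda>h. ?D (0, h))) (at b)" by (simp add: G_def)
 then have "(\<lambda>h. ?D (0, h)) = Df f x"
  by (rule has_derivative_unique[OF _ bounded_linear_imp_has_derivative[OF bl]])
 then have 2: "?D (0, k) = Df f x k" by (rule fun_cong)
 have "?D (h, k) = ?D ((h, 0) + (0, k))" by simp
 also have "\<dots> = ?D (h, 0) + ?D (0, k)" by (rule linear_add[OF hder_linear[OF D]])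
 finally show "?D (h, k) = Df (\<lambda>y. frechet_derivative f (at y) b) x h + Df f x k"
  by (simp add: 1 2)
qed

lemma smooth_map_continuous: "smooth_map_on A B (points A) f ==> continuous_map (manifold_topology A) (manifold_topology B) f"
 unfolding smooth_map_on_def by (simp add: subtopology_topspace flip: topspace_manifold_topology)

lemma (in atlas_locale) local_representative:
 assumes f: "smooth_map_on A A (points A) f" and cd: "c \<in> A" "d \<in> A"
 defines "S \<equiv> mp c ` (dm c \<inter> points A \<inter> f -` dm d)"
 shows "open S" "smooth_on (mp d \<circ> f \<circ> iv c) S"
  and "x \<in> dm c ==> f x \<in> dm d ==> mp c x \<in> S"
  and "y \<in> S ==> iv c y \<in> dm c \<and> mp c (iv c y) = y \<and> f (iv c y) \<in> dm d"
proof -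
 have "openin MT {x \<in> topspace MT. f x \<in> dm d}"
  by (rule openin_continuous_map_preimage[OF smooth_map_continuous[OF f] openin_chart_dom[OF cd(2)]])
 moreover have "dm c \<inter> points A \<inter> f -` dm d = dm c \<inter> {x \<in> topspace MT. f x \<in> dm d}" by auto
 ultimately show "open S" unfolding S_def using open_chart_image_openin[OF cd(1)] by simp
 show "smooth_on (mp d \<circ> f \<circ> iv c) S" using f cd unfolding smooth_map_on_def S_def by blast
 show "x \<in> dm c ==> f x \<in> dm d ==> mp c x \<in> S" using points_chart[OF cd(1)] by (auto simp: S_def)
 show "y \<in> S ==> iv c y \<in> dm c \<and> mp c (iv c y) = y \<and> f (iv c y) \<in> dm d"
  using cd(1) by (auto simp: S_def)
qed

lemma (in atlas_locale) C1_curve_compose: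
 assumes f: "smooth_map_on A A (points A) f" and q: "C1_curve A q"
 shows "C1_curve A (\<lambda>t. f (q t))"
  and "c \<in> A ==> d \<in> A ==> q t \<in> dm c ==> f (q t) \<in> dm d ==>
   velocity A (\<lambda>t. f (q t)) t d = Df (mp d \<circ> f \<circ> iv c) (mp c (q t)) (velocity A q t c)"
proof -
 have qc: "rcont MT q" by (rule C1_cont[OF q])
 have fc: "rcont MT (\<lambda>t. f (q t))"
  using continuous_map_compose[OF qc smooth_map_continuous[OF f]] by (simp add: o_def)
 have der: "((\<lambda>t. mp d (f (q t))) has_vector_derivative
   Df (mp d \<circ> f \<circ> iv c) (mp c (q t)) (velocity A q t c)) (at t)"
  if cd: "c \<in> A" "d \<in> A" and t: "q t \<in> dm c" "f (q t) \<in> dm d" for c d t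
 proof -
  note R = local_representative[OF f cd]
  have "(((mp d \<circ> f \<circ> iv c) \<circ> (\<lambda>t. mp c (q t))) has_vector_derivative
   Df (mp d \<circ> f \<circ> iv c) (mp c (q t)) (velocity A q t c)) (at t)"
   by (rule vector_derivative_diff_chain_within[OF C1_coords_hvd[OF q cd(1) t(1)]
      has_derivative_at_withinI[OF smooth_hder[OF R(2) R(3)[OF t]]]])
  then show ?thesis
   by (rule hvd_cong_open[OF _ open_curve_dom[OF qc cd(1)]]) (use t cd in auto)
 qed
 show "C1_curve A (\<lambda>t. f (q t))"
 proof (rule C1_curveI)
  fix t0
  obtain c d where c: "c \<in> A" "q t0 \<in> dm c" and d: "d \<in> A" "f (q t0) \<in> dm d"
   using curve_in_points[OF qc, of t0] curve_in_points[OF fc, of t0] unfolding points_def by blast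
  note R = local_representative[OF f c(1) d(1)]
  let ?J = "{t. q t \<in> dm c} \<inter> {t. f (q t) \<in> dm d}"
  have "open ?J" by (intro open_Int open_curve_dom[OF qc c(1)] open_curve_dom[OF fc d(1)])
  then obtain e where e: "e > 0" "ball t0 e \<subseteq> ?J" using c d open_contains_ball by blast
  have "cont (ball t0 e) (\<lambda>t. (mp c (q t), velocity A q t c))"
   by (intro cont_Pair cont_subset[OF cont_coords[OF qc c(1)]]
     cont_subset[OF C1_cont_velocity[OF q c(1)]]) (use e in auto)
  from cont_compose[OF smooth_Df_joint_cont[OF R(2)] this]
  have "cont (ball t0 e) (\<lambda>t. Df (mp d \<circ> f \<circ> iv c) (mp c (q t)) (velocity A q t c))"
   using R(3) e(2) by force
  then show "\<exists>c\<in>A. \<exists>e>0. \<exists>g. (\<forall>t\<in>ball t0 e. f (q t) \<in> dm c \<and>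
   ((\<lambda>t. mp c (f (q t))) hvd g t) (at t)) \<and> cont (ball t0 e) g"
   by (intro bexI[OF _ d(1)] exI[of _ e] conjI e(1)
     exI[of _ "\<lambda>t. Df (mp d \<circ> f \<circ> iv c) (mp c (q t)) (velocity A q t c)"])
    (use e(2) in \<open>auto intro!: der[OF c(1) d(1)]\<close>)
 qed
 show "velocity A (\<lambda>t. f (q t)) t d = Df (mp d \<circ> f \<circ> iv c) (mp c (q t)) (velocity A q t c)"
  if "c \<in> A" "d \<in> A" "q t \<in> dm c" "f (q t) \<in> dm d"
  by (rule velocity_eqI[OF that(2,4) der[OF that]])
qed

context atlas_locale
begin

text \<open>The bundle chart of a chart: the coordinates of a covector are its values on the coordinate vector fields.\<close>

definition lift :: "('a, 'e) chart => ('a \<times> ('a, 'e) cotangent, 'e \<times> 'e) chart" where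
 "lift c = (SIGMA x:dm c. cotangent_space A x,
   \<lambda>(x, p). (mp c x, \<Sum>b\<in>Basis. p (tangent_of_coords A c x b) *\<^sub>R b))"

lemma cotangent_bundle_atlas_lift: "cotangent_bundle_atlas A = lift ` A"
 by (simp add: cotangent_bundle_atlas_def lift_def[abs_def])

lemma lift_dom: "z \<in> dm (lift c) \<longleftrightarrow> fst z \<in> dm c \<and> snd z \<in> cotangent_space A (fst z)"
 by (cases z) (simp add: lift_def)

lemma fst_lift [simp]: "fst (mp (lift c) z) = mp c (fst z)" by (simp add: lift_def split_beta)

lemma cotangent_pairing:
 assumes c: "c \<in> charts_at A (fst z)" and p: "snd z \<in> cotangent_space A (fst z)" and v: "v \<in> tangent_space A (fst z)"
 shows "snd z v = snd (mp (lift c) z) \<bullet> v c"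
proof -
 define h where "h w = snd z (tangent_of_coords A c (fst z) w)" for w
 have comb: "h (a *\<^sub>R u + b *\<^sub>R w) = a * h u + b * h w" for a b u w
  using p unfolding h_def tangent_of_coords_linear[OF c] cotangent_space_def
  by (simp add: tangent_of_coords_in[OF c])
 have "linear h"
 proof (rule linearI)
  show "h (u + w) = h u + h w" for u w using comb[of 1 u 1 w] by simp
  show "h (r *\<^sub>R u) = r *\<^sub>R h u" for r u using comb[of r u 0 u] by simp
 qed
 have "snd z v = h (\<Sum>b\<in>Basis. (v c \<bullet> b) *\<^sub>R b)"
  unfolding h_def euclidean_representation using tangent_of_coords_coords[OF v c] by simp
 also have "\<dots> = (\<Sum>b\<in>Basis. (v c \<bullet> b) * h b)" by (simp add: linear_sum[OF \<open>linear h\<close>] linear_cmul[OF \<open>linear h\<close>])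
 also have "\<dots> = snd (mp (lift c) z) \<bullet> v c"
  by (simp add: lift_def split_beta h_def inner_sum_left inner_sum_right inner_commute mult.commute)
 finally show ?thesis .
qed

text \<open>The covector with coordinate vector P, an inverse of the bundle chart on a fibre.\<close>

definition covector :: "('a, 'e) chart => 'a => 'e => ('a, 'e) cotangent" where
 "covector c x P = (\<lambda>v\<in>tangent_space A x. P \<bullet> v c)"

lemma covector_in: "covector c x P \<in> cotangent_space A x"
 unfolding cotangent_space_def covector_def
 by (auto simp: tangent_space_combination inner_add_right simp del: split_paired_All)

lemma lift_covector:
 assumes c: "c \<in> charts_at A x" shows "mp (lift c) (x, covector c x P) = (mp c x, P)"
 by (simp add: lift_def covector_def tangent_of_coords_in[OF c] tangent_of_coords_self[OF c] euclidean_representation)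

lemma cotangent_eq_covector:
 assumes "c \<in> charts_at A (fst z)" "snd z \<in> cotangent_space A (fst z)"
 shows "snd z = covector c (fst z) (snd (mp (lift c) z))"
proof (rule ext)
 fix v
 show "snd z v = covector c (fst z) (snd (mp (lift c) z)) v"
  using cotangent_pairing[OF assms, of v] assms(2)
  by (cases "v \<in> tangent_space A (fst z)") (auto simp: covector_def cotangent_space_def extensional_def)
qed

lemma lift_inv:
 assumes c: "c \<in> A" and z: "z \<in> dm (lift c)" shows "iv (lift c) (mp (lift c) z) = z"
proof -
 have "inj_on (mp (lift c)) (dm (lift c))"
 proof (rule inj_onI)
  fix z w assume z: "z \<in> dm (lift c)" and w: "w \<in> dm (lift c)" and eq: "mp (lift c) z = mp (lift c) w"
  have f: "fst z = fst w"
   using arg_cong[OF eq, of fst] z w inj_onD[OF chart_inj[OF c]] by (simp add: lift_dom)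
  have "c \<in> charts_at A (fst z)" "c \<in> charts_at A (fst w)" using c z w by (auto simp: lift_dom charts_at_iff)
  then have "snd z = snd w" using cotangent_eq_covector[of c z] cotangent_eq_covector[of c w] z w eq f by (simp add: lift_dom)
  with f show "z = w" by (rule prod_eqI)
 qed
 then show ?thesis unfolding chart_inv_def using z by (rule inv_into_f_f)
qed

lemma lift_image:
 assumes c: "c \<in> A" and U: "U \<subseteq> dm c"
 shows "mp (lift c) ` {z \<in> dm (lift c). fst z \<in> U} = (mp c ` U) \<times> (UNIV :: 'e set)"
proof (intro equalityI subsetI)
 fix y assume y: "y \<in> (mp c ` U) \<times> (UNIV :: 'e set)"
 then obtain x where x: "x \<in> U" "fst y = mp c x" by auto
 have "c \<in> charts_at A x" using c x U by (auto simp: charts_at_iff)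
 then have "y = mp (lift c) (x, covector c x (snd y))" using x by (simp add: lift_covector prod_eq_iff)
 moreover have "(x, covector c x (snd y)) \<in> {z \<in> dm (lift c). fst z \<in> U}" using x U covector_in by (auto simp: lift_dom)
 ultimately show "y \<in> mp (lift c) ` {z \<in> dm (lift c). fst z \<in> U}" by (rule image_eqI)
qed (auto simp: lift_def)

lemma lift_chart_inv:
 assumes c: "c \<in> A" and y: "fst y \<in> mp c ` dm c"
 shows "iv (lift c) y = (iv c (fst y), covector c (iv c (fst y)) (snd y))"
proof -
 let ?z = "(iv c (fst y), covector c (iv c (fst y)) (snd y))"
 have z: "?z \<in> dm (lift c)" using chart_inv_in[OF y] covector_in by (simp add: lift_dom)
 have "mp (lift c) ?z = y"
  using lift_covector[of c "iv c (fst y)" "snd y"] chart_inv_in[OF y] map_chart_inv[OF y] c by (simp add: charts_at_iff)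
 then show ?thesis using lift_inv[OF c z] by simp
qed

lemma lift_transition:
 assumes cd: "c \<in> A" "d \<in> A" and y: "fst y \<in> mp c ` (dm c \<inter> dm d)"
 shows "(mp (lift d) \<circ> iv (lift c)) y = ((mp d \<circ> iv c) (fst y),
  \<Sum>b\<in>Basis. (snd y \<bullet> Df (mp c \<circ> iv d) ((mp d \<circ> iv c) (fst y)) b) *\<^sub>R b)"
proof -
 let ?x = "iv c (fst y)"
 have x: "?x \<in> dm c" "?x \<in> dm d" "fst y \<in> mp c ` dm c" using y cd by auto
 have at: "c \<in> charts_at A ?x" "d \<in> charts_at A ?x" using x cd by (auto simp: charts_at_iff)
 have "covector c ?x (snd y) (tangent_of_coords A d ?x b) = snd y \<bullet> Df (mp c \<circ> iv d) (mp d ?x) b" for b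
  unfolding covector_def restrict_apply'[OF tangent_of_coords_in[OF at(2)]]
  using at by (simp add: tangent_of_coords_def)
 then have "mp (lift d) (?x, covector c ?x (snd y)) = (mp d ?x,
  \<Sum>b\<in>Basis. (snd y \<bullet> Df (mp c \<circ> iv d) (mp d ?x) b) *\<^sub>R b)" by (simp add: lift_def)
 then show ?thesis by (simp add: lift_chart_inv[OF cd(1) x(3)])
qed

text \<open>A change of bundle charts sends P to its image under the transposed inverse of the derivative of the change of charts, which depends smoothly on the base point.\<close>

theorem smooth_cotangent_atlas: "smooth_atlas (cotangent_bundle_atlas A)"
 unfolding smooth_atlas_def cotangent_bundle_atlas_lift
proof (intro conjI ballI)
 fix C assume "C \<in> lift ` A"
 then obtain c where c: "c \<in> A" "C = lift c" by blast
 show "inj_on (mp C) (dm C)" unfolding c(2) by (rule inj_on_inverseI[where g = "iv (lift c)"]) (rule lift_inv[OF c(1)])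
 have "mp C ` dm C = (mp c ` dm c) \<times> UNIV"
  using lift_image[OF c(1) order_refl] unfolding c(2) by (metis (no_types, lifting) Collect_cong Collect_mem_eq lift_dom)
 then show "open (mp C ` dm C)" using open_Times[OF open_chart_image[OF c(1)] open_UNIV] by simp
 fix D assume "D \<in> lift ` A"
 then obtain d where d: "d \<in> A" "D = lift d" by blast
 let ?T = "mp c ` (dm c \<inter> dm d)"
 have "dm C \<inter> dm D = {z \<in> dm (lift c). fst z \<in> dm c \<inter> dm d}"
  unfolding c(2) d(2) by (auto simp: lift_dom)
 then have im: "mp C ` (dm C \<inter> dm D) = ?T \<times> UNIV"
  using lift_image[OF c(1), of "dm c \<inter> dm d"] unfolding c(2) by simp
 have TU: "open (?T \<times> (UNIV :: 'e set))" by (intro open_Times open_overlap c d open_UNIV)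
 then show "open (mp C ` (dm C \<inter> dm D))" unfolding im .
 let ?\<tau> = "mp d \<circ> iv c" and ?T' = "mp d ` (dm d \<inter> dm c)"
 have \<tau>: "smooth_on ?\<tau> ?T" by (rule smooth_transition[OF c(1) d(1)])
 have "smooth_on (\<lambda>y. Df (mp c \<circ> iv d) (?\<tau> y) b) ?T" for b
  by (rule smooth_on_compose[OF open_overlap[OF c(1) d(1)] _ \<tau> smooth_on_frechet[OF smooth_transition[OF d(1) c(1)]]]) (use c in auto)
 from smooth_on_compose[OF TU _ smooth_on_bounded_linear[OF bounded_linear_fst] this]
 have D: "smooth_on (\<lambda>y :: 'e \<times> 'e. Df (mp c \<circ> iv d) (?\<tau> (fst y)) b) (?T \<times> UNIV)" for b by force
 have "smooth_on (\<lambda>y. (?\<tau> (fst y), \<Sum>b\<in>Basis. (snd y \<bullet> Df (mp c \<circ> iv d) (?\<tau> (fst y)) b) *\<^sub>R b)) (?T \<times> UNIV)"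
 proof (rule smooth_on_Pair[OF TU])
  show "smooth_on (\<lambda>y :: 'e \<times> 'e. ?\<tau> (fst y)) (?T \<times> UNIV)"
   by (rule smooth_on_compose[OF TU _ smooth_on_bounded_linear[OF bounded_linear_fst] \<tau>]) auto
  have "smooth_on (\<lambda>y :: 'e \<times> 'e. snd y \<bullet> Df (mp c \<circ> iv d) (?\<tau> (fst y)) b) (?T \<times> UNIV)" for b
   by (rule smooth_on_inner[OF TU smooth_on_bounded_linear[OF bounded_linear_snd] D])
  then show "smooth_on (\<lambda>y :: 'e \<times> 'e. \<Sum>b\<in>Basis. (snd y \<bullet> Df (mp c \<circ> iv d) (?\<tau> (fst y)) b) *\<^sub>R b) (?T \<times> UNIV)"
   by (intro smooth_on_sum[OF TU] smooth_on_scaleR[OF TU] smooth_on_const)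
 qed
 then show "smooth_on (mp D \<circ> iv C) (mp C ` (dm C \<inter> dm D))"
  unfolding im by (rule smooth_on_cong[OF TU, rotated]) (use lift_transition[OF c(1) d(1)] c(2) d(2) in auto)
qed

end

locale cotangent = atlas_locale A for A :: "('a, 'e::euclidean_space) atlas"
begin

abbreviation "N \<equiv> cotangent_bundle_atlas A"

end

sublocale cotangent \<subseteq> N: atlas_locale "cotangent_bundle_atlas A"
 by unfold_locales (rule smooth_cotangent_atlas)

context cotangent
begin

lemma lift_in: "c \<in> A ==> lift c \<in> N" by (simp add: cotangent_bundle_atlas_lift)

lemma points_N: "points N = cotangent_bundle A"
 by (auto simp: points_def cotangent_bundle_atlas_lift lift_def cotangent_bundle_def)

lemma in_points_N: "z \<in> points N \<longleftrightarrow> fst z \<in> points A \<and> snd z \<in> cotangent_space A (fst z)"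
 unfolding points_N cotangent_bundle_def by (cases z) simp

lemma chart_at_N: assumes "z \<in> points N" obtains c where "c \<in> A" "chart_at N z = lift c" "z \<in> dm (lift c)" "fst z \<in> dm c"
  "c \<in> charts_at A (fst z)" "lift c \<in> charts_at N z"
proof -
 have 1: "chart_at N z \<in> charts_at N z" by (rule chart_at_in[OF assms])
 then obtain c where c: "c \<in> A" "chart_at N z = lift c" by (auto simp: charts_at_iff cotangent_bundle_atlas_lift)
 then have "z \<in> dm (lift c)" using 1 by (auto simp: charts_at_iff)
 with c 1 show thesis by (intro that) (auto simp: lift_dom charts_at_iff)
qed

lemma continuous_fst: "continuous_map (manifold_topology N) MT fst"
 unfolding continuous_map_into_manifold
proof (intro conjI ballI allI impI)
 show "fst ` topspace (manifold_topology N) \<subseteq> points A" by (auto simp: in_points_N)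
next
 fix c W assume c: "c \<in> A" and W: "open (W :: 'e set)"
 have "{z \<in> topspace (manifold_topology N). fst z \<in> dm c \<and> mp c (fst z) \<in> W} =
  dm (lift c) \<inter> mp (lift c) -` (W \<times> UNIV)"
  unfolding vimage_def mem_Times_iff fst_lift using points_chart[OF c] by (auto simp: in_points_N lift_dom)
 then show "openin (manifold_topology N) {z \<in> topspace (manifold_topology N). fst z \<in> dm c \<and> mp c (fst z) \<in> W}"
  using openin_chart_preimage[OF lift_in[OF c] open_Times[OF W open_UNIV]] by simp
qed

lemma C1_curve_fst:
 assumes \<zeta>: "C1_curve N \<zeta>"
 shows "C1_curve A (\<lambda>t. fst (\<zeta> t))"
  and "c \<in> A ==> fst (\<zeta> t) \<in> dm c ==> velocity A (\<lambda>t. fst (\<zeta> t)) t c = fst (velocity N \<zeta> t (lift c))"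
proof -
 have \<zeta>c: "rcont N.MT \<zeta>" by (rule C1_cont[OF \<zeta>])
 have dom: "\<zeta> t \<in> dm (lift c)" if "fst (\<zeta> t) \<in> dm c" for t c
  using that curve_in_points[OF \<zeta>c, of t] by (auto simp: lift_dom in_points_N)
 have der: "((\<lambda>t. mp c (fst (\<zeta> t))) hvd fst (velocity N \<zeta> t (lift c))) (at t)"
  if "c \<in> A" "fst (\<zeta> t) \<in> dm c" for c t
  using blin_hvd[OF bounded_linear_fst C1_coords_hvd[OF \<zeta> lift_in[OF that(1)] dom[OF that(2)]]] by simp
 show "C1_curve A (\<lambda>t. fst (\<zeta> t))"
 proof (rule C1_curveI)
  fix t0
  obtain c where c: "c \<in> A" "fst (\<zeta> t0) \<in> dm c" by (rule chart_at_N[OF curve_in_points[OF \<zeta>c, of t0]])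
  have "open {t. \<zeta> t \<in> dm (lift c)}" by (rule open_curve_dom[OF \<zeta>c lift_in[OF c(1)]])
  then obtain e where e: "e > 0" "ball t0 e \<subseteq> {t. \<zeta> t \<in> dm (lift c)}" using dom[OF c(2)] open_contains_ball by blast
  have "cont (ball t0 e) (\<lambda>t. fst (velocity N \<zeta> t (lift c)))"
   by (rule cont_fst[OF cont_subset[OF C1_cont_velocity[OF \<zeta> lift_in[OF c(1)]] e(2)]])
  then show "\<exists>c\<in>A. \<exists>e>0. \<exists>g. (\<forall>t\<in>ball t0 e. fst (\<zeta> t) \<in> dm c \<and>
   ((\<lambda>t. mp c (fst (\<zeta> t))) hvd g t) (at t)) \<and> cont (ball t0 e) g"
   using e(2) by (intro bexI[OF _ c(1)] exI[of _ e] conjI e(1) exI) (auto simp: lift_dom intro!: der[OF c(1)])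
 qed
 show "velocity A (\<lambda>t. fst (\<zeta> t)) t c = fst (velocity N \<zeta> t (lift c))" if "c \<in> A" "fst (\<zeta> t) \<in> dm c"
  by (rule velocity_eqI[OF that der[OF that]])
qed

text \<open>The canonical one-form on the velocity of the curve, the integrand of the action.\<close>

definition density :: "(real => 'a \<times> ('a, 'e) cotangent) => real => real" where
 "density \<zeta> t = snd (\<zeta> t) (velocity A (\<lambda>t. fst (\<zeta> t)) t)"

lemma density_coords:
 assumes \<zeta>: "C1_curve N \<zeta>" and c: "c \<in> A" "fst (\<zeta> t) \<in> dm c"
 shows "density \<zeta> t = snd (mp (lift c) (\<zeta> t)) \<bullet> fst (velocity N \<zeta> t (lift c))"
 unfolding density_def C1_curve_fst(2)[OF \<zeta> c, symmetric]
 using curve_in_points[OF C1_cont[OF \<zeta>], of t] c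
 by (intro cotangent_pairing velocity_tangent[OF C1_curve_fst(1)[OF \<zeta>]]) (auto simp: charts_at_iff in_points_N)

lemma density_continuous: assumes \<zeta>: "C1_curve N \<zeta>" shows "cont UNIV (density \<zeta>)"
proof (intro cont_at_imp ballI)
 fix t0
 have \<zeta>c: "rcont N.MT \<zeta>" by (rule C1_cont[OF \<zeta>])
 obtain c where c: "c \<in> A" "fst (\<zeta> t0) \<in> dm c" "\<zeta> t0 \<in> dm (lift c)"
  by (rule chart_at_N[OF curve_in_points[OF \<zeta>c, of t0]])
 let ?O = "{t. \<zeta> t \<in> dm (lift c)}"
 have "cont ?O (\<lambda>t. snd (mp (lift c) (\<zeta> t)) \<bullet> fst (velocity N \<zeta> t (lift c)))"
  by (intro continuous_on_inner cont_snd cont_fst cont_coords[OF \<zeta>c lift_in[OF c(1)]]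
    C1_cont_velocity[OF \<zeta> lift_in[OF c(1)]])
 then have "cont ?O (density \<zeta>)" by (rule continuous_on_eq) (use density_coords[OF \<zeta> c(1)] in \<open>auto simp: lift_dom\<close>)
 then show "isCont (density \<zeta>) t0"
  using cont_at[OF open_curve_dom[OF \<zeta>c lift_in[OF c(1)]]] c(3) by blast
qed

end

section \<open>Symplectic maps and the action\<close>

text \<open>The standard symplectic form, with the sign of the exterior derivative of the form p dx.\<close>

definition Om :: "'v::real_inner \<times> 'v => 'v \<times> 'v => real" where
 "Om a b = snd a \<bullet> fst b - snd b \<bullet> fst a"

text \<open>The product rule for the pulled back form along a curve of base points and vectors.\<close>

lemma action_integrand_derivative:
 fixes \<Psi> :: "'v::euclidean_space \<times> 'v => 'v \<times> 'v"
 assumes S: "open S" and \<Psi>: "smooth_on \<Psi> S"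
 defines "G \<equiv> \<lambda>q. Df \<Psi> (fst q) (snd q)"
 assumes \<zeta>: "(\<zeta> hvd h) (at s)" "\<zeta> s \<in> S" and b: "(b hvd k) (at (s :: real))"
 shows "((\<lambda>s. snd (\<Psi> (\<zeta> s)) \<bullet> fst (G (\<zeta> s, b s))) has_vector_derivative
  snd (\<Psi> (\<zeta> s)) \<bullet> fst (Df G (\<zeta> s, b s) (h, k)) + snd (G (\<zeta> s, h)) \<bullet> fst (G (\<zeta> s, b s))) (at s)"
proof -
 have 1: "((\<lambda>s. snd ((\<Psi> \<circ> \<zeta>) s)) hvd snd (Df \<Psi> (\<zeta> s) h)) (at s)"
  by (rule blin_hvd[OF bounded_linear_snd],
    rule vector_derivative_diff_chain_within[OF \<zeta>(1) has_derivative_at_withinI[OF smooth_hder[OF \<Psi> \<zeta>(2)]]])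
 have G: "(G hder Df G (\<zeta> s, b s)) (at (\<zeta> s, b s))"
  by (rule smooth_hder[OF smooth_Df_joint(1)[OF S \<Psi>, folded G_def]]) (use \<zeta>(2) in simp)
 have 2: "((\<lambda>s. fst ((G \<circ> (\<lambda>s. (\<zeta> s, b s))) s)) hvd fst (Df G (\<zeta> s, b s) (h, k))) (at s)"
  by (rule blin_hvd[OF bounded_linear_fst],
    rule vector_derivative_diff_chain_within[OF hvd_Pair[OF \<zeta>(1) b] has_derivative_at_withinI[OF G]])
 show ?thesis
  using bounded_bilinear.has_vector_derivative[OF bounded_bilinear_inner 1 2] by (simp add: G_def)
qed

lemma action_integrand_symmetric:
 fixes \<Psi> :: "'v::euclidean_space \<times> 'v => 'v \<times> 'v"
 assumes S: "open S" "x \<in> S" and \<Psi>: "smooth_on \<Psi> S"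
 defines "G \<equiv> \<lambda>q. Df \<Psi> (fst q) (snd q)"
 shows "Df G (x, a) (b, k) = Df G (x, b) (a, k)"
 unfolding G_def smooth_Df_joint(2)[OF S(1) \<Psi> S(2)]
 using smooth_on_second_derivative_symmetric[OF S \<Psi>] by metis

context cotangent
begin

lemma differential_fst:
 assumes z: "z \<in> points N" and \<zeta>: "\<zeta> \<in> tangent_space N z"
 shows "differential N A fst z \<zeta> = (\<lambda>d. if d \<in> charts_at A (fst z) then fst (\<zeta> (lift d)) else 0)"
proof (rule ext)
 fix d
 obtain c where c: "chart_at N z = lift c" "lift c \<in> charts_at N z" by (rule chart_at_N[OF z])
 show "differential N A fst z \<zeta> d = (if d \<in> charts_at A (fst z) then fst (\<zeta> (lift d)) else 0)"
 proof (cases "d \<in> charts_at A (fst z)")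
  case True
  then have d: "lift d \<in> charts_at N z" using z by (simp add: charts_at_iff lift_in lift_dom in_points_N)
  have eq: "mp d \<circ> fst \<circ> iv (lift c) = (\<lambda>y. fst ((mp (lift d) \<circ> iv (lift c)) y))" by (rule ext) simp
  have "Df (mp d \<circ> fst \<circ> iv (lift c)) (mp (lift c) z) h =
   fst (Df (mp (lift d) \<circ> iv (lift c)) (mp (lift c) z) h)" for h
   unfolding eq
   by (rule fun_cong[OF Df_at[symmetric]], rule has_derivative_fst, rule N.transition_derivative[OF c(2) d])
  then show ?thesis using True N.tangent_transition[OF \<zeta> c(2) d] c(1) by (simp add: differential_def Let_def)
 next
  case False
  then show ?thesis by (simp add: differential_def Let_def)
 qed
qed

lemma fst_tangent:
 assumes z: "z \<in> points N" and \<zeta>: "\<zeta> \<in> tangent_space N z"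
 shows "(\<lambda>d. if d \<in> charts_at A (fst z) then fst (\<zeta> (lift d)) else 0) \<in> tangent_space A (fst z)"
 unfolding tangent_space_def
proof (intro CollectI conjI allI impI ballI)
 fix c d assume cd: "c \<in> charts_at A (fst z)" "d \<in> charts_at A (fst z)"
 then have l: "lift c \<in> charts_at N z" "lift d \<in> charts_at N z" using z by (simp_all add: charts_at_iff lift_in lift_dom in_points_N)
 have cdA: "c \<in> A" "d \<in> A" and zcd: "fst z \<in> dm c" "fst z \<in> dm d" using cd by (auto simp: charts_at_iff)
 let ?D = "Df (mp d \<circ> iv c) (mp c (fst z))"
 have "((\<lambda>y. (mp d \<circ> iv c) (fst y)) hder (\<lambda>h. ?D (fst h))) (at (mp (lift c) z))"
  using transition_derivative[OF cd]
  by (intro hder_compose[OF bounded_linear_imp_has_derivative[OF bounded_linear_fst]]) (simp add: o_def)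
 moreover have "((\<lambda>y. (mp d \<circ> iv c) (fst y)) has_derivative
  (\<lambda>h. fst (Df (mp (lift d) \<circ> iv (lift c)) (mp (lift c) z) h))) (at (mp (lift c) z))"
 proof (rule hder_cong_open[OF has_derivative_fst[OF N.transition_derivative[OF l]]])
  show "open ((mp c ` (dm c \<inter> dm d)) \<times> (UNIV :: 'e set))" by (intro open_Times open_overlap cdA open_UNIV)
  show "mp (lift c) z \<in> (mp c ` (dm c \<inter> dm d)) \<times> UNIV" using zcd by (auto simp: mem_Times_iff)
  show "fst ((mp (lift d) \<circ> iv (lift c)) y) = (mp d \<circ> iv c) (fst y)"
   if "y \<in> (mp c ` (dm c \<inter> dm d)) \<times> UNIV" for y
   using lift_transition[OF cdA, of y] that by (simp add: mem_Times_iff)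
 qed
 ultimately have eq: "(\<lambda>h. ?D (fst h)) = (\<lambda>h. fst (Df (mp (lift d) \<circ> iv (lift c)) (mp (lift c) z) h))"
  by (rule has_derivative_unique)
 show "(if d \<in> charts_at A (fst z) then fst (\<zeta> (lift d)) else 0) = ?D (if c \<in> charts_at A (fst z) then fst (\<zeta> (lift c)) else 0)"
  using fun_cong[OF eq, of "\<zeta> (lift c)"] N.tangent_transition[OF \<zeta> l] cd by simp
qed simp

lemma liouville_form_coords:
 assumes z: "z \<in> points N" and \<zeta>: "\<zeta> \<in> tangent_space N z" and c: "c \<in> charts_at A (fst z)"
 shows "liouville_form A z \<zeta> = snd (mp (lift c) z) \<bullet> fst (\<zeta> (lift c))"
proof -
 have "liouville_form A z \<zeta> = snd z (differential N A fst z \<zeta>)" by (simp add: liouville_form_def split_beta)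
 also have "\<dots> = snd (mp (lift c) z) \<bullet> differential N A fst z \<zeta> c"
  using z fst_tangent[OF z \<zeta>] unfolding differential_fst[OF z \<zeta>] in_points_N by (intro cotangent_pairing c) auto
 finally show ?thesis using c by (simp add: differential_fst[OF z \<zeta>])
qed

text \<open>In a bundle chart the canonical one-form reads p dx, and differentiating it gives the standard form.\<close>

lemma canonical_symplectic_form_coords:
 assumes z: "z \<in> points N"
 shows "canonical_symplectic_form A z \<xi> \<eta> = Om (\<xi> (chart_at N z)) (\<eta> (chart_at N z))"
proof -
 obtain c where c: "c \<in> A" "chart_at N z = lift c" "z \<in> dm (lift c)" by (rule chart_at_N[OF z])
 let ?coeff = "\<lambda>w y. liouville_form A (iv (lift c) y) (tangent_of_coords N (lift c) (iv (lift c) y) w)"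
 have coeff: "?coeff w y = snd y \<bullet> fst w" if y: "y \<in> mp (lift c) ` dm (lift c)" for w y
 proof -
  have in': "iv (lift c) y \<in> dm (lift c)" by (rule N.chart_inv_in[OF y])
  then have l: "lift c \<in> charts_at N (iv (lift c) y)" using c(1) by (simp add: charts_at_iff lift_in)
  show ?thesis
   using liouville_form_coords[OF N.points_chart[OF lift_in[OF c(1)] in'] N.tangent_of_coords_in[OF l, of w], of c]
    in' c(1) N.tangent_of_coords_self[OF l] N.map_chart_inv[OF y] by (simp add: charts_at_iff lift_dom)
 qed
 have "(?coeff w hder (\<lambda>h. snd h \<bullet> fst w)) (at (mp (lift c) z))" for w
 proof (rule hder_cong_open[OF _ N.open_chart_image[OF lift_in[OF c(1)]]])
  show "((\<lambda>y :: 'e \<times> 'e. snd y \<bullet> fst w) hder (\<lambda>h. snd h \<bullet> fst w)) (at (mp (lift c) z))"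
   by (intro has_derivative_inner_left has_derivative_snd has_derivative_ident)
 qed (use c(3) coeff in auto)
 then have "Df (?coeff w) (mp (lift c) z) = (\<lambda>h. snd h \<bullet> fst w)" for w
  by (rule Df_at[symmetric])
 then show ?thesis unfolding canonical_symplectic_form_def exterior_derivative_def Let_def c(2) by (simp add: Om_def)
qed

definition rep :: "('a \<times> ('a, 'e) cotangent => 'a \<times> ('a, 'e) cotangent) => 'a \<times> ('a, 'e) cotangent => 'e \<times> 'e => 'e \<times> 'e" where
 "rep f z = mp (chart_at N (f z)) \<circ> f \<circ> iv (chart_at N z)"

definition coords :: "'a \<times> ('a, 'e) cotangent => 'e \<times> 'e" where "coords z = mp (chart_at N z) z"

definition drep :: "('a \<times> ('a, 'e) cotangent => 'a \<times> ('a, 'e) cotangent) => 'a \<times> ('a, 'e) cotangent => 'e \<times> 'e => 'e \<times> 'e" where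
 "drep f z = Df (rep f z) (coords z)"

text \<open>A symplectomorphism f with inverse g. Invariance of the form is stated as the differential of g being adjoint to that of f, which is how it is used: vectors at the image are transported back.\<close>

definition symplectic_pair where
 "symplectic_pair f g \<longleftrightarrow> smooth_map_on N N (points N) f \<and> smooth_map_on N N (points N) g \<and>
   (\<forall>z\<in>points N. f z \<in> points N \<and> g z \<in> points N \<and> g (f z) = z \<and> f (g z) = z \<and>
    (\<forall>\<xi> \<eta>. Om \<xi> (drep g (f z) \<eta>) = Om (drep f z \<xi>) \<eta>))"

lemma symplectic_pair_swap: assumes "symplectic_pair f g" shows "symplectic_pair g f"
proof -
 have anti: "Om a b = - Om b a" for a b :: "'e \<times> 'e" by (simp add: Om_def)
 have "Om \<xi> (drep f (g w) \<eta>) = Om (drep g w \<xi>) \<eta>" if w: "w \<in> points N" for w \<xi> \<eta>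
 proof -
  have "Om \<eta> (drep g (f (g w)) \<xi>) = Om (drep f (g w) \<eta>) \<xi>" "f (g w) = w"
   using assms w unfolding symplectic_pair_def by blast+
  then show ?thesis using anti[of \<xi> "drep f (g w) \<eta>"] anti[of "drep g w \<xi>" \<eta>] by simp
 qed
 then show ?thesis using assms unfolding symplectic_pair_def by blast
qed

lemma rep_derivative:
 assumes f: "smooth_map_on N N (points N) f" and z: "z \<in> points N"
 shows "(rep f z hder drep f z) (at (coords z))"
proof -
 have "f z \<in> points N" using smooth_map_continuous[OF f] z by (auto simp: continuous_map_def)
 then have *: "chart_at N z \<in> N" "z \<in> dm (chart_at N z)" "chart_at N (f z) \<in> N" "f z \<in> dm (chart_at N (f z))"
  using chart_at_in[OF z] chart_at_in[of "f z" N] by (simp_all add: charts_at_iff)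
 show ?thesis unfolding drep_def rep_def coords_def
  by (rule smooth_hder[OF N.local_representative(2)[OF f *(1,3)] N.local_representative(3)[OF f *(1,3,2,4)]])
qed

lemma rep_inverse:
 assumes fg: "smooth_map_on N N (points N) f" "smooth_map_on N N (points N) g"
  and inv: "\<And>z. z \<in> points N ==> f z \<in> points N \<and> g (f z) = z \<and> f (g z) = z" and z: "z \<in> points N"
 shows "\<exists>S. open S \<and> coords (f z) \<in> S \<and> (\<forall>y\<in>S. rep f z (rep g (f z) y) = y \<and> iv (chart_at N (f z)) y \<in> points N \<and>
  g (iv (chart_at N (f z)) y) \<in> dm (chart_at N z))"
  and "drep f z (drep g (f z) \<eta>) = \<eta>"
proof -
 let ?C = "chart_at N z" and ?D = "chart_at N (f z)"
 have fz: "f z \<in> points N" "g (f z) = z" using inv z by auto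
 have C: "?C \<in> N" "z \<in> dm ?C" and D: "?D \<in> N" "f z \<in> dm ?D"
  using chart_at_in[OF z] chart_at_in[OF fz(1)] by (auto simp: charts_at_iff)
 let ?S = "mp ?D ` (dm ?D \<inter> points N \<inter> g -` dm ?C)"
 have zg: "g (f z) \<in> dm ?C" using fz C by simp
 note R = N.local_representative[OF fg(2) D(1) C(1)]
 have S: "open ?S" "coords (f z) \<in> ?S" using R(1) R(3)[OF D(2) zg] by (auto simp: coords_def)
 have id: "rep f z (rep g (f z) y) = y \<and> iv ?D y \<in> points N \<and> g (iv ?D y) \<in> dm ?C" if y: "y \<in> ?S" for y
  using R(4)[OF y] inv[of "iv ?D y"] N.points_chart[OF D(1), of "iv ?D y"] C(1) fz(2) by (simp add: rep_def)
 then show "\<exists>S. open S \<and> coords (f z) \<in> S \<and> (\<forall>y\<in>S. rep f z (rep g (f z) y) = y \<and> iv ?D y \<in> points N \<and>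
  g (iv ?D y) \<in> dm ?C)" using S by (intro exI[of _ ?S]) blast
 have v: "rep g (f z) (coords (f z)) = coords z" using D fz by (simp add: rep_def coords_def)
 have "((\<lambda>y. rep f z (rep g (f z) y)) hder (\<lambda>h. drep f z (drep g (f z) h))) (at (coords (f z)))"
  by (rule hder_compose[OF rep_derivative[OF fg(2) fz(1)]]) (simp add: v rep_derivative[OF fg(1) z])
 then have "((\<lambda>y. y) hder (\<lambda>h. drep f z (drep g (f z) h))) (at (coords (f z)))"
  by (rule hder_cong_open[OF _ S]) (use id in blast)
 from has_derivative_unique[OF this has_derivative_ident] show "drep f z (drep g (f z) \<eta>) = \<eta>" by (rule fun_cong)
qed

lemma symplectic_pair_inv:
 assumes f: "symplectomorphism_between N (canonical_symplectic_form A) (points N) (points N) f"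
 shows "symplectic_pair f (inv_into (points N) f)"
proof -
 let ?g = "inv_into (points N) f"
 have bij: "bij_betw f (points N) (points N)" and fs: "smooth_map_on N N (points N) f" and gs: "smooth_map_on N N (points N) ?g"
  and sy: "\<And>z \<xi> \<eta>. z \<in> points N ==> \<xi> \<in> tangent_space N z ==> \<eta> \<in> tangent_space N z ==>
   canonical_symplectic_form A (f z) (differential N N f z \<xi>) (differential N N f z \<eta>) = canonical_symplectic_form A z \<xi> \<eta>"
  using f unfolding symplectomorphism_between_def by blast+
 have inv: "f z \<in> points N \<and> ?g z \<in> points N \<and> ?g (f z) = z \<and> f (?g z) = z" if "z \<in> points N" for z
  using bij that by (auto simp: bij_betw_def inv_into_f_f f_inv_into_f inv_into_into)
 have "Om (drep f z a) (drep f z b) = Om a b" if z: "z \<in> points N" for z a b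
 proof -
  let ?C = "chart_at N z"
  have C: "?C \<in> charts_at N z" by (rule chart_at_in[OF z])
  have fz: "f z \<in> points N" using inv z by blast
  have d: "differential N N f z (tangent_of_coords N ?C z w) (chart_at N (f z)) = drep f z w" for w
   unfolding differential_def Let_def using chart_at_in[OF fz] N.tangent_of_coords_self[OF C]
   by (simp add: drep_def rep_def coords_def)
  show ?thesis
   using sy[OF z N.tangent_of_coords_in[OF C, of a] N.tangent_of_coords_in[OF C, of b]]
   unfolding canonical_symplectic_form_coords[OF z] canonical_symplectic_form_coords[OF fz] d N.tangent_of_coords_self[OF C] .
 qed
 from this[symmetric] have "Om \<xi> (drep ?g (f z) \<eta>) = Om (drep f z \<xi>) \<eta>" if "z \<in> points N" for z \<xi> \<eta>
  using rep_inverse(2)[OF fs gs _ that, of \<eta>] inv that by metis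
 then show ?thesis unfolding symplectic_pair_def using fs gs inv by blast
qed

text \<open>Multiplication by r in the fibres. It joins a curve of covectors to its projection to the zero section.\<close>

definition scaled :: "real => 'a \<times> ('a, 'e) cotangent => 'a \<times> ('a, 'e) cotangent" where
 "scaled r w = (fst w, \<lambda>v\<in>tangent_space A (fst w). r * snd w v)"

lemma fst_scaled [simp]: "fst (scaled r w) = fst w" by (simp add: scaled_def)

lemma scaled_dom: "w \<in> dm (lift c) ==> scaled r w \<in> dm (lift c)"
 unfolding lift_dom cotangent_space_def
 by (auto simp: scaled_def tangent_space_combination algebra_simps simp del: split_paired_All)

lemma scaled_coords:
 assumes c: "c \<in> charts_at A (fst w)"
 shows "mp (lift c) (scaled r w) = (mp c (fst w), r *\<^sub>R snd (mp (lift c) w))"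
 by (simp add: lift_def split_beta scaled_def tangent_of_coords_in[OF c] scaleR_sum_right)

lemma scaled_one: "w \<in> points N ==> scaled 1 w = w"
 by (cases w) (auto simp: scaled_def in_points_N cotangent_space_def extensional_restrict)

lemma scaled_zero: "w \<in> points N ==> scaled 0 w \<in> zero_section A"
 by (auto simp: scaled_def in_points_N zero_section_def)

lemma C1_curve_lifted:
 assumes loc: "\<And>t. \<exists>c\<in>A. \<exists>e>0. \<forall>s\<in>ball t e. \<zeta> s \<in> dm (lift c)"
  and der: "\<And>c t. c \<in> A ==> \<zeta> t \<in> dm (lift c) ==> ((\<lambda>t. mp (lift c) (\<zeta> t)) hvd V c t) (at t)"
  and cont: "\<And>c. c \<in> A ==> cont {t. \<zeta> t \<in> dm (lift c)} (V c)"
 shows "C1_curve N \<zeta>" and "c \<in> A ==> \<zeta> t \<in> dm (lift c) ==> velocity N \<zeta> t (lift c) = V c t"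
proof -
 show "C1_curve N \<zeta>"
 proof (rule N.C1_curveI)
  fix t
  obtain c e where c: "c \<in> A" "e > 0" "\<forall>s\<in>ball t e. \<zeta> s \<in> dm (lift c)" using loc by blast
  show "\<exists>C\<in>N. \<exists>e>0. \<exists>g. (\<forall>s\<in>ball t e. \<zeta> s \<in> dm C \<and> ((\<lambda>t. mp C (\<zeta> t)) hvd g s) (at s)) \<and> cont (ball t e) g"
   by (intro bexI[OF _ lift_in[OF c(1)]] exI[of _ e] exI[of _ "V c"] conjI c(2) cont_subset[OF cont[OF c(1)]] ballI der[OF c(1)])
    (use c(3) in auto)
 qed
 show "c \<in> A ==> \<zeta> t \<in> dm (lift c) ==> velocity N \<zeta> t (lift c) = V c t"
  by (rule N.velocity_eqI[OF lift_in _ der])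
qed

lemma scaled_curve:
 assumes z: "C1_curve N z"
 shows "C1_curve N (\<lambda>t. scaled r (z t))"
  and "c \<in> A ==> z t \<in> dm (lift c) ==>
   velocity N (\<lambda>t. scaled r (z t)) t (lift c) = (fst (velocity N z t (lift c)), r *\<^sub>R snd (velocity N z t (lift c)))"
proof -
 have zc: "rcont N.MT z" by (rule C1_cont[OF z])
 have dom0: "z t \<in> dm (lift c)" if "scaled r (z t) \<in> dm (lift c)" for t c
  using that curve_in_points[OF zc, of t] by (auto simp: lift_dom in_points_N)
 have loc: "\<exists>c\<in>A. \<exists>e>0. \<forall>s\<in>ball t e. scaled r (z s) \<in> dm (lift c)" for t
 proof -
  obtain c where c: "c \<in> A" "z t \<in> dm (lift c)" by (rule chart_at_N[OF curve_in_points[OF zc, of t]])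
  obtain e where "e > 0" "\<And>s. s \<in> ball t e ==> z s \<in> dm (lift c)" using N.curve_chart_ball[OF zc lift_in[OF c(1)] c(2)] by blast
  then show ?thesis using c(1) scaled_dom by blast
 qed
 have der: "((\<lambda>t. mp (lift c) (scaled r (z t))) hvd (fst (velocity N z t (lift c)), r *\<^sub>R snd (velocity N z t (lift c)))) (at t)"
  if c: "c \<in> A" and t: "scaled r (z t) \<in> dm (lift c)" for c t
 proof (rule hvd_cong_open[OF _ open_curve_dom[OF zc lift_in[OF c]]])
  note d = C1_coords_hvd[OF z lift_in[OF c] dom0[OF t]]
  show "((\<lambda>t. (fst (mp (lift c) (z t)), r *\<^sub>R snd (mp (lift c) (z t)))) has_vector_derivative
   (fst (velocity N z t (lift c)), r *\<^sub>R snd (velocity N z t (lift c)))) (at t)"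
   by (intro hvd_Pair blin_hvd[OF bounded_linear_fst d]
    blin_hvd[OF bounded_linear_scaleR_right] blin_hvd[OF bounded_linear_snd d])
  show "t \<in> {t. z t \<in> dm (lift c)}" using dom0[OF t] by simp
  show "(fst (mp (lift c) (z s)), r *\<^sub>R snd (mp (lift c) (z s))) = mp (lift c) (scaled r (z s))"
   if "s \<in> {t. z t \<in> dm (lift c)}" for s
   using that c scaled_coords[of c "z s" r] by (simp add: charts_at_iff lift_dom)
 qed
 have cont: "cont {t. scaled r (z t) \<in> dm (lift c)} (\<lambda>t. (fst (velocity N z t (lift c)), r *\<^sub>R snd (velocity N z t (lift c))))"
  if "c \<in> A" for c
 proof -
  have "cont {t. scaled r (z t) \<in> dm (lift c)} (\<lambda>t. velocity N z t (lift c))"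
   by (rule cont_subset[OF C1_cont_velocity[OF z lift_in[OF that]]]) (use dom0 in blast)
  then show ?thesis by (intro continuous_intros)
 qed
 let ?V = "\<lambda>c t. (fst (velocity N z t (lift c)), r *\<^sub>R snd (velocity N z t (lift c)))"
 show "C1_curve N (\<lambda>t. scaled r (z t))" by (rule C1_curve_lifted(1)[where V = ?V]) (fact loc, fact der, fact cont)
 show "c \<in> A ==> z t \<in> dm (lift c) ==>
   velocity N (\<lambda>t. scaled r (z t)) t (lift c) = (fst (velocity N z t (lift c)), r *\<^sub>R snd (velocity N z t (lift c)))"
  by (rule C1_curve_lifted(2)[where V = ?V]) (rule loc, rule der, assumption+, rule cont, assumption+, rule scaled_dom, assumption)
qed

lemma scaled_ray:
 assumes w: "w \<in> points N"
 shows "C1_curve N (\<lambda>r. scaled r w)"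
  and "c \<in> A ==> w \<in> dm (lift c) ==> velocity N (\<lambda>r. scaled r w) r (lift c) = (0, snd (mp (lift c) w))"
proof -
 have at: "c \<in> charts_at A (fst w)" if "c \<in> A" "scaled r w \<in> dm (lift c)" for c r
  using that by (simp add: charts_at_iff lift_dom)
 have loc: "\<exists>c\<in>A. \<exists>e>0. \<forall>s\<in>ball r e. scaled s w \<in> dm (lift c)" for r
 proof -
  obtain c where "c \<in> A" "w \<in> dm (lift c)" by (rule chart_at_N[OF w])
  then show ?thesis using scaled_dom zero_less_one by blast
 qed
 have der: "((\<lambda>r. mp (lift c) (scaled r w)) hvd (0, snd (mp (lift c) w))) (at r)"
  if c: "c \<in> A" "scaled r w \<in> dm (lift c)" for c r
  unfolding scaled_coords[OF at[OF c]]
  using hvd_Pair[OF has_vector_derivative_const has_vector_derivative_scaleR[OF DERIV_ident has_vector_derivative_const]] by simp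
 let ?V = "\<lambda>c r. (0, snd (mp (lift c) w))"
 show "C1_curve N (\<lambda>r. scaled r w)" by (rule C1_curve_lifted(1)[where V = ?V]) (fact loc, fact der, rule cont_const)
 show "c \<in> A ==> w \<in> dm (lift c) ==> velocity N (\<lambda>r. scaled r w) r (lift c) = (0, snd (mp (lift c) w))"
  by (rule C1_curve_lifted(2)[where V = ?V]) (rule loc, rule der, assumption+, rule cont_const, assumption, rule scaled_dom, assumption)
qed

end

context cotangent
begin

text \<open>Consider the surface of points f(r z(t)) and let u and v be the canonical one-form on its r- and t-derivatives. The r-derivative of v minus the t-derivative of u is the canonical two-form on these two vectors. As f is symplectic, it can be evaluated before applying f, where it is the pairing of z(t) with the velocity of its base point.\<close>

lemma action_variation_local:
 assumes fg: "symplectic_pair f g" and z: "C1_curve N z"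
 defines "u \<equiv> \<lambda>t r. density (\<lambda>r. f (scaled r (z t))) r" and "v \<equiv> \<lambda>t r. density (\<lambda>t. f (scaled r (z t))) t"
 shows "\<exists>e>0. \<exists>D. cont (ball t0 e \<times> ball r0 e) (\<lambda>(t, r). D t r) \<and>
  (\<forall>t\<in>ball t0 e. \<forall>r\<in>ball r0 e. ((\<lambda>t. u t r) hvd D t r) (at t)) \<and>
  ((\<lambda>r. v t0 r) hvd D t0 r0 + density z t0) (at r0)"
proof -
 have fs: "smooth_map_on N N (points N) f" using fg by (simp add: symplectic_pair_def)
 have zc: "rcont N.MT z" by (rule C1_cont[OF z])
 have zN: "z t \<in> points N" for t by (rule curve_in_points[OF zc])
 define w0 where "w0 = scaled r0 (z t0)"
 have w0: "w0 \<in> points N" unfolding w0_def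
  by (rule curve_in_points[OF C1_cont[OF scaled_curve(1)[OF z]], of r0 t0])
 then have fw0: "f w0 \<in> points N" using fg by (simp add: symplectic_pair_def)
 obtain c where c: "c \<in> A" "chart_at N w0 = lift c" "w0 \<in> dm (lift c)" by (rule chart_at_N[OF w0])
 obtain d where d: "d \<in> A" "chart_at N (f w0) = lift d" "f w0 \<in> dm (lift d)" by (rule chart_at_N[OF fw0])
 define \<Psi> where "\<Psi> = mp (lift d) \<circ> f \<circ> iv (lift c)"
 define S where "S = mp (lift c) ` (dm (lift c) \<inter> points N \<inter> f -` dm (lift d))"
 note R = N.local_representative[OF fs lift_in[OF c(1)] lift_in[OF d(1)], folded \<Psi>_def S_def]
 define J where "J = {t. z t \<in> dm (lift c)}"
 have J: "open J" "t0 \<in> J" unfolding J_def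
  using open_curve_dom[OF zc lift_in[OF c(1)]] zN[of t0] c(3) by (auto simp: w0_def lift_dom in_points_N)
 have Jc: "z t \<in> dm (lift c)" "c \<in> charts_at A (fst (z t))" if "t \<in> J" for t
  using that c(1) by (auto simp: J_def lift_dom charts_at_iff)
 define X P X' P' where "X t = fst (mp (lift c) (z t))" and "P t = snd (mp (lift c) (z t))"
  and "X' t = fst (velocity N z t (lift c))" and "P' t = snd (velocity N z t (lift c))" for t
 define Z where "Z t r = (X t, r *\<^sub>R P t)" for t r
 have Zc: "mp (lift c) (scaled r (z t)) = Z t r" if "t \<in> J" for t r
  using scaled_coords[OF Jc(2)[OF that]] by (simp add: Z_def X_def P_def)
 have cXP: "cont J X" "cont J P" "cont J X'" "cont J P'"
  unfolding X_def P_def X'_def P'_def J_def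
  by (intro cont_fst cont_snd cont_coords[OF zc lift_in[OF c(1)]] C1_cont_velocity[OF z lift_in[OF c(1)]])+
 have proj: "cont (J \<times> UNIV) (\<lambda>(t, r). h t)" if "cont J h" for h :: "real => 'e"
  unfolding split_beta by (rule cont_compose[OF that cont_fst[OF cont_id]]) auto
 have scl: "cont (J \<times> UNIV) (\<lambda>(t, r :: real). r *\<^sub>R h t)" if "cont J h" for h :: "real => 'e"
  using cont_scaleR[OF cont_snd[OF cont_id] proj[OF that, unfolded split_beta]] by (simp add: split_beta)
 have cZ: "cont (J \<times> UNIV) (\<lambda>(t, r). Z t r)" unfolding Z_def
  using cont_Pair[OF proj[OF cXP(1)] scl[OF cXP(2)]] by (simp add: split_beta)
 define O' where "O' = (J \<times> UNIV) \<inter> (\<lambda>(t, r). Z t r) -` S"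
 have "open O'" unfolding O'_def
  using continuous_on_open_vimage[OF open_Times[OF J(1) open_UNIV]] cZ R(1) by (metis inf_commute)
 moreover have "(t0, r0) \<in> O'" using J(2) R(3)[OF c(3) d(3)] Zc[OF J(2), of r0] by (simp add: O'_def w0_def)
 ultimately obtain U V where "open U" "open V" "(t0, r0) \<in> U \<times> V" "U \<times> V \<subseteq> O'" by (rule open_prod_elim)
 then obtain e1 e2 where e12: "e1 > 0" "ball t0 e1 \<subseteq> U" "e2 > 0" "ball r0 e2 \<subseteq> V" unfolding open_contains_ball mem_Times_iff fst_conv snd_conv by metis
 define e where "e = min e1 e2"
 have e: "e > 0" using e12 by (simp add: e_def)
 have sub: "ball t0 e \<times> ball r0 e \<subseteq> O'" using e12 \<open>U \<times> V \<subseteq> O'\<close> by (force simp: e_def)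
 have inJ: "t \<in> J" "Z t r \<in> S" if "t \<in> ball t0 e" "r \<in> ball r0 e" for t r using subsetD[OF sub, of "(t, r)"] that by (auto simp: O'_def)
 have fdom: "scaled r (z t) \<in> dm (lift c)" "f (scaled r (z t)) \<in> dm (lift d)" "mp (lift d) (f (scaled r (z t))) = \<Psi> (Z t r)"
  if t: "t \<in> J" "Z t r \<in> S" for t r
 proof -
  show s: "scaled r (z t) \<in> dm (lift c)" by (rule scaled_dom[OF Jc(1)[OF t(1)]])
  have eq: "iv (lift c) (Z t r) = scaled r (z t)" using lift_inv[OF c(1) s] Zc[OF t(1)] by simp
  show "f (scaled r (z t)) \<in> dm (lift d)" using R(4)[OF t(2)] unfolding eq by blast
  show "mp (lift d) (f (scaled r (z t))) = \<Psi> (Z t r)" by (simp add: \<Psi>_def eq)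
 qed
 define G where "G = (\<lambda>q. Df \<Psi> (fst q) (snd q))"
 have u: "u t r = snd (\<Psi> (Z t r)) \<bullet> fst (G (Z t r, (0, P t)))" if t: "t \<in> J" "Z t r \<in> S" for t r
 proof -
  note s = fdom[OF t]
  note C = N.C1_curve_compose[OF fs scaled_ray(1)[OF zN[of t]]]
  have "velocity N (\<lambda>r. f (scaled r (z t))) r (lift d) = G (Z t r, (0, P t))"
   using C(2)[OF lift_in[OF c(1)] lift_in[OF d(1)] s(1,2)] scaled_ray(2)[OF zN c(1) Jc(1)[OF t(1)]] Zc[OF t(1)]
   by (simp add: G_def \<Psi>_def P_def)
  then show ?thesis unfolding u_def using density_coords[OF C(1) d(1), of r] s(2,3) by (simp add: lift_dom)
 qed
 have v: "v t r = snd (\<Psi> (Z t r)) \<bullet> fst (G (Z t r, (X' t, r *\<^sub>R P' t)))" if t: "t \<in> J" "Z t r \<in> S" for t r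
 proof -
  note s = fdom[OF t]
  note C = N.C1_curve_compose[OF fs scaled_curve(1)[OF z, of r]]
  have "velocity N (\<lambda>t. f (scaled r (z t))) t (lift d) = G (Z t r, (X' t, r *\<^sub>R P' t))"
   using C(2)[OF lift_in[OF c(1)] lift_in[OF d(1)] s(1,2)] scaled_curve(2)[OF z c(1) Jc(1)[OF t(1)]] Zc[OF t(1)]
   by (simp add: G_def \<Psi>_def X'_def P'_def)
  then show ?thesis unfolding v_def using density_coords[OF C(1) d(1), of t] s(2,3) by (simp add: lift_dom)
 qed
 have zd: "((\<lambda>t. mp (lift c) (z t)) hvd velocity N z t (lift c)) (at t)" if "t \<in> J" for t
  by (rule C1_coords_hvd[OF z lift_in[OF c(1)] Jc(1)[OF that]])
 have Xd: "(X hvd X' t) (at t)" and Pd: "(P hvd P' t) (at t)" if "t \<in> J" for t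
  unfolding X_def P_def X'_def P'_def
  by (rule blin_hvd[OF bounded_linear_fst zd[OF that]], rule blin_hvd[OF bounded_linear_snd zd[OF that]])
 have Zt: "((\<lambda>t. Z t r) hvd (X' t, r *\<^sub>R P' t)) (at t)" if "t \<in> J" for t r unfolding Z_def
  by (intro hvd_Pair Xd that blin_hvd[OF bounded_linear_scaleR_right] Pd)
 have Zr: "((\<lambda>r. Z t r) hvd (0, P t)) (at r)" for t r unfolding Z_def
  using hvd_Pair[OF has_vector_derivative_const has_vector_derivative_scaleR[OF DERIV_ident has_vector_derivative_const]] by simp
 define D where "D t r = snd (\<Psi> (Z t r)) \<bullet> fst (Df G (Z t r, (0, P t)) ((X' t, r *\<^sub>R P' t), (0, P' t)))
  + snd (G (Z t r, (X' t, r *\<^sub>R P' t))) \<bullet> fst (G (Z t r, (0, P t)))" for t r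
 show ?thesis
 proof (intro exI[of _ e] exI[of _ D] conjI e ballI)
  let ?B = "ball t0 e \<times> ball r0 e"
  have BJ: "?B \<subseteq> J \<times> UNIV" and BS: "(case q of (t, r) => Z t r) \<in> S" if "q \<in> ?B" for q using that sub by (auto simp: O'_def)
  have BJ: "?B \<subseteq> J \<times> UNIV" using sub by (auto simp: O'_def)
  note cB = cont_subset[OF _ BJ]
  have c1: "cont ?B (\<lambda>(t, r). Z t r)" by (rule cB[OF cZ])
  have c2: "cont ?B (\<lambda>(t, r). (0 :: 'e, P t))" using cont_Pair[OF cont_const cB[OF proj[OF cXP(2)]]] by (simp add: split_beta)
  have c3: "cont ?B (\<lambda>(t, r). (X' t, r *\<^sub>R P' t))" using cont_Pair[OF cB[OF proj[OF cXP(3)]] cB[OF scl[OF cXP(4)]]] by (simp add: split_beta)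
  have c4: "cont ?B (\<lambda>(t, r). (0 :: 'e, P' t))" using cont_Pair[OF cont_const cB[OF proj[OF cXP(4)]]] by (simp add: split_beta)
  note pair = cont_Pair[unfolded split_beta]
  have Gs: "smooth_on G (S \<times> UNIV)" unfolding G_def by (rule smooth_Df_joint(1)[OF R(1,2)])
  have g: "cont ?B (\<lambda>q. G (case q of (t, r) => Z t r, b q))" if "cont ?B b" for b
   by (rule cont_compose[OF smooth_cont[OF Gs] cont_Pair[OF c1 that]]) (use BS in auto)
  have gg: "cont ?B (\<lambda>q. Df G (case q of (t, r) => Z t r, b q) (h q))" if "cont ?B b" "cont ?B h" for b h
   using cont_compose[OF smooth_Df_joint_cont[OF Gs] cont_Pair[OF cont_Pair[OF c1 that(1)] that(2)]] BS by force
  have p: "cont ?B (\<lambda>q. \<Psi> (case q of (t, r) => Z t r))"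
   by (rule cont_compose[OF smooth_cont[OF R(2)] c1]) (use BS in auto)
  have "cont ?B (\<lambda>q. snd (\<Psi> (case q of (t, r) => Z t r)) \<bullet> fst (Df G (case q of (t, r) => Z t r, case q of (t, r) => (0, P t))
    (case q of (t, r) => (X' t, r *\<^sub>R P' t), case q of (t, r) => (0, P' t)))
   + snd (G (case q of (t, r) => Z t r, case q of (t, r) => (X' t, r *\<^sub>R P' t))) \<bullet> fst (G (case q of (t, r) => Z t r, case q of (t, r) => (0, P t))))"
   by (intro cont_add continuous_on_inner cont_snd cont_fst p gg g c1 c2 cont_Pair c3 c4)
  then show "cont ?B (\<lambda>(t, r). D t r)" by (simp add: split_beta D_def)
 next
  fix t r assume tr: "t \<in> ball t0 e" "r \<in> ball r0 e"
  have "((\<lambda>t. snd (\<Psi> (Z t r)) \<bullet> fst (G (Z t r, (0, P t)))) hvd D t r) (at t)"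
   unfolding D_def G_def
   by (rule action_integrand_derivative[OF R(1,2) Zt[OF inJ(1)[OF tr]] inJ(2)[OF tr]])
    (intro hvd_Pair has_vector_derivative_const Pd inJ(1)[OF tr])
  then show "((\<lambda>t. u t r) hvd D t r) (at t)"
   by (rule hvd_cong_open[OF _ open_ball tr(1)]) (use u inJ tr(2) in simp)
 next
  have tr: "t0 \<in> ball t0 e" "r0 \<in> ball r0 e" using e by auto
  note J0 = inJ[OF tr]
  let ?Zt = "(X' t0, r0 *\<^sub>R P' t0)" and ?Zr = "(0, P t0)"
  have "((\<lambda>r. snd (\<Psi> (Z t0 r)) \<bullet> fst (G (Z t0 r, (X' t0, r *\<^sub>R P' t0)))) has_vector_derivative
   snd (\<Psi> (Z t0 r0)) \<bullet> fst (Df G (Z t0 r0, ?Zt) (?Zr, (0, P' t0))) + snd (G (Z t0 r0, ?Zr)) \<bullet> fst (G (Z t0 r0, ?Zt))) (at r0)"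
   unfolding G_def
  proof (rule action_integrand_derivative[OF R(1,2) Zr J0(2)])
   show "((\<lambda>r. (X' t0, r *\<^sub>R P' t0)) hvd (0, P' t0)) (at r0)"
    using hvd_Pair[OF has_vector_derivative_const has_vector_derivative_scaleR[OF DERIV_ident has_vector_derivative_const]] by simp
  qed
  then have *: "((\<lambda>r. v t0 r) has_vector_derivative
   snd (\<Psi> (Z t0 r0)) \<bullet> fst (Df G (Z t0 r0, ?Zt) (?Zr, (0, P' t0))) + snd (G (Z t0 r0, ?Zr)) \<bullet> fst (G (Z t0 r0, ?Zt))) (at r0)"
   by (rule hvd_cong_open[OF _ open_ball tr(2)]) (use v inJ tr(1) in simp)
  (* The second derivatives of the map in coordinates are symmetric, so they cancel and the two-form remains. *)
  have sym: "Df G (Z t0 r0, ?Zt) (?Zr, (0, P' t0)) = Df G (Z t0 r0, ?Zr) (?Zt, (0, P' t0))"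
   unfolding G_def by (rule action_integrand_symmetric[OF R(1) J0(2) R(2)])
  have dr: "G (Z t0 r0, b) = drep f w0 b" for b
   using Zc[OF J0(1), of r0, folded w0_def] by (simp add: G_def drep_def rep_def coords_def c(2) d(2) \<Psi>_def)
  have inv: "\<And>z. z \<in> points N ==> f z \<in> points N \<and> g (f z) = z \<and> f (g z) = z" "smooth_map_on N N (points N) g"
   using fg by (auto simp: symplectic_pair_def)
  have inj: "drep g (f w0) (drep f w0 a) = a" for a
   using rep_inverse(2)[OF inv(2) fs _ fw0, of a] inv(1) w0 fg by (metis symplectic_pair_def)
  have "Om (G (Z t0 r0, ?Zr)) (G (Z t0 r0, ?Zt)) = Om ?Zr (drep g (f w0) (drep f w0 ?Zt))"
   unfolding dr using fg w0 unfolding symplectic_pair_def by metis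
  also have "\<dots> = Om ?Zr ?Zt" by (simp only: inj)
  also have "\<dots> = P t0 \<bullet> X' t0" by (simp add: Om_def)
  also have "\<dots> = density z t0" using density_coords[OF z c(1), of t0] Jc[OF J0(1)] by (simp add: P_def X'_def lift_dom)
  finally have "snd (G (Z t0 r0, ?Zr)) \<bullet> fst (G (Z t0 r0, ?Zt)) = density z t0 + snd (G (Z t0 r0, ?Zt)) \<bullet> fst (G (Z t0 r0, ?Zr))" by (simp add: Om_def)
  with * show "((\<lambda>r. v t0 r) hvd D t0 r0 + density z t0) (at r0)" unfolding D_def sym by (simp add: add.assoc add.commute add.left_commute)
 qed
qed

text \<open>On the graph of the differential of a function h the action density is the derivative of h along the base curve, which integrates to zero over a loop.\<close>

lemma density_exact_graph:
 assumes \<sigma>: "exact_one_form A \<sigma>" and z: "C1_curve N z" "periodic z" and gr: "\<And>t. z t \<in> one_form_graph A \<sigma>"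
 shows "integral {0..1} (density z) = 0"
proof -
 obtain h where h: "smooth_map_on A euclidean_atlas (points A) h" "\<And>x. x \<in> points A ==> \<sigma> x = function_differential A h x"
  using \<sigma> by (auto simp: exact_one_form_def)
 have y: "C1_curve A (\<lambda>t. fst (z t))" by (rule C1_curve_fst(1)[OF z(1)])
 have der: "((\<lambda>t. h (fst (z t))) hvd density z t) (at t)" for t
 proof -
  have x: "fst (z t) \<in> points A" and sz: "snd (z t) = \<sigma> (fst (z t))" using gr[of t] by (auto simp: one_form_graph_def)
  define c where "c = chart_at A (fst (z t))"
  have c: "c \<in> A" "fst (z t) \<in> dm c" using chart_at_in[OF x] by (auto simp: c_def charts_at_iff)
  have sm: "smooth_on (h \<circ> iv c) (mp c ` dm c)"
  proof -
   have "smooth_on (mp (UNIV, id) \<circ> h \<circ> iv c) (mp c ` (dm c \<inter> points A \<inter> h -` dm (UNIV, id)))"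
    using h(1) c(1) unfolding smooth_map_on_def euclidean_atlas_def by blast
   moreover have "dm c \<inter> points A \<inter> h -` dm (UNIV, id) = dm c" using points_chart[OF c(1)] by auto
   ultimately show ?thesis by (simp add: o_assoc)
  qed
  have 1: "((h \<circ> iv c) \<circ> (\<lambda>t. mp c (fst (z t))) has_vector_derivative
   Df (h \<circ> iv c) (mp c (fst (z t))) (velocity A (\<lambda>t. fst (z t)) t c)) (at t)"
   by (rule vector_derivative_diff_chain_within[OF C1_coords_hvd[OF y c] has_derivative_at_withinI[OF smooth_hder[OF sm]]])
    (use c in auto)
  have eq: "Df (h \<circ> iv c) (mp c (fst (z t))) (velocity A (\<lambda>t. fst (z t)) t c) = density z t"
   using velocity_tangent[OF y, of t] unfolding density_def sz h(2)[OF x] function_differential_def Let_def c_def by simp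
  show ?thesis
   by (rule hvd_cong_open[OF 1[unfolded eq] open_curve_dom[OF C1_cont[OF y] c(1)]]) (use c in simp_all)
 qed
 have "z 1 = z 0" using z(2)[unfolded periodic_def, rule_format, of 0] by simp
 then show ?thesis using integral_unique[OF integral_antiderivative[OF der, of 0 1]] by simp
qed

text \<open>The action of the loop t \<mapsto> f(r z(t)) has r-derivative equal to the action of z: the integral over t of the t-derivative of u vanishes by periodicity. At r = 0 the loop lies on the graph of an exact form and has action zero, at r = 1 it is the image of z.\<close>

theorem action_invariant:
 assumes fg: "symplectic_pair f g" and z: "C1_curve N z" "periodic z"
  and \<sigma>: "exact_one_form A \<sigma>" "f ` zero_section A = one_form_graph A \<sigma>"
 shows "integral {0..1} (density (\<lambda>t. f (z t))) = integral {0..1} (density z)"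
proof -
 define u where "u t r = density (\<lambda>r. f (scaled r (z t))) r" for t r
 define v where "v t r = density (\<lambda>t. f (scaled r (z t))) t" for t r
 define D where "D t r = vector_derivative (\<lambda>t. u t r) (at t)" for t r
 have fs: "smooth_map_on N N (points N) f" using fg by (simp add: symplectic_pair_def)
 have zN: "z t \<in> points N" for t by (rule curve_in_points[OF C1_cont[OF z(1)]])
 have loc: "\<exists>e>0. cont (ball t e \<times> ball r e) (\<lambda>(t, r). D t r) \<and> ((\<lambda>t. u t r) hvd D t r) (at t) \<and>
   ((\<lambda>r. v t r) hvd D t r + density z t) (at r)" for t r
 proof -
  obtain e E where e: "e > 0" and E: "cont (ball t e \<times> ball r e) (\<lambda>(t, r). E t r)"
   "\<forall>s\<in>ball t e. \<forall>q\<in>ball r e. ((\<lambda>t. u t q) hvd E s q) (at s)"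
   "((\<lambda>r. v t r) hvd E t r + density z t) (at r)"
   using action_variation_local[OF fg z(1), of t r] unfolding u_def v_def by blast
  have DE: "D s q = E s q" if "s \<in> ball t e" "q \<in> ball r e" for s q
   unfolding D_def by (rule vector_derivative_at) (use E(2) that in blast)
  have "cont (ball t e \<times> ball r e) (\<lambda>(t, r). D t r)" by (rule continuous_on_eq[OF E(1)]) (use DE in auto)
  then show ?thesis using E(2,3) DE[of t r] e by auto
 qed
 have cD: "cont UNIV (\<lambda>(t, r). D t r)"
 proof (intro cont_at_imp ballI)
  fix q :: "real \<times> real"
  obtain e where e: "e > 0" "cont (ball (fst q) e \<times> ball (snd q) e) (\<lambda>(t, r). D t r)" using loc by blast
  have "open (ball (fst q) e \<times> ball (snd q) e)" by (intro open_Times open_ball)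
  then show "isCont (\<lambda>(t, r). D t r) q" using cont_at e by (metis centre_in_ball mem_Times_iff)
 qed
 have du: "((\<lambda>t. u t r) hvd D t r) (at t)" and dv: "((\<lambda>r. v t r) hvd D t r + density z t) (at r)" for t r
  using loc by blast+
 have per: "z 1 = z 0" using z(2)[unfolded periodic_def, rule_format, of 0] by simp
 have "integral {0..1} (\<lambda>t. D t r) = 0" for r
  using integral_unique[OF integral_antiderivative[OF du, of 0 1]] per by (simp add: u_def)
 then have "0 = integral {0..1} (\<lambda>r. integral {0..1} (\<lambda>t. D t r))" by simp
 also have "\<dots> = integral {0..1} (\<lambda>t. integral {0..1} (D t))"
  using integral_swap_continuous[of 0 0 1 1 D] cont_subset[OF cD subset_UNIV] by simp
 also have "\<dots> = integral {0..1} (\<lambda>t. v t 1 - v t 0 - density z t)"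
 proof (rule integral_cong)
  fix t :: real
  have "((\<lambda>r. D t r + density z t - density z t) has_integral v t 1 - v t 0 - density z t) {0..1}"
   using has_integral_diff[OF integral_antiderivative[OF dv[of t], of 0 1] has_integral_const_real[of "density z t" 0 1]] by simp
  then show "integral {0..1} (D t) = v t 1 - v t 0 - density z t" by (simp add: integral_unique)
 qed
 also have "\<dots> = integral {0..1} (\<lambda>t. v t 1) - integral {0..1} (\<lambda>t. v t 0) - integral {0..1} (density z)"
 proof -
  have i: "(\<lambda>t. v t r) integrable_on {0..1}" "density z integrable_on {0..1}" for r unfolding v_def
   by (intro integrable_cont cont_subset[OF density_continuous] N.C1_curve_compose(1)[OF fs] scaled_curve(1) z subset_UNIV)+
  show ?thesis by (simp add: integral_diff i integrable_diff)
 qed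
 also have "integral {0..1} (\<lambda>t. v t 0) = 0"
  unfolding v_def
 proof (rule density_exact_graph[OF \<sigma>(1)])
  show "C1_curve N (\<lambda>t. f (scaled 0 (z t)))" by (rule N.C1_curve_compose(1)[OF fs scaled_curve(1)[OF z(1)]])
  show "periodic (\<lambda>t. f (scaled 0 (z t)))" using z(2) by (simp add: periodic_def)
  show "f (scaled 0 (z t)) \<in> one_form_graph A \<sigma>" for t using scaled_zero[OF zN[of t]] \<sigma>(2) by blast
 qed
 finally show ?thesis using zN by (simp add: v_def scaled_one)
qed

end

section \<open>Comparison of minimal lengths\<close>

context finsler
begin

text \<open>The duality between the metric and its dual norm, in coordinates. The converse below has a factor less than 1 in order to reach the open disc.\<close>

lemma disc_bound:
 assumes z: "z \<in> disc_cotangent_bundle A F" and c: "c \<in> charts_at A (fst z)"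
 shows "snd (mp (lift c) z) \<bullet> V \<le> Fc c (mp c (fst z), V)"
proof (cases "V = 0")
 case True
 then show ?thesis using Fc_nonneg[of c "mp c (fst z)" 0] c by (simp add: charts_at_iff)
next
 case False
 let ?x = "fst z" and ?P = "snd (mp (lift c) z)"
 have cA: "c \<in> A" and x: "mp c ?x \<in> rng c" using c by (auto simp: charts_at_iff)
 have p: "snd z \<in> cotangent_space A ?x" using z by (auto simp: disc_cotangent_bundle_def cotangent_bundle_def)
 let ?B = "{v \<in> tangent_space A ?x. F (?x, v) \<le> 1}"
 have pair: "snd z v = ?P \<bullet> v c" if "v \<in> tangent_space A ?x" for v by (rule cotangent_pairing[OF c p that])
 have "{mp c ?x} \<subseteq> rng c" using x by simp
 then obtain m where m: "m > 0" "\<And>y v. y \<in> {mp c ?x} ==> m * norm v \<le> Fc c (y, v)"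
  using Fc_lower_bound[OF cA compact_sing] by blast
 have "bdd_above (snd z ` ?B)"
 proof (rule bdd_aboveI2)
  fix v assume v: "v \<in> ?B"
  then have "m * norm (v c) \<le> 1" using m(2)[OF singletonI, of "v c"] F_eq_Fc[OF c, of v] by simp
  then have "norm (v c) \<le> 1 / m" using m(1) by (simp add: field_simps)
  have "snd z v \<le> norm ?P * norm (v c)" using pair v norm_cauchy_schwarz by simp
  also have "\<dots> \<le> norm ?P * (1 / m)" by (intro mult_left_mono \<open>norm (v c) \<le> 1 / m\<close> norm_ge_zero)
  finally show "snd z v \<le> norm ?P * (1 / m)" .
 qed
 moreover have fx: "Fc c (mp c ?x, V) > 0" by (rule Fc_pos[OF cA x False])
 define v where "v = tangent_of_coords A c ?x ((1 / Fc c (mp c ?x, V)) *\<^sub>R V)"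
 have v: "v \<in> tangent_space A ?x" "v c = (1 / Fc c (mp c ?x, V)) *\<^sub>R V"
  unfolding v_def using tangent_of_coords_in[OF c] tangent_of_coords_self[OF c] by auto
 then have "v \<in> ?B" using F_eq_Fc[OF c v(1)] Fc_scale[OF cA x, of "1 / Fc c (mp c ?x, V)" V] fx by simp
 ultimately have "snd z v \<le> dual_finsler A F z" unfolding dual_finsler_def split_beta by (intro cSUP_upper)
 then have "?P \<bullet> v c < 1" using z pair[OF v(1)] by (simp add: disc_cotangent_bundle_def)
 then show ?thesis unfolding v(2) using fx by (simp add: field_simps)
qed

lemma disc_intro:
 assumes c: "c \<in> charts_at A (fst z)" and p: "snd z \<in> cotangent_space A (fst z)" and k: "0 \<le> k" "k < 1"
  and le: "\<And>V. snd (mp (lift c) z) \<bullet> V \<le> k * Fc c (mp c (fst z), V)"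
 shows "z \<in> disc_cotangent_bundle A F"
proof -
 have cA: "c \<in> A" "fst z \<in> dm c" using c by (auto simp: charts_at_iff)
 have "dual_finsler A F z \<le> k" unfolding dual_finsler_def split_beta
 proof (rule cSUP_least)
  have "(\<lambda>c. 0) \<in> tangent_space A (fst z)" by (rule zero_tangent)
  moreover from this have "F (fst z, \<lambda>c. 0) = 0" using F_eq_Fc[OF c] Fc_zero[OF cA(1)] cA(2) by simp
  ultimately show "{v \<in> tangent_space A (fst z). F (fst z, v) \<le> 1} ~= {}" by force
  fix v assume v: "v \<in> {v \<in> tangent_space A (fst z). F (fst z, v) \<le> 1}"
  then have "snd z v \<le> k * F (fst z, v)" using cotangent_pairing[OF c p] F_eq_Fc[OF c] le by simp
  also have "\<dots> \<le> k * 1" by (rule mult_left_mono) (use v k in auto)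
  finally show "snd z v \<le> k" by simp
 qed
 then show ?thesis using k p cA points_chart[of c "fst z"]
  unfolding disc_cotangent_bundle_def cotangent_bundle_def by (cases z) auto
qed

text \<open>The Legendre transform of v, written without charts.\<close>

definition momentum :: "'a => ('a, 'e) tangent => ('a, 'e) cotangent" where
 "momentum x v = (\<lambda>u\<in>tangent_space A x. deriv (\<lambda>s. (F (x, \<lambda>c. v c + s *\<^sub>R u c))\<^sup>2 / 2) 0)"

lemma momentum_coords:
 assumes c: "c \<in> charts_at A x" and v: "v \<in> tangent_space A x"
 shows "momentum x v = covector c x (snd (Gc c (mp c x, v c)))"
proof -
 have cA: "c \<in> A" and x: "mp c x \<in> rng c" using c by (auto simp: charts_at_iff)
 have "deriv (\<lambda>s. (F (x, \<lambda>c. v c + s *\<^sub>R u c))\<^sup>2 / 2) 0 = snd (Gc c (mp c x, v c)) \<bullet> u c" if u: "u \<in> tangent_space A x" for u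
 proof -
  have "(F (x, \<lambda>c. v c + s *\<^sub>R u c))\<^sup>2 / 2 = Lc c (mp c x, v c + s *\<^sub>R u c)" for s
   using F_eq_Fc[OF c tangent_space_combination[OF v u, of 1 s]] by (simp add: Lc_def)
  then show ?thesis using DERIV_imp_deriv[OF Lc_line_derivative[OF cA x, of "v c" "u c" 0]] by simp
 qed
 then show ?thesis unfolding momentum_def covector_def by (intro restrict_ext) blast
qed

end

locale finsler_cotangent = cotangent A + finsler A F for A :: "('a, 'e::euclidean_space) atlas" and F
begin

text \<open>The closed geodesic in the unit cosphere bundle: scaling by the inverse of the speed l gives the momentum dual norm 1.\<close>

definition extremal_lift :: "(real => 'a) => real => real => 'a \<times> ('a, 'e) cotangent" where
 "extremal_lift q l t = scaled (1 / l) (q t, momentum (q t) (velocity A q t))"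

lemma fst_extremal_lift [simp]: "fst (extremal_lift q l t) = q t" by (simp add: extremal_lift_def)

context
 fixes q l
 assumes ext: "extremal q l"
begin

lemma q: "C1_curve A q" and l: "l > 0" and sp: "speed q t = l"
  and EL: "c \<in> A ==> q t \<in> dm c ==> ((\<lambda>t. snd (Gc c (mp c (q t), velocity A q t c)))
    hvd fst (Gc c (mp c (q t), velocity A q t c))) (at t)"
 using ext unfolding extremal_def by blast+

lemma lift_coords:
 assumes c: "c \<in> A" "q t \<in> dm c"
 shows "extremal_lift q l t \<in> dm (lift c)"
  "mp (lift c) (extremal_lift q l t) = (mp c (q t), (1 / l) *\<^sub>R snd (Gc c (mp c (q t), velocity A q t c)))"
proof -
 have at: "c \<in> charts_at A (q t)" using c by (simp add: charts_at_iff)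
 have m: "momentum (q t) (velocity A q t) = covector c (q t) (snd (Gc c (mp c (q t), velocity A q t c)))"
  by (rule momentum_coords[OF at velocity_tangent[OF q]])
 show "extremal_lift q l t \<in> dm (lift c)" unfolding extremal_lift_def m
  by (rule scaled_dom) (simp add: lift_dom c covector_in)
 show "mp (lift c) (extremal_lift q l t) = (mp c (q t), (1 / l) *\<^sub>R snd (Gc c (mp c (q t), velocity A q t c)))"
  unfolding extremal_lift_def m using scaled_coords[of c "(q t, covector c (q t) (snd (Gc c (mp c (q t), velocity A q t c))))"] at
  by (simp add: lift_covector[OF at])
qed

lemma lift_C1:
 shows "C1_curve N (extremal_lift q l)"
  and "c \<in> A ==> q t \<in> dm c ==> velocity N (extremal_lift q l) t (lift c) =
   (velocity A q t c, (1 / l) *\<^sub>R fst (Gc c (mp c (q t), velocity A q t c)))"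
proof -
 have qc: "rcont MT q" by (rule C1_cont[OF q])
 have dom: "extremal_lift q l t \<in> dm (lift c) \<longleftrightarrow> q t \<in> dm c" if "c \<in> A" for c t
  using lift_coords(1)[OF that] by (auto simp: lift_dom)
 have loc: "\<exists>c\<in>A. \<exists>e>0. \<forall>s\<in>ball t e. extremal_lift q l s \<in> dm (lift c)" for t
 proof -
  obtain c where c: "c \<in> A" "q t \<in> dm c" using chart_at_curve[OF qc] .
  obtain e where "e > 0" "\<And>s. s \<in> ball t e ==> q s \<in> dm c" using curve_chart_ball[OF qc c] by blast
  then show ?thesis using c(1) dom by blast
 qed
 let ?V = "\<lambda>c t. (velocity A q t c, (1 / l) *\<^sub>R fst (Gc c (mp c (q t), velocity A q t c)))"
 have der: "((\<lambda>t. mp (lift c) (extremal_lift q l t)) hvd ?V c t) (at t)"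
  if c: "c \<in> A" and t: "extremal_lift q l t \<in> dm (lift c)" for c t
 proof (rule hvd_cong_open[OF _ open_curve_dom[OF qc c]])
  have t': "q t \<in> dm c" using t dom[OF c] by blast
  show "((\<lambda>t. (mp c (q t), (1 / l) *\<^sub>R snd (Gc c (mp c (q t), velocity A q t c)))) hvd ?V c t) (at t)"
   by (intro hvd_Pair C1_coords_hvd[OF q c t'] blin_hvd[OF bounded_linear_scaleR_right EL[OF c t']])
  show "t \<in> {t. q t \<in> dm c}" using t' by simp
 qed (use lift_coords(2)[OF c] in simp)
 have cont: "cont {t. extremal_lift q l t \<in> dm (lift c)} (?V c)" if c: "c \<in> A" for c
  unfolding dom[OF c]
  by (intro cont_Pair C1_cont_velocity[OF q c] cont_scaleR cont_const cont_fst
    cont_compose[OF Gc_continuous[OF c]] cont_coords[OF qc c]) auto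
 show "C1_curve N (extremal_lift q l)" by (rule C1_curve_lifted(1)[where V = ?V]) (fact loc, fact der, fact cont)
 show "c \<in> A ==> q t \<in> dm c ==> velocity N (extremal_lift q l) t (lift c) = ?V c t"
  by (rule C1_curve_lifted(2)[where V = ?V]) (rule loc, rule der, assumption+, rule cont, assumption+, simp add: dom)
qed

text \<open>The momentum attains its dual norm 1 on the velocity, by Euler's identity and the fundamental inequality.\<close>

lemma extremal_norm:
 assumes c: "c \<in> A" "q t \<in> dm c"
 shows "Fc c (mp c (q t), velocity A q t c) = l"
  and "(1 / l) * (snd (Gc c (mp c (q t), velocity A q t c)) \<bullet> velocity A q t c) = l"
  and "(1 / l) * (snd (Gc c (mp c (q t), velocity A q t c)) \<bullet> U) \<le> Fc c (mp c (q t), U)"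
proof -
 show F: "Fc c (mp c (q t), velocity A q t c) = l" using speed_chart[OF q c] sp by simp
 have x: "mp c (q t) \<in> rng c" using c by simp
 show "(1 / l) * (snd (Gc c (mp c (q t), velocity A q t c)) \<bullet> velocity A q t c) = l"
  unfolding Gc_euler[OF c(1) x] F using l by (simp add: power2_eq_square)
 show "(1 / l) * (snd (Gc c (mp c (q t), velocity A q t c)) \<bullet> U) \<le> Fc c (mp c (q t), U)"
  using Gc_fundamental_inequality[OF c(1) x, of "velocity A q t c" U] l unfolding F by (simp add: field_simps)
qed

lemma extremal_density: "density (extremal_lift q l) t = l"
proof -
 obtain c where c: "c \<in> A" "q t \<in> dm c" using chart_at_curve[OF C1_cont[OF q]] .
 show ?thesis using density_coords[OF lift_C1(1) c(1), of t] c(2) lift_coords(2)[OF c] lift_C1(2)[OF c] extremal_norm(2)[OF c]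
  by simp
qed

end

end

locale two_finsler = cotangent A + F1: finsler_cotangent A F1 + F2: finsler_cotangent A F2
 for A :: "('a, 'e::euclidean_space) atlas" and F1 F2
begin

text \<open>Let w = f(z(t)), with fibre part p and velocity projecting to Y'. Let k be a covector at the same point of dual norm less than 1. The vertical vector k - p at w points into the F2-disc, so g maps a short segment from w in its direction to a curve R from z(t) into the F1-disc. Hence the function phi below is nonnegative for small positive s. It vanishes at 0, and its derivative there is the symplectic pairing of the velocity of z with that of R: this is where the geodesic equation enters. Transporting back by f gives k(Y') \<le> p(Y'), and the supremum over k is F2(Y').\<close>

theorem speed_le_density:
 assumes fg: "symplectic_pair f g"
  and disc: "\<And>w. w \<in> disc_cotangent_bundle A F2 ==> g w \<in> disc_cotangent_bundle A F1"
   "\<And>z. z \<in> disc_cotangent_bundle A F1 ==> f z \<in> disc_cotangent_bundle A F2"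
  and ext: "F1.extremal \<gamma> l"
 defines "z \<equiv> F1.extremal_lift \<gamma> l"
 shows "F2.speed (\<lambda>t. fst (f (z t))) t \<le> density (\<lambda>t. f (z t)) t"
proof -
 note E = F1.lift_coords[OF ext, folded z_def] F1.extremal_norm[OF ext]
 note EC = F1.lift_C1[OF ext, folded z_def]
 have l: "l > 0" using ext by (simp add: F1.extremal_def)
 have fs: "smooth_map_on N N (points N) f" and gs: "smooth_map_on N N (points N) g"
  and inv: "\<And>z. z \<in> points N ==> f z \<in> points N \<and> g (f z) = z \<and> f (g z) = z"
  using fg by (auto simp: symplectic_pair_def)
 have z0: "z t \<in> points N" by (rule curve_in_points[OF C1_cont[OF EC(1)]])
 have w0: "f (z t) \<in> points N" and gw: "g (f (z t)) = z t" using inv z0 by auto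
 obtain c where c: "c \<in> A" "chart_at N (z t) = lift c" "z t \<in> dm (lift c)" by (rule chart_at_N[OF z0])
 obtain d where d: "d \<in> A" "chart_at N (f (z t)) = lift d" "f (z t) \<in> dm (lift d)" by (rule chart_at_N[OF w0])
 have ct: "\<gamma> t \<in> dm c" using c(3) by (simp add: lift_dom z_def)
 have dt: "fst (f (z t)) \<in> dm d" and d_at: "d \<in> charts_at A (fst (f (z t)))" using d by (auto simp: lift_dom charts_at_iff)
 have c_at: "c \<in> charts_at A (\<gamma> t)" using c(1) ct by (simp add: charts_at_iff)
 define X V where "X = mp c (\<gamma> t)" and "V = velocity A \<gamma> t c"
 define Q Q' where "Q = (1 / l) *\<^sub>R snd (F1.Gc c (X, V))" and "Q' = (1 / l) *\<^sub>R fst (F1.Gc c (X, V))"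
 have X: "X \<in> F1.rng c" using ct by (simp add: X_def)
 have cz: "coords (z t) = (X, Q)" using E(2)[OF c(1) ct] by (simp add: coords_def c(2) X_def Q_def V_def)
 have FV: "F1.Fc c (X, V) = l" and QV: "Q \<bullet> V = l" and QU: "Q \<bullet> U \<le> F1.Fc c (X, U)" for U
  using E(3-5)[OF c(1) ct] by (simp_all add: X_def V_def Q_def)
 define Y Pw where "Y = mp d (fst (f (z t)))" and "Pw = snd (mp (lift d) (f (z t)))"
 have Yr: "Y \<in> F2.rng d" using dt by (simp add: Y_def)
 have cw: "coords (f (z t)) = (Y, Pw)" by (simp add: coords_def d(2) Y_def Pw_def prod_eq_iff)
 define W' where "W' = drep f (z t) (V, Q')"
 note fzC = N.C1_curve_compose[OF fs EC(1)]
 have W': "velocity N (\<lambda>t. f (z t)) t (lift d) = W'"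
  using fzC(2)[OF lift_in[OF c(1)] lift_in[OF d(1)] c(3) d(3)] EC(2)[OF c(1) ct] E(2)[OF c(1) ct]
  by (simp add: W'_def drep_def rep_def coords_def c(2) d(2) X_def V_def Q'_def)
 have dens: "density (\<lambda>t. f (z t)) t = Pw \<bullet> fst W'" using density_coords[OF fzC(1) d(1) dt] W' by (simp add: Pw_def)
 have y: "C1_curve A (\<lambda>t. fst (f (z t)))" "velocity A (\<lambda>t. fst (f (z t))) t d = fst W'"
  using C1_curve_fst[OF fzC(1)] d(1) dt W' by auto
 have spd: "F2.speed (\<lambda>t. fst (f (z t))) t = F2.Fc d (Y, fst W')" using F2.speed_chart[OF y(1) d(1) dt] y(2) by (simp add: Y_def)
 have Pw: "Pw \<bullet> U \<le> F2.Fc d (Y, U)" for U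
 proof -
  define q where "q r = mp (lift d) (f (scaled r (z t)))" for r
  have rC: "C1_curve N (\<lambda>r. f (scaled r (z t)))" by (rule N.C1_curve_compose(1)[OF fs scaled_ray(1)[OF z0]])
  let ?J = "{r. f (scaled r (z t)) \<in> dm (lift d)}"
  have J: "open ?J" "1 \<in> ?J" using open_curve_dom[OF C1_cont[OF rC] lift_in[OF d(1)]] d(3) scaled_one[OF z0] by auto
  have q1: "q 1 = (Y, Pw)" using scaled_one[OF z0] cw d(2) by (simp add: q_def coords_def)
  have "cont ?J q" unfolding q_def by (rule cont_coords[OF C1_cont[OF rC] lift_in[OF d(1)]])
  then have q: "(q \<longlongrightarrow> (Y, Pw)) (at_left 1)"
   using cont_at[OF J(1)] J(2) q1 by (metis continuous_at_imp_continuous_within continuous_within)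
  have "cont (F2.rng d \<times> UNIV) (F2.Fc d)" by (rule F2.Fc_continuous[OF d(1)])
  then have "isCont (F2.Fc d) (Y, U)"
   using cont_at[OF open_Times[OF open_chart_image[OF d(1)] open_UNIV]] Yr by blast
  then have F: "((\<lambda>r. F2.Fc d (fst (q r), U)) \<longlongrightarrow> F2.Fc d (Y, U)) (at_left 1)"
   using tendsto_Pair[OF tendsto_fst[OF q] tendsto_const] by (intro isCont_tendsto_compose[where g = "F2.Fc d"]) auto
  have P: "((\<lambda>r. snd (q r) \<bullet> U) \<longlongrightarrow> Pw \<bullet> U) (at_left 1)" using tendsto_inner[OF tendsto_snd[OF q] tendsto_const] by simp
  have "\<forall>\<^sub>F r in at_left 1. r \<in> ?J" using eventually_at_topological J by blast
  moreover have "\<forall>\<^sub>F r in at_left (1::real). r \<in> {0<..<1}" by (rule eventually_at_leftI[of 0]) auto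
  ultimately have "\<forall>\<^sub>F r in at_left 1. snd (q r) \<bullet> U \<le> F2.Fc d (fst (q r), U)"
  proof eventually_elim
   case (elim r)
   have sd: "scaled r (z t) \<in> dm (lift c)" by (rule scaled_dom[OF c(3)])
   have "scaled r (z t) \<in> disc_cotangent_bundle A F1"
   proof (rule F1.disc_intro[of c _ r])
    show "snd (mp (lift c) (scaled r (z t))) \<bullet> U \<le> r * F1.Fc c (mp c (fst (scaled r (z t))), U)" for U
     using scaled_coords[of c "z t" r] c_at mult_left_mono[OF QU[of U], of r] elim E(2)[OF c(1) ct]
     by (simp add: X_def Q_def V_def z_def)
   qed (use c_at sd elim in \<open>auto simp: lift_dom z_def\<close>)
   from F2.disc_bound[OF disc(2)[OF this], of d U] show ?case using elim d(1) by (simp add: q_def charts_at_iff lift_dom)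
  qed
  then show ?thesis by (rule tendsto_le[OF _ F P, rotated]) simp
 qed
 have key: "\<kappa> \<bullet> fst W' \<le> Pw \<bullet> fst W'" if k: "0 \<le> k" "k < 1" and \<kappa>: "\<And>U. \<kappa> \<bullet> U \<le> k * F2.Fc d (Y, U)" for \<kappa> k
 proof -
  define \<beta> where "\<beta> = \<kappa> - Pw"
  define ab where "ab = drep g (f (z t)) (0, \<beta>)"
  define R where "R s = rep g (f (z t)) ((Y, Pw) + s *\<^sub>R (0, \<beta>))" for s :: real
  (* Nonnegative on the F1-disc, since p(V) is at most F1(V) there, and F1(V) at most F1(V)^2 / (2 l) + l / 2. *)
  define \<phi> where "\<phi> s = (1 / l) * F1.Lc c (fst (R s), V) + l / 2 - snd (R s) \<bullet> V" for s
  have R0: "R 0 = (X, Q)" using cz cw gw w0 d(2,3) c(2) lift_inv[OF d(1,3)] by (simp add: R_def rep_def coords_def)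
  have \<phi>0: "\<phi> 0 = 0" unfolding \<phi>_def R0 using FV QV l by (simp add: F1.Lc_def power2_eq_square)
  have "((\<lambda>s. (Y, Pw) + s *\<^sub>R (0, \<beta>)) hder (\<lambda>s. 0 + s *\<^sub>R (0, \<beta>))) (at 0)"
   by (rule has_derivative_add[OF has_derivative_const bounded_linear_imp_has_derivative[OF bounded_linear_scaleR_left]])
  moreover have "(rep g (f (z t)) hder drep g (f (z t))) (at ((Y, Pw) + 0 *\<^sub>R (0, \<beta>)))"
   using rep_derivative[OF gs w0] unfolding cw by (simp only: scaleR_zero_left add_0_right)
  ultimately have "((\<lambda>s. rep g (f (z t)) ((Y, Pw) + s *\<^sub>R (0, \<beta>))) hder (\<lambda>s. drep g (f (z t)) (0 + s *\<^sub>R (0, \<beta>)))) (at 0)"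
   by (rule hder_compose)
  then have "(R hder (\<lambda>s. drep g (f (z t)) (s *\<^sub>R (0, \<beta>)))) (at 0)" unfolding R_def[abs_def] by (simp only: add_0)
  moreover have "drep g (f (z t)) (s *\<^sub>R (0, \<beta>)) = s *\<^sub>R ab" for s
   unfolding ab_def by (rule linear_cmul[OF hder_linear[OF rep_derivative[OF gs w0]]])
  ultimately have R: "(R hder (\<lambda>s. s *\<^sub>R ab)) (at 0)" by (simp only:)
  have "((\<lambda>s. (fst (R s), V)) hder (\<lambda>s. (fst (s *\<^sub>R ab), 0))) (at 0)"
   by (intro has_derivative_Pair has_derivative_fst R has_derivative_const)
  moreover have "(F1.Lc c hder (\<lambda>h. F1.Gc c (X, V) \<bullet> h)) (at (fst (R 0), V))"
   unfolding R0 fst_conv using X by (intro F1.Lc_has_derivative[OF c(1)]) blast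
  ultimately have "((\<lambda>s. F1.Lc c (fst (R s), V)) hder (\<lambda>s. F1.Gc c (X, V) \<bullet> (fst (s *\<^sub>R ab), 0))) (at 0)"
   by (rule hder_compose)
  moreover have "((\<lambda>s. snd (R s) \<bullet> V) hder (\<lambda>s. snd (s *\<^sub>R ab) \<bullet> V)) (at 0)"
   by (intro has_derivative_inner_left has_derivative_snd R)
  ultimately have "(\<phi> hder (\<lambda>s. (1 / l) * (F1.Gc c (X, V) \<bullet> (fst (s *\<^sub>R ab), 0)) + 0 - snd (s *\<^sub>R ab) \<bullet> V)) (at 0)"
   unfolding \<phi>_def by (intro has_derivative_diff has_derivative_add has_derivative_const has_derivative_mult_right)
  then have \<phi>': "(\<phi> hrd Q' \<bullet> fst ab - snd ab \<bullet> V) (at 0)"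
   unfolding has_field_derivative_def by (rule has_derivative_eq_rhs) (auto simp: Q'_def inner_prod_def algebra_simps)
  obtain S where S: "open S" "coords (f (z t)) \<in> S" "\<And>y. y \<in> S ==> iv (lift d) y \<in> points N \<and> g (iv (lift d) y) \<in> dm (lift c)"
   using rep_inverse(1)[OF fs gs inv z0] unfolding c(2) d(2) by blast
  have pos: "\<exists>e>0. \<forall>s. 0 < s \<and> s < e --> \<phi> s \<ge> 0"
  proof -
   have "open ((\<lambda>s. (Y, Pw) + s *\<^sub>R (0, \<beta>)) -` S)" by (intro open_vimage S(1) continuous_intros)
   moreover have "0 \<in> (\<lambda>s. (Y, Pw) + s *\<^sub>R (0, \<beta>)) -` S" using S(2) cw by simp
   ultimately obtain e where e: "e > 0" "ball 0 e \<subseteq> (\<lambda>s. (Y, Pw) + s *\<^sub>R (0, \<beta>)) -` S" using open_contains_ball by blast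
   have "\<phi> s \<ge> 0" if s: "0 < s" "s < min e 1" for s
   proof -
    let ?y = "(Y, Pw) + s *\<^sub>R (0, \<beta>)"
    let ?w = "iv (lift d) ?y"
    have yS: "?y \<in> S" using subsetD[OF e(2), of s] s by (simp add: dist_real_def)
    have fy: "fst ?y \<in> mp d ` dm d" using Yr by simp
    have yr: "?y \<in> mp (lift d) ` dm (lift d)" using lift_image[OF d(1) order_refl] fy by (auto simp: mem_Times_iff)
    have wd: "?w \<in> dm (lift d)" "mp (lift d) ?w = ?y" using N.chart_inv_in[OF yr] N.map_chart_inv[OF yr] by auto
    have "?w \<in> disc_cotangent_bundle A F2"
    proof (rule F2.disc_intro[of d _ "(1 - s) + s * k"])
     have mw: "mp d (fst ?w) = Y" using arg_cong[OF wd(2), of fst] by simp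
     show "snd (mp (lift d) ?w) \<bullet> U \<le> ((1 - s) + s * k) * F2.Fc d (mp d (fst ?w), U)" for U
     proof -
      have "(1 - s) * (Pw \<bullet> U) + s * (\<kappa> \<bullet> U) \<le> (1 - s) * F2.Fc d (Y, U) + s * (k * F2.Fc d (Y, U))"
       using s by (intro add_mono mult_left_mono Pw \<kappa>) auto
      then show ?thesis unfolding wd(2) mw by (simp add: \<beta>_def algebra_simps)
     qed
     have "s * k < s * 1" by (rule mult_strict_left_mono) (use k s in auto)
     then show "(1 - s) + s * k < 1" by simp
     show "0 \<le> (1 - s) + s * k" using s k by (intro add_nonneg_nonneg mult_nonneg_nonneg) auto
    qed (use wd(1) d(1) in \<open>auto simp: charts_at_iff lift_dom\<close>)
    from F1.disc_bound[OF disc(1)[OF this], of c V]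
    have "snd (R s) \<bullet> V \<le> F1.Fc c (fst (R s), V)"
     using S(3)[OF yS] c gw d(2) by (simp add: R_def rep_def charts_at_iff lift_dom)
    moreover have "0 \<le> (F1.Fc c (fst (R s), V) - l)\<^sup>2" by simp
    then have "F1.Fc c (fst (R s), V) \<le> (1 / l) * F1.Lc c (fst (R s), V) + l / 2"
     using l by (simp add: F1.Lc_def power2_diff field_simps power2_eq_square)
    ultimately show ?thesis unfolding \<phi>_def by linarith
   qed
   then show ?thesis using e(1) by (intro exI[of _ "min e 1"]) auto
  qed
  have "0 \<le> Q' \<bullet> fst ab - snd ab \<bullet> V"
  proof (rule ccontr)
   assume "\<not> 0 \<le> Q' \<bullet> fst ab - snd ab \<bullet> V"
   then obtain e' where e': "e' > 0" "\<And>h. 0 < h ==> h < e' ==> \<phi> (0 + h) < \<phi> 0"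
    using DERIV_neg_dec_right[OF \<phi>'] by (meson not_le)
   obtain e where e: "e > 0" "\<And>s. 0 < s ==> s < e ==> \<phi> s \<ge> 0" using pos by blast
   have h: "0 < min e e' / 2" "min e e' / 2 < e" "min e e' / 2 < e'" using e(1) e'(1) by (auto simp: min_def)
   show False using e'(2)[OF h(1,3)] e(2)[OF h(1,2)] \<phi>0 by simp
  qed
  also have "Q' \<bullet> fst ab - snd ab \<bullet> V = Om (V, Q') ab" by (simp add: Om_def)
  also have "\<dots> = Om W' (0, \<beta>)" unfolding ab_def W'_def using fg z0 unfolding symplectic_pair_def by blast
  finally show ?thesis by (simp add: Om_def \<beta>_def inner_diff_left)
 qed
 have "F2.Fc d (Y, fst W') \<le> Pw \<bullet> fst W'"
 proof (cases "fst W' = 0")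
  case True
  then show ?thesis using F2.Fc_zero[OF d(1) Yr] by simp
 next
  case False
  let ?F = "F2.Fc d (Y, fst W')"
  have F: "?F > 0" by (rule F2.Fc_pos[OF d(1) Yr False])
  show ?thesis
  proof (rule field_le_mult_one_interval)
   fix k :: real assume k: "0 < k" "k < 1"
   define \<kappa> where "\<kappa> = (k / ?F) *\<^sub>R snd (F2.Gc d (Y, fst W'))"
   have "\<kappa> \<bullet> U \<le> k * F2.Fc d (Y, U)" for U
    using mult_left_mono[OF F2.Gc_fundamental_inequality[OF d(1) Yr, of "fst W'" U], of "k / ?F"] k F by (simp add: \<kappa>_def)
   from key[OF _ k(2) this] have "\<kappa> \<bullet> fst W' \<le> Pw \<bullet> fst W'" using k by simp
   moreover have "\<kappa> \<bullet> fst W' = k * ?F" using F2.Gc_euler[OF d(1) Yr, of "fst W'"] F by (simp add: \<kappa>_def power2_eq_square)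
   ultimately show "k * ?F \<le> Pw \<bullet> fst W'" by simp
  qed
 qed
 then show ?thesis unfolding spd dens .
qed

text \<open>The projection of the image of the lifted closed geodesic is a loop of the same class, and its F2-length is at most its action, which is the action of the lift and hence the F1-length.\<close>

theorem min_length_comparison:
 assumes H: "Hausdorff_space MT" "compact_space MT" and \<alpha>: "\<alpha> \<in> free_homotopy_classes A" "nontrivial_class A \<alpha>"
  and ne: "smooth_loops A \<inter> \<alpha> ~= {}" and fg: "symplectic_pair f g"
  and disc: "\<And>w. w \<in> disc_cotangent_bundle A F2 ==> g w \<in> disc_cotangent_bundle A F1"
   "\<And>z. z \<in> disc_cotangent_bundle A F1 ==> f z \<in> disc_cotangent_bundle A F2"
  and act: "\<And>z. C1_curve N z ==> periodic z ==> integral {0..1} (density (\<lambda>t. f (z t))) = integral {0..1} (density z)"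
  and hom: "\<And>z. z \<in> loops N ==> homotopic_loops (\<lambda>t. fst (z t)) (\<lambda>t. fst (f (z t)))"
 shows "min_length A F2 \<alpha> \<le> min_length A F1 \<alpha>"
proof -
 let ?l = "min_length A F1 \<alpha>"
 obtain q where q\<alpha>: "q \<in> \<alpha>" and extr: "F1.extremal q ?l" using F1.closed_geodesic_exists[OF H \<alpha> ne] by blast
 define z where "z = F1.extremal_lift q ?l"
 have zC: "C1_curve N z" unfolding z_def by (rule F1.lift_C1(1)[OF extr])
 have p: "periodic q" using free_homotopy_class_loops[OF \<alpha>(1) q\<alpha>] by (simp add: loops_def)
 then have zp: "periodic z" using F1.velocity_periodic[OF p] by (simp add: z_def F1.extremal_lift_def periodic_def)
 have fs: "smooth_map_on N N (points N) f" using fg by (simp add: symplectic_pair_def)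
 let ?y = "\<lambda>t. fst (f (z t))"
 have fzC: "C1_curve N (\<lambda>t. f (z t))" by (rule N.C1_curve_compose(1)[OF fs zC])
 have y: "C1_curve A ?y" by (rule C1_curve_fst(1)[OF fzC])
 have "homotopic_loops q ?y" using hom[of z] zp C1_cont[OF zC] by (simp add: loops_def z_def)
 then have "?y \<in> \<alpha>" using free_homotopy_class_iff[OF \<alpha>(1) q\<alpha>] by blast
 then have "min_length A F2 \<alpha> \<le> finsler_length A F2 ?y" by (rule F2.min_length_le[OF \<alpha>(1) y])
 also have "\<dots> \<le> integral {0..1} (density (\<lambda>t. f (z t)))" unfolding F2.finsler_length_speed
  by (intro integral_le integrable_cont cont_subset[OF F2.speed_continuous[OF y]] cont_subset[OF density_continuous[OF fzC]] subset_UNIV)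
   (unfold z_def, rule speed_le_density[OF fg disc extr])
 also have "\<dots> = integral {0..1} (density z)" by (rule act[OF zC zp])
 also have "density z = (\<lambda>t. ?l)" unfolding z_def by (rule ext) (rule F1.extremal_density[OF extr])
 also have "integral {0..1} (\<lambda>t :: real. ?l) = ?l" by simp
 finally show ?thesis .
qed

end

section \<open>Symplectic isotopies preserve homotopy classes\<close>

context cotangent
begin

text \<open>Evaluation along a loop is continuous for the smooth topology: a basic neighbourhood controls f on compact coordinate pieces of the loop.\<close>

lemma conv_nhdsin:
 assumes f: "f \<in> Symp N \<omega>" and z: "z \<in> loops N"
 shows "conv (nhdsin (subtopology (C_infinity_topology N N) (Symp N \<omega>)) f) (\<lambda>g t. fst (g (z t))) (\<lambda>t. fst (f (z t)))"
proof (rule convI)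
 fix t0
 let ?T = "subtopology (C_infinity_topology N N) (Symp N \<omega>)"
 have fs: "smooth_map_on N N (points N) f" using f by (simp add: Symp_def symplectomorphism_between_def)
 have zc: "rcont N.MT z" using z by (simp add: loops_def)
 have fc: "rcont N.MT (\<lambda>t. f (z t))"
  using continuous_map_compose[OF zc smooth_map_continuous[OF fs]] by (simp add: o_def)
 obtain c where c: "c \<in> A" "z t0 \<in> dm (lift c)" by (rule chart_at_N[OF curve_in_points[OF zc, of t0]])
 obtain d where d: "d \<in> A" "f (z t0) \<in> dm (lift d)" "fst (f (z t0)) \<in> dm d" by (rule chart_at_N[OF curve_in_points[OF fc, of t0]])
 have "\<exists>e>0. \<forall>\<^sub>F g in nhdsin ?T f. \<forall>t\<in>ball t0 e. fst (g (z t)) \<in> dm d \<and>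
  dist (mp d (fst (g (z t)))) (mp d (fst (f (z t0)))) < \<eta>" if \<eta>: "\<eta> > 0" for \<eta>
 proof -
  let ?J = "{t. z t \<in> dm (lift c)} \<inter> {t. f (z t) \<in> dm (lift d) \<and>
   mp (lift d) (f (z t)) \<in> ball (mp (lift d) (f (z t0))) (\<eta> / 2)}"
  have "open ?J" by (intro open_Int open_curve_dom[OF zc lift_in[OF c(1)]] openin_curve_preimage[OF fc lift_in[OF d(1)]] open_ball)
  moreover have "t0 \<in> ?J" using c d \<eta> by simp
  ultimately obtain e where e: "e > 0" "cball t0 e \<subseteq> ?J" using open_contains_cball by blast
  let ?K = "z ` cball t0 e"
  let ?B = "C_infinity_nbhd N N f (lift c) (lift d) ?K 0 (\<eta> / 2)"
  have K: "compactin N.MT ?K" by (rule image_compactin[OF _ zc]) simp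
  have "openin (C_infinity_topology N N) ?B" unfolding C_infinity_topology_def
  proof (rule topology_generated_by_Basis, intro CollectI exI conjI)
   show "?B = ?B" ..
  qed (use fs c d e(2) K \<eta> in \<open>auto intro: lift_in\<close>)
  then have "openin ?T (?B \<inter> Symp N \<omega>)" unfolding openin_subtopology by blast
  moreover have "f \<in> ?B \<inter> Symp N \<omega>" using f fs e(2) \<eta> by (auto simp: C_infinity_nbhd_def)
  moreover have "\<forall>t\<in>ball t0 e. fst (g (z t)) \<in> dm d \<and>
   dist (mp d (fst (g (z t)))) (mp d (fst (f (z t0)))) < \<eta>" if g: "g \<in> ?B \<inter> Symp N \<omega>" for g
  proof
   fix t assume "t \<in> ball t0 e"
   then have t: "t \<in> cball t0 e" by simp
   then have tJ: "t \<in> ?J" using e(2) by blast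
   have gd: "g (z t) \<in> dm (lift d)" using g t by (auto simp: C_infinity_nbhd_def)
   have g': "\<forall>vs. length vs \<le> 0 \<and> set vs \<subseteq> Basis --> (\<forall>y \<in> mp (lift c) ` ?K.
    norm (iterated_derivative vs (mp (lift d) \<circ> g \<circ> iv (lift c)) y
      - iterated_derivative vs (mp (lift d) \<circ> f \<circ> iv (lift c)) y) < \<eta> / 2)"
    using g unfolding C_infinity_nbhd_def by blast
   have "dist (mp (lift d) (g (z t))) (mp (lift d) (f (z t))) < \<eta> / 2"
    using g'[rule_format, of "[]" "mp (lift c) (z t)"] t tJ lift_inv[OF c(1)] by (simp add: dist_norm)
   moreover have "dist (mp (lift d) (f (z t))) (mp (lift d) (f (z t0))) < \<eta> / 2" using tJ by (simp add: dist_commute)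
   ultimately have "dist (mp (lift d) (g (z t))) (mp (lift d) (f (z t0))) < \<eta>"
    using dist_triangle[of "mp (lift d) (g (z t))" "mp (lift d) (f (z t0))" "mp (lift d) (f (z t))"] by linarith
   then show "fst (g (z t)) \<in> dm d \<and> dist (mp d (fst (g (z t)))) (mp d (fst (f (z t0)))) < \<eta>"
    using gd dist_fst_le[of "mp (lift d) (g (z t))" "mp (lift d) (f (z t0))"] by (simp add: lift_dom)
  qed
  ultimately have "\<forall>\<^sub>F g in nhdsin ?T f. \<forall>t\<in>ball t0 e. fst (g (z t)) \<in> dm d \<and>
   dist (mp d (fst (g (z t)))) (mp d (fst (f (z t0)))) < \<eta>"
   unfolding eventually_nhdsin by blast
  then show ?thesis using e(1) by blast
 qed
 then show "\<exists>d\<in>A. fst (f (z t0)) \<in> dm d \<and> (\<forall>\<eta>>0. \<exists>e>0. \<forall>\<^sub>F g in nhdsin ?T f. \<forall>t\<in>ball t0 e.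
  fst (g (z t)) \<in> dm d \<and> dist (mp d (fst (g (z t)))) (mp d (fst (f (z t0)))) < \<eta>)" using d by blast
qed

lemma loops_fst_image:
 assumes f: "f \<in> Symp N \<omega>" and z: "z \<in> loops N"
 shows "(\<lambda>t. fst (f (z t))) \<in> loops A"
proof -
 have "smooth_map_on N N (points N) f" using f by (simp add: Symp_def symplectomorphism_between_def)
 from continuous_map_compose[OF _ continuous_map_compose[OF smooth_map_continuous[OF this] continuous_fst]]
 show ?thesis using z by (auto simp: loops_def periodic_def o_def)
qed

text \<open>Homotopy of projected image loops is an equivalence relation on symplectomorphisms whose classes are open, because nearby symplectomorphisms move the loop to a nearby one. So it is constant on the connected component of the identity.\<close>

theorem Symp0_homotopic:
 assumes \<psi>: "\<psi> \<in> Symp\<^sub>0 N \<omega>" and z: "z \<in> loops N"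
 shows "homotopic_loops (\<lambda>t. fst (z t)) (\<lambda>t. fst (\<psi> (z t)))" and "\<psi> \<in> Symp N \<omega>"
proof -
 let ?T = "subtopology (C_infinity_topology N N) (Symp N \<omega>)" and ?id = "\<lambda>z\<in>points N. z"
 let ?h = "\<lambda>f t. fst (f (z t))"
 have conn: "connected_component_of ?T ?id \<psi>" using \<psi> by (simp add: Symp\<^sub>0_def)
 have top: "f \<in> Symp N \<omega>" if "f \<in> topspace ?T" for f using that by simp
 have in_top: "?id \<in> topspace ?T" "\<psi> \<in> topspace ?T" using connected_component_in_topspace[OF conn] by blast+
 show "\<psi> \<in> Symp N \<omega>" by (rule top[OF in_top(2)])
 define P where "P f \<longleftrightarrow> homotopic_loops (?h ?id) (?h f)" for f :: "'a \<times> ('a, 'e) cotangent => 'a \<times> ('a, 'e) cotangent"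
 have nb: "\<exists>U. openin ?T U \<and> f \<in> U \<and> (\<forall>g\<in>U. P g = P f)" if f: "f \<in> topspace ?T" for f
 proof -
  have "\<forall>\<^sub>F g in nhdsin ?T f. g \<in> topspace ?T" unfolding eventually_nhdsin by (meson openin_topspace)
  then have "\<forall>\<^sub>F g in nhdsin ?T f. ?h g \<in> loops A" by (rule eventually_mono) (rule loops_fst_image[OF top z])
  from conv_eventually_homotopic[OF conv_nhdsin[OF top[OF f] z] loops_fst_image[OF top[OF f] z] this]
  have "\<forall>\<^sub>F g in nhdsin ?T f. P g = P f"
   by (rule eventually_mono) (auto simp only: P_def intro: homotopic_loops_trans homotopic_loops_sym)
  then show ?thesis unfolding eventually_nhdsin using f by blast
 qed
 let ?S = "{f \<in> topspace ?T. P f}"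
 have clop: "openin ?T Q" if Q: "Q \<subseteq> topspace ?T" "\<And>f g. f \<in> Q ==> g \<in> topspace ?T ==> P g = P f ==> g \<in> Q" for Q
 proof (subst openin_subopen, rule ballI)
  fix f assume f: "f \<in> Q"
  from nb[OF subsetD[OF Q(1) f]] obtain U where U: "openin ?T U" "f \<in> U" "\<forall>g\<in>U. P g = P f" by (elim exE conjE)
  have "g \<in> Q" if g: "g \<in> U" for g by (rule Q(2)[OF f _ bspec[OF U(3) g]]) (rule subsetD[OF openin_subset[OF U(1)] g])
  then have "U \<subseteq> Q" by (rule subsetI)
  with U(1,2) show "\<exists>U. openin ?T U \<and> f \<in> U \<and> U \<subseteq> Q" by (intro exI[of _ U] conjI)
 qed
 have S1: "?S \<subseteq> topspace ?T" by (rule Collect_restrict)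
 have "openin ?T ?S" by (rule clop[OF S1]) (simp only: mem_Collect_eq)
 moreover have "openin ?T (topspace ?T - ?S)" by (rule clop[OF Diff_subset]) (simp only: Diff_iff mem_Collect_eq, blast)
 then have "closedin ?T ?S" unfolding closedin_def using S1 by blast
 moreover obtain C where C: "connectedin ?T C" "?id \<in> C" "\<psi> \<in> C" using conn by (auto simp: connected_component_of_def)
 moreover have "P ?id" unfolding P_def by (rule homotopic_loops_refl[OF loops_fst_image[OF top[OF in_top(1)] z]])
 ultimately have "P \<psi>" using in_top connectedin_clopen_cases[of ?T C ?S] by (auto simp: disjnt_iff)
 moreover have "?h ?id = (\<lambda>t. fst (z t))" using z curve_in_points[of N z] by (auto simp: loops_def)
 ultimately show "homotopic_loops (\<lambda>t. fst (z t)) (\<lambda>t. fst (\<psi> (z t)))" by (simp add: P_def)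
qed

end

theorem theorem1p5:
  fixes A :: "('a, 'e::euclidean_space) atlas"
    and F\<^sub>1 F\<^sub>2 :: "'a \<times> ('a, 'e) tangent \<Rightarrow> real"
    and \<psi> :: "'a \<times> ('a, 'e) cotangent \<Rightarrow> 'a \<times> ('a, 'e) cotangent"
  assumes "closed_connected_manifold A"
    and "\<exists>\<alpha> \<in> free_homotopy_classes A. nontrivial_class A \<alpha>"
    and "finsler_metric A F\<^sub>1" and "finsler_metric A F\<^sub>2"
    and "\<psi> \<in> Symp\<^sub>0 (cotangent_bundle_atlas A) (canonical_symplectic_form A)"
    and "symplectomorphism_between (cotangent_bundle_atlas A) (canonical_symplectic_form A)
           (disc_cotangent_bundle A F\<^sub>1) (disc_cotangent_bundle A F\<^sub>2) \<psi>"
    and "\<exists>\<sigma>. exact_one_form A \<sigma> \<and> \<psi> ` zero_section A = one_form_graph A \<sigma>"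
  shows "\<forall>\<alpha> \<in> free_homotopy_classes A. nontrivial_class A \<alpha> \<longrightarrow>
           min_length A F\<^sub>1 \<alpha> = min_length A F\<^sub>2 \<alpha>"
proof (intro ballI impI)
 fix \<alpha> assume \<alpha>: "\<alpha> \<in> free_homotopy_classes A" "nontrivial_class A \<alpha>"
 have A: "smooth_atlas A" and H: "Hausdorff_space (manifold_topology A)" "compact_space (manifold_topology A)"
  using assms(1) by (auto simp: closed_connected_manifold_def smooth_manifold_def)
 interpret T12: two_finsler A F\<^sub>1 F\<^sub>2 by unfold_locales (fact A assms(3,4))+
 interpret T21: two_finsler A F\<^sub>2 F\<^sub>1 by unfold_locales
 let ?N = "cotangent_bundle_atlas A" and ?\<omega> = "canonical_symplectic_form A"
 let ?g = "inv_into (points ?N) \<psi>"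
 show "min_length A F\<^sub>1 \<alpha> = min_length A F\<^sub>2 \<alpha>"
 proof (cases "smooth_loops A \<inter> \<alpha> = {}")
  case True
  then show ?thesis by (simp add: min_length_def)
 next
  case ne: False
  obtain x where x: "x \<in> points A" using assms(1) by (auto simp: closed_connected_manifold_def)
  have hom: "T12.homotopic_loops (\<lambda>t. fst (z t)) (\<lambda>t. fst (\<psi> (z t)))" if "z \<in> loops ?N" for z
   by (rule T12.Symp0_homotopic(1)[OF assms(5) that])
  have "T12.scaled 0 (x, \<lambda>v\<in>tangent_space A x. 0) \<in> points ?N"
   using x T12.zero_tangent by (auto simp: T12.in_points_N T12.scaled_def cotangent_space_def T12.tangent_space_combination)
  then have "(\<lambda>t. T12.scaled 0 (x, \<lambda>v\<in>tangent_space A x. 0)) \<in> loops ?N" by (simp add: loops_def periodic_def)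
  from T12.Symp0_homotopic(2)[OF assms(5) this] have \<psi>: "symplectomorphism_between ?N ?\<omega> (points ?N) (points ?N) \<psi>"
   by (simp add: Symp_def)
  have fg: "T12.symplectic_pair \<psi> ?g" by (rule T12.symplectic_pair_inv[OF \<psi>])
  then have gf: "T12.symplectic_pair ?g \<psi>" by (rule T12.symplectic_pair_swap)
  have inv: "\<psi> z \<in> points ?N" "?g z \<in> points ?N" "?g (\<psi> z) = z" "\<psi> (?g z) = z" if "z \<in> points ?N" for z
   using fg that unfolding T12.symplectic_pair_def by blast+
  have gs: "smooth_map_on ?N ?N (points ?N) ?g" using fg by (simp add: T12.symplectic_pair_def)
  have disc: "\<psi> ` disc_cotangent_bundle A F\<^sub>1 = disc_cotangent_bundle A F\<^sub>2"
   using assms(6) by (simp add: symplectomorphism_between_def bij_betw_def)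
  have sub: "disc_cotangent_bundle A F\<^sub>1 \<subseteq> points ?N" by (auto simp: T12.points_N disc_cotangent_bundle_def)
  have d2: "?g w \<in> disc_cotangent_bundle A F\<^sub>1" if "w \<in> disc_cotangent_bundle A F\<^sub>2" for w
   using that sub inv(3) unfolding disc[symmetric] by auto
  have d1: "\<psi> z \<in> disc_cotangent_bundle A F\<^sub>2" if "z \<in> disc_cotangent_bundle A F\<^sub>1" for z using that disc by blast
  obtain \<sigma> where \<sigma>: "exact_one_form A \<sigma>" "\<psi> ` zero_section A = one_form_graph A \<sigma>" using assms(7) by blast
  have act: "integral {0..1} (T12.density (\<lambda>t. \<psi> (z t))) = integral {0..1} (T12.density z)" if "C1_curve ?N z" "periodic z" for z
   by (rule T12.action_invariant[OF fg that \<sigma>])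
  have "min_length A F\<^sub>2 \<alpha> \<le> min_length A F\<^sub>1 \<alpha>" by (rule T12.min_length_comparison[OF H \<alpha> ne fg d2 d1 act hom])
  moreover have "min_length A F\<^sub>1 \<alpha> \<le> min_length A F\<^sub>2 \<alpha>"
  proof (rule T21.min_length_comparison[OF H \<alpha> ne gf d1 d2])
   fix z assume z: "C1_curve ?N z" "periodic z"
   have "(\<lambda>t. \<psi> (?g (z t))) = z" using inv(4) curve_in_points[OF C1_cont[OF z(1)]] by auto
   then show "integral {0..1} (T12.density (\<lambda>t. ?g (z t))) = integral {0..1} (T12.density z)"
    using act[OF T12.N.C1_curve_compose(1)[OF gs z(1)]] z(2) by (simp add: periodic_def)
  next
   fix z assume z: "z \<in> loops ?N"
   have e: "(\<lambda>t. \<psi> (?g (z t))) = z" using z inv(4) curve_in_points[of ?N z] by (auto simp: loops_def)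
   have "(\<lambda>t. ?g (z t)) \<in> loops ?N"
    using z continuous_map_compose[OF _ smooth_map_continuous[OF gs], of euclideanreal z] by (simp add: loops_def periodic_def o_def)
   from hom[OF this] show "T12.homotopic_loops (\<lambda>t. fst (z t)) (\<lambda>t. fst (?g (z t)))"
    using fun_cong[OF e] by (simp add: T12.homotopic_loops_sym)
  qed
  ultimately show ?thesis by simp
 qed
qed

end
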